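(* Let $(A,\gamma_0,\gamma_1,\gamma_2,\dots)$ be a (possibly curved) $A_\infty$-algebra over a field $k$ of characteristic zero, and let $\gamma=\gamma_0+\gamma_1+\gamma_2+\cdots$, regarded as a Maurer–Cartan element of the $B_\infty$-algebra $\underline{\mathrm{End}}(A)=\bigoplus_{n\ge0}\mathrm{Hom}(A^{\otimes n},A)[1-n]$ with brace operations. Then $A\underline\otimes A=\bigoplus_{n\ge0}A\otimes A^{\otimes n}[n]$ has two distinct left $B_\infty$-module structures over the twisted $B_\infty$-algebra $(\underline{\mathrm{End}}(A),\mathrm d_\gamma,\mathrm m)$, given by $\mathrm m_{L,1}$ and $\mathrm m_{L,2}$, and the formula $$\mathrm b_\gamma:=\mathrm m_{L,1}(\gamma\otimes\bullet)-\mathrm m_{L,2}(\gamma\otimes\bullet)$$ specifies a degree $1$ operator which squares to $0$ (i.e. an $A_\infty$-module structure on $A\underline\otimes A$ over $\underline{\mathrm{End}}(A)$).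
   Context: **$B_\infty$-algebras.** For a graded vector space $V$, $T(V)$ is the tensor coalgebra with deconcatenation coproduct $\Delta$ and counit $\varepsilon$; $\eta$ is the natural unit. A $B_\infty$-algebra structure on $V$ is a pair $(\mathrm d,\mathrm m)$ making $(T(V),\mathrm m,\Delta,\eta,\varepsilon,\mathrm d)$ a DG bialgebra; it is determined by structure maps $\mathrm d_p:V^{\otimes p}\to V$, $\mathrm m_{p,q}:V^{\otimes p}\otimes V^{\otimes q}\to V$. A Maurer–Cartan element is $\gamma\in V$ of degree $1$ with $\mathrm d_1\gamma+\mathrm m_{1,1}(\gamma,\gamma)=0$; then $\mathrm d_\gamma=\mathrm d+\mathrm m(\gamma\otimes\bullet)-\mathrm m(\bullet\otimes\gamma)$ gives a new $B_\infty$-algebra $(V,\mathrm d_\gamma,\mathrm m)$. **Braces.** For $P\in\mathrm{Hom}(A^{\otimes p},A)$ of internal degree $|P|$ put $\|P\|=p-1+|P|$. On $V=\underline{\mathrm{End}}(A)$ take $\mathrm d=0$, $\mathrm m_{0,1}=\mathrm m_{1,0}=\mathrm{id}$, $\mathrm m_{p,q}=0$ for $p\ge2$, $q\geq1$, and $$\mathrm m_{1,q}(P,Q_1,\dots,Q_q)(e_1,\dots,e_n)=\sum(-1)^{\sum_k\|Q_k\|(i_k-1+\sum_{j<i_k}|e_j|)}P(e_1,\dots,Q_1(e_{i_1},\dots),\dots,Q_q(e_{i_q},\dots),\dots,e_n),$$ the sum being over $1\le i_1$, $i_k+q_k\le i_{k+1}$, $i_q+q_q-1\le n$ ($q_k$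 the arity of $Q_k$). A (possibly curved) $A_\infty$-structure on $A$ is a family $\gamma_n\in\mathrm{Hom}(A^{\otimes n},A)^{1-n}$ (up to degree convention: total degree $\|\gamma_n\|=1$) with $\gamma=\sum\gamma_n$ satisfying $\mathrm m_{1,1}(\gamma,\gamma)=0$ componentwise. Then $\mathrm d_{\gamma,1}(P)=[\gamma,P]$ and $\mathrm d_{\gamma,k}(P_1,\dots,P_k)=\mathrm m_{1,k}(\gamma,P_1,\dots,P_k)$ for $k\ge2$. **Left $B_\infty$-modules.** For a graded vector space $W$, let $\overline W=T(V)\otimes W\otimes T(V)$, with left and right coactions $\Delta\otimes1$, $1\otimes\Delta$. A left $B_\infty$-module structure on $W$ over a $B_\infty$-algebra $V$ is a degree $0$ left action $\mathrm m_L:T(V)\otimes\overline W\to\overline W$ of the algebra $(T(V),\mathrm m)$, which is a morphism of bi-comodules, together with a degree $1$ square-zero operator $\mathrm b$ on $\overline W$ which is a coderivation of the bi-comodule (relative to the differential of $T(V)$) and a derivation of the action. They are determined by structure maps $\mathrm m_L^{p,q,r}:V^{\otimes p}\otimes V^{\otimes q}\otimes W\otimes V^{\otimes r}\to W$ and $\mathrm b_{q,r}:V^{\otimes q}\otimes W\otimes V^{\otimes r}\to W$. Here both structures have the same differential $\mathrm b_\gamma$. **The two actions.** Let $c=(e_0|\cdots|e_m)\in A\underline\otimes A$. The only non-trivial structure maps of $\mathrm m_{L,2}$ are $$\mathrm m_{L,2}^{p,0,0}(P_1,\dots,P_p,c)=\sum(-1)^{\sum_a\|P_a\|(i_a-1+\sum_{d=0}^{i_a-1}|e_d|)}(e_0|\cdots|P_1(e_{i_1},\dots)|\cdots|P_p(e_{i_p},\dots)|\cdots|e_m),$$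 over $1\le i_1$, $i_k+p_k\le i_{k+1}$, $i_p+p_p-1\le m$ ($p_k$ the arity of $P_k$; identity for $p=0$). The only non-trivial structure maps of $\mathrm m_{L,1}$ are (besides the identity for $p=q=r=0$) $$\mathrm m_{L,1}^{1,q,r}(P,Q_1,\dots,Q_q,c,R_1,\dots,R_r)=\sum(-1)^{s}\big(P(e_l,\dots,Q_1(e_{j_1},\dots),\dots,Q_q(e_{j_q},\dots),\dots,e_m,e_0,\dots,R_1(e_{k_1},\dots),\dots,R_r(e_{k_r},\dots),\dots,e_{n-1})|e_n|\cdots|e_{l-1}\big),$$ $$s=\Big(l+\sum_{j=0}^{l-1}|e_j|\Big)\Big(m-l+1+\sum_{j=l}^{m}|e_j|\Big)+\sum_{a=1}^q\|Q_a\|\Big(j_a-l+\sum_{d=l}^{j_a-1}|e_d|\Big)+\sum_{b=1}^r\|R_b\|\Big(k_b-l-1+\sum_{f=k_b}^{l-1}|e_f|\Big),$$ the sum being over all $l,n$ and positions with $1\le n\le l\le m+1$, $l\le j_1$, $j_i+q_i\le j_{i+1}$, $j_q+q_q-1\le m$, $1\le k_1$, $k_i+r_i\le k_{i+1}$, $k_r+r_r-1\le n-1$ ($q_i,r_i$ arities of $Q_i,R_i$) for which the number of arguments of $P$ is its arity. (Here $\mathrm m_{L,1}$ arises by dualizing the braces on $\underline{\mathrm{End}}(A\oplus A^* )$.) **The operator $\mathrm b_\gamma$** is the coderivation of $\overline{A\underline\otimes A}$ (relative to $\mathrm d_\gamma$ on $T(\underline{\mathrm{End}}(A))$) with structure maps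 $\mathrm b_{\gamma,q,r}(Q_1,\dots,Q_q,c,R_1,\dots,R_r)=\mathrm m_{L,1}^{1,q,r}(\gamma,Q_1,\dots,Q_q,c,R_1,\dots,R_r)$ for $(q,r)\ne(0,0)$ and $\mathrm b_{\gamma,0,0}(c)=\mathrm m_{L,1}^{1,0,0}(\gamma,c)-\mathrm m_{L,2}^{1,0,0}(\gamma,c)$.
   Formalization: The left B∞-module given by m_{L,2} carries the differential with sole structure map c ↦ m_{L,2}(γ,c) in place of b_γ, which is not a derivation of that action; End(A) is a product over n rather than a direct sum; the two actions are shown distinct for A ≠ 0. *)

theory Defs
  imports Complex_Main "HOL-Library.Function_Algebras"
begin

section \<open>Graded vector spaces and tensors\<close>

definition pscale :: "('k \<Rightarrow> 'v \<Rightarrow> 'v) \<Rightarrow> 'k \<Rightarrow> ('x \<Rightarrow> 'v) \<Rightarrow> 'x \<Rightarrow> 'v" where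
  "pscale s c f = (\<lambda>x. s c (f x))"

abbreviation fscale :: "'k::field \<Rightarrow> ('x \<Rightarrow> 'k) \<Rightarrow> 'x \<Rightarrow> 'k" where
  "fscale \<equiv> pscale (*)"

definition ksign :: "int \<Rightarrow> 'k::field" where
  "ksign n = (if even n then 1 else - 1)"

text \<open>A graded vector space is an independent family of subspaces of an ambient vector space;
  the ambient space may be larger than the direct sum of the family, which is \<open>total\<close>.\<close>

locale graded_vector_space = vector_space scale
  for scale :: "'k::field \<Rightarrow> 'v::ab_group_add \<Rightarrow> 'v" +
  fixes G :: "int \<Rightarrow> 'v set"
  assumes subspace_component: "subspace (G i)"
    and independent_components:
      "\<lbrakk>finite I; \<And>i. i \<in> I \<Longrightarrow> x i \<in> G i; sum x I = 0; i \<in> I\<rbrakk> \<Longrightarrow> x i = 0"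

definition total :: "('k::field \<Rightarrow> 'v::ab_group_add \<Rightarrow> 'v) \<Rightarrow> (int \<Rightarrow> 'v set) \<Rightarrow> 'v set" where
  "total s G = module.span s (\<Union>i. G i)"

definition lin_on ::
  "('k \<Rightarrow> 'v::ab_group_add \<Rightarrow> 'v) \<Rightarrow> 'v set \<Rightarrow> ('k \<Rightarrow> 'w::ab_group_add \<Rightarrow> 'w) \<Rightarrow> ('v \<Rightarrow> 'w) \<Rightarrow> bool" where
  "lin_on s S t f \<longleftrightarrow>
     (\<forall>x\<in>S. \<forall>y\<in>S. f (x + y) = f x + f y) \<and> (\<forall>c. \<forall>x\<in>S. f (s c x) = t c (f x))"

definition graded_map ::
  "('k::field \<Rightarrow> 'v::ab_group_add \<Rightarrow> 'v) \<Rightarrow> (int \<Rightarrow> 'v set) \<Rightarrow>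
   ('k \<Rightarrow> 'w::ab_group_add \<Rightarrow> 'w) \<Rightarrow> (int \<Rightarrow> 'w set) \<Rightarrow> int \<Rightarrow> ('v \<Rightarrow> 'w) \<Rightarrow> bool" where
  "graded_map s G t H n f \<longleftrightarrow>
     lin_on s (total s G) t f \<and> (\<forall>i. \<forall>x\<in>G i. f x \<in> H (i + n))"

text \<open>Degree \<open>0\<close> linear maps out of a tensor product are encoded as bilinear maps.\<close>

definition graded_bilinear ::
  "('k::field \<Rightarrow> 'u::ab_group_add \<Rightarrow> 'u) \<Rightarrow> (int \<Rightarrow> 'u set) \<Rightarrow>
   ('k \<Rightarrow> 'v::ab_group_add \<Rightarrow> 'v) \<Rightarrow> (int \<Rightarrow> 'v set) \<Rightarrow>
   ('k \<Rightarrow> 'w::ab_group_add \<Rightarrow> 'w) \<Rightarrow> (int \<Rightarrow> 'w set) \<Rightarrow> ('u \<Rightarrow> 'v \<Rightarrow> 'w) \<Rightarrow> bool" where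
  "graded_bilinear r F s G t H f \<longleftrightarrow>
     (\<forall>x\<in>total r F. lin_on s (total s G) t (f x)) \<and>
     (\<forall>y\<in>total s G. lin_on r (total r F) t (\<lambda>x. f x y)) \<and>
     (\<forall>i j. \<forall>x\<in>F i. \<forall>y\<in>G j. f x y \<in> H (i + j))"

definition hom_word :: "(int \<Rightarrow> 'v set) \<Rightarrow> 'v list \<Rightarrow> int list \<Rightarrow> bool" where
  "hom_word G vs ds \<longleftrightarrow> list_all2 (\<lambda>v d. v \<in> G d) vs ds"

definition multilin ::
  "('k::field \<Rightarrow> 'v::ab_group_add \<Rightarrow> 'v) \<Rightarrow> ('k \<Rightarrow> 'w::ab_group_add \<Rightarrow> 'w) \<Rightarrow> ('v list \<Rightarrow> 'w) \<Rightarrow> bool" where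
  "multilin s t f \<longleftrightarrow> (\<forall>xs ys. Vector_Spaces.linear s t (\<lambda>x. f (xs @ x # ys)))"

definition bilin ::
  "('k::field \<Rightarrow> 'v::ab_group_add \<Rightarrow> 'v) \<Rightarrow> ('k \<Rightarrow> 'w::ab_group_add \<Rightarrow> 'w) \<Rightarrow>
   ('k \<Rightarrow> 'x::ab_group_add \<Rightarrow> 'x) \<Rightarrow> ('v \<Rightarrow> 'w \<Rightarrow> 'x) \<Rightarrow> bool" where
  "bilin s t r f \<longleftrightarrow>
     (\<forall>y. Vector_Spaces.linear s r (\<lambda>x. f x y)) \<and> (\<forall>x. Vector_Spaces.linear t r (f x))"

text \<open>Over a field, a tensor is determined by the values of all multilinear forms on it. Tensors
  are therefore represented by evaluation functionals: \<open>word s [v\<^sub>1, \<dots>, v\<^sub>n]\<close> is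
  \<open>v\<^sub>1 \<otimes> \<dots> \<otimes> v\<^sub>n\<close> in the tensor algebra, \<open>word s []\<close> is its unit, and the tensor spaces are spans
  of such pure tensors. The lemmas \<open>word_relations\<close> and \<open>tens_relations\<close> below state that pure
  tensors satisfy no linear relations except those that multilinearity forces. Functionals vanish
  on arguments that are not multilinear, so that equality of tensors is equality of functions.\<close>

type_synonym ('v, 'k) tensor_algebra = "('v list \<Rightarrow> 'k) \<Rightarrow> 'k"

definition word ::
  "('k::field \<Rightarrow> 'v::ab_group_add \<Rightarrow> 'v) \<Rightarrow> 'v list \<Rightarrow> ('v, 'k) tensor_algebra" where
  "word s vs = (\<lambda>\<phi>. if multilin s (*) \<phi> then \<phi> vs else 0)"

definition tens ::
  "('k::field \<Rightarrow> 'v::ab_group_add \<Rightarrow> 'v) \<Rightarrow> ('k \<Rightarrow> 'w::ab_group_add \<Rightarrow> 'w) \<Rightarrow>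
   'v \<Rightarrow> 'w \<Rightarrow> ('v \<Rightarrow> 'w \<Rightarrow> 'k) \<Rightarrow> 'k" where
  "tens s t v w = (\<lambda>\<beta>. if bilin s t (*) \<beta> then \<beta> v w else 0)"

abbreviation ftens (infixr \<open>\<otimes>\<^sub>f\<close> 75) where
  "u \<otimes>\<^sub>f v \<equiv> tens fscale fscale u v"

lemma separating_functional:
  fixes t :: "'k::field \<Rightarrow> 'w::ab_group_add \<Rightarrow> 'w"
  assumes "vector_space t" "w \<noteq> 0"
  shows "\<exists>h. Vector_Spaces.linear t (*) h \<and> h w = (1::'k)"
proof -
  interpret V: vector_space t by fact
  have k: "vector_space ((*) :: 'k \<Rightarrow> 'k \<Rightarrow> 'k)"
    by unfold_locales (auto simp: algebra_simps)
  interpret P: vector_space_pair t "(*) :: 'k \<Rightarrow> 'k \<Rightarrow> 'k"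
    using assms(1) k by (simp add: vector_space_pair_def)
  have "V.independent {w}" using assms(2) by simp
  from P.linear_independent_extend[OF this, of "\<lambda>_. 1"] show ?thesis by auto
qed

lemma word_relations:
  fixes s :: "'k::field \<Rightarrow> 'v::ab_group_add \<Rightarrow> 'v" and t :: "'k \<Rightarrow> 'w::ab_group_add \<Rightarrow> 'w"
  assumes rel: "(\<Sum>i\<in>I. fscale (c i) (word s (vs i))) = 0"
    and F: "multilin s t F"
  shows "(\<Sum>i\<in>I. t (c i) (F (vs i))) = 0"
proof (rule ccontr)
  assume nz: "(\<Sum>i\<in>I. t (c i) (F (vs i))) \<noteq> 0"
  from F have "Vector_Spaces.linear s t (\<lambda>x. F ([] @ x # []))" unfolding multilin_def by blast
  then interpret L: Vector_Spaces.linear s t "\<lambda>x. F ([] @ x # [])" .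
  obtain h where h: "Vector_Spaces.linear t (*) h" "h (\<Sum>i\<in>I. t (c i) (F (vs i))) = (1::'k)"
    using separating_functional[OF L.vs2.vector_space_axioms nz] by blast
  interpret H: Vector_Spaces.linear t "(*)" h by fact
  have "multilin s (*) (\<lambda>v. h (F v))"
    unfolding multilin_def
  proof (intro allI)
    fix xs ys
    have "Vector_Spaces.linear s t (\<lambda>x. F (xs @ x # ys))" using F by (simp add: multilin_def)
    from Vector_Spaces.linear_compose[OF this h(1)]
    show "Vector_Spaces.linear s (*) (\<lambda>x. h (F (xs @ x # ys)))" by (simp add: comp_def)
  qed
  then have "(\<Sum>i\<in>I. c i * h (F (vs i))) = (\<Sum>i\<in>I. fscale (c i) (word s (vs i))) (\<lambda>v. h (F v))"
    by (induction I rule: infinite_finite_induct) (auto simp: pscale_def word_def)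
  also have "\<dots> = 0" using rel by simp
  finally show False using h(2) by (simp add: H.sum H.scale)
qed

lemma tens_relations:
  fixes s :: "'k::field \<Rightarrow> 'v::ab_group_add \<Rightarrow> 'v" and t :: "'k \<Rightarrow> 'w::ab_group_add \<Rightarrow> 'w"
    and r :: "'k \<Rightarrow> 'x::ab_group_add \<Rightarrow> 'x"
  assumes rel: "(\<Sum>i\<in>I. fscale (c i) (tens s t (v i) (w i))) = 0"
    and F: "bilin s t r F"
  shows "(\<Sum>i\<in>I. r (c i) (F (v i) (w i))) = 0"
proof (rule ccontr)
  assume nz: "(\<Sum>i\<in>I. r (c i) (F (v i) (w i))) \<noteq> 0"
  from F have "Vector_Spaces.linear s r (\<lambda>x. F x 0)" unfolding bilin_def by blast
  then interpret L: Vector_Spaces.linear s r "\<lambda>x. F x 0" .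
  obtain h where h: "Vector_Spaces.linear r (*) h" "h (\<Sum>i\<in>I. r (c i) (F (v i) (w i))) = (1::'k)"
    using separating_functional[OF L.vs2.vector_space_axioms nz] by blast
  interpret H: Vector_Spaces.linear r "(*)" h by fact
  have "bilin s t (*) (\<lambda>x y. h (F x y))"
    unfolding bilin_def
  proof (intro conjI allI)
    fix y
    have "Vector_Spaces.linear s r (\<lambda>x. F x y)" using F by (simp add: bilin_def)
    from Vector_Spaces.linear_compose[OF this h(1)]
    show "Vector_Spaces.linear s (*) (\<lambda>x. h (F x y))" by (simp add: comp_def)
  next
    fix x
    have "Vector_Spaces.linear t r (F x)" using F by (simp add: bilin_def)
    from Vector_Spaces.linear_compose[OF this h(1)]
    show "Vector_Spaces.linear t (*) (\<lambda>y. h (F x y))" by (simp add: comp_def)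
  qed
  then have "(\<Sum>i\<in>I. c i * h (F (v i) (w i))) =
      (\<Sum>i\<in>I. fscale (c i) (tens s t (v i) (w i))) (\<lambda>x y. h (F x y))"
    by (induction I rule: infinite_finite_induct) (auto simp: pscale_def tens_def)
  also have "\<dots> = 0" using rel by simp
  finally show False using h(2) by (simp add: H.sum H.scale)
qed

section \<open>The tensor coalgebra and \<open>B\<^sub>\<infinity>\<close>-algebras\<close>

definition tensor_gr ::
  "('k::field \<Rightarrow> 'v::ab_group_add \<Rightarrow> 'v) \<Rightarrow> (int \<Rightarrow> 'v set) \<Rightarrow> int \<Rightarrow> ('v, 'k) tensor_algebra set" where
  "tensor_gr s G n =
     module.span fscale {word s vs | vs ds. hom_word G vs ds \<and> sum_list ds = n}"

abbreviation tensor_total where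
  "tensor_total s G \<equiv> total fscale (tensor_gr s G)"

text \<open>A functional representing a tensor is evaluated on the multilinear function that a linear
  map assigns to pure tensors; this extends the map linearly to all tensors.\<close>

definition deconc ::
  "('k::field \<Rightarrow> 'v::ab_group_add \<Rightarrow> 'v) \<Rightarrow> ('v, 'k) tensor_algebra \<Rightarrow>
   (('v, 'k) tensor_algebra \<Rightarrow> ('v, 'k) tensor_algebra \<Rightarrow> 'k) \<Rightarrow> 'k" where
  "deconc s t = (\<lambda>\<beta>. if bilin fscale fscale (*) \<beta>
     then t (\<lambda>vs. \<Sum>i\<le>length vs. \<beta> (word s (take i vs)) (word s (drop i vs))) else 0)"

definition counit :: "('v, 'k::field) tensor_algebra \<Rightarrow> 'k" where
  "counit t = t (\<lambda>vs. if vs = [] then 1 else 0)"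

text \<open>The projection of \<open>T(V)\<close> onto the tensors of length one, with \<open>v \<in> V\<close> written \<open>word s [v]\<close>.
  Composed with \<open>d\<close> and \<open>m\<close> it yields the structure maps.\<close>

definition cogen ::
  "('k::field \<Rightarrow> 'v::ab_group_add \<Rightarrow> 'v) \<Rightarrow> ('v, 'k) tensor_algebra \<Rightarrow> ('v, 'k) tensor_algebra" where
  "cogen s t = (\<lambda>\<phi>. if multilin s (*) \<phi>
     then t (\<lambda>vs. if length vs = 1 then \<phi> vs else 0) else 0)"

locale Binf_algebra = graded_vector_space sV V
  for sV :: "'k::field \<Rightarrow> 'v::ab_group_add \<Rightarrow> 'v" and V :: "int \<Rightarrow> 'v set" +
  fixes d :: "('v, 'k) tensor_algebra \<Rightarrow> ('v, 'k) tensor_algebra"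
    and m :: "('v, 'k) tensor_algebra \<Rightarrow> ('v, 'k) tensor_algebra \<Rightarrow> ('v, 'k) tensor_algebra"
  assumes m_bilinear:
      "graded_bilinear fscale (tensor_gr sV V) fscale (tensor_gr sV V) fscale (tensor_gr sV V) m"
    and m_assoc:
      "\<lbrakk>x \<in> tensor_total sV V; y \<in> tensor_total sV V; z \<in> tensor_total sV V\<rbrakk>
        \<Longrightarrow> m (m x y) z = m x (m y z)"
    and m_unit_left: "x \<in> tensor_total sV V \<Longrightarrow> m (word sV []) x = x"
    and m_unit_right: "x \<in> tensor_total sV V \<Longrightarrow> m x (word sV []) = x"
    and m_deconc:
      "\<lbrakk>hom_word V xs ds; hom_word V ys es\<rbrakk> \<Longrightarrow>
        deconc sV (m (word sV xs) (word sV ys)) =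
          (\<Sum>i\<le>length xs. \<Sum>j\<le>length ys.
             fscale (ksign (sum_list (drop i ds) * sum_list (take j es)))
               (m (word sV (take i xs)) (word sV (take j ys))
                 \<otimes>\<^sub>f m (word sV (drop i xs)) (word sV (drop j ys))))"
    and m_counit:
      "\<lbrakk>x \<in> tensor_total sV V; y \<in> tensor_total sV V\<rbrakk> \<Longrightarrow> counit (m x y) = counit x * counit y"
    and d_graded: "graded_map fscale (tensor_gr sV V) fscale (tensor_gr sV V) 1 d"
    and d_square: "x \<in> tensor_total sV V \<Longrightarrow> d (d x) = 0"
    and d_deconc:
      "hom_word V xs ds \<Longrightarrow>
        deconc sV (d (word sV xs)) =
          (\<Sum>i\<le>length xs.
             d (word sV (take i xs)) \<otimes>\<^sub>f word sV (drop i xs) +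
             fscale (ksign (sum_list (take i ds))) (word sV (take i xs) \<otimes>\<^sub>f d (word sV (drop i xs))))"
    and d_counit: "x \<in> tensor_total sV V \<Longrightarrow> counit (d x) = 0"
    and d_unit: "d (word sV []) = 0"
    and d_derivation:
      "\<lbrakk>x \<in> tensor_gr sV V i; y \<in> tensor_total sV V\<rbrakk>
        \<Longrightarrow> d (m x y) = m (d x) y + fscale (ksign i) (m x (d y))"

text \<open>The twist of a \<open>B\<^sub>\<infinity>\<close>-algebra with vanishing differential by a Maurer--Cartan element \<open>\<gamma>\<close>;
  the commutator with \<open>\<gamma>\<close> carries the Koszul sign.\<close>

definition is_twisted_differential ::
  "('k::field \<Rightarrow> 'v::ab_group_add \<Rightarrow> 'v) \<Rightarrow> (int \<Rightarrow> 'v set) \<Rightarrow>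
   (('v, 'k) tensor_algebra \<Rightarrow> ('v, 'k) tensor_algebra \<Rightarrow> ('v, 'k) tensor_algebra) \<Rightarrow> 'v \<Rightarrow>
   (('v, 'k) tensor_algebra \<Rightarrow> ('v, 'k) tensor_algebra) \<Rightarrow> bool" where
  "is_twisted_differential sV V m \<gamma> d \<longleftrightarrow>
     (\<forall>i. \<forall>x\<in>tensor_gr sV V i.
        d x = m (word sV [\<gamma>]) x - fscale (ksign i) (m x (word sV [\<gamma>])))"

section \<open>Left \<open>B\<^sub>\<infinity>\<close>-modules\<close>

text \<open>\<open>T(V) \<otimes> W \<otimes> T(V)\<close>, represented by evaluation functionals in the same way.\<close>

type_synonym ('v, 'w, 'k) bar_space = "('v list \<Rightarrow> 'w \<Rightarrow> 'v list \<Rightarrow> 'k) \<Rightarrow> 'k"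

definition bar_form ::
  "('k::field \<Rightarrow> 'v::ab_group_add \<Rightarrow> 'v) \<Rightarrow> ('k \<Rightarrow> 'w::ab_group_add \<Rightarrow> 'w) \<Rightarrow>
   ('v list \<Rightarrow> 'w \<Rightarrow> 'v list \<Rightarrow> 'k) \<Rightarrow> bool" where
  "bar_form sV sW \<phi> \<longleftrightarrow>
     (\<forall>w vs. multilin sV (*) (\<lambda>us. \<phi> us w vs)) \<and>
     (\<forall>us vs. Vector_Spaces.linear sW (*) (\<lambda>w. \<phi> us w vs)) \<and>
     (\<forall>us w. multilin sV (*) (\<lambda>vs. \<phi> us w vs))"

definition barw ::
  "('k::field \<Rightarrow> 'v::ab_group_add \<Rightarrow> 'v) \<Rightarrow> ('k \<Rightarrow> 'w::ab_group_add \<Rightarrow> 'w) \<Rightarrow>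
   'v list \<Rightarrow> 'w \<Rightarrow> 'v list \<Rightarrow> ('v, 'w, 'k) bar_space" where
  "barw sV sW us w vs = (\<lambda>\<phi>. if bar_form sV sW \<phi> then \<phi> us w vs else 0)"

definition bar_gr ::
  "('k::field \<Rightarrow> 'v::ab_group_add \<Rightarrow> 'v) \<Rightarrow> (int \<Rightarrow> 'v set) \<Rightarrow>
   ('k \<Rightarrow> 'w::ab_group_add \<Rightarrow> 'w) \<Rightarrow> (int \<Rightarrow> 'w set) \<Rightarrow> int \<Rightarrow> ('v, 'w, 'k) bar_space set" where
  "bar_gr sV V sW W n =
     module.span fscale {barw sV sW us w vs | us ds w j vs es.
       hom_word V us ds \<and> w \<in> W j \<and> hom_word V vs es \<and> sum_list ds + j + sum_list es = n}"

abbreviation bar_total where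
  "bar_total sV V sW W \<equiv> total fscale (bar_gr sV V sW W)"

definition lcoact ::
  "('k::field \<Rightarrow> 'v::ab_group_add \<Rightarrow> 'v) \<Rightarrow> ('k \<Rightarrow> 'w::ab_group_add \<Rightarrow> 'w) \<Rightarrow>
   ('v, 'w, 'k) bar_space \<Rightarrow> (('v, 'k) tensor_algebra \<Rightarrow> ('v, 'w, 'k) bar_space \<Rightarrow> 'k) \<Rightarrow> 'k" where
  "lcoact sV sW z = (\<lambda>\<beta>. if bilin fscale fscale (*) \<beta>
     then z (\<lambda>us w vs. \<Sum>i\<le>length us. \<beta> (word sV (take i us)) (barw sV sW (drop i us) w vs))
     else 0)"

definition rcoact ::
  "('k::field \<Rightarrow> 'v::ab_group_add \<Rightarrow> 'v) \<Rightarrow> ('k \<Rightarrow> 'w::ab_group_add \<Rightarrow> 'w) \<Rightarrow>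
   ('v, 'w, 'k) bar_space \<Rightarrow> (('v, 'w, 'k) bar_space \<Rightarrow> ('v, 'k) tensor_algebra \<Rightarrow> 'k) \<Rightarrow> 'k" where
  "rcoact sV sW z = (\<lambda>\<beta>. if bilin fscale fscale (*) \<beta>
     then z (\<lambda>us w vs. \<Sum>i\<le>length vs. \<beta> (barw sV sW us w (take i vs)) (word sV (drop i vs)))
     else 0)"

text \<open>The projection of \<open>T(V) \<otimes> W \<otimes> T(V)\<close> onto \<open>W\<close>, with \<open>w \<in> W\<close> written \<open>barw sV sW [] w []\<close>.\<close>

definition bar_cogen ::
  "('k::field \<Rightarrow> 'v::ab_group_add \<Rightarrow> 'v) \<Rightarrow> ('k \<Rightarrow> 'w::ab_group_add \<Rightarrow> 'w) \<Rightarrow>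
   ('v, 'w, 'k) bar_space \<Rightarrow> ('v, 'w, 'k) bar_space" where
  "bar_cogen sV sW z = (\<lambda>\<phi>. if bar_form sV sW \<phi>
     then z (\<lambda>us w vs. if us = [] \<and> vs = [] then \<phi> us w vs else 0) else 0)"

text \<open>A degree \<open>1\<close> square-zero coderivation of the bi-comodule \<open>T(V) \<otimes> W \<otimes> T(V)\<close>,
  relative to the differential \<open>d\<close> of \<open>T(V)\<close>.\<close>

locale bar_differential =
  V: graded_vector_space sV V + W: graded_vector_space sW W
  for sV :: "'k::field \<Rightarrow> 'v::ab_group_add \<Rightarrow> 'v" and V :: "int \<Rightarrow> 'v set"
    and sW :: "'k \<Rightarrow> 'w::ab_group_add \<Rightarrow> 'w" and W :: "int \<Rightarrow> 'w set" +
  fixes d :: "('v, 'k) tensor_algebra \<Rightarrow> ('v, 'k) tensor_algebra"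
    and b :: "('v, 'w, 'k) bar_space \<Rightarrow> ('v, 'w, 'k) bar_space"
  assumes b_graded: "graded_map fscale (bar_gr sV V sW W) fscale (bar_gr sV V sW W) 1 b"
    and b_square: "z \<in> bar_total sV V sW W \<Longrightarrow> b (b z) = 0"
    and b_lcoact:
      "\<lbrakk>hom_word V us ds; w \<in> W k; hom_word V vs es\<rbrakk> \<Longrightarrow>
        lcoact sV sW (b (barw sV sW us w vs)) =
          (\<Sum>j\<le>length us.
             d (word sV (take j us)) \<otimes>\<^sub>f barw sV sW (drop j us) w vs +
             fscale (ksign (sum_list (take j ds)))
               (word sV (take j us) \<otimes>\<^sub>f b (barw sV sW (drop j us) w vs)))"
    and b_rcoact:
      "\<lbrakk>hom_word V us ds; w \<in> W k; hom_word V vs es\<rbrakk> \<Longrightarrow>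
        rcoact sV sW (b (barw sV sW us w vs)) =
          (\<Sum>j\<le>length vs.
             b (barw sV sW us w (take j vs)) \<otimes>\<^sub>f word sV (drop j vs) +
             fscale (ksign (sum_list ds + k + sum_list (take j es)))
               (barw sV sW us w (take j vs) \<otimes>\<^sub>f d (word sV (drop j vs))))"

locale left_Binf_module =
  Binf_algebra sV V d m + bar_differential sV V sW W d b
  for sV :: "'k::field \<Rightarrow> 'v::ab_group_add \<Rightarrow> 'v" and V :: "int \<Rightarrow> 'v set"
    and d :: "('v, 'k) tensor_algebra \<Rightarrow> ('v, 'k) tensor_algebra"
    and m :: "('v, 'k) tensor_algebra \<Rightarrow> ('v, 'k) tensor_algebra \<Rightarrow> ('v, 'k) tensor_algebra"
    and sW :: "'k \<Rightarrow> 'w::ab_group_add \<Rightarrow> 'w" and W :: "int \<Rightarrow> 'w set"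
    and b :: "('v, 'w, 'k) bar_space \<Rightarrow> ('v, 'w, 'k) bar_space" +
  fixes mL :: "('v, 'k) tensor_algebra \<Rightarrow> ('v, 'w, 'k) bar_space \<Rightarrow> ('v, 'w, 'k) bar_space"
  assumes mL_bilinear:
      "graded_bilinear fscale (tensor_gr sV V) fscale (bar_gr sV V sW W) fscale (bar_gr sV V sW W) mL"
    and mL_unit: "z \<in> bar_total sV V sW W \<Longrightarrow> mL (word sV []) z = z"
    and mL_assoc:
      "\<lbrakk>x \<in> tensor_total sV V; y \<in> tensor_total sV V; z \<in> bar_total sV V sW W\<rbrakk>
        \<Longrightarrow> mL (m x y) z = mL x (mL y z)"
    and mL_lcoact:
      "\<lbrakk>hom_word V xs cs; hom_word V us ds; w \<in> W k; hom_word V vs es\<rbrakk> \<Longrightarrow>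
        lcoact sV sW (mL (word sV xs) (barw sV sW us w vs)) =
          (\<Sum>i\<le>length xs. \<Sum>j\<le>length us.
             fscale (ksign (sum_list (drop i cs) * sum_list (take j ds)))
               (m (word sV (take i xs)) (word sV (take j us))
                 \<otimes>\<^sub>f mL (word sV (drop i xs)) (barw sV sW (drop j us) w vs)))"
    and mL_rcoact:
      "\<lbrakk>hom_word V xs cs; hom_word V us ds; w \<in> W k; hom_word V vs es\<rbrakk> \<Longrightarrow>
        rcoact sV sW (mL (word sV xs) (barw sV sW us w vs)) =
          (\<Sum>i\<le>length xs. \<Sum>j\<le>length vs.
             fscale (ksign (sum_list (drop i cs) * (sum_list ds + k + sum_list (take j es))))
               (mL (word sV (take i xs)) (barw sV sW us w (take j vs))
                 \<otimes>\<^sub>f m (word sV (drop i xs)) (word sV (drop j vs))))"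
    and b_derivation:
      "\<lbrakk>x \<in> tensor_gr sV V i; z \<in> bar_total sV V sW W\<rbrakk>
        \<Longrightarrow> b (mL x z) = mL (d x) z + fscale (ksign i) (mL x (b z))"

section \<open>Endomorphisms, braces and curved \<open>A\<^sub>\<infinity>\<close>-algebras\<close>

text \<open>A single function \<open>P\<close> on lists encodes the family of its components
  \<open>P\<^sub>n \<in> Hom(A\<^sup>\<otimes>\<^sup>n, A)\<close>. Degree \<open>p\<close> is the total degree \<open>n - 1 + |P\<^sub>n|\<close> for every \<open>n\<close>.
  Infinitely many \<open>P\<^sub>n\<close> may be nonzero, as is needed for \<open>\<gamma> = \<gamma>\<^sub>0 + \<gamma>\<^sub>1 + \<dots>\<close> to be an element.\<close>

definition End_gr ::
  "('k::field \<Rightarrow> 'a::ab_group_add \<Rightarrow> 'a) \<Rightarrow> (int \<Rightarrow> 'a set) \<Rightarrow> int \<Rightarrow> ('a list \<Rightarrow> 'a) set" where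
  "End_gr sA A p = {P. multilin sA sA P \<and>
     (\<forall>es \<delta>. hom_word A es \<delta> \<longrightarrow> P es \<in> A (p - (int (length es) - 1) + sum_list \<delta>))}"

text \<open>A placement of \<open>q\<close> operations into the entries \<open>e\<^sub>a, \<dots>, e\<^sub>b\<^sub>-\<^sub>1\<close> lists, for each operation, the
  index of its first argument and its arity. Operations of arity \<open>0\<close> may also be placed after
  the last entry.\<close>

definition placements :: "nat \<Rightarrow> nat \<Rightarrow> nat \<Rightarrow> (nat \<times> nat) list set" where
  "placements a b q = {ps. length ps = q \<and>
     (\<forall>k<q. a \<le> fst (ps ! k) \<and> fst (ps ! k) + snd (ps ! k) \<le> b) \<and>
     (\<forall>k. Suc k < q \<longrightarrow> fst (ps ! k) + snd (ps ! k) \<le> fst (ps ! Suc k))}"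

definition seg :: "'a list \<Rightarrow> nat \<Rightarrow> nat \<Rightarrow> 'a list" where
  "seg es a b = map ((!) es) [a..<b]"

fun plug :: "'a list \<Rightarrow> nat \<Rightarrow> nat \<Rightarrow> (('a list \<Rightarrow> 'a) \<times> nat \<times> nat) list \<Rightarrow> 'a list" where
  "plug es a b [] = seg es a b"
| "plug es a b ((Q, i, q) # qs) = seg es a i @ Q (seg es i (i + q)) # plug es (i + q) b qs"

text \<open>The brace \<open>m\<^sub>1\<^sub>,\<^sub>q(P; Q\<^sub>1, \<dots>, Q\<^sub>q)\<close> on homogeneous arguments of degrees \<open>\<delta>\<close>, for \<open>Q\<^sub>k\<close> of degree
  \<open>ds ! k\<close>. The entries are indexed from \<open>0\<close> here, so \<open>i\<close> entries precede the one with index \<open>i\<close>.\<close>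

definition brace_value ::
  "('k::field \<Rightarrow> 'a::ab_group_add \<Rightarrow> 'a) \<Rightarrow> ('a list \<Rightarrow> 'a) \<Rightarrow> ('a list \<Rightarrow> 'a) list \<Rightarrow> int list \<Rightarrow>
   'a list \<Rightarrow> int list \<Rightarrow> 'a" where
  "brace_value sA P Qs ds es \<delta> =
     (\<Sum>ps\<in>placements 0 (length es) (length Qs).
        sA (ksign (\<Sum>k<length Qs. ds ! k * (int (fst (ps ! k)) + (\<Sum>j<fst (ps ! k). \<delta> ! j))))
           (P (plug es 0 (length es) (zip Qs ps))))"

definition is_brace ::
  "('k::field \<Rightarrow> 'a::ab_group_add \<Rightarrow> 'a) \<Rightarrow> (int \<Rightarrow> 'a set) \<Rightarrow> ('a list \<Rightarrow> 'a) \<Rightarrow>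
   ('a list \<Rightarrow> 'a) list \<Rightarrow> int list \<Rightarrow> ('a list \<Rightarrow> 'a) \<Rightarrow> bool" where
  "is_brace sA A P Qs ds B \<longleftrightarrow>
     multilin sA sA B \<and> (\<forall>es \<delta>. hom_word A es \<delta> \<longrightarrow> B es = brace_value sA P Qs ds es \<delta>)"

definition has_brace_structure_maps ::
  "('k::field \<Rightarrow> 'a::ab_group_add \<Rightarrow> 'a) \<Rightarrow> (int \<Rightarrow> 'a set) \<Rightarrow>
   (('a list \<Rightarrow> 'a, 'k) tensor_algebra \<Rightarrow> ('a list \<Rightarrow> 'a, 'k) tensor_algebra \<Rightarrow>
    ('a list \<Rightarrow> 'a, 'k) tensor_algebra) \<Rightarrow> bool" where
  "has_brace_structure_maps sA A m \<longleftrightarrow>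
     (let sE = pscale sA; E = End_gr sA A in
       (\<forall>Q q. Q \<in> E q \<longrightarrow> cogen sE (m (word sE []) (word sE [Q])) = word sE [Q]) \<and>
       (\<forall>P p. P \<in> E p \<longrightarrow> cogen sE (m (word sE [P]) (word sE [])) = word sE [P]) \<and>
       (\<forall>P p Qs ds. P \<in> E p \<and> hom_word E Qs ds \<and> Qs \<noteq> [] \<longrightarrow>
          (\<exists>B. is_brace sA A P Qs ds B \<and>
               cogen sE (m (word sE [P]) (word sE Qs)) = word sE [B])) \<and>
       (\<forall>Ps cs Qs ds. hom_word E Ps cs \<and> hom_word E Qs ds \<and> 2 \<le> length Ps \<and> Qs \<noteq> [] \<longrightarrow>
          cogen sE (m (word sE Ps) (word sE Qs)) = 0))"

text \<open>The last axiom is \<open>m\<^sub>1\<^sub>,\<^sub>1(\<gamma>, \<gamma>) = 0\<close>, the Maurer--Cartan equation for \<open>d = 0\<close>.\<close>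

locale curved_Ainf_algebra = graded_vector_space sA A
  for sA :: "'k::field \<Rightarrow> 'a::ab_group_add \<Rightarrow> 'a" and A :: "int \<Rightarrow> 'a set" +
  fixes \<gamma> :: "'a list \<Rightarrow> 'a"
  assumes total_UNIV: "total sA A = UNIV"
    and gamma_degree: "\<gamma> \<in> End_gr sA A 1"
    and gamma_brace: "hom_word A es \<delta> \<Longrightarrow> brace_value sA \<gamma> [\<gamma>] [1] es \<delta> = 0"

section \<open>The two actions on chains\<close>

text \<open>\<open>(e\<^sub>0| \<dots> |e\<^sub>m) \<in> A \<otimes> A\<^sup>\<otimes>\<^sup>m[m]\<close> is \<open>word sA [e\<^sub>0, \<dots>, e\<^sub>m]\<close>, of degree \<open>\<Sum>|e\<^sub>j| - m\<close>.\<close>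

definition chain_gr ::
  "('k::field \<Rightarrow> 'a::ab_group_add \<Rightarrow> 'a) \<Rightarrow> (int \<Rightarrow> 'a set) \<Rightarrow> int \<Rightarrow> ('a, 'k) tensor_algebra set" where
  "chain_gr sA A n = module.span fscale
     {word sA es | es \<delta>. es \<noteq> [] \<and> hom_word A es \<delta> \<and> sum_list \<delta> - (int (length es) - 1) = n}"

definition cyclic_value ::
  "('k::field \<Rightarrow> 'a::ab_group_add \<Rightarrow> 'a) \<Rightarrow> ('a list \<Rightarrow> 'a) \<Rightarrow> ('a list \<Rightarrow> 'a) list \<Rightarrow> int list \<Rightarrow>
   'a list \<Rightarrow> int list \<Rightarrow> ('a list \<Rightarrow> 'a) list \<Rightarrow> int list \<Rightarrow> ('a, 'k) tensor_algebra" where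
  "cyclic_value sA P Qs cs es \<delta> Rs ds = (let m = length es - 1 in
     \<Sum>l\<in>{1..m + 1}. \<Sum>n\<in>{1..l}.
     \<Sum>js\<in>placements l (m + 1) (length Qs). \<Sum>ks\<in>placements 1 n (length Rs).
       fscale (ksign
          ((int l + (\<Sum>j<l. \<delta> ! j)) * (int m - int l + 1 + (\<Sum>j\<in>{l..m}. \<delta> ! j))
           + (\<Sum>a<length Qs. cs ! a * (int (fst (js ! a)) - int l + (\<Sum>i\<in>{l..<fst (js ! a)}. \<delta> ! i)))
           + (\<Sum>b<length Rs. ds ! b * (int (fst (ks ! b)) - int l - 1 + (\<Sum>f\<in>{fst (ks ! b)..<l}. \<delta> ! f)))))
         (word sA (P (plug es l (m + 1) (zip Qs js) @ es ! 0 # plug es 1 n (zip Rs ks)) # seg es n l)))"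

definition insertion_value ::
  "('k::field \<Rightarrow> 'a::ab_group_add \<Rightarrow> 'a) \<Rightarrow> ('a list \<Rightarrow> 'a) list \<Rightarrow> int list \<Rightarrow>
   'a list \<Rightarrow> int list \<Rightarrow> ('a, 'k) tensor_algebra" where
  "insertion_value sA Ps ds es \<delta> = (let m = length es - 1 in
     \<Sum>ps\<in>placements 1 (m + 1) (length Ps).
       fscale (ksign (\<Sum>a<length Ps. ds ! a * (int (fst (ps ! a)) - 1 + (\<Sum>i<fst (ps ! a). \<delta> ! i))))
         (word sA (es ! 0 # plug es 1 (m + 1) (zip Ps ps))))"

type_synonym ('a, 'k) chain_bar = "('a list \<Rightarrow> 'a, ('a, 'k) tensor_algebra, 'k) bar_space"

definition has_cyclic_structure_maps ::
  "('k::field \<Rightarrow> 'a::ab_group_add \<Rightarrow> 'a) \<Rightarrow> (int \<Rightarrow> 'a set) \<Rightarrow>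
   (('a list \<Rightarrow> 'a, 'k) tensor_algebra \<Rightarrow> ('a, 'k) chain_bar \<Rightarrow> ('a, 'k) chain_bar) \<Rightarrow> bool" where
  "has_cyclic_structure_maps sA A mL \<longleftrightarrow>
     (let sE = pscale sA; E = End_gr sA A; act = (\<lambda>Ps Qs es Rs.
          bar_cogen sE fscale (mL (word sE Ps) (barw sE fscale Qs (word sA es) Rs))) in
       \<forall>Ps bs Qs cs es \<delta> Rs ds.
         hom_word E Ps bs \<and> hom_word E Qs cs \<and> es \<noteq> [] \<and> hom_word A es \<delta> \<and> hom_word E Rs ds \<longrightarrow>
         (length Ps = 1 \<longrightarrow> act Ps Qs es Rs =
            barw sE fscale [] (cyclic_value sA (hd Ps) Qs cs es \<delta> Rs ds) []) \<and>
         (Ps = [] \<and> Qs = [] \<and> Rs = [] \<longrightarrow> act Ps Qs es Rs = barw sE fscale [] (word sA es) []) \<and>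
         (Ps = [] \<and> \<not> (Qs = [] \<and> Rs = []) \<longrightarrow> act Ps Qs es Rs = 0) \<and>
         (2 \<le> length Ps \<longrightarrow> act Ps Qs es Rs = 0))"

definition has_insertion_structure_maps ::
  "('k::field \<Rightarrow> 'a::ab_group_add \<Rightarrow> 'a) \<Rightarrow> (int \<Rightarrow> 'a set) \<Rightarrow>
   (('a list \<Rightarrow> 'a, 'k) tensor_algebra \<Rightarrow> ('a, 'k) chain_bar \<Rightarrow> ('a, 'k) chain_bar) \<Rightarrow> bool" where
  "has_insertion_structure_maps sA A mL \<longleftrightarrow>
     (let sE = pscale sA; E = End_gr sA A; act = (\<lambda>Ps Qs es Rs.
          bar_cogen sE fscale (mL (word sE Ps) (barw sE fscale Qs (word sA es) Rs))) in
       \<forall>Ps bs Qs cs es \<delta> Rs ds.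
         hom_word E Ps bs \<and> hom_word E Qs cs \<and> es \<noteq> [] \<and> hom_word A es \<delta> \<and> hom_word E Rs ds \<longrightarrow>
         (Qs = [] \<and> Rs = [] \<longrightarrow> act Ps Qs es Rs =
            barw sE fscale [] (insertion_value sA Ps bs es \<delta>) []) \<and>
         (\<not> (Qs = [] \<and> Rs = []) \<longrightarrow> act Ps Qs es Rs = 0))"

definition has_b_gamma_structure_maps ::
  "('k::field \<Rightarrow> 'a::ab_group_add \<Rightarrow> 'a) \<Rightarrow> (int \<Rightarrow> 'a set) \<Rightarrow> ('a list \<Rightarrow> 'a) \<Rightarrow>
   (('a, 'k) chain_bar \<Rightarrow> ('a, 'k) chain_bar) \<Rightarrow> bool" where
  "has_b_gamma_structure_maps sA A \<gamma> b \<longleftrightarrow>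
     (let sE = pscale sA; E = End_gr sA A; op = (\<lambda>Qs es Rs.
          bar_cogen sE fscale (b (barw sE fscale Qs (word sA es) Rs))) in
       \<forall>Qs cs es \<delta> Rs ds.
         hom_word E Qs cs \<and> es \<noteq> [] \<and> hom_word A es \<delta> \<and> hom_word E Rs ds \<longrightarrow>
         (Qs = [] \<and> Rs = [] \<longrightarrow> op Qs es Rs =
            barw sE fscale []
              (cyclic_value sA \<gamma> [] [] es \<delta> [] [] - insertion_value sA [\<gamma>] [1] es \<delta>) []) \<and>
         (\<not> (Qs = [] \<and> Rs = []) \<longrightarrow> op Qs es Rs =
            barw sE fscale [] (cyclic_value sA \<gamma> Qs cs es \<delta> Rs ds) []))"

text \<open>The operator \<open>b\<^sub>\<gamma>\<close> is not a derivation of the insertion action. For \<open>\<gamma> = \<gamma>\<^sub>2\<close> an associative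
  product on \<open>A\<close> concentrated in degree \<open>0\<close>, \<open>P = id\<^sub>A\<close> and \<open>c = (e\<^sub>0|e\<^sub>1)\<close>, the component in \<open>A\<close> of
  \<open>b\<^sub>\<gamma>(P \<cdot> c) - d\<^sub>\<gamma>(P) \<cdot> c - P \<cdot> b\<^sub>\<gamma>(c)\<close> is \<open>2(e\<^sub>0 e\<^sub>1 - e\<^sub>1 e\<^sub>0)\<close>. The differential compatible with the
  insertion action has \<open>c \<mapsto> m\<^sub>L\<^sub>,\<^sub>2(\<gamma>, c)\<close> as its only structure map.\<close>

definition has_insertion_differential_structure_maps ::
  "('k::field \<Rightarrow> 'a::ab_group_add \<Rightarrow> 'a) \<Rightarrow> (int \<Rightarrow> 'a set) \<Rightarrow> ('a list \<Rightarrow> 'a) \<Rightarrow>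
   (('a, 'k) chain_bar \<Rightarrow> ('a, 'k) chain_bar) \<Rightarrow> bool" where
  "has_insertion_differential_structure_maps sA A \<gamma> b \<longleftrightarrow>
     (let sE = pscale sA; E = End_gr sA A; op = (\<lambda>Qs es Rs.
          bar_cogen sE fscale (b (barw sE fscale Qs (word sA es) Rs))) in
       \<forall>Qs cs es \<delta> Rs ds.
         hom_word E Qs cs \<and> es \<noteq> [] \<and> hom_word A es \<delta> \<and> hom_word E Rs ds \<longrightarrow>
         (Qs = [] \<and> Rs = [] \<longrightarrow> op Qs es Rs =
            barw sE fscale [] (insertion_value sA [\<gamma>] [1] es \<delta>) []) \<and>
         (\<not> (Qs = [] \<and> Rs = []) \<longrightarrow> op Qs es Rs = 0))"

end

theory Submission
 imports Defs
begin

text \<open>A word \<open>P\<^sub>1, \<dots>, P\<^sub>p\<close> of operations acts on a word of letters by replacing, in all possible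
  ways, \<open>p\<close> consecutive disjoint blocks of letters by the values of the operations on them, with
  Koszul sign; this is \<open>act\<close>. On words in \<open>A\<close> it applies multilinear maps, and on words in \<open>End(A)\<close>,
  with the brace as value, it is the product of \<open>T(End(A))\<close>. Two properties of \<open>act\<close> carry the
  proof. Deconcatenating a result amounts to deconcatenating both arguments (\<open>act_split\<close>); every
  compatibility with a coproduct or a coaction comes from this. Acting twice is acting once with
  the product of the operations (\<open>act_compose\<close>), as soon as this is known for the value of one single
  operation; every associativity law comes from this.

  The space \<open>T(V) \<otimes> W \<otimes> T(V)\<close> is brought into this form by writing \<open>u \<otimes> c \<otimes> v\<close> as a word: the
  operations of \<open>u\<close>, letters that spell the chain \<open>c\<close>, the operations of \<open>v\<close>. A module structure is
  then determined by the value of an operation on a block of such letters, and its extension to the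
  bi-comodule is \<open>act\<close> again. The locale \<open>letter_model\<close> lists the laws that these values have to
  satisfy. In each model the differential is the commutator with \<open>\<gamma>\<close>: \<open>\<gamma>\<close> acts from the left as an
  operation and from the right by inserting the letter \<open>\<gamma>\<close> into the word. It squares to zero since
  \<open>\<gamma>{\<gamma>} = 0\<close> and \<open>\<gamma>\<close> is odd, and it is a derivation since left and right multiplications commute.

  In the model of the cyclic action a chain is a single letter. The value of \<open>P\<close> on a block that
  contains this letter applies \<open>P\<close> around \<open>e\<^sub>0\<close>, and the right multiplication of the letter by \<open>\<gamma>\<close>
  inserts \<open>\<gamma>\<close> into \<open>e\<^sub>1, \<dots>, e\<^sub>m\<close>. Hence the commutator has the structure map
  \<open>m\<^sub>L\<^sub>,\<^sub>1(\<gamma>, c) - m\<^sub>L\<^sub>,\<^sub>2(\<gamma>, c)\<close> and is \<open>b\<^sub>\<gamma>\<close>. The work is in two laws: the compatibility of the cyclic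
  value with braces (\<open>ev_cyclic_brace\<close>) and with the right multiplication by \<open>\<gamma>\<close> (\<open>ev_cyclic_gamma\<close>).
  In the model of the insertion action the chain is spelled by one letter for each entry; operations
  take values on blocks of operations and on blocks of entries other than \<open>e\<^sub>0\<close>, and both laws
  reduce to those of \<open>End(A)\<close> and \<open>A\<close>.

  Tensors are functionals on multilinear functions. Linear maps out of them are obtained from
  functions on words of homogeneous letters, extended along a homogeneous basis, so that all
  identities only have to be checked on words. The two actions are told apart by the projection
  \<open>P\<close> to words of length one: the cyclic action of \<open>P\<close> sends the chain
  \<open>(e\<^sub>0)\<close> to \<open>(P(e\<^sub>0)) = (e\<^sub>0)\<close>, the insertion action sends it to \<open>(e\<^sub>0|P()) = 0\<close>.\<close>

type_synonym 'b oper = "('b list => 'b) \<times> int"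

section \<open>Formal signed sums\<close>

text \<open>Signs are kept as integers read modulo two, so that a comparison of signs is a parity
  check of polynomials.\<close>

definition sg :: "int => 'x::ab_group_add => 'x" where
 "sg n v = (if even n then v else - v)"

lemma sg_sg: "sg a (sg b v) = sg (a + b) v"
 by (simp add: sg_def)

lemma sg_0 [simp]: "sg 0 v = v"
 by (simp add: sg_def)

lemma sg_zero [simp]: "sg n 0 = 0"
 by (simp add: sg_def)

lemma sg_add: "sg n (v + w) = sg n v + sg n w"
 by (simp add: sg_def)

lemma sg_minus: "sg n (- v) = - sg n v"
 by (simp add: sg_def)

lemma sg_eq: "even (a - b) ==> sg a v = sg b v"
 by (auto simp: sg_def)

lemma sg_neg: "odd (a - b) ==> sg a v = - sg b v"
 by (auto simp: sg_def)

text \<open>A list of signed terms, with a function evaluated on it. Values of operations are formal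
  signed sums; they become sums only after a function with values in a group is applied.\<close>

definition lsum :: "(int \<times> 'z) list => ('z => 'x::ab_group_add) => 'x" where
 "lsum L k = (\<Sum>(n, z)\<leftarrow>L. sg n (k z))"

lemma lsum_Nil [simp]: "lsum [] k = 0"
 by (simp add: lsum_def)

lemma lsum_Cons [simp]: "lsum ((n, z) # L) k = sg n (k z) + lsum L k"
 by (simp add: lsum_def)

lemma lsum_append [simp]: "lsum (L @ M) k = lsum L k + lsum M k"
 by (simp add: lsum_def)

lemma lsum_zero [simp]: "lsum L (\<lambda>z. 0) = 0"
 by (induction L) auto

lemma lsum_plus: "lsum L (\<lambda>z. k z + k' z) = lsum L k + lsum L k'"
 by (induction L) (auto simp: sg_add)

lemma lsum_minus: "lsum L (\<lambda>z. - k z) = - lsum L k"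
 by (induction L) (auto simp: sg_minus)

lemma lsum_sg: "lsum L (\<lambda>z. sg n (k z)) = sg n (lsum L k)"
 by (simp add: sg_def lsum_minus)

lemma lsum_additive:
 assumes "\<And>x y. h (x + y) = h x + h y"
 shows "h (lsum L k) = lsum L (\<lambda>z. h (k z :: 'x::ab_group_add) :: 'y::ab_group_add)"
proof -
 have z: "h 0 = 0" using assms[of 0 0] by simp
 have m: "h (- x) = - h x" for x using assms[of x "- x"] z by (simp add: eq_neg_iff_add_eq_0 add.commute)
 show ?thesis by (induction L) (auto simp: assms z m sg_def)
qed

lemma lsum_swap: "lsum L (\<lambda>z. lsum M (\<lambda>w. k z w)) = lsum M (\<lambda>w. lsum L (\<lambda>z. k z w))"
 by (induction L) (auto simp: lsum_plus lsum_sg)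

lemma lsum_cong: "(\<And>n z. (n, z) \<in> set L ==> k z = k' z) ==> lsum L k = lsum L k'"
proof (induction L)
 case (Cons p L)
 obtain n z where p: "p = (n, z)" by (cases p)
 have "lsum L k = lsum L k'" by (rule Cons.IH) (use Cons.prems in auto)
 moreover have "k z = k' z" using Cons.prems[of n z] p by simp
 ultimately show ?case by (simp add: p)
qed simp

definition bind :: "(int \<times> 'y) list => ('y => (int \<times> 'z) list) => (int \<times> 'z) list" where
 "bind L f = concat (map (\<lambda>(n, y). map (\<lambda>(m, z). (n + m, z)) (f y)) L)"

lemma lsum_shift: "lsum (map (\<lambda>(m, z). (n + m, f z)) L) k = sg n (lsum L (\<lambda>z. k (f z)))"
 by (induction L) (auto simp: sg_add sg_sg)

lemma lsum_bind [simp]: "lsum (bind L f) k = lsum L (\<lambda>y. lsum (f y) k)"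
 by (induction L) (auto simp: bind_def lsum_shift[where f = "\<lambda>z. z", simplified])

lemma set_bindE:
 assumes "(n, z) \<in> set (bind L f)"
 obtains i y j where "(i, y) \<in> set L" "(j, z) \<in> set (f y)" "n = i + j"
 using assms unfolding bind_def by auto

section \<open>Deconcatenation\<close>

text \<open>All terms carry the sign exponent 0; the format is that of formal signed sums.\<close>

fun splits :: "'c list => (int \<times> 'c list \<times> 'c list) list" where
 "splits [] = [(0, [], [])]"
| "splits (c # cs) = (0, [], c # cs) # map (\<lambda>(n, a, b). (n, c # a, b)) (splits cs)"

definition spl :: "'c list => ('c list => 'c list => 'x::ab_group_add) => 'x" where
 "spl cs f = lsum (splits cs) (\<lambda>p. f (fst p) (snd p))"

lemma spl_Nil [simp]: "spl [] f = f [] []"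
 by (simp add: spl_def)

lemma spl_Cons [simp]: "spl (c # cs) f = f [] (c # cs) + spl cs (\<lambda>a b. f (c # a) b)"
proof -
 have "lsum (map (\<lambda>(n, a, b). (n, c # a, b)) L) (\<lambda>p. f (fst p) (snd p)) =
   lsum L (\<lambda>p. f (c # fst p) (snd p))" for L
  by (induction L) auto
 then show ?thesis by (simp add: spl_def)
qed

lemma splits_append: "(n, a, b) \<in> set (splits cs) ==> cs = a @ b \<and> n = 0"
 by (induction cs arbitrary: a) auto

lemma spl_cong: "(\<And>a b. cs = a @ b ==> f a b = g a b) ==> spl cs f = spl cs g"
 unfolding spl_def by (rule lsum_cong) (auto dest: splits_append)

lemma spl_zero [simp]: "spl cs (\<lambda>a b. 0) = 0"
 by (induction cs) auto

lemma spl_plus: "spl cs (\<lambda>a b. f a b + g a b) = spl cs f + spl cs g"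
 by (simp add: spl_def lsum_plus split_beta)

lemma spl_sg: "spl cs (\<lambda>a b. sg n (f a b)) = sg n (spl cs f)"
 by (simp add: spl_def lsum_sg split_beta)

lemma spl_lsum: "spl cs (\<lambda>a b. lsum L (\<lambda>z. f a b z)) = lsum L (\<lambda>z. spl cs (\<lambda>a b. f a b z))"
 by (simp add: spl_def split_beta lsum_swap[of L])

lemma spl_spl: "spl cs (\<lambda>a b. spl ds (\<lambda>c d. f a b c d)) = spl ds (\<lambda>c d. spl cs (\<lambda>a b. f a b c d))"
 by (simp add: spl_def[of ds] split_beta spl_lsum)

lemma spl_additive:
 assumes "\<And>x y. h (x + y) = h x + h y"
 shows "h (spl cs f) = spl cs (\<lambda>a b. h (f a b :: 'x::ab_group_add) :: 'y::ab_group_add)"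
 unfolding spl_def by (subst lsum_additive[of h, OF assms]) (simp add: split_beta)

lemma spl_assoc:
 "spl cs (\<lambda>p c. spl p (\<lambda>a b. f a b c)) = spl cs (\<lambda>a r. spl r (\<lambda>b c. f a b c))"
proof (induction cs arbitrary: f)
 case (Cons c cs)
 have "spl (c # cs) (\<lambda>p d. spl p (\<lambda>a b. f a b d)) =
   f [] [] (c # cs) + spl cs (\<lambda>p d. f [] (c # p) d) + spl cs (\<lambda>p d. spl p (\<lambda>a b. f (c # a) b d))"
  by (simp add: spl_plus)
 also have "... = spl (c # cs) (\<lambda>a r. spl r (\<lambda>b d. f a b d))"
  by (simp add: Cons.IH[of "\<lambda>a b d. f (c # a) b d"])
 finally show ?case .
qed simp

lemma spl_append_Cons:
 "spl (u @ c # v) f = spl u (\<lambda>a b. f a (b @ c # v)) + spl v (\<lambda>a b. f (u @ c # a) b)"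
 by (induction u arbitrary: f) (simp_all add: add.assoc)

lemma spl_map: "spl (map g cs) f = spl cs (\<lambda>a b. f (map g a) (map g b))"
 by (induction cs arbitrary: f) auto

lemma spl_atMost: "spl cs f = (\<Sum>i\<le>length cs. f (take i cs) (drop i cs))"
proof (induction cs arbitrary: f)
 case (Cons c cs)
 show ?case by (simp add: Cons.IH sum.atMost_Suc_shift del: sum.atMost_Suc)
qed simp

text \<open>The sum over all choices of one letter, together with what precedes and what follows it.\<close>

fun marked :: "'c list => ('c list => 'c => 'c list => 'x::ab_group_add) => 'x" where
 "marked [] f = 0"
| "marked (c # cs) f = f [] c cs + marked cs (\<lambda>a x b. f (c # a) x b)"

lemma marked_cong:
 "(\<And>a x b. cs = a @ x # b ==> f a x b = g a x b) ==> marked cs f = marked cs g"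
proof (induction cs arbitrary: f g)
 case (Cons c cs)
 have "marked cs (\<lambda>a x b. f (c # a) x b) = marked cs (\<lambda>a x b. g (c # a) x b)"
  by (rule Cons.IH) (use Cons.prems in auto)
 with Cons.prems[of "[]" c cs] show ?case by simp
qed simp

lemma marked_zero [simp]: "marked cs (\<lambda>a x b. 0) = 0"
 by (induction cs) auto

lemma marked_minus: "marked cs (\<lambda>a x b. - f a x b) = - marked cs f"
 by (induction cs arbitrary: f) auto

lemma marked_sg: "marked cs (\<lambda>a x b. sg n (f a x b)) = sg n (marked cs f)"
 by (simp add: sg_def marked_minus)

lemma marked_lsum: "lsum L (\<lambda>z. marked cs (\<lambda>a x b. f a x b z)) = marked cs (\<lambda>a x b. lsum L (\<lambda>z. f a x b z))"
 by (induction cs arbitrary: f) (auto simp: lsum_plus)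

lemma marked_spl: "spl ds (\<lambda>c d. marked cs (\<lambda>a x b. f a x b c d)) = marked cs (\<lambda>a x b. spl ds (\<lambda>c d. f a x b c d))"
 by (simp add: spl_def split_beta marked_lsum)

section \<open>Operations inserted into words\<close>

definition wdeg :: "('c => int) => 'c list => int" where
 "wdeg dc cs = sum_list (map dc cs)"

lemma wdeg_simps [simp]:
 "wdeg dc [] = 0" "wdeg dc (c # cs) = dc c + wdeg dc cs" "wdeg dc (a @ b) = wdeg dc a + wdeg dc b"
 by (simp_all add: wdeg_def)

type_synonym ('p, 'c) operation = "'p => 'c list => (int \<times> 'c) list"

text \<open>The sign moves each operation past the letters in front of its block; \<open>wdeg dp
  xs\<close> accounts for the operations that still have to pass the first two blocks.\<close>

primrec inserted ::
 "('p, 'c) operation => ('p => int) => ('c => int) => 'p list => 'c list => (int \<times> 'c list) list" where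
 "inserted ev dp dc [] = (\<lambda>cs. [(0, cs)])"
| "inserted ev dp dc (P # xs) = (\<lambda>cs.
   bind (splits cs) (\<lambda>(a, r). bind (splits r) (\<lambda>(b, c). bind (ev P b) (\<lambda>z.
    map (\<lambda>(n, w). (dp P * wdeg dc a + wdeg dp xs * (wdeg dc a + wdeg dc b) + n, a @ z # w))
     (inserted ev dp dc xs c)))))"

definition act ::
 "('p, 'c) operation => ('p => int) => ('c => int) => 'p list => 'c list =>
  ('c list => 'x::ab_group_add) => 'x" where
 "act ev dp dc xs cs \<phi> = lsum (inserted ev dp dc xs cs) \<phi>"

lemma act_Nil [simp]: "act ev dp dc [] cs \<phi> = \<phi> cs"
 by (simp add: act_def)

lemma act_Cons:
 "act ev dp dc (P # xs) cs \<phi> = spl cs (\<lambda>a r. spl r (\<lambda>b c.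
   sg (dp P * wdeg dc a + wdeg dp xs * (wdeg dc a + wdeg dc b))
    (lsum (ev P b) (\<lambda>z. act ev dp dc xs c (\<lambda>w. \<phi> (a @ z # w))))))"
 by (simp add: act_def spl_def split_beta lsum_shift lsum_sg)

lemma act_zero [simp]: "act ev dp dc xs cs (\<lambda>w. 0) = 0"
 by (simp add: act_def)

lemma act_plus: "act ev dp dc xs cs (\<lambda>w. f w + g w) = act ev dp dc xs cs f + act ev dp dc xs cs g"
 by (simp add: act_def lsum_plus)

lemma act_sg: "act ev dp dc xs cs (\<lambda>w. sg n (f w)) = sg n (act ev dp dc xs cs f)"
 by (simp add: act_def lsum_sg)

lemma act_additive:
 assumes "\<And>x y. h (x + y) = h x + h y"
 shows "h (act ev dp dc xs cs \<phi>) = act ev dp dc xs cs (\<lambda>w. h (\<phi> w :: 'x::ab_group_add) :: 'y::ab_group_add)"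
 unfolding act_def by (rule lsum_additive[of h, OF assms])

lemma act_lsum: "act ev dp dc xs cs (\<lambda>w. lsum L (\<lambda>z. f w z)) = lsum L (\<lambda>z. act ev dp dc xs cs (\<lambda>w. f w z))"
 by (simp add: act_def lsum_swap[of L])

lemma act_spl: "act ev dp dc xs cs (\<lambda>w. spl ds (\<lambda>a b. f w a b)) = spl ds (\<lambda>a b. act ev dp dc xs cs (\<lambda>w. f w a b))"
 by (simp add: act_def spl_lsum)

lemma act_marked_swap:
 "act ev dp dc xs cs (\<lambda>w. marked ds (\<lambda>a x b. f w a x b)) = marked ds (\<lambda>a x b. act ev dp dc xs cs (\<lambda>w. f w a x b))"
 by (simp add: act_def marked_lsum)

lemma act_act:
 "act ev dp dc xs cs (\<lambda>w. act ev' dp' dc' ys ds (\<lambda>v. f w v)) =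
  act ev' dp' dc' ys ds (\<lambda>v. act ev dp dc xs cs (\<lambda>w. f w v))"
 unfolding act_def by (rule lsum_swap)

text \<open>Where the word is cut, some of the operations have been used up on the left of the cut
  and the others on the right; the latter have passed the letters on the left, which is the sign.
  This is the compatibility of the action with deconcatenation.\<close>

lemma act_split:
 "act ev dp dc xs cs (\<lambda>w. spl w \<psi>) =
  spl xs (\<lambda>x y. spl cs (\<lambda>e f. sg (wdeg dp y * wdeg dc e)
   (act ev dp dc x e (\<lambda>w. act ev dp dc y f (\<lambda>v. \<psi> w v)))))"
proof (induction xs arbitrary: cs \<psi>)
 case (Cons P xs)
 let ?A = "act ev dp dc" and ?d = "wdeg dc"
 define s where "s a b = dp P * ?d a + wdeg dp xs * (?d a + ?d b)" for a b
 have "?A (P # xs) cs (\<lambda>w. spl w \<psi>) =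
  spl cs (\<lambda>a r. spl r (\<lambda>b c. sg (s a b) (lsum (ev P b) (\<lambda>z. ?A xs c (\<lambda>w.
    spl a (\<lambda>a1 a2. \<psi> a1 (a2 @ z # w)))))))
 + spl cs (\<lambda>a r. spl r (\<lambda>b c. sg (s a b) (lsum (ev P b) (\<lambda>z. ?A xs c (\<lambda>w.
    spl w (\<lambda>w1 w2. \<psi> (a @ z # w1) w2))))))" (is "_ = ?T1 + ?T2")
  by (simp only: act_Cons s_def spl_append_Cons act_plus lsum_plus sg_add spl_plus)
 moreover have "?T1 = spl cs (\<lambda>e f. sg (wdeg dp (P # xs) * ?d e) (?A (P # xs) f (\<lambda>v. \<psi> e v)))"
 proof -
  have "?T1 = spl cs (\<lambda>a r. spl a (\<lambda>a1 a2. spl r (\<lambda>b c. sg (s (a1 @ a2) b)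
    (lsum (ev P b) (\<lambda>z. ?A xs c (\<lambda>w. \<psi> a1 (a2 @ z # w)))))))"
  proof (rule spl_cong)
   fix a r
   have "spl r (\<lambda>b c. sg (s a b) (lsum (ev P b) (\<lambda>z. ?A xs c (\<lambda>w. spl a (\<lambda>a1 a2. \<psi> a1 (a2 @ z # w))))))
    = spl a (\<lambda>a1 a2. spl r (\<lambda>b c. sg (s a b) (lsum (ev P b) (\<lambda>z. ?A xs c (\<lambda>w. \<psi> a1 (a2 @ z # w))))))"
    by (simp add: act_spl spl_lsum[symmetric] spl_sg[symmetric] spl_spl[of r])
   also have "... = spl a (\<lambda>a1 a2. spl r (\<lambda>b c. sg (s (a1 @ a2) b) (lsum (ev P b) (\<lambda>z. ?A xs c (\<lambda>w. \<psi> a1 (a2 @ z # w))))))"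
    by (rule spl_cong) simp
   finally show "spl r (\<lambda>b c. sg (s a b) (lsum (ev P b) (\<lambda>z. ?A xs c (\<lambda>w. spl a (\<lambda>a1 a2. \<psi> a1 (a2 @ z # w))))))
    = spl a (\<lambda>a1 a2. spl r (\<lambda>b c. sg (s (a1 @ a2) b) (lsum (ev P b) (\<lambda>z. ?A xs c (\<lambda>w. \<psi> a1 (a2 @ z # w))))))" .
  qed
  also have "... = spl cs (\<lambda>a1 r. spl r (\<lambda>a2 r. spl r (\<lambda>b c. sg (s (a1 @ a2) b)
    (lsum (ev P b) (\<lambda>z. ?A xs c (\<lambda>w. \<psi> a1 (a2 @ z # w)))))))"
   by (rule spl_assoc)
  finally show ?thesis
   by (simp add: act_Cons spl_sg[symmetric] sg_sg s_def algebra_simps)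
 qed
 moreover have "?T2 = spl xs (\<lambda>x y. spl cs (\<lambda>e f. sg (wdeg dp y * ?d e)
   (?A (P # x) e (\<lambda>w. ?A y f (\<lambda>v. \<psi> w v)))))"
 proof -
  have "spl cs (\<lambda>e f. sg (wdeg dp y * ?d e) (?A (P # x) e (\<lambda>w. ?A y f (\<lambda>v. \<psi> w v)))) =
    spl cs (\<lambda>a r. spl r (\<lambda>b r. spl r (\<lambda>c f. sg (s a b + wdeg dp y * ?d c)
     (lsum (ev P b) (\<lambda>z. ?A x c (\<lambda>w. ?A y f (\<lambda>v. \<psi> (a @ z # w) v)))))))"
   if "xs = x @ y" for x y
  proof -
   define g where "g a b c f = sg (s a b + wdeg dp y * ?d c)
     (lsum (ev P b) (\<lambda>z. ?A x c (\<lambda>w. ?A y f (\<lambda>v. \<psi> (a @ z # w) v))))" for a b c f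
   have "spl cs (\<lambda>e f. sg (wdeg dp y * ?d e) (?A (P # x) e (\<lambda>w. ?A y f (\<lambda>v. \<psi> w v))))
    = spl cs (\<lambda>e f. spl e (\<lambda>a r. spl r (\<lambda>b c. g a b c f)))"
   proof (rule spl_cong)
    fix e f
    show "sg (wdeg dp y * ?d e) (?A (P # x) e (\<lambda>w. ?A y f (\<lambda>v. \<psi> w v))) =
     spl e (\<lambda>a r. spl r (\<lambda>b c. g a b c f))"
     unfolding act_Cons spl_sg[symmetric] sg_sg g_def s_def
     by (intro spl_cong) (simp add: that algebra_simps)
   qed
   also have "... = spl cs (\<lambda>a r. spl r (\<lambda>r f. spl r (\<lambda>b c. g a b c f)))"
    by (rule spl_assoc)
   also have "... = spl cs (\<lambda>a r. spl r (\<lambda>b r. spl r (\<lambda>c f. g a b c f)))"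
    by (simp add: spl_assoc)
   finally show ?thesis by (simp add: g_def)
  qed
  then have "spl xs (\<lambda>x y. spl cs (\<lambda>e f. sg (wdeg dp y * ?d e)
    (?A (P # x) e (\<lambda>w. ?A y f (\<lambda>v. \<psi> w v))))) =
   spl xs (\<lambda>x y. spl cs (\<lambda>a r. spl r (\<lambda>b r. spl r (\<lambda>c f. sg (s a b + wdeg dp y * ?d c)
     (lsum (ev P b) (\<lambda>z. ?A x c (\<lambda>w. ?A y f (\<lambda>v. \<psi> (a @ z # w) v))))))))"
   by (rule spl_cong)
  also have "... = ?T2"
   unfolding Cons.IH
   by (simp add: spl_sg[symmetric] spl_lsum[symmetric] lsum_sg[symmetric] sg_sg spl_spl[of xs] add.commute)
  finally show ?thesis by simp
 qed
 ultimately show ?case by simp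
qed simp

lemma act_append_Cons:
 "act ev dp dc (x @ Q # y) cs \<phi> =
  spl cs (\<lambda>e r. spl r (\<lambda>f g. sg (dp Q * wdeg dc e + wdeg dp y * (wdeg dc e + wdeg dc f))
   (act ev dp dc x e (\<lambda>a. lsum (ev Q f) (\<lambda>z. act ev dp dc y g (\<lambda>w. \<phi> (a @ z # w)))))))"
proof (induction x arbitrary: cs \<phi>)
 case Nil
 show ?case by (simp add: act_Cons)
next
 case (Cons P x)
 let ?A = "act ev dp dc" and ?d = "wdeg dc"
 define g where "g a b e f h = sg (dp P * ?d a + wdeg dp x * (?d a + ?d b) +
    (dp Q * (?d a + ?d b + ?d e) + wdeg dp y * (?d a + ?d b + ?d e + ?d f)))
   (lsum (ev P b) (\<lambda>z'. ?A x e (\<lambda>w'. lsum (ev Q f) (\<lambda>z. ?A y h (\<lambda>w. \<phi> (a @ z' # w' @ z # w))))))" for a b e f h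
 have "?A ((P # x) @ Q # y) cs \<phi> = spl cs (\<lambda>a r. spl r (\<lambda>b r. spl r (\<lambda>e r. spl r (\<lambda>f h. g a b e f h))))"
  unfolding append_Cons act_Cons Cons.IH g_def
  by (simp add: spl_lsum[symmetric] lsum_sg spl_sg[symmetric] sg_sg algebra_simps)
 also have "... = spl cs (\<lambda>e r. spl r (\<lambda>f h. spl e (\<lambda>a q. spl q (\<lambda>b e. g a b e f h))))"
 proof -
  have "spl cs (\<lambda>e r. spl r (\<lambda>f h. spl e (\<lambda>a q. spl q (\<lambda>b e. g a b e f h)))) =
   spl cs (\<lambda>e r. spl e (\<lambda>a q. spl r (\<lambda>f h. spl q (\<lambda>b e. g a b e f h))))"
   by (subst spl_spl) (rule refl)
  also have "... = spl cs (\<lambda>a r. spl r (\<lambda>q r. spl r (\<lambda>f h. spl q (\<lambda>b e. g a b e f h))))"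
   by (rule spl_assoc)
  also have "... = spl cs (\<lambda>a r. spl r (\<lambda>q r. spl q (\<lambda>b e. spl r (\<lambda>f h. g a b e f h))))"
   by (intro spl_cong spl_spl)
  also have "... = spl cs (\<lambda>a r. spl r (\<lambda>b r. spl r (\<lambda>e r. spl r (\<lambda>f h. g a b e f h))))"
   by (simp only: spl_assoc)
  finally show ?thesis by simp
 qed
 also have "... = spl cs (\<lambda>e r. spl r (\<lambda>f h. sg (dp Q * ?d e + wdeg dp y * (?d e + ?d f))
   (?A (P # x) e (\<lambda>a. lsum (ev Q f) (\<lambda>z. ?A y h (\<lambda>w. \<phi> (a @ z # w)))))))"
  unfolding act_Cons g_def
  by (intro spl_cong) (simp add: spl_sg[symmetric] sg_sg, intro spl_cong, simp add: algebra_simps)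
 finally show ?case .
qed

text \<open>A letter \<open>c\<close> of the word is either left alone, and separates the operations
  before it from those behind it, or it lies in the block of exactly one operation.\<close>

lemma act_marked:
 "act ev dp dc y (u @ c # v) \<phi> =
  spl y (\<lambda>y1 y2. sg (wdeg dp y2 * (wdeg dc u + dc c))
   (act ev dp dc y1 u (\<lambda>a. act ev dp dc y2 v (\<lambda>b. \<phi> (a @ c # b)))))
 + marked y (\<lambda>y1 P y2. spl u (\<lambda>u1 u2. spl v (\<lambda>v1 v2.
   sg (dp P * wdeg dc u1 + wdeg dp y2 * (wdeg dc u + dc c + wdeg dc v1))
    (act ev dp dc y1 u1 (\<lambda>a. lsum (ev P (u2 @ c # v1)) (\<lambda>z. act ev dp dc y2 v2 (\<lambda>b. \<phi> (a @ z # b))))))))"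
proof (induction y arbitrary: u \<phi>)
 case Nil
 show ?case by simp
next
 case (Cons P ys)
 let ?A = "act ev dp dc" and ?d = "wdeg dc"
 define g where "g a b r = sg (dp P * ?d a + wdeg dp ys * (?d a + ?d b))
    (lsum (ev P b) (\<lambda>z. ?A ys r (\<lambda>w. \<phi> (a @ z # w))))" for a b r
 have "?A (P # ys) (u @ c # v) \<phi> =
   spl u (\<lambda>u1 u'. spl u' (\<lambda>u2 u3. g u1 u2 (u3 @ c # v)))
  + spl u (\<lambda>u1 u'. spl v (\<lambda>v1 v2. g u1 (u' @ c # v1) v2))
  + spl v (\<lambda>v1 r. spl r (\<lambda>b v2. g (u @ c # v1) b v2))" (is "_ = ?T1 + ?T2 + ?T3")
  by (simp add: act_Cons spl_append_Cons g_def spl_plus)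
 moreover have "?T2 = spl u (\<lambda>u1 u2. spl v (\<lambda>v1 v2.
   sg (dp P * ?d u1 + wdeg dp ys * (?d u + dc c + ?d v1))
    (?A [] u1 (\<lambda>a. lsum (ev P (u2 @ c # v1)) (\<lambda>z. ?A ys v2 (\<lambda>b. \<phi> (a @ z # b)))))))"
  by (intro spl_cong) (simp add: g_def algebra_simps)
 moreover have "?T3 = sg (wdeg dp (P # ys) * (?d u + dc c)) (?A (P # ys) v (\<lambda>b. \<phi> (u @ c # b)))"
  unfolding act_Cons spl_sg[symmetric] by (intro spl_cong) (simp add: g_def sg_sg algebra_simps)
 moreover have "?T1 =
   spl ys (\<lambda>y1 y2. sg (wdeg dp y2 * (?d u + dc c))
    (?A (P # y1) u (\<lambda>a. ?A y2 v (\<lambda>b. \<phi> (a @ c # b)))))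
  + marked ys (\<lambda>y1 Q y2. spl u (\<lambda>u1 u2. spl v (\<lambda>v1 v2.
    sg (dp Q * ?d u1 + wdeg dp y2 * (?d u + dc c + ?d v1))
     (?A (P # y1) u1 (\<lambda>a. lsum (ev Q (u2 @ c # v1)) (\<lambda>z. ?A y2 v2 (\<lambda>b. \<phi> (a @ z # b))))))))"
  (is "_ = ?R1 + ?R2")
 proof -
  define g1 where "g1 u1 u2 u3 = sg (dp P * ?d u1 + wdeg dp ys * (?d u1 + ?d u2))
   (lsum (ev P u2) (\<lambda>z. spl ys (\<lambda>y1 y2. sg (wdeg dp y2 * (?d u3 + dc c))
    (?A y1 u3 (\<lambda>a. ?A y2 v (\<lambda>b. \<phi> (u1 @ z # a @ c # b)))))))" for u1 u2 u3
  define g2 where "g2 u1 u2 u3 = sg (dp P * ?d u1 + wdeg dp ys * (?d u1 + ?d u2))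
   (lsum (ev P u2) (\<lambda>z. marked ys (\<lambda>y1 Q y2. spl u3 (\<lambda>u3 u4. spl v (\<lambda>v1 v2.
    sg (dp Q * ?d u3 + wdeg dp y2 * (?d u3 + ?d u4 + dc c + ?d v1))
     (?A y1 u3 (\<lambda>a. lsum (ev Q (u4 @ c # v1)) (\<lambda>z'. ?A y2 v2 (\<lambda>b. \<phi> (u1 @ z # a @ z' # b))))))))))" for u1 u2 u3
  have g12: "g u1 u2 (u3 @ c # v) = g1 u1 u2 u3 + g2 u1 u2 u3" for u1 u2 u3
  proof -
   have "marked ys (\<lambda>y1 Q y2. spl u3 (\<lambda>u3' u4. spl v (\<lambda>v1 v2.
    sg (dp Q * ?d u3' + wdeg dp y2 * (?d u3 + dc c + ?d v1))
     (?A y1 u3' (\<lambda>a. lsum (ev Q (u4 @ c # v1)) (\<lambda>z'. ?A y2 v2 (\<lambda>b. \<phi> (u1 @ z # a @ z' # b))))))))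
    = marked ys (\<lambda>y1 Q y2. spl u3 (\<lambda>u3 u4. spl v (\<lambda>v1 v2.
    sg (dp Q * ?d u3 + wdeg dp y2 * (?d u3 + ?d u4 + dc c + ?d v1))
     (?A y1 u3 (\<lambda>a. lsum (ev Q (u4 @ c # v1)) (\<lambda>z'. ?A y2 v2 (\<lambda>b. \<phi> (u1 @ z # a @ z' # b))))))))" for z
    by (intro marked_cong spl_cong) simp
   then show ?thesis unfolding g_def g1_def g2_def Cons.IH by (simp add: lsum_plus sg_add)
  qed
  have "spl u (\<lambda>u1 u'. spl u' (\<lambda>u2 u3. g1 u1 u2 u3)) = ?R1"
  proof -
   have "?R1 = spl ys (\<lambda>y1 y2. spl u (\<lambda>u1 u'. spl u' (\<lambda>u2 u3.
     sg (dp P * ?d u1 + (wdeg dp y1 + wdeg dp y2) * (?d u1 + ?d u2) + wdeg dp y2 * (?d u3 + dc c))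
     (lsum (ev P u2) (\<lambda>z. ?A y1 u3 (\<lambda>a. ?A y2 v (\<lambda>b. \<phi> (u1 @ z # a @ c # b))))))))"
    by (intro spl_cong) (simp add: act_Cons spl_sg[symmetric] sg_sg, intro spl_cong, simp add: algebra_simps)
   also have "... = spl u (\<lambda>u1 u'. spl u' (\<lambda>u2 u3. spl ys (\<lambda>y1 y2.
     sg (dp P * ?d u1 + (wdeg dp y1 + wdeg dp y2) * (?d u1 + ?d u2) + wdeg dp y2 * (?d u3 + dc c))
     (lsum (ev P u2) (\<lambda>z. ?A y1 u3 (\<lambda>a. ?A y2 v (\<lambda>b. \<phi> (u1 @ z # a @ c # b))))))))"
    by (simp only: spl_spl[of ys])
   also have "... = spl u (\<lambda>u1 u'. spl u' (\<lambda>u2 u3. g1 u1 u2 u3))"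
    unfolding g1_def spl_lsum[symmetric] spl_sg[symmetric]
    by (intro spl_cong) (simp add: lsum_sg sg_sg algebra_simps)
   finally show ?thesis by simp
  qed
  moreover have "spl u (\<lambda>u1 u'. spl u' (\<lambda>u2 u3. g2 u1 u2 u3)) = ?R2"
  proof -
   define h where "h y1 Q y2 u1 u2 u3 u4 v1 v2 =
     sg (dp P * ?d u1 + (wdeg dp y1 + dp Q + wdeg dp y2) * (?d u1 + ?d u2) +
       (dp Q * ?d u3 + wdeg dp y2 * (?d u3 + ?d u4 + dc c + ?d v1)))
     (lsum (ev P u2) (\<lambda>z. ?A y1 u3 (\<lambda>a. lsum (ev Q (u4 @ c # v1)) (\<lambda>z'. ?A y2 v2 (\<lambda>b. \<phi> (u1 @ z # a @ z' # b))))))"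
    for y1 Q y2 u1 u2 u3 u4 v1 v2
   have "?R2 = marked ys (\<lambda>y1 Q y2. spl u (\<lambda>u' u4. spl u' (\<lambda>u1 u''. spl u'' (\<lambda>u2 u3. spl v (\<lambda>v1 v2. h y1 Q y2 u1 u2 u3 u4 v1 v2)))))"
    by (intro marked_cong spl_cong)
     (simp add: act_Cons spl_sg[symmetric] sg_sg spl_spl[of v], intro spl_cong, simp add: h_def algebra_simps)
   also have "... = marked ys (\<lambda>y1 Q y2. spl u (\<lambda>u1 u'. spl u' (\<lambda>u2 u''. spl u'' (\<lambda>u3 u4. spl v (\<lambda>v1 v2. h y1 Q y2 u1 u2 u3 u4 v1 v2)))))"
    by (simp only: spl_assoc)
   also have "... = spl u (\<lambda>u1 u'. spl u' (\<lambda>u2 u''. marked ys (\<lambda>y1 Q y2. spl u'' (\<lambda>u3 u4. spl v (\<lambda>v1 v2. h y1 Q y2 u1 u2 u3 u4 v1 v2)))))"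
    by (simp only: marked_spl[symmetric])
   also have "... = spl u (\<lambda>u1 u'. spl u' (\<lambda>u2 u3. g2 u1 u2 u3))"
    unfolding g2_def marked_lsum marked_sg[symmetric] spl_lsum[symmetric] spl_sg[symmetric]
    by (intro spl_cong marked_cong) (simp add: h_def lsum_sg sg_sg algebra_simps)
   finally show ?thesis by simp
  qed
  ultimately show ?thesis unfolding g12 spl_plus by simp
 qed
 ultimately show ?case by (simp add: algebra_simps)
qed

definition graded_operation ::
 "('p => bool) => ('p => int) => ('c => bool) => ('c => int) => ('p, 'c) operation => bool" where
 "graded_operation gp dp gc dc ev \<longleftrightarrow>
   (\<forall>P b n z. gp P \<and> list_all gc b \<and> (n, z) \<in> set (ev P b) \<longrightarrow> gc z \<and> dc z = dp P + wdeg dc b)"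

lemma inserted_graded:
 assumes "graded_operation gp dp gc dc ev" "list_all gp xs" "list_all gc cs"
  and "(n, w) \<in> set (inserted ev dp dc xs cs)"
 shows "list_all gc w \<and> wdeg dc w = wdeg dp xs + wdeg dc cs"
 using assms(2-4)
proof (induction xs arbitrary: cs n w)
 case (Cons P xs)
 obtain a b c z w' where *: "cs = a @ b @ c" "\<exists>n. (n, z) \<in> set (ev P b)"
   "\<exists>m. (m, w') \<in> set (inserted ev dp dc xs c)" "w = a @ z # w'"
  using Cons.prems(3) by (auto elim!: set_bindE dest!: splits_append) blast
 then have "gc z \<and> dc z = dp P + wdeg dc b"
  using assms(1) Cons.prems unfolding graded_operation_def by auto
 moreover have "list_all gc w' \<and> wdeg dc w' = wdeg dp xs + wdeg dc c"
  using *(3) Cons.prems *(1) Cons.IH by auto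
 ultimately show ?case using * Cons.prems by auto
qed auto

lemma act_cong:
 assumes "graded_operation gp dp gc dc ev" "list_all gp xs" "list_all gc cs"
  and "\<And>w. list_all gc w ==> wdeg dc w = wdeg dp xs + wdeg dc cs ==> \<phi> w = \<phi>' w"
 shows "act ev dp dc xs cs \<phi> = act ev dp dc xs cs \<phi>'"
 unfolding act_def by (rule lsum_cong) (use inserted_graded[OF assms(1-3)] assms(4) in blast)

lemma lsum_closed:
 assumes "K (\<lambda>z. 0)" "\<And>k k'. K k ==> K k' ==> K (\<lambda>z. k z + k' z)" "\<And>n k. K k ==> K (\<lambda>z. sg n (k z))"
  and "\<And>n w. (n, w) \<in> set L ==> K (f w)"
 shows "K (\<lambda>z. lsum L (\<lambda>w. f w z))"
 using assms(4)
proof (induction L)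
 case (Cons p L)
 obtain n w where "p = (n, w)" by (cases p)
 moreover from this Cons.prems have "K (f w)" by auto
 moreover have "K (\<lambda>z. lsum L (\<lambda>w. f w z))" by (rule Cons.IH) (use Cons.prems in auto)
 ultimately show ?case by (auto intro!: assms(2,3))
qed (simp add: assms(1))

text \<open>Associativity for words of operations follows from associativity for one operation: by
  induction on \<open>x\<close>, the block of the first operation consists of letters of
  \<open>e\<close> and of values of a factor of \<open>y\<close>, and \<open>act_split\<close>
  isolates that factor. The class \<open>K\<close> of admissible continuations is abstract; it is
  instantiated by linearity in a letter.\<close>

lemma act_compose:
 fixes \<phi> :: "'c list => 'x::ab_group_add"
 assumes grp: "graded_operation gp dp gc dc evpc" and grq: "graded_operation gp dp gq dq evpq" and grc: "graded_operation gq dq gc dc evqc"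
  and "list_all gp x" "list_all gq y" "list_all gc e"
  and K: "K (\<lambda>z. 0)" "\<And>k k'. K k ==> K k' ==> K (\<lambda>z. k z + k' z)" "\<And>n k. K k ==> K (\<lambda>z. sg n (k z))"
  and K_\<phi>: "\<And>a c. list_all gc a ==> list_all gc c ==> K (\<lambda>z. \<phi> (a @ z # c))"
  and "\<And>P y1 y2 y3 e1 e2 e3 k. [|P \<in> set x; y = y1 @ y2 @ y3; e = e1 @ e2 @ e3; K k|] ==>
   lsum (evpq P y2) (\<lambda>Q. lsum (evqc Q e2) k) = act evqc dq dc y2 e2 (\<lambda>b. lsum (evpc P b) k)"
 shows "act evqc dq dc y e (\<lambda>w. act evpc dp dc x w \<phi>) = act evpq dp dq x y (\<lambda>z. act evqc dq dc z e \<phi>)"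
 using assms(4-6,10-11)
proof (induction x arbitrary: y e \<phi>)
 case (Cons P xs)
 let ?p = "wdeg dp" and ?q = "wdeg dq" and ?c = "wdeg dc"
 let ?A = "act evqc dq dc" and ?B = "act evpq dp dq" and ?C = "act evpc dp dc"
 define s where "s y1 y2 y3 e1 e2 = dp P * (?q y1 + ?c e1) + ?p xs * (?q y1 + ?c e1 + ?q y2 + ?c e2)
  + ?q y3 * ?c e2 + (?q y2 + ?q y3) * ?c e1" for y1 y2 y3 e1 e2
 define h where "h y1 y2 y3 e1 e2 e3 = sg (s y1 y2 y3 e1 e2)
  (?A y1 e1 (\<lambda>a. lsum (evpq P y2) (\<lambda>Q. lsum (evqc Q e2) (\<lambda>z. ?B xs y3 (\<lambda>v. ?A v e3 (\<lambda>c. \<phi> (a @ z # c)))))))"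
  for y1 y2 y3 e1 e2 e3
 have "?A y e (\<lambda>w. ?C (P # xs) w \<phi>) =
  spl y (\<lambda>y1 r. spl e (\<lambda>e1 f. sg (?q r * ?c e1) (?A y1 e1 (\<lambda>a. ?A r f (\<lambda>w. spl w (\<lambda>b c.
   sg (dp P * ?c a + ?p xs * (?c a + ?c b)) (lsum (evpc P b) (\<lambda>z. ?C xs c (\<lambda>w. \<phi> (a @ z # w))))))))))"
  unfolding act_Cons act_split ..
 also have "... = spl y (\<lambda>y1 r. spl e (\<lambda>e1 f. spl r (\<lambda>y2 y3. spl f (\<lambda>e2 e3. h y1 y2 y3 e1 e2 e3))))"
 proof (intro spl_cong)
  fix y1 r e1 f assume y: "y = y1 @ r" and e: "e = e1 @ f"
  have "sg (?q r * ?c e1) (?A y1 e1 (\<lambda>a. ?A r f (\<lambda>w. spl w (\<lambda>b c.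
    sg (dp P * ?c a + ?p xs * (?c a + ?c b)) (lsum (evpc P b) (\<lambda>z. ?C xs c (\<lambda>w. \<phi> (a @ z # w))))))))
   = spl r (\<lambda>y2 y3. spl f (\<lambda>e2 e3. sg (?q r * ?c e1 + ?q y3 * ?c e2)
     (?A y1 e1 (\<lambda>a. ?A y2 e2 (\<lambda>b. ?A y3 e3 (\<lambda>c. sg (dp P * ?c a + ?p xs * (?c a + ?c b))
       (lsum (evpc P b) (\<lambda>z. ?C xs c (\<lambda>w. \<phi> (a @ z # w))))))))))"
   unfolding act_split by (simp add: act_spl act_sg spl_sg[symmetric] sg_sg)
  also have "... = spl r (\<lambda>y2 y3. spl f (\<lambda>e2 e3. h y1 y2 y3 e1 e2 e3))"
  proof (intro spl_cong)
   fix y2 y3 e2 e3 assume r: "r = y2 @ y3" and f: "f = e2 @ e3"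
   have good: "list_all gq y1" "list_all gq y2" "list_all gq y3" "list_all gc e1" "list_all gc e2" "list_all gc e3"
     "list_all gp xs" "gp P"
    using Cons.prems y e r f by auto
   have "?A y1 e1 (\<lambda>a. ?A y2 e2 (\<lambda>b. ?A y3 e3 (\<lambda>c. sg (dp P * ?c a + ?p xs * (?c a + ?c b))
       (lsum (evpc P b) (\<lambda>z. ?C xs c (\<lambda>w. \<phi> (a @ z # w)))))))
    = ?A y1 e1 (\<lambda>a. sg (dp P * (?q y1 + ?c e1) + ?p xs * (?q y1 + ?c e1 + ?q y2 + ?c e2))
      (lsum (evpq P y2) (\<lambda>Q. lsum (evqc Q e2) (\<lambda>z. ?B xs y3 (\<lambda>v. ?A v e3 (\<lambda>c. \<phi> (a @ z # c)))))))"
   proof (rule act_cong[OF grc good(1,4)])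
    fix a assume a: "list_all gc a" "?c a = ?q y1 + ?c e1"
    have Kk: "K (\<lambda>z. ?B xs y3 (\<lambda>v. ?A v e3 (\<lambda>c. \<phi> (a @ z # c))))"
    proof -
     have "K (\<lambda>z. ?A v e3 (\<lambda>c. \<phi> (a @ z # c)))" if "list_all gq v" for v
      unfolding act_def by (intro lsum_closed[of K, OF K] Cons.prems(4)) (use inserted_graded[OF grc that good(6)] a in blast)+
     moreover have "list_all gq v" if "(n, v) \<in> set (inserted evpq dp dq xs y3)" for n v
      using inserted_graded[OF grq good(7,3) that] by simp
     ultimately show ?thesis
      unfolding act_def[of evpq] by (intro lsum_closed[of K, OF K]) auto
    qed
    have "?A y2 e2 (\<lambda>b. ?A y3 e3 (\<lambda>c. sg (dp P * ?c a + ?p xs * (?c a + ?c b))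
       (lsum (evpc P b) (\<lambda>z. ?C xs c (\<lambda>w. \<phi> (a @ z # w))))))
     = ?A y2 e2 (\<lambda>b. sg (dp P * ?c a + ?p xs * (?c a + (?q y2 + ?c e2)))
       (lsum (evpc P b) (\<lambda>z. ?A y3 e3 (\<lambda>c. ?C xs c (\<lambda>w. \<phi> (a @ z # w))))))"
     by (rule act_cong[OF grc good(2,5)]) (simp add: act_sg act_lsum)
    also have "... = ?A y2 e2 (\<lambda>b. sg (dp P * ?c a + ?p xs * (?c a + (?q y2 + ?c e2)))
       (lsum (evpc P b) (\<lambda>z. ?B xs y3 (\<lambda>v. ?A v e3 (\<lambda>c. \<phi> (a @ z # c))))))"
    proof (intro act_cong[OF grc good(2,5)] arg_cong[where f = "sg _"] lsum_cong)
     fix b n z assume "list_all gc b" "(n, z) \<in> set (evpc P b)"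
     then have z: "gc z" using grp good(8) unfolding graded_operation_def by blast
     show "?A y3 e3 (\<lambda>c. ?C xs c (\<lambda>w. \<phi> (a @ z # w))) = ?B xs y3 (\<lambda>v. ?A v e3 (\<lambda>c. \<phi> (a @ z # c)))"
     proof (rule Cons.IH[OF good(7,3,6)])
      fix a' c' assume "list_all gc a'" "list_all gc c'"
      then show "K (\<lambda>z'. \<phi> (a @ z # a' @ z' # c'))"
       using Cons.prems(4)[of "a @ z # a'" c'] a z by simp
     next
      fix P' z1 z2 z3 h1 h2 h3 k
      assume "P' \<in> set xs" "y3 = z1 @ z2 @ z3" "e3 = h1 @ h2 @ h3" "K k"
      then show "lsum (evpq P' z2) (\<lambda>Q. lsum (evqc Q h2) k) = ?A z2 h2 (\<lambda>b. lsum (evpc P' b) k)"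
       using Cons.prems(5)[of P' "y1 @ y2 @ z1" z2 z3 "e1 @ e2 @ h1" h2 h3 k] y e r f by simp
     qed
    qed
    also have "... = sg (dp P * ?c a + ?p xs * (?c a + (?q y2 + ?c e2)))
      (lsum (evpq P y2) (\<lambda>Q. lsum (evqc Q e2) (\<lambda>z. ?B xs y3 (\<lambda>v. ?A v e3 (\<lambda>c. \<phi> (a @ z # c))))))"
     using Cons.prems(5)[OF _ _ _ Kk, of P y1 y2 y3 e1 e2 e3] y e r f by (simp add: act_sg)
    finally show "?A y2 e2 (\<lambda>b. ?A y3 e3 (\<lambda>c. sg (dp P * ?c a + ?p xs * (?c a + ?c b))
       (lsum (evpc P b) (\<lambda>z. ?C xs c (\<lambda>w. \<phi> (a @ z # w)))))) =
     sg (dp P * (?q y1 + ?c e1) + ?p xs * (?q y1 + ?c e1 + ?q y2 + ?c e2))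
      (lsum (evpq P y2) (\<lambda>Q. lsum (evqc Q e2) (\<lambda>z. ?B xs y3 (\<lambda>v. ?A v e3 (\<lambda>c. \<phi> (a @ z # c))))))"
     using a(2) by (simp add: algebra_simps)
   qed
   then show "sg (?q r * ?c e1 + ?q y3 * ?c e2)
     (?A y1 e1 (\<lambda>a. ?A y2 e2 (\<lambda>b. ?A y3 e3 (\<lambda>c. sg (dp P * ?c a + ?p xs * (?c a + ?c b))
       (lsum (evpc P b) (\<lambda>z. ?C xs c (\<lambda>w. \<phi> (a @ z # w)))))))) = h y1 y2 y3 e1 e2 e3"
    by (simp add: h_def act_sg sg_sg s_def r algebra_simps)
  qed
  finally show "sg (?q r * ?c e1) (?A y1 e1 (\<lambda>a. ?A r f (\<lambda>w. spl w (\<lambda>b c.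
    sg (dp P * ?c a + ?p xs * (?c a + ?c b)) (lsum (evpc P b) (\<lambda>z. ?C xs c (\<lambda>w. \<phi> (a @ z # w))))))))
   = spl r (\<lambda>y2 y3. spl f (\<lambda>e2 e3. h y1 y2 y3 e1 e2 e3))" .
 qed
 also have "... = spl y (\<lambda>y1 r. spl r (\<lambda>y2 y3. spl e (\<lambda>e1 f. spl f (\<lambda>e2 e3. h y1 y2 y3 e1 e2 e3))))"
  by (intro spl_cong) (rule spl_spl)
 also have "... = ?B (P # xs) y (\<lambda>z. ?A z e \<phi>)"
  unfolding act_Cons[of evpq]
 proof (intro spl_cong)
  fix y1 r y2 y3 assume y: "y = y1 @ r" and r: "r = y2 @ y3"
  have good: "list_all gq y2" "list_all gq y3" "list_all gp xs" "gp P"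
   using Cons.prems y r by auto
  have "lsum (evpq P y2) (\<lambda>Q. ?B xs y3 (\<lambda>v. ?A (y1 @ Q # v) e \<phi>)) =
   lsum (evpq P y2) (\<lambda>Q. ?B xs y3 (\<lambda>v. spl e (\<lambda>e1 f. spl f (\<lambda>e2 e3.
    sg ((dp P + ?q y2) * ?c e1 + (?p xs + ?q y3) * (?c e1 + ?c e2))
     (?A y1 e1 (\<lambda>a. lsum (evqc Q e2) (\<lambda>z. ?A v e3 (\<lambda>w. \<phi> (a @ z # w)))))))))"
  proof (intro lsum_cong act_cong[OF grq good(3,2)])
   fix n Q v assume "(n, Q) \<in> set (evpq P y2)" "?q v = ?p xs + ?q y3"
   moreover from this have "dq Q = dp P + ?q y2"
    using grq good(1,4) unfolding graded_operation_def by blast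
   ultimately show "?A (y1 @ Q # v) e \<phi> = spl e (\<lambda>e1 f. spl f (\<lambda>e2 e3.
    sg ((dp P + ?q y2) * ?c e1 + (?p xs + ?q y3) * (?c e1 + ?c e2))
     (?A y1 e1 (\<lambda>a. lsum (evqc Q e2) (\<lambda>z. ?A v e3 (\<lambda>w. \<phi> (a @ z # w)))))))"
    by (simp add: act_append_Cons)
  qed
  also have "... = spl e (\<lambda>e1 f. spl f (\<lambda>e2 e3. sg ((dp P + ?q y2) * ?c e1 + (?p xs + ?q y3) * (?c e1 + ?c e2))
    (?A y1 e1 (\<lambda>a. lsum (evpq P y2) (\<lambda>Q. lsum (evqc Q e2) (\<lambda>z. ?B xs y3 (\<lambda>v. ?A v e3 (\<lambda>c. \<phi> (a @ z # c)))))))))"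
   by (simp add: act_spl act_sg spl_lsum[symmetric] lsum_sg act_lsum act_act[of evpq _ _ _ _ evqc _ _ y1])
  finally show "spl e (\<lambda>e1 f. spl f (\<lambda>e2 e3. h y1 y2 y3 e1 e2 e3)) =
   sg (dp P * ?q y1 + ?p xs * (?q y1 + ?q y2)) (lsum (evpq P y2) (\<lambda>Q. ?B xs y3 (\<lambda>v. ?A (y1 @ Q # v) e \<phi>)))"
   by (simp add: spl_sg[symmetric] sg_sg h_def s_def algebra_simps)
 qed
 finally show ?case .
qed simp

section \<open>Multilinear functions of words\<close>

type_synonym ('c, 'k) linear_relations = "('c \<times> 'k \<times> 'c \<times> 'k \<times> 'c) set"

text \<open>A linear relation \<open>z = a z1 + b z2\<close> between letters is a tuple \<open>(z,
  a, z1, b, z2)\<close>. Letters carry a degree and form no vector space, so linearity is stated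
  along a set of such relations.\<close>

definition linear_along ::
 "('k => 'x => 'x) => ('c, 'k) linear_relations => ('c => 'x::ab_group_add) => bool" where
 "linear_along t R k \<longleftrightarrow> (\<forall>(z, a, z1, b, z2)\<in>R. k z = t a (k z1) + t b (k z2))"

definition graded_relations :: "('c => bool) => ('c => int) => ('c, 'k) linear_relations => bool" where
 "graded_relations g dc R \<longleftrightarrow>
   (\<forall>(z, a, z1, b, z2)\<in>R. g z \<and> g z1 \<and> g z2 \<and> dc z1 = dc z \<and> dc z2 = dc z)"

definition word_multilinear ::
 "('k => 'x => 'x) => ('c, 'k) linear_relations => ('c => bool) => ('c list => 'x::ab_group_add) => bool" where
 "word_multilinear t R g \<phi> \<longleftrightarrow>
   (\<forall>l r. list_all g l \<and> list_all g r \<longrightarrow> linear_along t R (\<lambda>z. \<phi> (l @ z # r)))"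

lemma word_multilinearI:
 "(\<And>l r z a z1 b z2. [|list_all g l; list_all g r; (z, a, z1, b, z2) \<in> R|] ==>
   \<phi> (l @ z # r) = t a (\<phi> (l @ z1 # r)) + t b (\<phi> (l @ z2 # r))) ==> word_multilinear t R g \<phi>"
 by (auto simp: word_multilinear_def linear_along_def)

lemma word_multilinearD:
 "[|word_multilinear t R g \<phi>; list_all g l; list_all g r; (z, a, z1, b, z2) \<in> R|] ==>
   \<phi> (l @ z # r) = t a (\<phi> (l @ z1 # r)) + t b (\<phi> (l @ z2 # r))"
 by (fastforce simp: word_multilinear_def linear_along_def)

lemma word_multilinear_linear_along:
 "[|word_multilinear t R g \<phi>; list_all g l; list_all g r|] ==> linear_along t R (\<lambda>z. \<phi> (l @ z # r))"
 by (auto simp: word_multilinear_def)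

context vector_space
begin

lemma sg_scale: "sg n (scale c x) = scale c (sg n x)"
 by (simp add: sg_def)

lemma linear_along_sg: "linear_along scale R k ==> linear_along scale R (\<lambda>z. sg n (k z))"
 unfolding linear_along_def by (auto simp: sg_add sg_scale)

lemma linear_along_plus: "linear_along scale R k ==> linear_along scale R k' ==> linear_along scale R (\<lambda>z. k z + k' z)"
 unfolding linear_along_def by (fastforce simp: scale_right_distrib add_ac)

lemma linear_along_zero: "linear_along scale R (\<lambda>z. 0)"
 unfolding linear_along_def by auto

lemma linear_along_lsum:
 "(\<And>n w. (n, w) \<in> set L ==> linear_along scale R (f w)) ==> linear_along scale R (\<lambda>z. lsum L (\<lambda>w. f w z))"
 by (rule lsum_closed) (auto intro: linear_along_plus linear_along_sg linear_along_zero)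

lemma linear_along_spl:
 "(\<And>a b. cs = a @ b ==> linear_along scale R (f a b)) ==> linear_along scale R (\<lambda>z. spl cs (\<lambda>a b. f a b z))"
 unfolding spl_def by (intro linear_along_lsum) (auto dest: splits_append)

lemma linear_along_act:
 assumes "graded_operation gp dp gc dc ev" "list_all gp xs" "list_all gc cs"
  and "\<And>w. list_all gc w ==> linear_along scale R (f w)"
 shows "linear_along scale R (\<lambda>z. act ev dp dc xs cs (\<lambda>w. f w z))"
 unfolding act_def by (intro linear_along_lsum) (use inserted_graded[OF assms(1-3)] assms(4) in blast)

lemma word_multilinear_plus:
 "[|word_multilinear scale R g \<phi>; word_multilinear scale R g \<phi>'|] ==> word_multilinear scale R g (\<lambda>w. \<phi> w + \<phi>' w)"
 unfolding word_multilinear_def by (auto intro: linear_along_plus)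

lemma word_multilinear_sg:
 assumes "word_multilinear scale R g \<phi>" "graded_relations g dc R"
 shows "word_multilinear scale R g (\<lambda>w. sg (h (wdeg dc w)) (\<phi> w))"
proof (rule word_multilinearI)
 fix l r z a z1 b z2
 assume *: "list_all g l" "list_all g r" "(z, a, z1, b, z2) \<in> R"
 then have "dc z1 = dc z" "dc z2 = dc z" using assms(2) unfolding graded_relations_def by auto
 with word_multilinearD[OF assms(1) *]
 show "sg (h (wdeg dc (l @ z # r))) (\<phi> (l @ z # r)) =
  scale a (sg (h (wdeg dc (l @ z1 # r))) (\<phi> (l @ z1 # r))) + scale b (sg (h (wdeg dc (l @ z2 # r))) (\<phi> (l @ z2 # r)))"
  by (simp add: sg_add sg_scale)
qed

lemma word_multilinear_lsum:
 "(\<And>n y. (n, y) \<in> set L ==> word_multilinear scale R g (f y)) ==> word_multilinear scale R g (\<lambda>w. lsum L (\<lambda>y. f y w))"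
 unfolding word_multilinear_def by (auto intro: linear_along_lsum)

lemma word_multilinear_spl_param:
 "(\<And>a b. cs = a @ b ==> word_multilinear scale R g (f a b)) ==> word_multilinear scale R g (\<lambda>w. spl cs (\<lambda>a b. f a b w))"
 unfolding word_multilinear_def by (auto intro: linear_along_spl)

lemma word_multilinear_act_param:
 assumes "graded_operation gp dp gc dc ev" "list_all gp xs" "list_all gc cs"
  and "\<And>w. list_all gc w ==> word_multilinear scale R g (f w)"
 shows "word_multilinear scale R g (\<lambda>v. act ev dp dc xs cs (\<lambda>w. f w v))"
 using assms(4) unfolding word_multilinear_def by (auto intro: linear_along_act[OF assms(1-3)])

lemma word_multilinear_spl:
 assumes R: "graded_relations g dc R"
  and f: "\<And>b. list_all g b ==> word_multilinear scale R g (\<lambda>a. f a b)"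
   "\<And>a. list_all g a ==> word_multilinear scale R g (f a)"
 shows "word_multilinear scale R g (\<lambda>cs. spl cs f)"
proof (rule word_multilinearI)
 fix l r z a z1 b z2
 assume *: "list_all g l" "list_all g r" "(z, a, z1, b, z2) \<in> R"
 have "spl l (\<lambda>p q. f p (q @ z # r)) =
  spl l (\<lambda>p q. scale a (f p (q @ z1 # r)) + scale b (f p (q @ z2 # r)))"
  using * by (intro spl_cong) (auto intro!: word_multilinearD[OF f(2)])
 moreover have "spl r (\<lambda>p q. f (l @ z # p) q) =
  spl r (\<lambda>p q. scale a (f (l @ z1 # p) q) + scale b (f (l @ z2 # p) q))"
  using * by (intro spl_cong) (auto intro!: word_multilinearD[OF f(1)])
 ultimately show "spl (l @ z # r) f = scale a (spl (l @ z1 # r) f) + scale b (spl (l @ z2 # r) f)"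
  by (simp add: spl_append_Cons spl_plus scale_right_distrib spl_additive[of "scale a"]
    spl_additive[of "scale b"] algebra_simps)
qed

lemma word_multilinear_act:
 assumes gr: "graded_operation gp dp gc dc ev" and R: "graded_relations gc dc R"
  and ev: "\<And>P k. gp P ==> linear_along scale R k ==> word_multilinear scale R gc (\<lambda>b. lsum (ev P b) k)"
  and "word_multilinear scale R gc \<phi>" "list_all gp xs"
 shows "word_multilinear scale R gc (\<lambda>cs. act ev dp dc xs cs \<phi>)"
 using assms(4,5)
proof (induction xs arbitrary: \<phi>)
 case Nil
 then show ?case by simp
next
 case (Cons P xs)
 define F where "F a b c = lsum (ev P b) (\<lambda>z. act ev dp dc xs c (\<lambda>w. \<phi> (a @ z # w)))" for a b c
 have P: "gp P" "list_all gp xs" using Cons.prems by auto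
 have evg: "gc z" if "(n, z) \<in> set (ev P b)" "list_all gc b" for n z b
  using gr that P unfolding graded_operation_def by blast
 have Fa: "word_multilinear scale R gc (\<lambda>a. F a b c)" if "list_all gc b" "list_all gc c" for b c
  unfolding F_def
 proof (intro word_multilinear_lsum word_multilinear_act_param[OF gr P(2) that(2)])
  fix n z w assume "(n, z) \<in> set (ev P b)" "list_all gc w"
  then show "word_multilinear scale R gc (\<lambda>a. \<phi> (a @ z # w))"
   using evg[of n z b] that(1) word_multilinearD[OF Cons.prems(1)]
   by (intro word_multilinearI) simp
 qed
 have Fb: "word_multilinear scale R gc (\<lambda>b. F a b c)" if "list_all gc a" "list_all gc c" for a c
  unfolding F_def
  by (intro ev P linear_along_act[OF gr P(2) that(2)] word_multilinear_linear_along[OF Cons.prems(1)] that)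
 have Fc: "word_multilinear scale R gc (F a b)" if "list_all gc a" "list_all gc b" for a b
  unfolding F_def
 proof (intro word_multilinear_lsum Cons.IH P)
  fix n z assume "(n, z) \<in> set (ev P b)"
  then show "word_multilinear scale R gc (\<lambda>w. \<phi> (a @ z # w))"
   using evg[of n z b] that word_multilinearD[OF Cons.prems(1), of "a @ z # _"]
   by (intro word_multilinearI) simp
 qed
 show ?case
  unfolding act_Cons F_def[symmetric]
 proof (intro word_multilinear_spl[OF R] word_multilinear_spl_param)
  fix r a b assume "list_all gc r" "r = a @ b"
  then show "word_multilinear scale R gc (\<lambda>e. sg (dp P * wdeg dc e + wdeg dp xs * (wdeg dc e + wdeg dc a)) (F e a b))"
   by (intro word_multilinear_sg[OF _ R] Fa) auto
 next
  fix a c assume "list_all gc a" "list_all gc c"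
  then show "word_multilinear scale R gc (\<lambda>b. sg (dp P * wdeg dc a + wdeg dp xs * (wdeg dc a + wdeg dc b)) (F a b c))"
   by (intro word_multilinear_sg[OF _ R] Fb)
 next
  fix a b assume "list_all gc a" "list_all gc b"
  then show "word_multilinear scale R gc (\<lambda>c. sg (dp P * wdeg dc a + wdeg dp xs * (wdeg dc a + wdeg dc b)) (F a b c))"
   using word_multilinear_sg[OF Fc R, of a b "\<lambda>_. dp P * wdeg dc a + wdeg dp xs * (wdeg dc a + wdeg dc b)"] by simp
 qed
qed

lemma word_multilinear_act_operations:
 assumes gr: "graded_operation gp dp gc dc ev" and Rp: "graded_relations gp dp Rp"
  and ev: "\<And>b k. list_all gc b ==> linear_along scale R k ==> linear_along scale Rp (\<lambda>P. lsum (ev P b) k)"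
  and \<phi>: "word_multilinear scale R gc \<phi>" and cs: "list_all gc cs"
 shows "word_multilinear scale Rp gp (\<lambda>xs. act ev dp dc xs cs \<phi>)"
proof (rule word_multilinearI)
 fix l r z a z1 b z2
 assume *: "list_all gp l" "list_all gp r" "(z, a, z1, b, z2) \<in> Rp"
 then have d: "dp z1 = dp z" "dp z2 = dp z" using Rp unfolding graded_relations_def by auto
 define F where "F Q e f g = act ev dp dc l e (\<lambda>p. lsum (ev Q f) (\<lambda>z. act ev dp dc r g (\<lambda>w. \<phi> (p @ z # w))))" for Q e f g
 have "F z e f g = scale a (F z1 e f g) + scale b (F z2 e f g)" if "cs = e @ f @ g" for e f g
 proof -
  have "linear_along scale Rp (\<lambda>Q. F Q e f g)"
   unfolding F_def
   using that cs by (intro linear_along_act[OF gr *(1)] ev linear_along_act[OF gr *(2)] word_multilinear_linear_along[OF \<phi>]) auto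
  then show ?thesis using *(3) by (auto simp: linear_along_def)
 qed
 then have "spl cs (\<lambda>e q. spl q (\<lambda>f g. sg (dp z * wdeg dc e + wdeg dp r * (wdeg dc e + wdeg dc f)) (F z e f g))) =
  spl cs (\<lambda>e q. spl q (\<lambda>f g. scale a (sg (dp z1 * wdeg dc e + wdeg dp r * (wdeg dc e + wdeg dc f)) (F z1 e f g)) +
   scale b (sg (dp z2 * wdeg dc e + wdeg dp r * (wdeg dc e + wdeg dc f)) (F z2 e f g))))"
  by (intro spl_cong) (simp add: d sg_add sg_scale)
 then show "act ev dp dc (l @ z # r) cs \<phi> =
  scale a (act ev dp dc (l @ z1 # r) cs \<phi>) + scale b (act ev dp dc (l @ z2 # r) cs \<phi>)"
  unfolding act_append_Cons F_def[symmetric]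
  by (simp add: spl_plus spl_additive[of "scale a"] spl_additive[of "scale b"] scale_right_distrib)
qed

end

section \<open>Multilinear extension from homogeneous words\<close>

declare plus_fun_apply [simp del] zero_fun_apply [simp del] minus_apply [simp del] uminus_apply [simp del]

lemmas pointwise = plus_fun_apply zero_fun_apply minus_apply uminus_apply pscale_def

lemma linear_iff_additive:
 "Vector_Spaces.linear s t f \<longleftrightarrow> vector_space s \<and> vector_space t \<and>
   (\<forall>x y. f (x + y) = f x + f y) \<and> (\<forall>c x. f (s c x) = t c (f x))"
 unfolding Vector_Spaces.linear_def module_hom_def module_hom_axioms_def module_iff_vector_space
 by auto

lemma vector_space_scalars: "vector_space ((*) :: 'k::field => 'k => 'k)"
 by unfold_locales (auto simp: algebra_simps)

lemma vector_space_pscale: "vector_space s ==> vector_space (pscale s)"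
 unfolding vector_space_def pscale_def fun_eq_iff by (auto simp: plus_fun_def)

lemma vector_space_fscale: "vector_space (fscale :: 'k::field => ('x => 'k) => 'x => 'k)"
 by (rule vector_space_pscale[OF vector_space_scalars])

text \<open>A homogeneous vector with its degree serves as a letter. The degree is stored since the
  vector zero does not determine it.\<close>

definition homogeneous :: "(int => 'v set) => 'v \<times> int => bool" where
 "homogeneous G = (\<lambda>(v, d). v \<in> G d)"

definition letter_relations ::
 "('k => 'v => 'v) => (int => 'v set) => ('v::ab_group_add \<times> int, 'k) linear_relations" where
 "letter_relations s G =
   {((s a x + s b y, d), a, (x, d), b, (y, d)) | a b x y d. x \<in> G d \<and> y \<in> G d}"

lemma hom_word_iff:
 "hom_word G vs ds \<longleftrightarrow> (\<exists>ws. list_all (homogeneous G) ws \<and> vs = map fst ws \<and> ds = map snd ws)"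
proof
 assume "hom_word G vs ds"
 then have "list_all (homogeneous G) (zip vs ds) \<and> vs = map fst (zip vs ds) \<and> ds = map snd (zip vs ds)"
  unfolding hom_word_def by (auto simp: list_all2_conv_all_nth homogeneous_def list_all_length)
 then show "\<exists>ws. list_all (homogeneous G) ws \<and> vs = map fst ws \<and> ds = map snd ws" by blast
next
 assume "\<exists>ws. list_all (homogeneous G) ws \<and> vs = map fst ws \<and> ds = map snd ws"
 then show "hom_word G vs ds"
  unfolding hom_word_def by (auto simp: list_all2_conv_all_nth homogeneous_def list_all_length split_beta)
qed

lemma hom_wordE:
 assumes "hom_word G vs ds"
 obtains ws where "list_all (homogeneous G) ws" "vs = map fst ws" "ds = map snd ws"
 using assms unfolding hom_word_iff by blast

lemma hom_wordI: "list_all (homogeneous G) ws ==> hom_word G (map fst ws) (map snd ws)"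
 unfolding hom_word_iff by blast

context graded_vector_space
begin

lemma graded_letter_relations: "graded_relations (homogeneous G) (\<lambda>(v, d). f d) (letter_relations scale G)"
 unfolding graded_relations_def letter_relations_def homogeneous_def
 using subspace_component subspace_add subspace_scale by fastforce

lemma homogeneous_basis_exists:
 "\<exists>H dg. independent H \<and> (\<forall>b\<in>H. b \<in> G (dg b)) \<and> (\<forall>d. \<forall>x\<in>G d. x \<in> span {b\<in>H. dg b = d})"
proof -
 have "\<forall>d. \<exists>B. B \<subseteq> G d \<and> independent B \<and> G d \<subseteq> span B"
  using basis_exists by metis
 then obtain B where B: "\<And>d. B d \<subseteq> G d" "\<And>d. independent (B d)" "\<And>d. G d \<subseteq> span (B d)"
  by metis
 define H where "H = (\<Union>d. B d)"
 have unique: "d = d'" if "b \<in> B d" "b \<in> B d'" for b d d'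
 proof (rule ccontr)
  assume ne: "d \<noteq> d'"
  have "(\<Sum>i\<in>{d, d'}. if i = d then b else - b) = 0" using ne by simp
  moreover have "(if i = d then b else - b) \<in> G i" if "i \<in> {d, d'}" for i
   using \<open>b \<in> B d\<close> \<open>b \<in> B d'\<close> B(1) that subspace_neg[OF subspace_component] by auto
  ultimately have "b = 0" using independent_components[of "{d, d'}" "\<lambda>i. if i = d then b else - b" d] by simp
  with that(1) B(2) dependent_zero show False by metis
 qed
 define dg where "dg b = (THE d. b \<in> B d)" for b
 have dg: "dg b = d" if "b \<in> B d" for b d
  unfolding dg_def using that unique by blast
 have Hd: "{b\<in>H. dg b = d} = B d" for d
  using dg unfolding H_def by auto
 have "independent H"
  unfolding dependent_explicit
 proof (rule notI, elim exE conjE bexE)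
  fix t u v assume t: "finite t" "t \<subseteq> H" and sum: "(\<Sum>v\<in>t. scale (u v) v) = 0" and v: "v \<in> t" "u v \<noteq> 0"
  define x where "x d = (\<Sum>v\<in>{v\<in>t. dg v = d}. scale (u v) v)" for d
  have "sum x (dg ` t) = 0"
   using sum unfolding x_def by (subst sum.group[OF t(1) finite_imageI[OF t(1)] subset_refl]) simp
  moreover have "x d \<in> G d" for d
   unfolding x_def using t(2) B(1) Hd
   by (intro subspace_sum[OF subspace_component] subspace_scale[OF subspace_component]) blast
  ultimately have "x (dg v) = 0"
   using independent_components[of "dg ` t" x "dg v"] t v by auto
  moreover have "finite {w\<in>t. dg w = dg v}" "{w\<in>t. dg w = dg v} \<subseteq> B (dg v)" "v \<in> {w\<in>t. dg w = dg v}"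
   using t Hd v by auto
  ultimately show False
   using B(2)[of "dg v"] v(2) unfolding dependent_explicit x_def by blast
 qed
 moreover have "\<forall>b\<in>H. b \<in> G (dg b)" using B(1) Hd by blast
 moreover have "\<forall>d. \<forall>x\<in>G d. x \<in> span {b\<in>H. dg b = d}" using B(3) Hd by auto
 ultimately show ?thesis by blast
qed

text \<open>A basis of the direct sum of the components that consists of homogeneous vectors, with
  the degree of each.\<close>

definition hbasis_hdeg where
 "hbasis_hdeg = (SOME p. independent (fst p) \<and> (\<forall>b\<in>fst p. b \<in> G (snd p b)) \<and>
   (\<forall>d. \<forall>x\<in>G d. x \<in> span {b\<in>fst p. snd p b = d}))"

abbreviation "hbasis \<equiv> fst hbasis_hdeg"
abbreviation "hdeg \<equiv> snd hbasis_hdeg"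

lemma hbasis:
 "independent hbasis" "b \<in> hbasis ==> b \<in> G (hdeg b)" "x \<in> G d ==> x \<in> span {b\<in>hbasis. hdeg b = d}"
proof -
 have "\<exists>p. independent (fst p) \<and> (\<forall>b\<in>fst p. b \<in> G (snd p b)) \<and>
   (\<forall>d. \<forall>x\<in>G d. x \<in> span {b\<in>fst p. snd p b = d})"
  using homogeneous_basis_exists by simp
 from someI_ex[OF this]
 show "independent hbasis" "b \<in> hbasis ==> b \<in> G (hdeg b)" "x \<in> G d ==> x \<in> span {b\<in>hbasis. hdeg b = d}"
  unfolding hbasis_hdeg_def by blast+
qed

text \<open>The homogeneous basis is completed to a basis of the ambient space; only the
  coefficients on the homogeneous part are used.\<close>

definition coef :: "'v => 'v => 'k" where
 "coef x = representation (extend_basis hbasis) x"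

definition supp :: "'v => 'v set" where
 "supp x = {b\<in>hbasis. coef x b \<noteq> 0}"

lemma finite_supp: "finite (supp x)"
 unfolding supp_def coef_def using finite_representation[of "extend_basis hbasis" x] by simp

lemma coef_add: "coef (x + y) b = coef x b + coef y b"
 unfolding coef_def using representation_add independent_extend_basis[OF hbasis(1)] span_extend_basis[OF hbasis(1)]
 by simp

lemma coef_scale: "coef (scale c x) b = c * coef x b"
 unfolding coef_def using representation_scale independent_extend_basis[OF hbasis(1)] span_extend_basis[OF hbasis(1)]
 by simp

lemma coef_homogeneous:
 assumes "x \<in> G d"
 shows "(\<Sum>b\<in>supp x. scale (coef x b) b) = x" and "b \<in> supp x ==> hdeg b = d"
proof -
 let ?H = "{b\<in>hbasis. hdeg b = d}"
 have sub: "?H \<subseteq> extend_basis hbasis"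
  using extend_basis_superset[OF hbasis(1)] by auto
 have "representation (extend_basis hbasis) x = representation ?H x"
  by (rule representation_extend[OF independent_extend_basis[OF hbasis(1)] hbasis(3)[OF assms] sub])
 then have c: "coef x = representation ?H x" by (simp add: coef_def)
 have ind: "independent ?H" by (rule independent_mono[OF hbasis(1)]) auto
 have "supp x = {b. representation ?H x b \<noteq> 0}"
  unfolding supp_def c by (auto dest: representation_ne_zero)
 then show "(\<Sum>b\<in>supp x. scale (coef x b) b) = x"
  using sum_nonzero_representation_eq[OF ind hbasis(3)[OF assms]] by (simp add: c)
 show "b \<in> supp x ==> hdeg b = d"
  unfolding supp_def c using representation_ne_zero[of ?H x b] by blast
qed

text \<open>The multilinear function on all vectors that agrees with \<open>F\<close> on words of
  homogeneous basis vectors.\<close>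

primrec extension :: "('k => 'x => 'x) => 'v list => (('v \<times> int) list => 'x::ab_group_add) => 'x" where
 "extension t [] = (\<lambda>F. F [])"
| "extension t (v # vs) = (\<lambda>F. \<Sum>b\<in>supp v. t (coef v b) (extension t vs (\<lambda>ws. F ((b, hdeg b) # ws))))"

lemma extension_Cons_superset:
 assumes "vector_space t" "finite S" "supp v \<subseteq> S" "S \<subseteq> hbasis"
 shows "extension t (v # vs) F = (\<Sum>b\<in>S. t (coef v b) (extension t vs (\<lambda>ws. F ((b, hdeg b) # ws))))"
proof -
 interpret T: vector_space t by fact
 show ?thesis
  unfolding extension.simps
  by (rule sum.mono_neutral_left) (use assms in \<open>auto simp: supp_def\<close>)
qed

lemma extension_multilin:
 assumes "vector_space t"
 shows "multilin scale t (\<lambda>vs. extension t vs F)"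
proof -
 interpret T: vector_space t by fact
 have "extension t (us @ (x + y) # vs) F = extension t (us @ x # vs) F + extension t (us @ y # vs) F"
  and "extension t (us @ (scale c x) # vs) F = t c (extension t (us @ x # vs) F)" for us vs x y c
 proof (induction us arbitrary: F)
  case Nil
  case 1
  have sub: "supp (x + y) \<subseteq> supp x \<union> supp y" by (auto simp: supp_def coef_add)
  have S: "finite (supp x \<union> supp y)" "supp x \<union> supp y \<subseteq> hbasis" using finite_supp by (auto simp: supp_def)
  show ?case
   using extension_Cons_superset[OF assms S(1) sub S(2)] extension_Cons_superset[OF assms S(1) _ S(2), of x]
    extension_Cons_superset[OF assms S(1) _ S(2), of y]
   by (simp add: coef_add T.scale_left_distrib sum.distrib del: extension.simps)
 next
  case Nil
  case 2
  have sub: "supp (scale c x) \<subseteq> supp x" by (auto simp: supp_def coef_scale)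
  have S: "supp x \<subseteq> hbasis" by (auto simp: supp_def)
  show ?case
   using extension_Cons_superset[OF assms finite_supp sub S]
   by (simp add: coef_scale T.scale_sum_right)
 next
  case (Cons u us)
  case 1
  show ?case using Cons.IH(1) by (simp add: T.scale_right_distrib sum.distrib)
 next
  case (Cons u us)
  case 2
  show ?case using Cons.IH(2) by (simp add: T.scale_sum_right mult.commute)
 qed
 then show ?thesis
  unfolding multilin_def linear_iff_additive using assms vector_space_axioms by simp
qed

lemma extension_cong:
 "(\<And>ws. list_all (homogeneous G) ws ==> F ws = F' ws) ==> extension t vs F = extension t vs F'"
proof (induction vs arbitrary: F F')
 case (Cons v vs)
 have "extension t vs (\<lambda>ws. F ((b, hdeg b) # ws)) = extension t vs (\<lambda>ws. F' ((b, hdeg b) # ws))" if "b \<in> supp v" for b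
  using that by (intro Cons.IH Cons.prems) (auto simp: homogeneous_def supp_def intro: hbasis)
 then show ?case by simp
qed simp

lemma extension_plus:
 assumes "vector_space t"
 shows "extension t vs (\<lambda>ws. F ws + F' ws) = extension t vs F + extension t vs F'"
proof -
 interpret T: vector_space t by fact
 show ?thesis by (induction vs arbitrary: F F') (auto simp: T.scale_right_distrib sum.distrib)
qed

lemma extension_scale:
 assumes "vector_space t"
 shows "extension t vs (\<lambda>ws. t c (F ws)) = t c (extension t vs F)"
proof -
 interpret T: vector_space t by fact
 show ?thesis by (induction vs arbitrary: F) (auto simp: T.scale_sum_right mult.commute)
qed

lemma word_multilinear_sum:
 assumes t: "vector_space t" and F: "word_multilinear t (letter_relations scale G) (homogeneous G) F"
  and good: "list_all (homogeneous G) l" "list_all (homogeneous G) r"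
  and S: "finite S" "\<And>b. b \<in> S ==> x b \<in> G d"
 shows "F (l @ ((\<Sum>b\<in>S. scale (c b) (x b)), d) # r) = (\<Sum>b\<in>S. t (c b) (F (l @ (x b, d) # r)))"
proof -
 interpret T: vector_space t by fact
 have lin: "F (l @ (scale a x + scale b y, d) # r) = t a (F (l @ (x, d) # r)) + t b (F (l @ (y, d) # r))"
  if "x \<in> G d" "y \<in> G d" for a b x y
  by (rule word_multilinearD[OF F good]) (use that in \<open>auto simp: letter_relations_def\<close>)
 have zero: "F (l @ (0, d) # r) = 0"
  using lin[of 0 0 0 0] subspace_0[OF subspace_component] by simp
 show ?thesis
  using S
 proof (induction S rule: finite_induct)
  case (insert b S)
  have "(\<Sum>b\<in>S. scale (c b) (x b)) \<in> G d"
   using insert.prems by (intro subspace_sum subspace_scale subspace_component) auto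
  then have "F (l @ (scale (c b) (x b) + scale 1 (\<Sum>b\<in>S. scale (c b) (x b)), d) # r) =
    t (c b) (F (l @ (x b, d) # r)) + t 1 (F (l @ ((\<Sum>b\<in>S. scale (c b) (x b)), d) # r))"
   using insert.prems by (intro lin) auto
  then show ?case using insert by simp
 qed (simp add: zero)
qed

text \<open>A function that is multilinear on homogeneous words is recovered from its values on
  basis words.\<close>

lemma extension_word:
 assumes t: "vector_space t" and F: "word_multilinear t (letter_relations scale G) (homogeneous G) F"
  and "list_all (homogeneous G) ws"
 shows "extension t (map fst ws) F = F ws"
 using F assms(3)
proof (induction ws arbitrary: F)
 case (Cons p ws)
 obtain v d where p: "p = (v, d)" by (cases p)
 with Cons.prems have v: "v \<in> G d" and ws: "list_all (homogeneous G) ws" by (auto simp: homogeneous_def)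
 have "extension t (map fst (p # ws)) F = (\<Sum>b\<in>supp v. t (coef v b) (F ((b, d) # ws)))"
  unfolding list.map p fst_conv extension.simps
 proof (rule sum.cong[OF refl])
  fix b assume b: "b \<in> supp v"
  then have d: "hdeg b = d" and bG: "b \<in> G d" using coef_homogeneous(2)[OF v b] hbasis(2)[of b] by (auto simp: supp_def)
  have "word_multilinear t (letter_relations scale G) (homogeneous G) (\<lambda>ws. F ((b, d) # ws))"
   using word_multilinearD[OF Cons.prems(1), of "(b, d) # _"] bG
   by (intro word_multilinearI) (simp add: homogeneous_def)
  from Cons.IH[OF this ws]
  show "t (coef v b) (extension t (map fst ws) (\<lambda>ws. F ((b, hdeg b) # ws))) = t (coef v b) (F ((b, d) # ws))"
   by (simp add: d)
 qed
 also have "... = F (((\<Sum>b\<in>supp v. scale (coef v b) b), d) # ws)"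
 proof -
  have "b \<in> G d" if "b \<in> supp v" for b
   using coef_homogeneous(2)[OF v that] hbasis(2)[of b] that by (auto simp: supp_def)
  then show ?thesis
   using word_multilinear_sum[OF t Cons.prems(1) _ ws finite_supp, of "[]" v "\<lambda>b. b" d "coef v"] by simp
 qed
 also have "... = F (p # ws)" using coef_homogeneous(1)[OF v] p by simp
 finally show ?case .
qed simp

section \<open>Linear maps out of tensor spaces\<close>

lemma word_multilinear_const_word:
 "word_multilinear fscale (letter_relations scale G) (homogeneous G) (\<lambda>ws. word scale (map fst ws))"
proof (rule word_multilinearI)
 fix l r :: "('v \<times> int) list" and z z1 z2 a b
 assume "(z, a, z1, b, z2) \<in> letter_relations scale G"
 then have z: "fst z = scale a (fst z1) + scale b (fst z2)" by (auto simp: letter_relations_def)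
 show "word scale (map fst (l @ z # r)) =
  fscale a (word scale (map fst (l @ z1 # r))) + fscale b (word scale (map fst (l @ z2 # r)))"
 proof
  fix \<phi> :: "'v list => 'k"
  show "word scale (map fst (l @ z # r)) \<phi> =
   (fscale a (word scale (map fst (l @ z1 # r))) + fscale b (word scale (map fst (l @ z2 # r)))) \<phi>"
  proof (cases "multilin scale (*) \<phi>")
   case True
   then have "Vector_Spaces.linear scale (*) (\<lambda>x. \<phi> (map fst l @ x # map fst r))"
    unfolding multilin_def by blast
   with True z show ?thesis by (simp add: word_def pointwise linear_iff_additive)
  qed (simp add: word_def pointwise)
 qed
qed

end

lemma span_induct_generators:
 assumes "vector_space s" "x \<in> module.span s B"
  and "P 0" "\<And>x y. [|x \<in> module.span s B; y \<in> module.span s B; P x; P y|] ==> P (x + y)"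
  and "\<And>c x. [|x \<in> module.span s B; P x|] ==> P (s c x)" "\<And>x. x \<in> B ==> P x"
 shows "P x"
proof -
 interpret vector_space s by fact
 have "P x \<and> x \<in> span B"
  using assms(2)
 proof (induction rule: span_induct_alt)
  case (step c x y)
  then have "x \<in> span B" "P x" using assms(6) span_base by auto
  then have "s c x \<in> span B" "P (s c x)" using assms(5) span_scale by auto
  with step show ?case using assms(4) span_add by auto
 qed (use assms(3) span_zero in auto)
 then show ?thesis by simp
qed

lemma total_span_generators:
 assumes "vector_space s"
 shows "total s (\<lambda>i. module.span s (B i)) = module.span s (\<Union>i. B i)"
proof -
 interpret vector_space s by fact
 show ?thesis
  unfolding total_def
 proof
  show "span (\<Union>i. span (B i)) \<subseteq> span (\<Union>i. B i)"
   by (rule span_minimal) (use span_mono[of "B _" "\<Union>i. B i"] in blast, simp)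
  show "span (\<Union>i. B i) \<subseteq> span (\<Union>i. span (B i))"
   by (rule span_mono) (use span_superset in blast)
 qed
qed

lemma tensor_gr_eq:
 "tensor_gr s G n = module.span fscale {word s (map fst ws) | ws. list_all (homogeneous G) ws \<and> sum_list (map snd ws) = n}"
 unfolding tensor_gr_def hom_word_iff by (rule arg_cong[where f = "module.span fscale"]) blast

lemma tensor_total_eq:
 fixes s :: "'k::field => 'v::ab_group_add => 'v"
 shows "tensor_total s G = module.span fscale {word s (map fst ws) | ws. list_all (homogeneous G) ws}"
 unfolding tensor_gr_eq total_span_generators[OF vector_space_fscale]
 by (rule arg_cong[where f = "module.span fscale"]) blast

lemma tensor_total_induct [consumes 1, case_names zero add scale word]:
 fixes s :: "'k::field => 'v::ab_group_add => 'v"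
 assumes "x \<in> tensor_total s G"
  and "P 0" "\<And>x y. [|x \<in> tensor_total s G; y \<in> tensor_total s G; P x; P y|] ==> P (x + y)"
  and "\<And>c x. [|x \<in> tensor_total s G; P x|] ==> P (fscale c x)"
  and "\<And>ws. list_all (homogeneous G) ws ==> P (word s (map fst ws))"
 shows "P x"
 by (rule span_induct_generators[where P = P, OF vector_space_fscale, of x "{word s (map fst ws) | ws. list_all (homogeneous G) ws}"])
  (use assms in \<open>auto simp: tensor_total_eq\<close>)

lemma tensor_gr_induct [consumes 1, case_names zero add scale word]:
 fixes s :: "'k::field => 'v::ab_group_add => 'v"
 assumes "x \<in> tensor_gr s G n"
  and "P 0" "\<And>x y. [|x \<in> tensor_gr s G n; y \<in> tensor_gr s G n; P x; P y|] ==> P (x + y)"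
  and "\<And>c x. [|x \<in> tensor_gr s G n; P x|] ==> P (fscale c x)"
  and "\<And>ws. list_all (homogeneous G) ws ==> sum_list (map snd ws) = n ==> P (word s (map fst ws))"
 shows "P x"
 by (rule span_induct_generators[where P = P, OF vector_space_fscale, of x
   "{word s (map fst ws) | ws. list_all (homogeneous G) ws \<and> sum_list (map snd ws) = n}"])
  (use assms in \<open>auto simp: tensor_gr_eq\<close>)

lemma subspace_tensor_gr: "module.subspace fscale (tensor_gr s G n)"
proof -
 interpret F: vector_space "fscale :: 'k::field => ('x => 'k) => 'x => 'k" by (rule vector_space_fscale)
 show ?thesis unfolding tensor_gr_def by (rule F.subspace_span)
qed

lemma word_in_tensor_gr: "list_all (homogeneous G) ws ==> word s (map fst ws) \<in> tensor_gr s G (sum_list (map snd ws))"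
proof -
 interpret F: vector_space "fscale :: 'k::field => ('x => 'k) => 'x => 'k" by (rule vector_space_fscale)
 show "list_all (homogeneous G) ws ==> ?thesis" unfolding tensor_gr_eq by (rule F.span_base) blast
qed

lemma tensor_gr_total: "x \<in> tensor_gr s G n ==> x \<in> tensor_total s G"
proof -
 interpret F: vector_space "fscale :: 'k::field => ('x => 'k) => 'x => 'k" by (rule vector_space_fscale)
 show "x \<in> tensor_gr s G n ==> ?thesis" unfolding total_def by (rule F.span_base) blast
qed

lemma tensor_total_linear:
 fixes s :: "'k::field => 'v::ab_group_add => 'v"
 assumes "x \<in> tensor_total s G"
 shows "[|multilin s (*) f; multilin s (*) g|] ==> x (\<lambda>vs. f vs + g vs) = x f + x g"
  and "multilin s (*) f ==> x (\<lambda>vs. c * f vs) = c * x f"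
proof -
 have m: "multilin s (*) (\<lambda>vs. f vs + g vs)" if "multilin s (*) f" "multilin s (*) g" for f g
  using that unfolding multilin_def linear_iff_additive by (simp add: algebra_simps)
 have m': "multilin s (*) (\<lambda>vs. c * f vs)" if "multilin s (*) f" for f and c :: 'k
  using that unfolding multilin_def linear_iff_additive by (simp add: algebra_simps)
 show "[|multilin s (*) f; multilin s (*) g|] ==> x (\<lambda>vs. f vs + g vs) = x f + x g"
  using assms by (induction rule: tensor_total_induct) (auto simp: m word_def pointwise algebra_simps)
 show "multilin s (*) f ==> x (\<lambda>vs. c * f vs) = c * x f"
  using assms by (induction rule: tensor_total_induct) (auto simp: m' word_def pointwise algebra_simps)
qed

context graded_vector_space
begin

text \<open>The linear map out of the tensor algebra that extends \<open>F\<close> from homogeneous words.\<close>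

definition induced :: "(('v \<times> int) list => 'y => 'k) => ('v, 'k) tensor_algebra => 'y => 'k" where
 "induced F x = (\<lambda>y. x (\<lambda>vs. extension (*) vs (\<lambda>ws. F ws y)))"

lemma induced_plus: "induced F (x + x') = induced F x + induced F x'"
 by (simp add: induced_def fun_eq_iff pointwise)

lemma induced_zero [simp]: "induced F 0 = 0"
 by (simp add: induced_def fun_eq_iff pointwise)

lemma induced_scale: "induced F (fscale c x) = fscale c (induced F x)"
 by (simp add: induced_def fun_eq_iff pointwise)

abbreviation "multilinear_on_words F \<equiv> word_multilinear fscale (letter_relations scale G) (homogeneous G) F"

lemma multilinear_pointwise:
 "word_multilinear fscale R g F ==> word_multilinear (*) R g (\<lambda>ws. F ws y)"
 unfolding word_multilinear_def linear_along_def by (fastforce simp: pointwise)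

lemma induced_word:
 assumes "multilinear_on_words F" "list_all (homogeneous G) ws"
 shows "induced F (word scale (map fst ws)) = F ws"
 unfolding induced_def word_def
 using extension_multilin[OF vector_space_scalars] extension_word[OF vector_space_scalars multilinear_pointwise[OF assms(1)] assms(2)]
 by (simp add: fun_eq_iff)

lemma induced_mem:
 assumes "module.subspace fscale S" "multilinear_on_words F" "x \<in> tensor_total scale G"
  and "\<And>ws. list_all (homogeneous G) ws ==> F ws \<in> S"
 shows "induced F x \<in> S"
proof -
 interpret F: vector_space "fscale :: 'k => ('y => 'k) => 'y => 'k" by (rule vector_space_fscale)
 show ?thesis
  using assms(3)
  by (induction rule: tensor_total_induct)
   (use assms in \<open>auto simp: induced_plus induced_scale induced_word F.subspace_0 F.subspace_add F.subspace_scale\<close>)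
qed

lemma induced_mem_gr:
 assumes "module.subspace fscale S" "multilinear_on_words F" "x \<in> tensor_gr scale G n"
  and "\<And>ws. list_all (homogeneous G) ws ==> sum_list (map snd ws) = n ==> F ws \<in> S"
 shows "induced F x \<in> S"
proof -
 interpret F: vector_space "fscale :: 'k => ('y => 'k) => 'y => 'k" by (rule vector_space_fscale)
 show ?thesis
  using assms(3)
  by (induction rule: tensor_gr_induct)
   (use assms in \<open>auto simp: induced_plus induced_scale induced_word F.subspace_0 F.subspace_add F.subspace_scale\<close>)
qed

lemma linear_along_induced:
 assumes x: "x \<in> tensor_total scale G"
  and F: "\<And>z a z1 b z2. (z, a, z1, b, z2) \<in> R ==> multilinear_on_words (\<lambda>ws. F ws z) \<and>
   multilinear_on_words (\<lambda>ws. F ws z1) \<and> multilinear_on_words (\<lambda>ws. F ws z2)"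
  and lin: "\<And>ws. list_all (homogeneous G) ws ==> linear_along fscale R (F ws)"
 shows "linear_along fscale R (\<lambda>z. induced (\<lambda>ws. F ws z) x)"
proof -
 interpret F: vector_space "fscale :: 'k => ('y => 'k) => 'y => 'k" by (rule vector_space_fscale)
 have "induced (\<lambda>ws. F ws z) x = fscale a (induced (\<lambda>ws. F ws z1) x) + fscale b (induced (\<lambda>ws. F ws z2) x)"
  if "(z, a, z1, b, z2) \<in> R" for z a z1 b z2
  using x
 proof (induction rule: tensor_total_induct)
  case (word ws)
  then show ?case using lin[OF word] F[OF that] that by (fastforce simp: induced_word linear_along_def)
 qed (simp_all add: induced_plus induced_scale F.scale_right_distrib mult.commute add_ac)
 then show ?thesis by (auto simp: linear_along_def)
qed

end

section \<open>Sums over placements\<close>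

lemma seg_simps:
 "seg es a a = []" "length (seg es a b) = b - a"
 by (simp_all add: seg_def)

lemma take_seg: "i \<le> b - a ==> take i (seg es a b) = seg es a (a + i)"
 by (cases "i = 0") (simp_all add: seg_def take_map)

lemma drop_seg: "drop i (seg es a b) = seg es (a + i) b"
 by (simp add: seg_def drop_map add.commute)

lemma map_seg: "b \<le> length es ==> map f (seg es a b) = seg (map f es) a b"
 by (auto simp: seg_def)

lemma spl_seg:
 assumes "a \<le> b"
 shows "spl (seg es a b) f = (\<Sum>i\<in>{a..b}. f (seg es a i) (seg es i b))"
proof -
 have "spl (seg es a b) f = (\<Sum>i\<le>b - a. f (seg es a (a + i)) (seg es (a + i) b))"
  unfolding spl_atMost by (intro sum.cong) (simp_all add: seg_simps take_seg drop_seg)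
 also have "... = (\<Sum>i\<in>{a..b}. f (seg es a i) (seg es i b))"
  by (rule sum.reindex_bij_witness[of _ "\<lambda>i. i - a" "\<lambda>i. a + i"]) (use assms in auto)
 finally show ?thesis .
qed

lemma placements_0: "placements a b 0 = {[]}"
 by (auto simp: placements_def)

lemma placements_Suc:
 "placements a b (Suc q) = (\<Union>i\<in>{a..b}. \<Union>j\<in>{i..b}. (\<lambda>ps. (i, j - i) # ps) ` placements j b q)"
proof (intro set_eqI iffI)
 fix ps assume "ps \<in> placements a b (Suc q)"
 then obtain i r ps' where ps: "ps = (i, r) # ps'" and len: "length ps' = q"
  and bnd: "\<And>k. k < Suc q ==> a \<le> fst (ps ! k) \<and> fst (ps ! k) + snd (ps ! k) \<le> b"
  and chain: "\<And>k. Suc k < Suc q ==> fst (ps ! k) + snd (ps ! k) \<le> fst (ps ! Suc k)"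
  unfolding placements_def by (cases ps) auto
 have ir: "a \<le> i" "i + r \<le> b" using bnd[of 0] ps by auto
 have lower: "i + r \<le> fst (ps' ! k)" if "k < q" for k
  using that
 proof (induction k)
  case 0
  then show ?case using chain[of 0] ps by simp
 next
  case (Suc k)
  then show ?case using chain[of "Suc k"] ps by simp
 qed
 have "ps' \<in> placements (i + r) b q"
  unfolding placements_def using len lower bnd[of "Suc _"] chain[of "Suc _"] ps by auto
 then show "ps \<in> (\<Union>i\<in>{a..b}. \<Union>j\<in>{i..b}. (\<lambda>ps. (i, j - i) # ps) ` placements j b q)"
  using ir ps by (intro UN_I[of i] UN_I[of "i + r"]) auto
next
 fix ps assume "ps \<in> (\<Union>i\<in>{a..b}. \<Union>j\<in>{i..b}. (\<lambda>ps. (i, j - i) # ps) ` placements j b q)"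
 then obtain i j ps' where *: "a \<le> i" "i \<le> j" "j \<le> b" "ps = (i, j - i) # ps'" "ps' \<in> placements j b q"
  by auto
 then show "ps \<in> placements a b (Suc q)"
  unfolding placements_def by (fastforce simp: nth_Cons split: nat.split)
qed

lemma finite_placements: "finite (placements a b q)"
 by (induction q arbitrary: a) (auto simp: placements_0 placements_Suc)

lemma sum_placements_Suc:
 "sum f (placements a b (Suc q)) = (\<Sum>i\<in>{a..b}. \<Sum>j\<in>{i..b}. \<Sum>ps\<in>placements j b q. f ((i, j - i) # ps))"
proof -
 have 1: "sum f (\<Union>j\<in>{i..b}. (\<lambda>ps. (i, j - i) # ps) ` placements j b q) =
   (\<Sum>j\<in>{i..b}. \<Sum>ps\<in>placements j b q. f ((i, j - i) # ps))" for i
 proof (subst sum.UNION_disjoint)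
  show "(\<Sum>j\<in>{i..b}. sum f ((\<lambda>ps. (i, j - i) # ps) ` placements j b q)) =
   (\<Sum>j\<in>{i..b}. \<Sum>ps\<in>placements j b q. f ((i, j - i) # ps))"
   by (rule sum.cong[OF refl], subst sum.reindex) (auto simp: inj_on_def)
 qed (auto simp: finite_placements)
 show ?thesis
  unfolding placements_Suc
  by (subst sum.UNION_disjoint) (auto simp: finite_placements 1)
qed

section \<open>The action of operations on words of arguments\<close>

text \<open>The shifted degree, for which all Koszul signs below are those of the bar construction.\<close>

definition sdeg :: "'a \<times> int => int" where
 "sdeg e = snd e - 1"

definition apply_op :: "'a oper => ('a \<times> int) list => 'a \<times> int" where
 "apply_op P es = (fst P (map fst es), snd P + 1 + wdeg sdeg es)"

definition on_args :: "('a oper, 'a \<times> int) operation" where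
 "on_args P es = [(0, apply_op P es)]"

abbreviation act_args where
 "act_args \<equiv> act on_args snd sdeg"

lemma lsum_on_args [simp]: "lsum (on_args P es) k = k (apply_op P es)"
 by (simp add: on_args_def)

lemma sdeg_apply_op [simp]: "sdeg (apply_op P es) = snd P + wdeg sdeg es"
 by (simp add: sdeg_def apply_op_def)

lemma wdeg_seg:
 "b \<le> length ws ==> wdeg dc (seg ws a b) = (\<Sum>j\<in>{a..<b}. dc (ws ! j))"
 by (simp add: wdeg_def seg_def comp_def interv_sum_list_conv_sum_set_nat)

text \<open>Unfolding the action from left to right enumerates the placements: the first operation
  takes the entries from \<open>i\<close> to \<open>j - 1\<close>, the others are placed from
  \<open>j\<close> on.\<close>

lemma act_args_placements:
 fixes \<phi> :: "'a list => 'x::ab_group_add"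
 assumes "a \<le> b" "b \<le> length ws"
 shows "act_args Qs (seg ws a b) (\<lambda>w. \<phi> (map fst w)) =
  (\<Sum>ps\<in>placements a b (length Qs). sg (\<Sum>k<length Qs. snd (Qs ! k) * (\<Sum>j\<in>{a..<fst (ps ! k)}. sdeg (ws ! j)))
    (\<phi> (plug (map fst ws) a b (zip (map fst Qs) ps))))"
 using assms
proof (induction Qs arbitrary: a \<phi>)
 case Nil
 then show ?case by (simp add: placements_0 map_seg)
next
 case (Cons Q Qs)
 let ?S = "\<lambda>i j. \<Sum>k\<in>{i..<j}. sdeg (ws ! k)"
 define q where "q = length Qs"
 have "act_args (Q # Qs) (seg ws a b) (\<lambda>w. \<phi> (map fst w)) =
   (\<Sum>i\<in>{a..b}. \<Sum>j\<in>{i..b}. sg (snd Q * ?S a i + wdeg snd Qs * (?S a i + ?S i j))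
    (act_args Qs (seg ws j b) (\<lambda>w. \<phi> (seg (map fst ws) a i @ fst Q (seg (map fst ws) i j) # map fst w))))"
  unfolding act_Cons spl_seg[OF Cons.prems(1)]
  by (intro sum.cong refl) (use Cons.prems in \<open>simp add: spl_seg wdeg_seg apply_op_def map_seg\<close>)
 also have "... = (\<Sum>i\<in>{a..b}. \<Sum>j\<in>{i..b}. \<Sum>ps\<in>placements j b q.
   sg (\<Sum>k<Suc q. snd ((Q # Qs) ! k) * ?S a (fst (((i, j - i) # ps) ! k)))
    (\<phi> (plug (map fst ws) a b (zip (map fst (Q # Qs)) ((i, j - i) # ps)))))"
 proof (intro sum.cong refl)
  fix i j assume i: "i \<in> {a..b}" and j: "j \<in> {i..b}"
  have "sg (snd Q * ?S a i + wdeg snd Qs * (?S a i + ?S i j)) (sg (\<Sum>k<q. snd (Qs ! k) * ?S j (fst (ps ! k))) x) =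
   sg (\<Sum>k<Suc q. snd ((Q # Qs) ! k) * ?S a (fst (((i, j - i) # ps) ! k))) x"
   if ps: "ps \<in> placements j b q" for ps and x :: 'x
  proof -
   have "?S a i + ?S i j + ?S j (fst (ps ! k)) = ?S a (fst (ps ! k))" if "k < q" for k
   proof -
    have "j \<le> fst (ps ! k)" using ps that by (auto simp: placements_def)
    then show ?thesis using i j by (simp add: sum.atLeastLessThan_concat)
   qed
   then have "(\<Sum>k<q. snd (Qs ! k) * ?S a (fst (ps ! k))) =
     (\<Sum>k<q. snd (Qs ! k) * (?S a i + ?S i j) + snd (Qs ! k) * ?S j (fst (ps ! k)))"
    by (intro sum.cong refl) (metis distrib_left lessThan_iff)
   also have "... = wdeg snd Qs * (?S a i + ?S i j) + (\<Sum>k<q. snd (Qs ! k) * ?S j (fst (ps ! k)))"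
    by (simp add: sum.distrib sum_distrib_right[symmetric] wdeg_def sum_list_sum_nth q_def atLeast0LessThan)
   finally show ?thesis by (simp add: sum.lessThan_Suc_shift sg_sg add.assoc del: sum.lessThan_Suc)
  qed
  then show "sg (snd Q * ?S a i + wdeg snd Qs * (?S a i + ?S i j))
    (act_args Qs (seg ws j b) (\<lambda>w. \<phi> (seg (map fst ws) a i @ fst Q (seg (map fst ws) i j) # map fst w))) =
   (\<Sum>ps\<in>placements j b q. sg (\<Sum>k<Suc q. snd ((Q # Qs) ! k) * ?S a (fst (((i, j - i) # ps) ! k)))
    (\<phi> (plug (map fst ws) a b (zip (map fst (Q # Qs)) ((i, j - i) # ps)))))"
   using i j Cons.prems
   by (subst Cons.IH) (auto simp: q_def sg_def sum_negf[symmetric] intro!: sum.cong)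
 qed
 also have "... = (\<Sum>ps\<in>placements a b (length (Q # Qs)).
   sg (\<Sum>k<length (Q # Qs). snd ((Q # Qs) ! k) * ?S a (fst (ps ! k)))
    (\<phi> (plug (map fst ws) a b (zip (map fst (Q # Qs)) ps))))"
  by (simp only: list.size add_0_right add_Suc_right sum_placements_Suc q_def)
 finally show ?case .
qed

lemma lsum_apply: "lsum L f y = lsum L (\<lambda>b. f b y)"
 by (rule lsum_additive[where h = "\<lambda>f. f y"]) (simp add: pointwise)

lemma sg_sum_cong:
 assumes "\<And>k. k < q ==> even (f k - g k)"
 shows "sg (\<Sum>k<q. f k) x = sg (\<Sum>k<q. g k) x"
proof (rule sg_eq)
 show "even ((\<Sum>k<q. f k) - (\<Sum>k<q. g k))"
  unfolding sum_subtractf[symmetric] using assms by (intro dvd_sum) auto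
qed

lemma (in vector_space) scale_ksign: "scale (ksign n) x = sg n x"
 by (simp add: ksign_def sg_def)

section \<open>Braces\<close>

lemma linear_alongI:
 "(\<And>z a z1 b z2. (z, a, z1, b, z2) \<in> R ==> k z = t a (k z1) + t b (k z2)) ==> linear_along t R k"
 by (auto simp: linear_along_def)

lemma linear_alongD:
 "[|linear_along t R k; (z, a, z1, b, z2) \<in> R|] ==> k z = t a (k z1) + t b (k z2)"
 by (auto simp: linear_along_def)

context graded_vector_space
begin

lemma linear_along_lsum_letter:
 assumes t: "vector_space t" and k: "linear_along t (letter_relations scale G) k"
  and f: "\<And>n w. (n, w) \<in> set L ==> f w \<in> G d"
 shows "k (lsum L f, d) = lsum L (\<lambda>w. k (f w, d))"
proof -
 interpret T: vector_space t by fact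
 have lin: "k (scale a x + scale b y, d) = t a (k (x, d)) + t b (k (y, d))" if "x \<in> G d" "y \<in> G d" for a b x y
  using k that unfolding linear_along_def letter_relations_def by fastforce
 have 0: "0 \<in> G d" by (rule subspace_0[OF subspace_component])
 have "k (lsum L f, d) = lsum L (\<lambda>w. k (f w, d)) \<and> lsum L f \<in> G d"
  using f
 proof (induction L)
  case Nil
  show ?case using lin[OF 0 0, of 0 0] 0 by simp
 next
  case (Cons p L)
  obtain n w where p: "p = (n, w)" by (cases p)
  have IH: "k (lsum L f, d) = lsum L (\<lambda>w. k (f w, d))" "lsum L f \<in> G d" using Cons by auto
  have w: "f w \<in> G d" using Cons.prems p by auto
  have "k (lsum (p # L) f, d) = k (scale (if even n then 1 else -1) (f w) + scale 1 (lsum L f), d)"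
   by (simp add: p sg_def)
  also have "... = lsum (p # L) (\<lambda>w. k (f w, d))"
   using lin[OF w IH(2), of "if even n then 1 else -1" 1] IH(1)
   by (simp only: p lsum_Cons sg_def T.scale_one) simp
  finally show ?case
   using w IH(2) subspace_component by (auto simp: p sg_def intro: subspace_add subspace_neg subspace_diff)
 qed
 then show ?thesis by simp
qed

lemma lsum_component: "(\<And>n w. (n, w) \<in> set L ==> f w \<in> G d) ==> lsum L f \<in> G d"
proof (induction L)
 case (Cons p L)
 obtain n w where "p = (n, w)" by (cases p)
 with Cons show ?case
  by (auto simp: sg_def intro!: subspace_add subspace_neg subspace_diff subspace_component)
qed (simp add: subspace_0 subspace_component)

lemma coef_total:
 assumes "x \<in> total scale G"
 shows "(\<Sum>b\<in>supp x. scale (coef x b) b) = x"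
proof -
 have "(\<Union>i. G i) \<subseteq> span hbasis"
  using hbasis(3) span_mono[of "{b \<in> hbasis. hdeg b = _}" hbasis] by fastforce
 then have x: "x \<in> span hbasis"
  using assms span_minimal[OF _ subspace_span] unfolding total_def by blast
 have "coef x = representation hbasis x"
  unfolding coef_def
  by (rule representation_extend[OF independent_extend_basis[OF hbasis(1)] x extend_basis_superset[OF hbasis(1)]])
 moreover from this have "supp x = {b. representation hbasis x b \<noteq> 0}"
  unfolding supp_def by (auto dest: representation_ne_zero)
 ultimately show ?thesis using sum_nonzero_representation_eq[OF hbasis(1) x] by simp
qed

lemma extension_multilin_eq:
 assumes t: "vector_space t" and P: "multilin scale t P" and tot: "total scale G = UNIV"
 shows "extension t vs (\<lambda>ws. P (map fst ws)) = P vs"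
 using P
proof (induction vs arbitrary: P)
 case (Cons v vs)
 interpret T: vector_space t by fact
 have lin: "Vector_Spaces.linear scale t (\<lambda>x. P (us @ x # vs))" for us vs
  using Cons.prems unfolding multilin_def by blast
 interpret L: Vector_Spaces.linear scale t "\<lambda>x. P (x # vs)" using lin[of "[]" vs] by simp
 have "multilin scale t (\<lambda>vs. P (b # vs))" for b
  unfolding multilin_def using lin[of "b # _"] by simp
 then have "extension t vs (\<lambda>ws. P (b # map fst ws)) = P (b # vs)" for b
  using Cons.IH[of "\<lambda>vs. P (b # vs)"] by simp
 then have "extension t (v # vs) (\<lambda>ws. P (map fst ws)) = (\<Sum>b\<in>supp v. t (coef v b) (P (b # vs)))"
  by simp
 also have "... = P ((\<Sum>b\<in>supp v. scale (coef v b) b) # vs)"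
  by (simp add: L.sum L.scale)
 finally show ?case using coef_total[of v] tot by simp
qed simp

end

context curved_Ainf_algebra
begin

abbreviation "homA \<equiv> homogeneous A"
abbreviation "homV \<equiv> homogeneous (End_gr sA A)"
abbreviation "homAs \<equiv> list_all homA"
abbreviation "homVs \<equiv> list_all homV"
abbreviation "relA \<equiv> letter_relations sA A"
abbreviation "relV \<equiv> letter_relations (pscale sA) (End_gr sA A)"

lemma vs_A: "vector_space sA"
 by (rule vector_space_axioms)

lemma graded_relA: "graded_relations homA sdeg relA"
 using graded_letter_relations[of "\<lambda>d. d - 1"] unfolding sdeg_def[abs_def] by (simp add: split_beta')

lemma End_apply:
 assumes "homV P" "homAs es"
 shows "homA (apply_op P es)"
proof -
 have "sum_list (map snd es) - int (length es) = wdeg sdeg es"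
  by (induction es) (auto simp: sdeg_def)
 moreover have "fst P (map fst es) \<in> A (snd P - (int (length (map fst es)) - 1) + sum_list (map snd es))"
 proof -
  have "\<And>es \<delta>. hom_word A es \<delta> ==> fst P es \<in> A (snd P - (int (length es) - 1) + sum_list \<delta>)"
   using assms(1) unfolding homogeneous_def End_gr_def by (cases P) auto
  from this[OF hom_wordI[OF assms(2)]] show ?thesis .
 qed
 ultimately show ?thesis unfolding apply_op_def homogeneous_def by (simp add: algebra_simps)
qed

lemma graded_on_args: "graded_operation homV snd homA sdeg on_args"
 unfolding graded_operation_def on_args_def using End_apply by auto

lemma End_linear:
 assumes "homV P"
 shows "fst P (l @ (sA a x + sA b y) # r) = sA a (fst P (l @ x # r)) + sA b (fst P (l @ y # r))"
proof -
 have "Vector_Spaces.linear sA sA (\<lambda>x. fst P (l @ x # r))"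
  using assms unfolding homogeneous_def End_gr_def multilin_def by (cases P) auto
 then show ?thesis by (simp add: linear_iff_additive)
qed

lemma End_word_multilinear: "homV P ==> word_multilinear sA relA homA (\<lambda>w. fst P (map fst w))"
 by (rule word_multilinearI) (auto simp: letter_relations_def End_linear)

lemma on_args_multilinear:
 assumes "homV P" "linear_along t relA k"
 shows "word_multilinear t relA homA (\<lambda>b. lsum (on_args P b) k)"
proof (rule word_multilinearI)
 fix l r z a z1 b z2 assume lr: "homAs l" "homAs r" and R: "(z, a, z1, b, z2) \<in> relA"
 have g: "homA z1" "homA z2" "sdeg z1 = sdeg z" "sdeg z2 = sdeg z"
  using graded_relA R unfolding graded_relations_def by auto
 have z: "fst z = sA a (fst z1) + sA b (fst z2)" using R by (auto simp: letter_relations_def)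
 have "homA (apply_op P (l @ z1 # r))" "homA (apply_op P (l @ z2 # r))"
  using assms(1) lr g by (auto intro!: End_apply)
 then have "(apply_op P (l @ z # r), a, apply_op P (l @ z1 # r), b, apply_op P (l @ z2 # r)) \<in> relA"
  unfolding letter_relations_def apply_op_def homogeneous_def using g End_linear[OF assms(1)] z
  by auto
 then show "lsum (on_args P (l @ z # r)) k = t a (lsum (on_args P (l @ z1 # r)) k) + t b (lsum (on_args P (l @ z2 # r)) k)"
  using linear_alongD[OF assms(2)] by auto
qed

lemma on_args_linear:
 assumes "homAs b" "linear_along t relA k"
 shows "linear_along t relV (\<lambda>P. lsum (on_args P b) k)"
proof (rule linear_alongI)
 fix z c1 z1 c2 z2 assume R: "(z, c1, z1, c2, z2) \<in> relV"
 then have *: "fst z = pscale sA c1 (fst z1) + pscale sA c2 (fst z2)" "snd z1 = snd z" "snd z2 = snd z" "homV z1" "homV z2"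
  by (auto simp: letter_relations_def homogeneous_def)
 have "(apply_op z b, c1, apply_op z1 b, c2, apply_op z2 b) \<in> relA"
  using End_apply[OF *(4) assms(1)] End_apply[OF *(5) assms(1)]
  unfolding letter_relations_def apply_op_def homogeneous_def by (auto simp: * pointwise)
 then show "lsum (on_args z b) k = t c1 (lsum (on_args z1 b) k) + t c2 (lsum (on_args z2 b) k)"
  using linear_alongD[OF assms(2)] by auto
qed

lemma multilin_eqI:
 assumes "multilin sA sA P" "multilin sA sA Q"
  and "\<And>es. homAs es ==> P (map fst es) = Q (map fst es)"
 shows "P = Q"
proof
 fix es
 have "extension sA es (\<lambda>ws. P (map fst ws)) = extension sA es (\<lambda>ws. Q (map fst ws))"
  by (rule extension_cong) (rule assms(3))
 then show "P es = Q es"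
  using extension_multilin_eq[OF vs_A assms(1) total_UNIV] extension_multilin_eq[OF vs_A assms(2) total_UNIV] by simp
qed

lemma multilin_zero: "multilin sA sA 0"
 unfolding multilin_def linear_iff_additive by (auto simp: pointwise vs_A)

lemma subspace_End: "module.subspace (pscale sA) (End_gr sA A p)"
proof -
 interpret V: vector_space "pscale sA :: 'k => ('a list => 'a) => _" by (rule vector_space_pscale[OF vs_A])
 show ?thesis
  unfolding V.subspace_def End_gr_def multilin_def linear_iff_additive
  using subspace_component
  by (auto simp: pointwise vs_A subspace_0 scale_right_distrib scale_left_commute subspace_add subspace_scale add_ac mult.commute)
qed

lemma graded_vs_End: "graded_vector_space (pscale sA) (End_gr sA A)"
proof -
 interpret V: vector_space "pscale sA :: 'k => ('a list => 'a) => _" by (rule vector_space_pscale[OF vs_A])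
 show ?thesis
 proof
  fix I :: "int set" and x i
  assume I: "finite I" "i \<in> I" and x: "\<And>i. i \<in> I ==> x i \<in> End_gr sA A i" and sum: "sum x I = 0"
  show "x i = 0"
  proof (rule multilin_eqI[OF _ multilin_zero])
   show "multilin sA sA (x i)" using x[OF I(2)] by (simp add: End_gr_def)
  next
   fix es assume es: "homAs es"
   define s where "s = sum_list (map snd es) - (int (length es) - 1)"
   have mem: "x i (map fst es) \<in> A (i + s)" if "i \<in> I" for i
    using x[OF that] hom_wordI[OF es] unfolding End_gr_def s_def by (fastforce simp: algebra_simps)
   have "sum x J (map fst es) = (\<Sum>i\<in>J. x i (map fst es))" for J
    by (induction J rule: infinite_finite_induct) (auto simp: pointwise)
   from this[of I] have "(\<Sum>i\<in>I. x i (map fst es)) = 0" by (simp add: sum pointwise)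
   then have "(\<Sum>j\<in>(\<lambda>i. i + s) ` I. x (j - s) (map fst es)) = 0"
    by (subst sum.reindex) (auto simp: inj_on_def)
   moreover have "finite ((\<lambda>i. i + s) ` I)" using I(1) by simp
   ultimately have "x ((i + s) - s) (map fst es) = 0"
    using independent_components[of "(\<lambda>i. i + s) ` I" "\<lambda>j. x (j - s) (map fst es)" "i + s"] mem I(2) by fastforce
   then show "x i (map fst es) = 0 (map fst es)" by (simp add: pointwise)
  qed
 qed (rule subspace_End)
qed

sublocale V: graded_vector_space "pscale sA" "End_gr sA A"
 by (rule graded_vs_End)

lemma graded_relV: "graded_relations homV snd relV"
proof -
 have "(\<lambda>(v :: 'a list => 'a, d :: int). d) = snd" by auto
 then show ?thesis using V.graded_letter_relations[of "\<lambda>d. d"] by simp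
qed

text \<open>The brace \<open>P{Q\<^sub>1, \<dots>, Q\<^sub>q}\<close>: apply \<open>P\<close> after the operations \<open>Q\<^sub>k\<close> have acted on the arguments.\<close>

definition brace :: "'a oper => ('a oper) list => 'a oper" where
 "brace P ys = (\<lambda>es. extension sA es (\<lambda>ws. act_args ys ws (\<lambda>w. fst P (map fst w))), snd P + wdeg snd ys)"

definition on_ops :: "('a oper, 'a oper) operation" where
 "on_ops P ys = [(0, brace P ys)]"

abbreviation "act_ops \<equiv> act on_ops snd snd"

lemma lsum_on_ops [simp]: "lsum (on_ops P es) k = k (brace P es)"
 by (simp add: on_ops_def)

lemma snd_brace [simp]: "snd (brace P ys) = snd P + wdeg snd ys"
 by (simp add: brace_def)

lemma act_args_multilinear:
 assumes "vector_space t" "homVs ys" "word_multilinear t relA homA \<phi>"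
 shows "word_multilinear t relA homA (\<lambda>es. act_args ys es \<phi>)"
 by (rule vector_space.word_multilinear_act[OF assms(1) graded_on_args graded_relA on_args_multilinear assms(3,2)])

lemma act_args_multilinear_ops:
 assumes "vector_space t" "homAs es" "word_multilinear t relA homA \<phi>"
 shows "word_multilinear t relV homV (\<lambda>ys. act_args ys es \<phi>)"
 by (rule vector_space.word_multilinear_act_operations[OF assms(1) graded_on_args graded_relV on_args_linear assms(3,2)])

lemma brace_word:
 assumes "homV P" "homVs ys" "homAs es"
 shows "fst (brace P ys) (map fst es) = act_args ys es (\<lambda>w. fst P (map fst w))"
 unfolding brace_def fst_conv
 by (rule extension_word[OF vs_A act_args_multilinear[OF vs_A assms(2) End_word_multilinear[OF assms(1)]] assms(3)])

lemma homV_I: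
 assumes "multilin sA sA P" "\<And>es. homAs es ==> P (map fst es) \<in> A (p + 1 + wdeg sdeg es)"
 shows "homV (P, p)"
proof -
 have "sum_list (map snd es) - int (length es) = wdeg sdeg es" for es :: "('a \<times> int) list"
  by (induction es) (auto simp: sdeg_def)
 then have e: "p - (int (length es) - 1) + sum_list (map snd es) = p + 1 + wdeg sdeg es" for es :: "('a \<times> int) list"
  by (simp add: algebra_simps)
 have "P es \<in> A (p - (int (length es) - 1) + sum_list \<delta>)" if "hom_word A es \<delta>" for es \<delta>
  using that
 proof (rule hom_wordE)
  fix ws assume "homAs ws" "es = map fst ws" "\<delta> = map snd ws"
  then show ?thesis using assms(2)[of ws] by (simp only: length_map e)
 qed
 then show ?thesis using assms(1) by (simp add: homogeneous_def End_gr_def)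
qed

lemma homV_D: "homV P ==> homAs es ==> fst P (map fst es) \<in> A (snd P + 1 + wdeg sdeg es)"
 using End_apply[of P es] by (simp add: apply_op_def homogeneous_def)

lemma brace_homogeneous:
 assumes "homV P" "homVs ys"
 shows "homV (brace P ys)"
proof -
 have "homV (fst (brace P ys), snd P + wdeg snd ys)"
 proof (rule homV_I)
  show "multilin sA sA (fst (brace P ys))"
   unfolding brace_def fst_conv by (rule extension_multilin[OF vs_A])
 next
  fix es assume es: "homAs es"
  have "act_args ys es (\<lambda>w. fst P (map fst w)) \<in> A (snd P + wdeg snd ys + 1 + wdeg sdeg es)"
   unfolding act_def
  proof (rule lsum_component)
   fix n w assume "(n, w) \<in> set (inserted on_args snd sdeg ys es)"
   from inserted_graded[OF graded_on_args assms(2) es this]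
   show "fst P (map fst w) \<in> A (snd P + wdeg snd ys + 1 + wdeg sdeg es)"
    using homV_D[OF assms(1), of w] by (simp add: algebra_simps)
  qed
  then show "fst (brace P ys) (map fst es) \<in> A (snd P + wdeg snd ys + 1 + wdeg sdeg es)"
   by (simp add: brace_word[OF assms es])
 qed
 then show ?thesis by (simp add: brace_def)
qed

lemma graded_on_ops: "graded_operation homV snd homV snd on_ops"
 unfolding graded_operation_def on_ops_def using brace_homogeneous by auto

lemma brace_Nil: "homV P ==> brace P [] = P"
 unfolding brace_def using extension_multilin_eq[OF vs_A _ total_UNIV, of "fst P"]
 by (cases P) (auto simp: homogeneous_def End_gr_def)

text \<open>By multilinearity a function that is linear in the letter \<open>P{ys}(es)\<close> can
  be evaluated on each summand.\<close>

lemma brace_letter: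
 assumes t: "vector_space t" and "homV P" "homVs ys" "homAs es" "linear_along t relA k"
 shows "k (apply_op (brace P ys) es) = act_args ys es (\<lambda>w. k (apply_op P w))"
proof -
 define d where "d = snd P + wdeg snd ys + 1 + wdeg sdeg es"
 have in_d: "fst P (map fst w) \<in> A d \<and> apply_op P w = (fst P (map fst w), d)"
  if "homAs w" "wdeg sdeg w = wdeg snd ys + wdeg sdeg es" for w
  using homV_D[OF assms(2) that(1)] that(2) by (simp add: d_def apply_op_def algebra_simps)
 have "k (apply_op (brace P ys) es) = k (lsum (inserted on_args snd sdeg ys es) (\<lambda>w. fst P (map fst w)), d)"
  by (simp add: apply_op_def d_def brace_word[OF assms(2-4)] act_def)
 also have "... = lsum (inserted on_args snd sdeg ys es) (\<lambda>w. k (fst P (map fst w), d))"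
  by (rule linear_along_lsum_letter[OF t assms(5)])
   (use inserted_graded[OF graded_on_args assms(3,4)] in_d in blast)
 also have "... = act_args ys es (\<lambda>w. k (apply_op P w))"
  unfolding act_def
  by (rule lsum_cong) (use inserted_graded[OF graded_on_args assms(3,4)] in_d in fastforce)
 finally show ?thesis .
qed

lemma act_args_compose:
 assumes t: "vector_space t" and "homVs xs" "homVs ys" "homAs es"
  and "word_multilinear t relA homA \<phi>"
 shows "act_args ys es (\<lambda>w. act_args xs w \<phi>) = act_ops xs ys (\<lambda>z. act_args z es \<phi>)"
proof (rule act_compose[where K = "linear_along t relA", OF graded_on_args graded_on_ops graded_on_args assms(2-4)])
 fix P y1 y2 y3 e1 e2 e3 k
 assume "P \<in> set xs" "ys = y1 @ y2 @ y3" "es = e1 @ e2 @ e3" "linear_along t relA k"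
 with assms(2-4) show "lsum (on_ops P y2) (\<lambda>Q. lsum (on_args Q e2) k) = act_args y2 e2 (\<lambda>b. lsum (on_args P b) k)"
  by (auto simp: list_all_iff intro!: brace_letter[OF t])
qed (use assms(5) vector_space.linear_along_zero[OF t] vector_space.linear_along_plus[OF t]
   vector_space.linear_along_sg[OF t] in \<open>auto intro: word_multilinear_linear_along\<close>)

text \<open>Associativity of the braces: both sides are operations, and on words they agree by
  \<open>act_args_compose\<close>.\<close>

lemma brace_brace:
 assumes "homV P" "homVs ys" "homVs zs"
 shows "fst (brace (brace P ys) zs) = act_ops ys zs (\<lambda>b. fst (brace P b))"
proof -
 have "fst (brace (brace P ys) zs) = (\<lambda>es. extension sA es (\<lambda>ws. act_ops ys zs (\<lambda>b. act_args b ws (\<lambda>w. fst P (map fst w)))))"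
  unfolding brace_def[of "brace P ys"] fst_conv
 proof (intro ext extension_cong)
  fix ws assume ws: "homAs ws"
  have "act_args zs ws (\<lambda>w. fst (brace P ys) (map fst w)) =
    act_args zs ws (\<lambda>w. act_args ys w (\<lambda>w. fst P (map fst w)))"
   by (rule act_cong[OF graded_on_args assms(3) ws]) (simp add: brace_word[OF assms(1,2)])
  also have "... = act_ops ys zs (\<lambda>b. act_args b ws (\<lambda>w. fst P (map fst w)))"
   by (rule act_args_compose[OF vs_A assms(2,3) ws End_word_multilinear[OF assms(1)]])
  finally show "act_args zs ws (\<lambda>w. fst (brace P ys) (map fst w)) =
   act_ops ys zs (\<lambda>b. act_args b ws (\<lambda>w. fst P (map fst w)))" .
 qed
 also have "... = act_ops ys zs (\<lambda>b. fst (brace P b))"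
 proof
  fix es
  have "extension sA es (\<lambda>ws. lsum L (\<lambda>b. F b ws)) = lsum L (\<lambda>b. extension sA es (F b))" for L F
  proof -
   have "extension sA es (\<lambda>ws. lsum L (\<lambda>b. F b ws)) = extension sA es (lsum L F)"
    by (intro arg_cong[where f = "extension sA es"] ext) (simp add: lsum_apply)
   also have "... = lsum L (\<lambda>b. extension sA es (F b))"
    by (rule lsum_additive[where h = "extension sA es"])
     (use extension_plus[OF vs_A, of es] in \<open>simp add: plus_fun_def\<close>)
   finally show ?thesis .
  qed
  then show "extension sA es (\<lambda>ws. act_ops ys zs (\<lambda>b. act_args b ws (\<lambda>w. fst P (map fst w)))) =
   act_ops ys zs (\<lambda>b. fst (brace P b)) es"
   by (simp add: act_def[of on_ops] brace_def lsum_apply)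
 qed
 finally show ?thesis .
qed

lemma brace_brace_letter:
 assumes t: "vector_space t" and "homV P" "homVs ys" "homVs zs" "linear_along t relV k"
 shows "k (brace (brace P ys) zs) = act_ops ys zs (\<lambda>b. k (brace P b))"
proof -
 define d where "d = snd P + wdeg snd ys + wdeg snd zs"
 have in_d: "fst (brace P w) \<in> End_gr sA A d \<and> brace P w = (fst (brace P w), d)"
  if "homVs w \<and> wdeg snd w = wdeg snd ys + wdeg snd zs" for w
  using brace_homogeneous[OF assms(2), of w] that by (simp add: d_def brace_def homogeneous_def algebra_simps)
 have "brace (brace P ys) zs = (fst (brace (brace P ys) zs), d)"
  by (simp add: brace_def[of "brace P ys"] d_def)
 then have "k (brace (brace P ys) zs) = k (lsum (inserted on_ops snd snd ys zs) (\<lambda>b. fst (brace P b)), d)"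
  by (simp add: brace_brace[OF assms(2-4)] act_def)
 also have "... = lsum (inserted on_ops snd snd ys zs) (\<lambda>w. k (fst (brace P w), d))"
  by (rule V.linear_along_lsum_letter[OF t assms(5)])
   (use inserted_graded[OF graded_on_ops assms(3,4)] in_d in blast)
 also have "... = act_ops ys zs (\<lambda>w. k (brace P w))"
  unfolding act_def
  by (rule lsum_cong) (use inserted_graded[OF graded_on_ops assms(3,4)] in_d in fastforce)
 finally show ?thesis .
qed

lemma act_ops_compose:
 assumes t: "vector_space t" and "homVs xs" "homVs ys" "homVs es"
  and "word_multilinear t relV homV \<phi>"
 shows "act_ops ys es (\<lambda>w. act_ops xs w \<phi>) = act_ops xs ys (\<lambda>z. act_ops z es \<phi>)"
proof (rule act_compose[where K = "linear_along t relV", OF graded_on_ops graded_on_ops graded_on_ops assms(2-4)])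
 fix P y1 y2 y3 e1 e2 e3 k
 assume "P \<in> set xs" "ys = y1 @ y2 @ y3" "es = e1 @ e2 @ e3" "linear_along t relV k"
 with assms(2-4) show "lsum (on_ops P y2) (\<lambda>Q. lsum (on_ops Q e2) k) = act_ops y2 e2 (\<lambda>b. lsum (on_ops P b) k)"
  by (auto simp: list_all_iff intro!: brace_brace_letter[OF t])
qed (use assms(5) vector_space.linear_along_zero[OF t] vector_space.linear_along_plus[OF t]
   vector_space.linear_along_sg[OF t] in \<open>auto intro: word_multilinear_linear_along\<close>)

lemma brace_relation:
 assumes "homV P" "homVs l" "homVs r" "(z, a, z1, b, z2) \<in> relV"
 shows "(brace P (l @ z # r), a, brace P (l @ z1 # r), b, brace P (l @ z2 # r)) \<in> relV"
proof -
 have g: "homV z1" "homV z2" "snd z1 = snd z" "snd z2 = snd z"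
  using graded_relV assms(4) unfolding graded_relations_def by auto
 have "fst (brace P (l @ z # r)) = pscale sA a (fst (brace P (l @ z1 # r))) + pscale sA b (fst (brace P (l @ z2 # r)))"
 proof
  fix es
  have "extension sA es (\<lambda>ws. act_args (l @ z # r) ws (\<lambda>w. fst P (map fst w))) =
   extension sA es (\<lambda>ws. sA a (act_args (l @ z1 # r) ws (\<lambda>w. fst P (map fst w))) +
     sA b (act_args (l @ z2 # r) ws (\<lambda>w. fst P (map fst w))))"
   by (rule extension_cong)
    (rule word_multilinearD[OF act_args_multilinear_ops[OF vs_A _ End_word_multilinear[OF assms(1)]] assms(2-4)])
  then show "fst (brace P (l @ z # r)) es =
   (pscale sA a (fst (brace P (l @ z1 # r))) + pscale sA b (fst (brace P (l @ z2 # r)))) es"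
   by (simp add: brace_def pointwise extension_plus[OF vs_A] extension_scale[OF vs_A])
 qed
 moreover have "homV (brace P (l @ z1 # r))" "homV (brace P (l @ z2 # r))"
  using assms g by (auto intro!: brace_homogeneous)
 ultimately show ?thesis
  unfolding letter_relations_def homogeneous_def brace_def using g by auto
qed

lemma brace_relation_op:
 assumes "homVs ys" "(z, a, z1, b, z2) \<in> relV"
 shows "(brace z ys, a, brace z1 ys, b, brace z2 ys) \<in> relV"
proof -
 have g: "homV z1" "homV z2" "snd z1 = snd z" "snd z2 = snd z"
  using graded_relV assms(2) unfolding graded_relations_def by auto
 have z: "fst z = pscale sA a (fst z1) + pscale sA b (fst z2)"
  using assms(2) by (auto simp: letter_relations_def)
 have "act_args ys ws (\<lambda>w. fst z (map fst w)) =
   sA a (act_args ys ws (\<lambda>w. fst z1 (map fst w))) + sA b (act_args ys ws (\<lambda>w. fst z2 (map fst w)))" for ws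
  by (simp add: z pointwise act_plus act_additive[of "sA a"] act_additive[of "sA b"] scale_right_distrib)
 then have "fst (brace z ys) = pscale sA a (fst (brace z1 ys)) + pscale sA b (fst (brace z2 ys))"
  by (simp add: brace_def fun_eq_iff pointwise extension_plus[OF vs_A] extension_scale[OF vs_A])
 moreover have "homV (brace z1 ys)" "homV (brace z2 ys)"
  using assms g by (auto intro!: brace_homogeneous)
 ultimately show ?thesis
  unfolding letter_relations_def homogeneous_def brace_def using g by auto
qed

lemma on_ops_multilinear:
 assumes "homV P" "linear_along t relV k"
 shows "word_multilinear t relV homV (\<lambda>b. lsum (on_ops P b) k)"
 by (rule word_multilinearI) (simp add: linear_alongD[OF assms(2) brace_relation[OF assms(1)]])

lemma on_ops_linear:
 assumes "homVs b" "linear_along t relV k"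
 shows "linear_along t relV (\<lambda>P. lsum (on_ops P b) k)"
 by (rule linear_alongI) (simp add: linear_alongD[OF assms(2) brace_relation_op[OF assms(1)]])

lemma brace_value_eq:
 assumes "homAs es"
 shows "brace_value sA P (map fst Qs) (map snd Qs) (map fst es) (map snd es) =
  act_args Qs es (\<lambda>w. P (map fst w))"
proof -
 have "act_args Qs (seg es 0 (length es)) (\<lambda>w. P (map fst w)) =
  (\<Sum>ps\<in>placements 0 (length es) (length Qs).
   sg (\<Sum>k<length Qs. snd (Qs ! k) * (\<Sum>j\<in>{0..<fst (ps ! k)}. sdeg (es ! j)))
    (P (plug (map fst es) 0 (length es) (zip (map fst Qs) ps))))"
  by (rule act_args_placements) auto
 also have "... = brace_value sA P (map fst Qs) (map snd Qs) (map fst es) (map snd es)"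
  unfolding brace_value_def length_map
 proof (rule sum.cong[OF refl])
  fix ps assume ps: "ps \<in> placements 0 (length es) (length Qs)"
  have "even (snd (Qs ! k) * (\<Sum>j\<in>{0..<fst (ps ! k)}. sdeg (es ! j)) -
    map snd Qs ! k * (int (fst (ps ! k)) + (\<Sum>j<fst (ps ! k). map snd es ! j)))" if "k < length Qs" for k
  proof -
   have "fst (ps ! k) \<le> length es" using ps that by (fastforce simp: placements_def)
   then show ?thesis using that
    by (simp add: sdeg_def sum_subtractf atLeast0LessThan algebra_simps)
  qed
  then show "sg (\<Sum>k<length Qs. snd (Qs ! k) * (\<Sum>j\<in>{0..<fst (ps ! k)}. sdeg (es ! j)))
    (P (plug (map fst es) 0 (length es) (zip (map fst Qs) ps))) =
   sA (ksign (\<Sum>k<length Qs. map snd Qs ! k * (int (fst (ps ! k)) + (\<Sum>j<fst (ps ! k). map snd es ! j))))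
    (P (plug (map fst es) 0 (length es) (zip (map fst Qs) ps)))"
   by (simp only: scale_ksign) (rule sg_sum_cong, simp)
 qed
 finally show ?thesis by (simp add: seg_def map_nth)
qed

lemma gamma_homogeneous: "homV (\<gamma>, 1)"
 using gamma_degree by (simp add: homogeneous_def)

lemma gamma_brace_zero: "brace (\<gamma>, 1) [(\<gamma>, 1)] = (0, 2)"
proof -
 have "fst (brace (\<gamma>, 1) [(\<gamma>, 1)]) = 0"
 proof (rule multilin_eqI[OF _ multilin_zero])
  show "multilin sA sA (fst (brace (\<gamma>, 1) [(\<gamma>, 1)]))"
   unfolding brace_def fst_conv by (rule extension_multilin[OF vs_A])
 next
  fix es assume es: "homAs es"
  have "fst (brace (\<gamma>, 1) [(\<gamma>, 1)]) (map fst es) = brace_value sA \<gamma> [\<gamma>] [1] (map fst es) (map snd es)"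
   using brace_word[OF gamma_homogeneous _ es, of "[(\<gamma>, 1)]"] brace_value_eq[OF es, of \<gamma> "[(\<gamma>, 1)]"] gamma_homogeneous
   by simp
  then show "fst (brace (\<gamma>, 1) [(\<gamma>, 1)]) (map fst es) = 0 (map fst es)"
   using gamma_brace[OF hom_wordI[OF es]] by (simp add: pointwise)
 qed
 then show ?thesis by (simp add: brace_def)
qed

end

section \<open>Linear maps out of the bar space\<close>

context graded_vector_space
begin

text \<open>A linear projection of the ambient space onto the direct sum of the components.\<close>

definition proj :: "'v => 'v" where
 "proj x = extension scale [x] (\<lambda>ws. fst (hd ws))"

lemma proj_linear: "Vector_Spaces.linear scale scale proj"
proof -
 have "Vector_Spaces.linear scale scale (\<lambda>x. extension scale ([] @ x # []) (\<lambda>ws. fst (hd ws)))"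
  using extension_multilin[OF vector_space_axioms] unfolding multilin_def by blast
 then show ?thesis by (simp add: proj_def[abs_def] del: extension.simps)
qed

lemma proj_total: "x \<in> total scale G ==> proj x = x"
 using coef_total by (simp add: proj_def)

lemma proj_in_total: "proj x \<in> total scale G"
proof -
 have "scale (coef x b) b \<in> span (\<Union>i. G i)" if "b \<in> supp x" for b
  using that hbasis(2)[of b] by (intro span_scale span_base) (auto simp: supp_def)
 then show ?thesis unfolding proj_def total_def by (auto intro: span_sum)
qed

lemma multilin_extension_param:
 assumes t: "vector_space t" and s: "vector_space s" and H: "\<And>ws. multilin s t (H ws)"
 shows "multilin s t (\<lambda>es. extension t us (\<lambda>ws. H ws es))"
proof -
 interpret T: vector_space t by fact
 show ?thesis
  using H
 proof (induction us arbitrary: H)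
  case (Cons u us)
  have "multilin s t (\<lambda>es. extension t us (\<lambda>ws. H ((b, hdeg b) # ws) es))" for b
   by (rule Cons.IH) (rule Cons.prems)
  then show ?case
   unfolding multilin_def linear_iff_additive extension.simps
   by (simp add: T.scale_right_distrib sum.distrib T.scale_sum_right mult.commute)
 qed simp
qed

end

lemma pscale_apply: "pscale s c f x = s c (f x)"
 by (simp add: pscale_def)

lemma fscale_zero: "fscale c 0 = 0"
 by (simp add: fun_eq_iff pointwise)

context curved_Ainf_algebra
begin

abbreviation "W \<equiv> chain_gr sA A"
abbreviation "sE \<equiv> pscale sA"
abbreviation "E \<equiv> End_gr sA A"
abbreviation "chain es \<equiv> word sA (map fst es)"
abbreviation "opword ws \<equiv> word sE (map fst ws)"
abbreviation "barword us es vs \<equiv> barw sE fscale (map fst us) (chain es) (map fst vs)"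

lemma degree_chain: "sum_list (map snd es) - int (length es) = wdeg sdeg es"
 by (induction es) (auto simp: sdeg_def)

lemma chain_gr_eq:
 "W n = module.span fscale {chain es | es. es \<noteq> [] \<and> homAs es \<and> wdeg sdeg es + 1 = n}"
proof -
 have deg: "sum_list (map snd es) - (int (length (map fst es)) - 1) = wdeg sdeg es + 1" for es :: "('a \<times> int) list"
  using degree_chain[of es] by simp
 have "{word sA es | es \<delta>. es \<noteq> [] \<and> hom_word A es \<delta> \<and> sum_list \<delta> - (int (length es) - 1) = n} =
  {chain es | es. es \<noteq> [] \<and> homAs es \<and> wdeg sdeg es + 1 = n}" (is "?L = ?R")
 proof
  show "?L \<subseteq> ?R"
  proof clarify
   fix es \<delta> assume "es \<noteq> []" "hom_word A es \<delta>"
   then obtain ws where "homAs ws" "es = map fst ws" "\<delta> = map snd ws" "ws \<noteq> []" by (auto elim: hom_wordE)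
   then show "\<exists>ws. word sA es = chain ws \<and> ws \<noteq> [] \<and> homAs ws \<and>
     wdeg sdeg ws + 1 = sum_list \<delta> - (int (length es) - 1)"
    using deg[of ws] by metis
  qed
  show "?R \<subseteq> ?L"
  proof clarify
   fix ws assume "ws \<noteq> []" "homAs ws"
   then show "\<exists>es \<delta>. chain ws = word sA es \<and> es \<noteq> [] \<and> hom_word A es \<delta> \<and>
     sum_list \<delta> - (int (length es) - 1) = wdeg sdeg ws + 1"
    using deg[of ws] hom_wordI[of A ws] by (intro exI[of _ "map fst ws"] exI[of _ "map snd ws"]) simp
  qed
 qed
 then show ?thesis by (simp only: chain_gr_def)
qed

lemma chain_gr_induct [consumes 1, case_names zero add scale word]:
 assumes "x \<in> W n"
  and "P 0" "\<And>x y. [|x \<in> W n; y \<in> W n; P x; P y|] ==> P (x + y)"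
  and "\<And>c x. [|x \<in> W n; P x|] ==> P (fscale c x)"
  and "\<And>es. [|es \<noteq> []; homAs es; wdeg sdeg es + 1 = n|] ==> P (chain es)"
 shows "P x"
 by (rule span_induct_generators[where P = P, OF vector_space_fscale, of x
   "{chain es | es. es \<noteq> [] \<and> homAs es \<and> wdeg sdeg es + 1 = n}"])
  (use assms in \<open>auto simp: chain_gr_eq\<close>)

lemma chain_in_W: "es \<noteq> [] ==> homAs es ==> chain es \<in> W (wdeg sdeg es + 1)"
proof -
 interpret F: vector_space "fscale :: 'k => ('x => 'k) => 'x => 'k" by (rule vector_space_fscale)
 show "es \<noteq> [] ==> homAs es ==> ?thesis" unfolding chain_gr_eq by (rule F.span_base) blast
qed

lemma W_tensor_total: "x \<in> W n ==> x \<in> tensor_total sA A"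
proof -
 interpret F: vector_space "fscale :: 'k => (('a list => 'k) => 'k) => _" by (rule vector_space_fscale)
 show "x \<in> W n ==> ?thesis"
  by (induction rule: chain_gr_induct)
   (auto simp: tensor_total_eq intro: F.span_zero F.span_add F.span_scale F.span_base)
qed

lemma graded_vs_W: "graded_vector_space fscale W"
proof -
 interpret F: vector_space "fscale :: 'k => (('a list => 'k) => 'k) => _" by (rule vector_space_fscale)
 show ?thesis
 proof
  show "F.subspace (W i)" for i unfolding chain_gr_def by (rule F.subspace_span)
 next
  fix I :: "int set" and x i
  assume I: "finite I" "i \<in> I" and x: "\<And>i. i \<in> I ==> x i \<in> W i" and sum: "sum x I = 0"
  define p where "p = induced (\<lambda>es. if wdeg sdeg es + 1 = i then chain es else 0)"
  have ml: "multilinear_on_words (\<lambda>es. if wdeg sdeg es + 1 = i then chain es else 0)"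
  proof (rule word_multilinearI)
   fix l r z a z1 b z2 assume *: "homAs l" "homAs r" "(z, a, z1, b, z2) \<in> relA"
   then have "sdeg z1 = sdeg z" "sdeg z2 = sdeg z" using graded_relA unfolding graded_relations_def by auto
   then show "(if wdeg sdeg (l @ z # r) + 1 = i then chain (l @ z # r) else 0) =
    fscale a (if wdeg sdeg (l @ z1 # r) + 1 = i then chain (l @ z1 # r) else 0) +
    fscale b (if wdeg sdeg (l @ z2 # r) + 1 = i then chain (l @ z2 # r) else 0)"
    using word_multilinearD[OF word_multilinear_const_word *] by simp
  qed
  have px: "p y = (if j = i then y else 0)" if "y \<in> W j" for y j
   using that
   by (induction rule: chain_gr_induct) (auto simp: p_def induced_plus induced_scale induced_word[OF ml])
  have "p (sum x J) = (\<Sum>j\<in>J. p (x j))" for J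
   by (induction J rule: infinite_finite_induct) (auto simp: p_def induced_plus)
  from this[of I] have "0 = (\<Sum>j\<in>I. if j = i then x j else 0)"
   using px[OF x] sum by (simp add: p_def cong: sum.cong)
  then show "x i = 0" using I by simp
 qed
qed

sublocale W: graded_vector_space fscale W
 by (rule graded_vs_W)

lemma total_W_tensor_total:
 assumes "x \<in> total fscale W"
 shows "x \<in> tensor_total sA A"
proof -
 have "W.span (\<Union>i. W i) \<subseteq> tensor_total sA A"
  by (rule W.span_minimal) (auto simp: W_tensor_total, simp add: tensor_total_eq)
 then show ?thesis using assms unfolding total_def[of fscale W] by blast
qed

lemma W_total: "x \<in> W n ==> x \<in> total fscale W"
 unfolding total_def by (rule W.span_base) blast

lemma barw_w:
 "barw sE fscale us (x + y) vs = barw sE fscale us x vs + barw sE fscale us y vs"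
 "barw sE fscale us (fscale c x) vs = fscale c (barw sE fscale us x vs)"
 "barw sE fscale us 0 vs = 0"
proof -
 have *: "\<phi> us (x + y) vs = \<phi> us x vs + \<phi> us y vs" "\<phi> us (fscale c x) vs = c * \<phi> us x vs" "\<phi> us 0 vs = 0"
  if "bar_form sE fscale \<phi>" for \<phi> :: "_ => _ => _ => 'k" and us x y vs c
 proof -
  have l: "Vector_Spaces.linear fscale (*) (\<lambda>w. \<phi> us w vs)" using that by (simp add: bar_form_def)
  then show "\<phi> us (x + y) vs = \<phi> us x vs + \<phi> us y vs" "\<phi> us (fscale c x) vs = c * \<phi> us x vs"
   by (simp_all add: linear_iff_additive)
  have "\<phi> us (fscale 0 0) vs = 0 * \<phi> us 0 vs"
   using l unfolding linear_iff_additive by blast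
  then show "\<phi> us 0 vs = 0" by (simp add: fscale_zero)
 qed
 show "barw sE fscale us (x + y) vs = barw sE fscale us x vs + barw sE fscale us y vs"
  "barw sE fscale us (fscale c x) vs = fscale c (barw sE fscale us x vs)"
  "barw sE fscale us 0 vs = 0"
  by (auto simp: barw_def fun_eq_iff plus_fun_apply zero_fun_apply pscale_apply *)
qed

lemma bar_gr_eq:
 "bar_gr sE E fscale W n = module.span fscale {barword us es vs | us es vs. homVs us \<and> es \<noteq> [] \<and>
   homAs es \<and> homVs vs \<and> wdeg snd us + (wdeg sdeg es + 1) + wdeg snd vs = n}" (is "_ = module.span _ ?B")
proof -
 interpret F: vector_space "fscale :: 'k => ('x => 'k) => 'x => 'k" by (rule vector_space_fscale)
 have wd: "sum_list (map snd us) = wdeg snd us" for us :: "('a oper) list" by (simp add: wdeg_def)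
 show ?thesis
 proof
  show "bar_gr sE E fscale W n \<subseteq> F.span ?B"
   unfolding bar_gr_def
  proof (rule F.span_minimal[OF _ F.subspace_span], clarify)
   fix us ds w j vs fs
   assume us: "hom_word E us ds" and w: "w \<in> W j" and vs: "hom_word E vs fs" and n: "n = sum_list ds + j + sum_list fs"
   from us obtain us' where us': "homVs us'" "us = map fst us'" "ds = map snd us'" by (rule hom_wordE)
   from vs obtain vs' where vs': "homVs vs'" "vs = map fst vs'" "fs = map snd vs'" by (rule hom_wordE)
   from w have "barw sE fscale us w vs \<in> F.span {barword us es vs | us es vs. homVs us \<and> es \<noteq> [] \<and>
     homAs es \<and> homVs vs \<and> wdeg snd us + (wdeg sdeg es + 1) + wdeg snd vs = sum_list ds + j + sum_list (map snd vs')}"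
   proof (induction rule: chain_gr_induct)
    case (word es)
    then show ?case using us' vs' by (intro F.span_base) (auto simp: wd)
   qed (simp_all add: barw_w F.span_zero F.span_add F.span_scale)
   then show "barw sE fscale us w vs \<in> F.span {barword us es vs | us es vs. homVs us \<and> es \<noteq> [] \<and>
     homAs es \<and> homVs vs \<and> wdeg snd us + (wdeg sdeg es + 1) + wdeg snd vs = sum_list ds + j + sum_list fs}"
    using vs' by simp
  qed
  show "F.span ?B \<subseteq> bar_gr sE E fscale W n"
   unfolding bar_gr_def
  proof (rule F.span_mono, clarify)
   fix us es vs assume "homVs us" "homVs vs" "es \<noteq> []" "homAs es"
   then show "\<exists>us' ds w j vs' es'. barword us es vs = barw sE fscale us' w vs' \<and> hom_word E us' ds \<and> w \<in> W j \<and>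
     hom_word E vs' es' \<and> sum_list ds + j + sum_list es' = wdeg snd us + (wdeg sdeg es + 1) + wdeg snd vs"
    using chain_in_W[of es] hom_wordI[of E us] hom_wordI[of E vs] unfolding wd[symmetric] by blast
  qed
 qed
qed

lemma bar_gr_induct [consumes 1, case_names zero add scale word]:
 assumes "x \<in> bar_gr sE E fscale W n"
  and "P 0" "\<And>x y. [|x \<in> bar_gr sE E fscale W n; y \<in> bar_gr sE E fscale W n; P x; P y|] ==> P (x + y)"
  and "\<And>c x. [|x \<in> bar_gr sE E fscale W n; P x|] ==> P (fscale c x)"
  and "\<And>us es vs. [|homVs us; es \<noteq> []; homAs es; homVs vs;
   wdeg snd us + (wdeg sdeg es + 1) + wdeg snd vs = n|] ==> P (barword us es vs)"
 shows "P x"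
 by (rule span_induct_generators[where P = P, OF vector_space_fscale, of x
   "{barword us es vs | us es vs. homVs us \<and> es \<noteq> [] \<and>
   homAs es \<and> homVs vs \<and> wdeg snd us + (wdeg sdeg es + 1) + wdeg snd vs = n}"])
  (use assms in \<open>auto simp: bar_gr_eq\<close>)

abbreviation "BT \<equiv> bar_total sE E fscale W"
abbreviation "TT \<equiv> tensor_total sE E"

lemma bar_total_eq:
 "BT = module.span fscale {barword us es vs | us es vs. homVs us \<and> es \<noteq> [] \<and>
   homAs es \<and> homVs vs}"
 unfolding bar_gr_eq total_span_generators[OF vector_space_fscale]
 by (rule arg_cong[where f = "module.span fscale"]) blast

lemma bar_total_induct [consumes 1, case_names zero add scale word]:
 assumes "x \<in> BT"
  and "P 0" "\<And>x y. [|x \<in> BT; y \<in> BT; P x; P y|] ==> P (x + y)"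
  and "\<And>c x. [|x \<in> BT; P x|] ==> P (fscale c x)"
  and "\<And>us es vs. [|homVs us; es \<noteq> []; homAs es; homVs vs|] ==> P (barword us es vs)"
 shows "P x"
 by (rule span_induct_generators[where P = P, OF vector_space_fscale, of x
   "{barword us es vs | us es vs. homVs us \<and> es \<noteq> [] \<and> homAs es \<and> homVs vs}"])
  (use assms in \<open>auto simp: bar_total_eq\<close>)

lemma barword_in_gr:
 "[|homVs us; es \<noteq> []; homAs es; homVs vs|] ==>
  barword us es vs \<in> bar_gr sE E fscale W (wdeg snd us + (wdeg sdeg es + 1) + wdeg snd vs)"
proof -
 interpret F: vector_space "fscale :: 'k => ('x => 'k) => 'x => 'k" by (rule vector_space_fscale)
 show "[|homVs us; es \<noteq> []; homAs es; homVs vs|] ==> ?thesis"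
  unfolding bar_gr_eq by (rule F.span_base) blast
qed

lemma subspace_bar_gr: "module.subspace fscale (bar_gr sE E fscale W n)"
proof -
 interpret F: vector_space "fscale :: 'k => ('x => 'k) => 'x => 'k" by (rule vector_space_fscale)
 show ?thesis unfolding bar_gr_def by (rule F.subspace_span)
qed

lemma bar_gr_total: "x \<in> bar_gr sE E fscale W n ==> x \<in> BT"
proof -
 interpret F: vector_space "fscale :: 'k => ('x => 'k) => 'x => 'k" by (rule vector_space_fscale)
 show "x \<in> bar_gr sE E fscale W n ==> ?thesis" unfolding total_def by (rule F.span_base) blast
qed

definition multilinear_form ::
 "(('a oper) list => ('a \<times> int) list => ('a oper) list => 'y => 'k) => bool" where
 "multilinear_form F \<longleftrightarrow>
   (\<forall>es vs. homAs es \<and> es \<noteq> [] \<and> homVs vs \<longrightarrow> word_multilinear fscale relV homV (\<lambda>us. F us es vs)) \<and>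
   (\<forall>us vs. homVs us \<and> homVs vs \<longrightarrow> word_multilinear fscale relA homA (\<lambda>es. F us es vs)) \<and>
   (\<forall>us es. homVs us \<and> homAs es \<and> es \<noteq> [] \<longrightarrow> word_multilinear fscale relV homV (F us es))"

definition extension3 where
 "extension3 F us es vs = V.extension (*) us (\<lambda>us. extension (*) es (\<lambda>es. V.extension (*) vs (\<lambda>vs. F us es vs)))"

text \<open>The chain in the middle is a tensor itself: it is projected to the direct sum of the
  graded parts and then evaluated on the extension in the entries.\<close>

definition induced_bar ::
 "(('a oper) list => ('a \<times> int) list => ('a oper) list => 'y => 'k) =>
  ('a, 'k) chain_bar => 'y => 'k" where
 "induced_bar F z = (\<lambda>y. z (\<lambda>us w vs. (W.proj w) (\<lambda>es. extension3 (\<lambda>us es vs. F us es vs y) us es vs)))"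

lemma induced_bar_plus: "induced_bar F (z + z') = induced_bar F z + induced_bar F z'"
 by (simp add: induced_bar_def fun_eq_iff pointwise)

lemma induced_bar_zero [simp]: "induced_bar F 0 = 0"
 by (simp add: induced_bar_def fun_eq_iff pointwise)

lemma induced_bar_scale: "induced_bar F (fscale c z) = fscale c (induced_bar F z)"
 by (simp add: induced_bar_def fun_eq_iff pointwise)

lemma vs_k: "vector_space ((*) :: 'k => 'k => 'k)"
 by (rule vector_space_scalars)

lemma extension3_multilin:
 "multilin sE (*) (\<lambda>us. extension3 F us es vs)"
 "multilin sA (*) (\<lambda>es. extension3 F us es vs)"
 "multilin sE (*) (\<lambda>vs. extension3 F us es vs)"
 unfolding extension3_def
 by (intro V.extension_multilin V.multilin_extension_param extension_multilin multilin_extension_param vs_k vs_A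
   vector_space_pscale)+

lemma bar_form_extension3: "bar_form sE fscale (\<lambda>us w vs. (W.proj w) (\<lambda>es. extension3 F us es vs))"
proof -
 have p: "W.proj w \<in> tensor_total sA A" for w using W.proj_in_total total_W_tensor_total by blast
 note lin = tensor_total_linear(1)[OF p, of "\<lambda>es. extension3 F _ es _" "\<lambda>es. extension3 F _ es _" , OF extension3_multilin(2) extension3_multilin(2)]
  tensor_total_linear(2)[OF p, of "\<lambda>es. extension3 F _ es _", OF extension3_multilin(2)]
 have vsE: "vector_space sE" by (rule vector_space_pscale[OF vs_A])
 have "multilin sE (*) (\<lambda>us. (W.proj w) (\<lambda>es. extension3 F us es vs))" for w vs
  using extension3_multilin(1)[of F] lin unfolding multilin_def linear_iff_additive by (simp add: vsE vs_k)
 moreover have "multilin sE (*) (\<lambda>vs. (W.proj w) (\<lambda>es. extension3 F us es vs))" for w us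
  using extension3_multilin(3)[of F] lin unfolding multilin_def linear_iff_additive by (simp add: vsE vs_k)
 moreover have "Vector_Spaces.linear fscale (*) (\<lambda>w. (W.proj w) (\<lambda>es. extension3 F us es vs))" for us vs
  using W.proj_linear unfolding linear_iff_additive by (simp add: vector_space_fscale vs_k pointwise)
 ultimately show ?thesis unfolding bar_form_def by blast
qed

lemma induced_bar_word:
 assumes F: "multilinear_form F"
  and good: "homVs us" "es \<noteq> []" "homAs es" "homVs vs"
 shows "induced_bar F (barword us es vs) = F us es vs"
proof
 fix y
 let ?F = "\<lambda>us es vs. F us es vs y"
 have ml: "word_multilinear (*) relV homV (\<lambda>us. ?F us es vs)"
  "word_multilinear (*) relA homA (\<lambda>es. ?F us' es vs)"
  "word_multilinear (*) relV homV (?F us' es')" if "homVs us'" "homAs es'" "es' \<noteq> []" for us' es'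
  using F that good by (auto simp: multilinear_form_def intro!: V.multilinear_pointwise multilinear_pointwise)
 have "W.proj (chain es) = chain es"
  by (rule W.proj_total[OF W_total[OF chain_in_W[OF good(2,3)]]])
 then have "induced_bar F (barword us es vs) y = extension3 ?F (map fst us) (map fst es) (map fst vs)"
  using bar_form_extension3 extension3_multilin(2) by (simp add: induced_bar_def barw_def word_def)
 also have "... = V.extension (*) (map fst us) (\<lambda>us. ?F us es vs)"
  unfolding extension3_def
 proof (rule V.extension_cong)
  fix us' assume us': "homVs us'"
  have "word_multilinear (*) relA homA (\<lambda>es. V.extension (*) (map fst vs) (\<lambda>vs. ?F us' es vs))"
  proof (rule word_multilinearI)
   fix l r z a z1 b z2 assume *: "homAs l" "homAs r" "(z, a, z1, b, z2) \<in> relA"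
   then have g: "homA z" "homA z1" "homA z2" using graded_relA unfolding graded_relations_def by auto
   have "V.extension (*) (map fst vs) (\<lambda>vs. ?F us' (l @ x # r) vs) = ?F us' (l @ x # r) vs" if "homA x" for x
    by (rule V.extension_word[OF vs_k ml(3)[OF us'] good(4)]) (use * that in auto)
   then show "V.extension (*) (map fst vs) (\<lambda>vs. ?F us' (l @ z # r) vs) =
    a * V.extension (*) (map fst vs) (\<lambda>vs. ?F us' (l @ z1 # r) vs) + b * V.extension (*) (map fst vs) (\<lambda>vs. ?F us' (l @ z2 # r) vs)"
    using word_multilinearD[OF ml(2)[OF us' good(3,2)] *] g by simp
  qed
  from extension_word[OF vs_k this good(3)]
  show "extension (*) (map fst es) (\<lambda>es. V.extension (*) (map fst vs) (\<lambda>vs. ?F us' es vs)) = ?F us' es vs"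
   using V.extension_word[OF vs_k ml(3)[OF us' good(3,2)] good(4)] by simp
 qed
 also have "... = F us es vs y"
  by (rule V.extension_word[OF vs_k ml(1)[OF good(1,3,2)] good(1)])
 finally show "induced_bar F (barword us es vs) y = F us es vs y" .
qed

lemma linear_along_induced_bar:
 assumes z: "z \<in> BT" and F: "\<And>y a y1 b y2. (y, a, y1, b, y2) \<in> R ==> multilinear_form (\<lambda>us es vs. F us es vs y) \<and>
   multilinear_form (\<lambda>us es vs. F us es vs y1) \<and> multilinear_form (\<lambda>us es vs. F us es vs y2)"
  and lin: "\<And>us es vs. [|homVs us; es \<noteq> []; homAs es; homVs vs|] ==> linear_along fscale R (F us es vs)"
 shows "linear_along fscale R (\<lambda>y. induced_bar (\<lambda>us es vs. F us es vs y) z)"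
proof (rule linear_alongI)
 interpret F: vector_space "fscale :: 'k => ('y => 'k) => 'y => 'k" by (rule vector_space_fscale)
 fix y a y1 b y2 assume R: "(y, a, y1, b, y2) \<in> R"
 show "induced_bar (\<lambda>us es vs. F us es vs y) z =
  fscale a (induced_bar (\<lambda>us es vs. F us es vs y1) z) + fscale b (induced_bar (\<lambda>us es vs. F us es vs y2) z)"
  using z
 proof (induction rule: bar_total_induct)
  case (word us es vs)
  then show ?case using linear_alongD[OF lin R] F[OF R] by (simp add: induced_bar_word)
 qed (simp_all add: induced_bar_plus induced_bar_scale F.scale_right_distrib mult.commute add_ac)
qed

end

section \<open>Commutators with an element of degree one\<close>

lemma act_unit_right:
 assumes "\<And>c. c \<in> set xs ==> ev c [] = [(0, c)]"
 shows "act ev dp dc xs [] \<phi> = \<phi> xs"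
 using assms by (induction xs arbitrary: \<phi>) (auto simp: act_Cons)

lemma sg_Suc: "sg (n + 1) v = - sg n v" "sg (1 + n) v = - sg n v"
 by (simp_all add: sg_def)

lemma sg_diff: "sg n (v - w) = sg n v - sg n w"
 by (simp add: sg_def)

lemma act_diff: "act ev dp dc xs cs (\<lambda>w. f w - g w) = act ev dp dc xs cs f - act ev dp dc xs cs g"
 using act_plus[of ev dp dc xs cs "\<lambda>w. f w - g w" g] by simp

text \<open>The graded commutator with an odd element: \<open>g\<close> acts from the left, and from
  the right the word acts on the letter \<open>g\<close>, with the sign of moving \<open>g\<close>
  past the word.\<close>

definition commutator ::
 "('p, 'c) operation => ('p => int) => ('c, 'c) operation => ('c => int) => 'p => 'c =>
  'c list => ('c list => 'x::ab_group_add) => 'x" where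
 "commutator evL dp evR dc g g' cs \<phi> =
   act evL dp dc [g] cs \<phi> + sg (wdeg dc cs + 1) (act evR dc dc cs [g'] \<phi>)"

text \<open>A commutator with an odd primitive element is a coderivation: by
  \<open>act_split\<close> both multiplications split, and the terms in which \<open>g\<close> lands
  on the other side match.\<close>

lemma commutator_split:
 fixes \<psi> :: "'c list => 'c list => 'x::ab_group_add"
 assumes d: "dp g = 1" "dc g' = 1" and unit: "\<And>c. c \<in> set cs ==> evR c [] = [(0, c)]"
 shows "commutator evL dp evR dc g g' cs (\<lambda>w. spl w \<psi>) =
  spl cs (\<lambda>a b. commutator evL dp evR dc g g' a (\<lambda>w. \<psi> w b) +
   sg (wdeg dc a) (commutator evL dp evR dc g g' b (\<lambda>w. \<psi> a w)))"
proof -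
 let ?L = "act evL dp dc" and ?R = "act evR dc dc"
 have L: "?L [g] cs (\<lambda>w. spl w \<psi>) =
   spl cs (\<lambda>a b. ?L [g] a (\<lambda>w. \<psi> w b) + sg (wdeg dc a) (?L [g] b (\<lambda>w. \<psi> a w)))"
  unfolding act_split by (simp add: d spl_plus add.commute)
 have "?R cs [g'] (\<lambda>w. spl w \<psi>) =
   spl cs (\<lambda>a b. ?R b [g'] (\<lambda>w. \<psi> a w) + sg (wdeg dc b) (?R a [g'] (\<lambda>w. \<psi> w b)))"
  unfolding act_split
  by (rule spl_cong) (simp add: d unit act_unit_right)
 then have R: "sg (wdeg dc cs + 1) (?R cs [g'] (\<lambda>w. spl w \<psi>)) =
   spl cs (\<lambda>a b. sg (wdeg dc a + wdeg dc b + 1) (?R b [g'] (\<lambda>w. \<psi> a w) + sg (wdeg dc b) (?R a [g'] (\<lambda>w. \<psi> w b))))"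
  by (simp only: spl_sg[symmetric], intro spl_cong) simp
 have "sg (wdeg dc a + wdeg dc b + 1 + wdeg dc b) y = sg (wdeg dc a + 1) y" for a b and y :: 'x
  by (rule sg_eq) simp
 then show ?thesis
  unfolding commutator_def L R spl_plus[symmetric]
  by (intro spl_cong) (simp add: sg_add sg_sg add_ac)
qed

lemma commutator_derivation:
 fixes \<phi> :: "'c list => 'x::ab_group_add"
 assumes "\<And>h :: 'c list => 'x. act evL dp dc x cs (\<lambda>w. sg (wdeg dc w) (h w)) = sg (wdeg dp x + wdeg dc cs) (act evL dp dc x cs h)"
  and "act evL dp dc x cs (\<lambda>w. act evL dp dc [g] w \<phi>) = act evV dp dp [g] x (\<lambda>y. act evL dp dc y cs \<phi>)"
  and "act evL dp dc [g] cs (\<lambda>w. act evL dp dc x w \<phi>) = act evV dp dp x [g] (\<lambda>y. act evL dp dc y cs \<phi>)"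
  and "act evR dc dc cs [g'] (\<lambda>w. act evL dp dc x w \<phi>) = act evL dp dc x cs (\<lambda>w. act evR dc dc w [g'] \<phi>)"
 shows "act evL dp dc x cs (\<lambda>w. commutator evL dp evR dc g g' w \<phi>) =
  commutator evV dp evV dp g g x (\<lambda>y. act evL dp dc y cs \<phi>) +
  sg (wdeg dp x) (commutator evL dp evR dc g g' cs (\<lambda>w. act evL dp dc x w \<phi>))"
 unfolding commutator_def
 using assms
 by (simp add: act_diff sg_Suc sg_diff sg_sg sg_minus)

text \<open>The two squares vanish by assumption and the mixed terms cancel, since one of them
  passes an odd element once more than the other.\<close>

lemma commutator_square:
 fixes \<phi> :: "'c list => 'x::ab_group_add"
 assumes "\<And>h :: 'c list => 'x. act evL dp dc [g] cs (\<lambda>w. sg (wdeg dc w) (h w)) = sg (1 + wdeg dc cs) (act evL dp dc [g] cs h)"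
  and "\<And>h :: 'c list => 'x. act evR dc dc cs [g'] (\<lambda>w. sg (wdeg dc w) (h w)) = sg (1 + wdeg dc cs) (act evR dc dc cs [g'] h)"
  and "act evL dp dc [g] cs (\<lambda>w. act evL dp dc [g] w \<phi>) = 0"
  and "act evR dc dc cs [g'] (\<lambda>w. act evR dc dc w [g'] \<phi>) = 0"
  and "act evR dc dc cs [g'] (\<lambda>w. act evL dp dc [g] w \<phi>) = act evL dp dc [g] cs (\<lambda>w. act evR dc dc w [g'] \<phi>)"
 shows "commutator evL dp evR dc g g' cs (\<lambda>w. commutator evL dp evR dc g g' w \<phi>) = 0"
 unfolding commutator_def
 using assms
 by (simp add: act_diff sg_Suc sg_diff sg_minus)

lemma act_sg_degree:
 assumes "graded_operation gp dp gc dc ev" "list_all gp xs" "list_all gc cs"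
 shows "act ev dp dc xs cs (\<lambda>w. sg (wdeg dc w) (h w)) = sg (wdeg dp xs + wdeg dc cs) (act ev dp dc xs cs h)"
 unfolding act_sg[symmetric] by (rule act_cong[OF assms]) simp

section \<open>Tensors, deconcatenation and coactions on pure tensors\<close>

lemma spl_apply: "spl cs f y = spl cs (\<lambda>a b. f a b y)"
 by (simp add: spl_def lsum_apply)

lemma word_letter:
 "word s (us @ (x + y) # vs) = word s (us @ x # vs) + word s (us @ y # vs)"
 "word s (us @ s c x # vs) = fscale c (word s (us @ x # vs))"
 unfolding word_def fun_eq_iff multilin_def linear_iff_additive by (auto simp: pointwise)

lemma bilin_linear:
 assumes "bilin fscale fscale (*) vb"
 shows "vb (x + x') y = vb x y + vb x' y" "vb (fscale c x) y = c * vb x y"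
  "vb x (y + y') = vb x y + vb x y'" "vb x (fscale c y) = c * vb x y"
 using assms unfolding bilin_def linear_iff_additive by auto

lemma tens_plus:
 "(x + x') \<otimes>\<^sub>f y = x \<otimes>\<^sub>f y + x' \<otimes>\<^sub>f y" "x \<otimes>\<^sub>f (y + y') = x \<otimes>\<^sub>f y + x \<otimes>\<^sub>f y'"
 by (auto simp: tens_def fun_eq_iff plus_fun_apply zero_fun_apply bilin_linear)

lemma tens_zero [simp]: "0 \<otimes>\<^sub>f y = 0" "x \<otimes>\<^sub>f 0 = 0"
 using tens_plus(1)[of 0 0 y] tens_plus(2)[of x 0 0] by auto

lemma tens_minus: "(x - x') \<otimes>\<^sub>f y = x \<otimes>\<^sub>f y - x' \<otimes>\<^sub>f y" "x \<otimes>\<^sub>f (y - y') = x \<otimes>\<^sub>f y - x \<otimes>\<^sub>f y'"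
proof -
 show "(x - x') \<otimes>\<^sub>f y = x \<otimes>\<^sub>f y - x' \<otimes>\<^sub>f y" using tens_plus(1)[of "x - x'" x' y] by simp
 show "x \<otimes>\<^sub>f (y - y') = x \<otimes>\<^sub>f y - x \<otimes>\<^sub>f y'" using tens_plus(2)[of x "y - y'" y'] by simp
qed

lemma tens_sg: "sg n x \<otimes>\<^sub>f y = sg n (x \<otimes>\<^sub>f y)" "x \<otimes>\<^sub>f sg n y = sg n (x \<otimes>\<^sub>f y)"
 using tens_minus(1)[of 0 x y] tens_minus(2)[of x 0 y] by (auto simp: sg_def)

lemma act_tens:
 "act ev dp dc xs cs (\<lambda>w. act ev' dp' dc' ys ds (\<lambda>v. \<phi> w \<otimes>\<^sub>f \<psi> v)) =
  act ev dp dc xs cs \<phi> \<otimes>\<^sub>f act ev' dp' dc' ys ds \<psi>"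
 by (simp add: act_additive[of "\<lambda>y. _ \<otimes>\<^sub>f y", OF tens_plus(2), symmetric]
   act_additive[of "\<lambda>x. x \<otimes>\<^sub>f _", OF tens_plus(1), symmetric])

lemma commutator_tens:
 "commutator evL dp evR dc g g' cs (\<lambda>w. \<phi> w \<otimes>\<^sub>f y) = commutator evL dp evR dc g g' cs \<phi> \<otimes>\<^sub>f y"
 "commutator evL dp evR dc g g' cs (\<lambda>w. x \<otimes>\<^sub>f \<psi> w) = x \<otimes>\<^sub>f commutator evL dp evR dc g g' cs \<psi>"
 unfolding commutator_def
 by (simp_all add: tens_plus tens_sg act_additive[of "\<lambda>y. _ \<otimes>\<^sub>f y", OF tens_plus(2), symmetric]
   act_additive[of "\<lambda>x. x \<otimes>\<^sub>f _", OF tens_plus(1), symmetric])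

lemma commutator_additive:
 assumes "\<And>x y. h (x + y) = h x + h y"
 shows "h (commutator evL dp evR dc g g' cs \<phi>) =
  commutator evL dp evR dc g g' cs (\<lambda>w. h (\<phi> w :: 'x::ab_group_add) :: 'y::ab_group_add)"
proof -
 have "h 0 = 0" using assms[of 0 0] by simp
 then have m: "h (- x) = - h x" for x using assms[of x "- x"] by (simp add: eq_neg_iff_add_eq_0 add.commute)
 show ?thesis
  unfolding commutator_def
  by (simp add: assms m sg_def act_additive[of h, OF assms])
qed

lemma deconc_plus: "deconc s (x + y) = deconc s x + deconc s y"
 by (auto simp: deconc_def fun_eq_iff pointwise)

lemma lcoact_plus: "lcoact s t (x + y) = lcoact s t x + lcoact s t y"
 by (auto simp: lcoact_def fun_eq_iff pointwise)

lemma rcoact_plus: "rcoact s t (x + y) = rcoact s t x + rcoact s t y"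
 by (auto simp: rcoact_def fun_eq_iff pointwise)

lemma multilin_spl:
 fixes s :: "'k::field => 'v::ab_group_add => 'v" and f :: "'v list => 'v list => 'k"
 assumes "vector_space s" "\<And>b. multilin s (*) (\<lambda>a. f a b)" "\<And>a. multilin s (*) (f a)"
 shows "multilin s (*) (\<lambda>vs. spl vs f)"
 using assms unfolding multilin_def linear_iff_additive
 by (simp add: vector_space_scalars spl_append_Cons spl_plus distrib_left spl_additive[of "(*) _", OF distrib_left])

lemma multilin_linear_word:
 assumes "vector_space s" "\<And>x y. h (x + y) = h x + h y" "\<And>c x. h (fscale c x) = c * h x"
 shows "multilin s (*) (\<lambda>vs. h (word s vs))"
 using assms unfolding multilin_def linear_iff_additive by (simp add: word_letter vector_space_scalars)

lemma deconc_word: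
 assumes "vector_space s"
 shows "deconc s (word s vs) = spl vs (\<lambda>a b. word s a \<otimes>\<^sub>f word s b)"
proof
 fix vb :: "_ => _ => 'a"
 show "deconc s (word s vs) vb = spl vs (\<lambda>a b. word s a \<otimes>\<^sub>f word s b) vb"
 proof (cases "bilin fscale fscale (*) vb")
  case True
  have "multilin s (*) (\<lambda>vs. spl vs (\<lambda>a b. vb (word s a) (word s b)))"
   by (intro multilin_spl[OF assms] multilin_linear_word[OF assms]) (simp_all add: bilin_linear[OF True])
  moreover have "spl vs (\<lambda>a b. word s a \<otimes>\<^sub>f word s b) vb = spl vs (\<lambda>a b. vb (word s a) (word s b))"
   using True by (simp add: spl_apply tens_def)
  ultimately show ?thesis
   using True by (simp add: deconc_def word_def[of s vs] spl_atMost)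
 qed (simp add: deconc_def spl_apply tens_def)
qed

lemma barw_apply: "bar_form sV sW \<phi> ==> barw sV sW us w vs \<phi> = \<phi> us w vs"
 by (simp add: barw_def)

lemma bar_form_barw:
 fixes sV :: "'k::field => 'v::ab_group_add => 'v"
 assumes "vector_space sV" "vector_space sW"
  and h: "\<And>x y. h (x + y) = h x + h y" "\<And>c x. h (fscale c x) = c * h x"
 shows "bar_form sV sW (\<lambda>us w vs. h (barw sV sW us w vs))"
proof -
 have lin: "barw sV sW (us @ (x + y) # us') w vs = barw sV sW (us @ x # us') w vs + barw sV sW (us @ y # us') w vs"
  "barw sV sW (us @ sV c x # us') w vs = fscale c (barw sV sW (us @ x # us') w vs)"
  "barw sV sW us w (vs @ (x + y) # vs') = barw sV sW us w (vs @ x # vs') + barw sV sW us w (vs @ y # vs')"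
  "barw sV sW us w (vs @ sV c x # vs') = fscale c (barw sV sW us w (vs @ x # vs'))"
  "barw sV sW us (w + w') vs = barw sV sW us w vs + barw sV sW us w' vs"
  "barw sV sW us (sW c w) vs = fscale c (barw sV sW us w vs)" for us us' vs vs' x y w w' c
  unfolding barw_def fun_eq_iff bar_form_def multilin_def linear_iff_additive
  by (auto simp: plus_fun_apply pscale_apply)
 show ?thesis
  unfolding bar_form_def multilin_def linear_iff_additive by (simp add: lin h assms vector_space_scalars)
qed

lemma lcoact_barw:
 fixes sV :: "'k::field => 'v::ab_group_add => 'v"
 assumes "vector_space sV" "vector_space sW"
 shows "lcoact sV sW (barw sV sW us w vs) = spl us (\<lambda>a b. word sV a \<otimes>\<^sub>f barw sV sW b w vs)"
proof
 fix vb :: "_ => _ => 'k"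
 show "lcoact sV sW (barw sV sW us w vs) vb = spl us (\<lambda>a b. word sV a \<otimes>\<^sub>f barw sV sW b w vs) vb"
 proof (cases "bilin fscale fscale (*) vb")
  case True
  have b: "bar_form sV sW (\<lambda>us w vs. vb x (barw sV sW us w vs))" for x
   by (rule bar_form_barw[OF assms]) (simp_all add: bilin_linear[OF True])
  have "multilin sV (*) (\<lambda>us. spl us (\<lambda>a b. vb (word sV a) (barw sV sW b w vs)))" for w vs
   using b unfolding bar_form_def
   by (intro multilin_spl[OF assms(1)] multilin_linear_word[OF assms(1)]) (simp_all add: bilin_linear[OF True])
  moreover have "multilin sV (*) (\<lambda>vs. spl us (\<lambda>a b. vb (word sV a) (barw sV sW b w vs)))" for us w
   using b assms(1) unfolding bar_form_def multilin_def linear_iff_additive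
   by (simp add: spl_plus spl_additive[of "(*) _", OF distrib_left])
  moreover have "Vector_Spaces.linear sW (*) (\<lambda>w. spl us (\<lambda>a b. vb (word sV a) (barw sV sW b w vs)))" for us vs
   using b assms(2) unfolding bar_form_def multilin_def linear_iff_additive
   by (simp add: spl_plus spl_additive[of "(*) _", OF distrib_left])
  ultimately have "bar_form sV sW (\<lambda>us w vs. spl us (\<lambda>a b. vb (word sV a) (barw sV sW b w vs)))"
   unfolding bar_form_def by blast
  moreover have "spl us (\<lambda>a b. word sV a \<otimes>\<^sub>f barw sV sW b w vs) vb = spl us (\<lambda>a b. vb (word sV a) (barw sV sW b w vs))"
   using True by (simp add: spl_apply tens_def)
  ultimately show ?thesis
   using True by (simp add: lcoact_def barw_apply spl_atMost)
 qed (simp add: lcoact_def spl_apply tens_def)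
qed

lemma rcoact_barw:
 fixes sV :: "'k::field => 'v::ab_group_add => 'v"
 assumes "vector_space sV" "vector_space sW"
 shows "rcoact sV sW (barw sV sW us w vs) = spl vs (\<lambda>a b. barw sV sW us w a \<otimes>\<^sub>f word sV b)"
proof
 fix vb :: "_ => _ => 'k"
 show "rcoact sV sW (barw sV sW us w vs) vb = spl vs (\<lambda>a b. barw sV sW us w a \<otimes>\<^sub>f word sV b) vb"
 proof (cases "bilin fscale fscale (*) vb")
  case True
  have b: "bar_form sV sW (\<lambda>us w vs. vb (barw sV sW us w vs) x)" for x
   by (rule bar_form_barw[OF assms]) (simp_all add: bilin_linear[OF True])
  have "multilin sV (*) (\<lambda>vs. spl vs (\<lambda>a b. vb (barw sV sW us w a) (word sV b)))" for us w
   using b unfolding bar_form_def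
   by (intro multilin_spl[OF assms(1)] multilin_linear_word[OF assms(1)]) (simp_all add: bilin_linear[OF True])
  moreover have "multilin sV (*) (\<lambda>us. spl vs (\<lambda>a b. vb (barw sV sW us w a) (word sV b)))" for vs w
   using b assms(1) unfolding bar_form_def multilin_def linear_iff_additive
   by (simp add: spl_plus spl_additive[of "(*) _", OF distrib_left])
  moreover have "Vector_Spaces.linear sW (*) (\<lambda>w. spl vs (\<lambda>a b. vb (barw sV sW us w a) (word sV b)))" for us vs
   using b assms(2) unfolding bar_form_def multilin_def linear_iff_additive
   by (simp add: spl_plus spl_additive[of "(*) _", OF distrib_left])
  ultimately have "bar_form sV sW (\<lambda>us w vs. spl vs (\<lambda>a b. vb (barw sV sW us w a) (word sV b)))"
   unfolding bar_form_def by blast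
  moreover have "spl vs (\<lambda>a b. barw sV sW us w a \<otimes>\<^sub>f word sV b) vb = spl vs (\<lambda>a b. vb (barw sV sW us w a) (word sV b))"
   using True by (simp add: spl_apply tens_def)
  ultimately show ?thesis
   using True by (simp add: rcoact_def barw_apply spl_atMost)
 qed (simp add: rcoact_def spl_apply tens_def)
qed

lemma act_mem:
 assumes "module.subspace t S" "vector_space t" "graded_operation gp dp gc dc ev" "list_all gp xs" "list_all gc cs"
  and "\<And>w. list_all gc w ==> wdeg dc w = wdeg dp xs + wdeg dc cs ==> \<phi> w \<in> S"
 shows "act ev dp dc xs cs \<phi> \<in> S"
proof -
 interpret T: vector_space t by fact
 have "lsum L f \<in> S" if "\<And>n w. (n, w) \<in> set L ==> f w \<in> S" for L :: "(int \<times> 'd list) list" and f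
  using that
 proof (induction L)
  case (Cons p L)
  obtain n w where p: "p = (n, w)" by (cases p)
  have "f w \<in> S" "lsum L f \<in> S" using Cons p by auto
  then show ?case using assms(1) by (simp add: p sg_def T.subspace_add T.subspace_neg T.subspace_diff)
 qed (use assms(1) T.subspace_0 in simp)
 then show ?thesis
  unfolding act_def using inserted_graded[OF assms(3-5)] assms(6) by blast
qed

lemma commutator_cong:
 assumes "graded_operation gp dp gc dc evL" "graded_operation gc dc gc dc evR"
  and "gp g" "dp g = 1" "gc g'" "dc g' = 1" "list_all gc cs"
  and "\<And>w. list_all gc w ==> wdeg dc w = wdeg dc cs + 1 ==> \<phi> w = \<phi>' w"
 shows "commutator evL dp evR dc g g' cs \<phi> = commutator evL dp evR dc g g' cs \<phi>'"
proof -
 have "act evL dp dc [g] cs \<phi> = act evL dp dc [g] cs \<phi>'"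
  by (rule act_cong[OF assms(1)]) (use assms in auto)
 moreover have "act evR dc dc cs [g'] \<phi> = act evR dc dc cs [g'] \<phi>'"
  by (rule act_cong[OF assms(2)]) (use assms in auto)
 ultimately show ?thesis by (simp add: commutator_def)
qed

lemma commutator_mem:
 assumes "module.subspace t S" "vector_space t" "graded_operation gp dp gc dc evL" "graded_operation gc dc gc dc evR"
  and "gp g" "dp g = 1" "gc g'" "dc g' = 1" "list_all gc cs"
  and "\<And>w. list_all gc w ==> wdeg dc w = wdeg dc cs + 1 ==> \<phi> w \<in> S"
 shows "commutator evL dp evR dc g g' cs \<phi> \<in> S"
proof -
 interpret T: vector_space t by fact
 have "act evL dp dc [g] cs \<phi> \<in> S"
  by (rule act_mem[OF assms(1,2,3)]) (use assms in auto)
 moreover have "act evR dc dc cs [g'] \<phi> \<in> S"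
  by (rule act_mem[OF assms(1,2,4)]) (use assms in auto)
 ultimately show ?thesis
  using assms(1) by (simp add: commutator_def sg_def T.subspace_add T.subspace_neg T.subspace_diff)
qed

lemma word_multilinear_zero_letter:
 assumes "vector_space t" "word_multilinear t R g \<phi>" "list_all g l" "list_all g r" "(z, 0, z, 0, z) \<in> R"
 shows "\<phi> (l @ z # r) = 0"
proof -
 interpret T: vector_space t by fact
 show ?thesis using word_multilinearD[OF assms(2-5)] by simp
qed

lemma fscale_plus: "fscale c (x + y) = fscale c x + fscale c y"
 by (simp add: fun_eq_iff pointwise algebra_simps)

lemma fscale_commute: "fscale c (fscale d x) = fscale d (fscale c x)"
 by (simp add: fun_eq_iff pointwise)

lemma sg_fscale: "sg n (fscale c x) = fscale c (sg n x)"
 by (simp add: sg_def fun_eq_iff pointwise)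

lemma fscale_minus: "fscale c (x - y) = fscale c x - fscale c y"
 by (simp add: fun_eq_iff pointwise algebra_simps)

lemma fscale_ksign: "fscale (ksign n) x = sg n x"
 by (simp add: fun_eq_iff pointwise ksign_def sg_def)

section \<open>The twisted \<open>B\<^sub>\<infinity>\<close>-algebra of multilinear endomorphisms\<close>

context curved_Ainf_algebra
begin

abbreviation "g \<equiv> (\<gamma>, 1 :: int)"
abbreviation "commutator_ops \<equiv> commutator on_ops snd on_ops snd g g"

lemma vs_f: "vector_space (fscale :: 'k => ('x => 'k) => 'x => 'k)"
 by (rule vector_space_fscale)

lemma g_good: "homV g" "snd g = 1"
 by (simp_all add: gamma_homogeneous)

lemma opword_multilinear: "word_multilinear fscale relV homV (\<lambda>w. opword w)"
 by (rule V.word_multilinear_const_word)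

lemma act_ops_multilinear:
 assumes "vector_space t" "homVs ys" "word_multilinear t relV homV \<phi>"
 shows "word_multilinear t relV homV (\<lambda>es. act_ops ys es \<phi>)"
 by (rule vector_space.word_multilinear_act[OF assms(1) graded_on_ops graded_relV on_ops_multilinear assms(3,2)])

lemma act_ops_multilinear_ops:
 assumes "vector_space t" "homVs es" "word_multilinear t relV homV \<phi>"
 shows "word_multilinear t relV homV (\<lambda>ys. act_ops ys es \<phi>)"
 by (rule vector_space.word_multilinear_act_operations[OF assms(1) graded_on_ops graded_relV on_ops_linear assms(3,2)])

lemma commutator_ops_multilinear:
 assumes "vector_space t" "word_multilinear t relV homV \<phi>"
 shows "word_multilinear t relV homV (\<lambda>cs. commutator_ops cs \<phi>)"
 unfolding commutator_def
 by (intro vector_space.word_multilinear_plus[OF assms(1)] act_ops_multilinear act_ops_multilinear_ops assms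
   vector_space.word_multilinear_sg[OF assms(1) _ graded_relV, where h = "\<lambda>n. n + 1"])
  (simp_all add: g_good)

text \<open>The two insertions of \<open>\<gamma>\<close> next to \<open>\<gamma>\<close> cancel
  because \<open>\<gamma>\<close> is odd, and the remaining term is \<open>\<gamma>{\<gamma>} =
  0\<close>.\<close>

lemma act_ops_gamma_gamma:
 assumes "vector_space t" "word_multilinear t relV homV \<phi>"
 shows "act_ops [g] [g] \<phi> = 0"
proof -
 have "\<phi> [(0, 2)] = 0"
  using word_multilinear_zero_letter[OF assms, of "[]" "[]" "(0, 2)"] V.subspace_0[OF V.subspace_component, of 2]
  by (auto simp: letter_relations_def)
 moreover have "act_ops [g] [g] \<phi> = \<phi> [g, g] + (\<phi> [(0, 2)] + sg 1 (\<phi> [g, g]))"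
  by (simp add: act_Cons gamma_brace_zero brace_Nil[OF g_good(1)] add_ac)
 ultimately show ?thesis by (simp add: sg_def)
qed

definition brace_product where
 "brace_product x y = V.induced (\<lambda>xs. V.induced (\<lambda>ys. act_ops xs ys (\<lambda>w. opword w)) y) x"

definition twisted_d where
 "twisted_d = V.induced (\<lambda>xs. commutator_ops xs (\<lambda>w. opword w))"

lemma tensor_gr_closed:
 fixes s :: "'f::field => 'v::ab_group_add => 'v"
 shows "0 \<in> tensor_gr s G n" "x \<in> tensor_gr s G n ==> y \<in> tensor_gr s G n ==> x + y \<in> tensor_gr s G n"
  "x \<in> tensor_gr s G n ==> fscale c x \<in> tensor_gr s G n"
proof -
 have m: "module (fscale :: 'f => ('x => 'f) => 'x => 'f)" using vector_space_fscale by (simp add: module_iff_vector_space)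
 show "0 \<in> tensor_gr s G n" "x \<in> tensor_gr s G n ==> y \<in> tensor_gr s G n ==> x + y \<in> tensor_gr s G n"
  "x \<in> tensor_gr s G n ==> fscale c x \<in> tensor_gr s G n"
  unfolding tensor_gr_eq by (simp_all add: module.span_zero[OF m] module.span_add[OF m] module.span_scale[OF m])
qed

lemma TT_closed:
 "0 \<in> TT" "x \<in> TT ==> y \<in> TT ==> x + y \<in> TT" "x \<in> TT ==> fscale c x \<in> TT"
 and subspace_TT: "module.subspace fscale TT"
proof -
 have m: "module (fscale :: 'k => ('x => 'k) => 'x => 'k)" using vector_space_fscale by (simp add: module_iff_vector_space)
 show "0 \<in> TT" "x \<in> TT ==> y \<in> TT ==> x + y \<in> TT" "x \<in> TT ==> fscale c x \<in> TT"
  unfolding tensor_total_eq by (simp_all add: module.span_zero[OF m] module.span_add[OF m] module.span_scale[OF m])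
 show "module.subspace fscale TT" unfolding tensor_total_eq by (rule module.subspace_span[OF m])
qed

lemma brace_product_op:
 assumes "homVs xs" "y \<in> TT"
 shows "brace_product (opword xs) y = V.induced (\<lambda>ys. act_ops xs ys (\<lambda>w. opword w)) y"
 unfolding brace_product_def
proof (rule V.induced_word[OF _ assms(1)])
 show "V.multilinear_on_words (\<lambda>xs. V.induced (\<lambda>ys. act_ops xs ys (\<lambda>w. opword w)) y)"
  unfolding word_multilinear_def
 proof (intro allI impI, elim conjE)
  fix l r assume lr: "homVs l" "homVs r"
  show "linear_along fscale relV (\<lambda>z. V.induced (\<lambda>ys. act_ops (l @ z # r) ys (\<lambda>w. opword w)) y)"
  proof (rule V.linear_along_induced[OF assms(2)])
   fix z a z1 b z2 assume "(z, a, z1, b, z2) \<in> relV"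
   then have "homV z" "homV z1" "homV z2" using graded_relV unfolding graded_relations_def by auto
   then show "V.multilinear_on_words (\<lambda>ys. act_ops (l @ z # r) ys (\<lambda>w. opword w)) \<and>
    V.multilinear_on_words (\<lambda>ys. act_ops (l @ z1 # r) ys (\<lambda>w. opword w)) \<and>
    V.multilinear_on_words (\<lambda>ys. act_ops (l @ z2 # r) ys (\<lambda>w. opword w))"
    using lr by (auto intro!: act_ops_multilinear vs_f opword_multilinear)
  next
   fix ws assume "homVs ws"
   then show "linear_along fscale relV (\<lambda>z. act_ops (l @ z # r) ws (\<lambda>w. opword w))"
    by (rule word_multilinear_linear_along[OF act_ops_multilinear_ops[OF vs_f _ opword_multilinear] lr])
  qed
 qed
qed

lemma opword_total: "homVs xs ==> opword xs \<in> TT"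
 using word_in_tensor_gr tensor_gr_total by blast

lemma brace_product_words:
 "homVs xs ==> homVs ys ==> brace_product (opword xs) (opword ys) = act_ops xs ys (\<lambda>w. opword w)"
 by (simp add: brace_product_op opword_total V.induced_word act_ops_multilinear[OF vs_f _ opword_multilinear])

lemma brace_product_left:
 "brace_product (x + x') y = brace_product x y + brace_product x' y"
 "brace_product (fscale c x) y = fscale c (brace_product x y)"
 "brace_product 0 y = 0"
 by (simp_all add: brace_product_def V.induced_plus V.induced_scale)

lemma brace_product_right:
 assumes "x \<in> TT"
 shows "y \<in> TT ==> y' \<in> TT ==> brace_product x (y + y') = brace_product x y + brace_product x y'"
  and "y \<in> TT ==> brace_product x (fscale c y) = fscale c (brace_product x y)"
  and "brace_product x 0 = 0"
proof -
 note TT = TT_closed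
 show "y \<in> TT ==> y' \<in> TT ==> brace_product x (y + y') = brace_product x y + brace_product x y'"
  using assms
  by (induction rule: tensor_total_induct)
   (simp_all add: brace_product_left brace_product_op TT V.induced_plus fscale_plus add_ac fscale_zero)
 show "y \<in> TT ==> brace_product x (fscale c y) = fscale c (brace_product x y)"
  using assms
  by (induction rule: tensor_total_induct)
   (simp_all add: brace_product_left brace_product_op TT V.induced_scale fscale_plus fscale_commute[of c] fscale_zero)
 show "brace_product x 0 = 0"
  using assms
  by (induction rule: tensor_total_induct)
   (simp_all add: brace_product_left brace_product_op TT fscale_zero)
qed

lemma act_ops_in_gr:
 assumes "homVs xs" "homVs ys"
 shows "act_ops xs ys (\<lambda>w. opword w) \<in> tensor_gr sE E (wdeg snd xs + wdeg snd ys)"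
 by (rule act_mem[OF subspace_tensor_gr vs_f graded_on_ops assms])
  (metis wdeg_def word_in_tensor_gr)

lemma brace_product_gr:
 assumes "x \<in> tensor_gr sE E i" "y \<in> tensor_gr sE E j"
 shows "brace_product x y \<in> tensor_gr sE E (i + j)"
 using assms(1)
proof (induction rule: tensor_gr_induct)
 case (word ws)
 then show ?case
  unfolding brace_product_op[OF word(1) tensor_gr_total[OF assms(2)]]
  using act_ops_in_gr[OF word(1)]
  by (intro V.induced_mem_gr[OF subspace_tensor_gr _ assms(2)] act_ops_multilinear vs_f opword_multilinear)
   (auto simp: wdeg_def)
qed (simp_all add: brace_product_left tensor_gr_closed)

lemma brace_product_closed:
 assumes "x \<in> TT" "y \<in> TT"
 shows "brace_product x y \<in> TT"
 using assms(1)
proof (induction rule: tensor_total_induct)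
 case (word ws)
 then show ?case
  unfolding brace_product_op[OF word assms(2)]
  using act_ops_in_gr[OF word] tensor_gr_total
  by (intro V.induced_mem[OF subspace_TT _ assms(2)] act_ops_multilinear vs_f opword_multilinear) blast+
qed (simp_all add: brace_product_left TT_closed)

lemma brace_product_act_left:
 assumes "homVs xs" "homVs ys" "homVs zs"
 shows "brace_product (act_ops xs ys (\<lambda>w. opword w)) (opword zs) = act_ops xs ys (\<lambda>w. act_ops w zs (\<lambda>w. opword w))"
proof -
 have "brace_product (act_ops xs ys (\<lambda>w. opword w)) (opword zs) = act_ops xs ys (\<lambda>w. brace_product (opword w) (opword zs))"
  by (rule act_additive[where h = "\<lambda>x. brace_product x (opword zs)"]) (rule brace_product_left)
 also have "... = act_ops xs ys (\<lambda>w. act_ops w zs (\<lambda>w. opword w))"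
  by (rule act_cong[OF graded_on_ops assms(1,2)]) (simp add: brace_product_words assms)
 finally show ?thesis .
qed

lemma brace_product_act_right:
 assumes "homVs xs" "homVs ys" "homVs zs"
 shows "brace_product (opword xs) (act_ops ys zs (\<lambda>w. opword w)) = act_ops ys zs (\<lambda>w. act_ops xs w (\<lambda>w. opword w))"
proof -
 have "brace_product (opword xs) (act_ops ys zs (\<lambda>w. opword w)) =
   V.induced (\<lambda>ys. act_ops xs ys (\<lambda>w. opword w)) (act_ops ys zs (\<lambda>w. opword w))"
  using brace_product_op[OF assms(1) tensor_gr_total[OF act_ops_in_gr[OF assms(2,3)]]] .
 also have "... = act_ops ys zs (\<lambda>w. V.induced (\<lambda>ys. act_ops xs ys (\<lambda>w. opword w)) (opword w))"
  by (rule act_additive[where h = "V.induced (\<lambda>ys. act_ops xs ys (\<lambda>w. opword w))"]) (rule V.induced_plus)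
 also have "... = act_ops ys zs (\<lambda>w. act_ops xs w (\<lambda>w. opword w))"
  by (rule act_cong[OF graded_on_ops assms(2,3)])
   (simp add: V.induced_word act_ops_multilinear[OF vs_f assms(1) opword_multilinear])
 finally show ?thesis .
qed

lemma brace_product_assoc:
 assumes "x \<in> TT" "y \<in> TT" "z \<in> TT"
 shows "brace_product (brace_product x y) z = brace_product x (brace_product y z)"
 using assms(1)
proof (induction rule: tensor_total_induct)
 case (word xs)
 note xs = word
 show ?case
  using assms(2)
 proof (induction rule: tensor_total_induct)
  case (word ys)
  note ys = word
  show ?case
   using assms(3)
  proof (induction rule: tensor_total_induct)
   case (word zs)
   show ?case
    by (simp add: brace_product_words xs ys word brace_product_act_left brace_product_act_right
      act_ops_compose[OF vs_f xs ys word opword_multilinear])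
  qed (simp_all add: brace_product_right brace_product_closed opword_total xs ys)
 qed (simp_all add: brace_product_left brace_product_right brace_product_closed opword_total xs assms)
qed (simp_all add: brace_product_left)

lemma twisted_d_word:
 "homVs xs ==> twisted_d (opword xs) = commutator_ops xs (\<lambda>w. opword w)"
 unfolding twisted_d_def
 by (rule V.induced_word[OF commutator_ops_multilinear[OF vs_f opword_multilinear]])

lemma twisted_d_linear:
 "twisted_d (x + y) = twisted_d x + twisted_d y"
 "twisted_d (fscale c x) = fscale c (twisted_d x)"
 "twisted_d 0 = 0"
 by (simp_all add: twisted_d_def V.induced_plus V.induced_scale)

lemma twisted_d_gr:
 assumes "x \<in> tensor_gr sE E i"
 shows "twisted_d x \<in> tensor_gr sE E (i + 1)"
 unfolding twisted_d_def
proof (rule V.induced_mem_gr[OF subspace_tensor_gr commutator_ops_multilinear[OF vs_f opword_multilinear] assms])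
 fix ws assume ws: "homVs ws" "sum_list (map snd ws) = i"
 show "commutator_ops ws (\<lambda>w. opword w) \<in> tensor_gr sE E (i + 1)"
 proof (rule commutator_mem[OF subspace_tensor_gr vs_f graded_on_ops graded_on_ops])
  fix w assume "homVs w" "wdeg snd w = wdeg snd ws + 1"
  then show "opword w \<in> tensor_gr sE E (i + 1)"
   using word_in_tensor_gr[of E w sE] ws by (simp add: wdeg_def)
 qed (use g_good ws in auto)
qed

lemma twisted_d_closed:
 assumes "x \<in> TT"
 shows "twisted_d x \<in> TT"
 using assms
proof (induction rule: tensor_total_induct)
 case (word ws)
 then show ?case using twisted_d_gr[OF word_in_tensor_gr[OF word]] tensor_gr_total by blast
qed (simp_all add: twisted_d_linear TT_closed)

lemma is_twisted: "is_twisted_differential sE E brace_product \<gamma> twisted_d"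
 unfolding is_twisted_differential_def
proof (intro allI ballI)
 fix i x assume x: "x \<in> tensor_gr sE E i"
 have gw: "word sE [\<gamma>] = opword [g]" by simp
 have gT: "opword [g] \<in> TT" by (rule opword_total) (simp add: g_good)
 show "twisted_d x = brace_product (word sE [\<gamma>]) x - fscale (ksign i) (brace_product x (word sE [\<gamma>]))"
  unfolding gw fscale_ksign
  using x
 proof (induction rule: tensor_gr_induct)
  case (word ws)
  have "homVs [g]" by (simp add: g_good)
  with word show ?case
   unfolding twisted_d_word[OF word(1)] commutator_def
   by (simp only: brace_product_words) (simp add: sg_Suc wdeg_def)
 next
  case (scale c x)
  then show ?case
   by (simp only: twisted_d_linear brace_product_left brace_product_right[OF gT] tensor_gr_total)
    (simp add: sg_fscale fscale_plus fscale_minus)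
 qed (simp_all add: twisted_d_linear brace_product_left brace_product_right[OF gT] sg_add
   tensor_gr_total del: list.map)
qed

lemma commutator_ops_square:
 assumes "homVs cs" "vector_space t" "word_multilinear t relV homV \<phi>"
 shows "commutator_ops cs (\<lambda>w. commutator_ops w \<phi>) = 0"
proof (rule commutator_square)
 have gg: "homVs [g]" by (simp add: g_good)
 note comp = act_ops_compose[OF assms(2) _ _ _ assms(3)]
 show "act_ops [g] cs (\<lambda>w. act_ops [g] w \<phi>) = 0"
  unfolding comp[OF gg gg assms(1)]
  by (rule act_ops_gamma_gamma[OF assms(2) act_ops_multilinear_ops[OF assms(2,1,3)]])
 show "act_ops cs [g] (\<lambda>w. act_ops w [g] \<phi>) = 0"
  unfolding comp[OF assms(1) gg gg, symmetric]
  by (rule act_ops_gamma_gamma[OF assms(2) act_ops_multilinear[OF assms(2,1,3)]])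
 show "act_ops cs [g] (\<lambda>w. act_ops [g] w \<phi>) = act_ops [g] cs (\<lambda>w. act_ops w [g] \<phi>)"
  by (rule comp[OF gg assms(1) gg])
 show "act_ops [g] cs (\<lambda>w. sg (wdeg snd w) (h w)) = sg (1 + wdeg snd cs) (act_ops [g] cs h)" for h :: "_ => 'b"
  using act_sg_degree[OF graded_on_ops gg assms(1), of h] by simp
 show "act_ops cs [g] (\<lambda>w. sg (wdeg snd w) (h w)) = sg (1 + wdeg snd cs) (act_ops cs [g] h)" for h :: "_ => 'b"
  using act_sg_degree[OF graded_on_ops assms(1) gg, of h] by (simp add: add.commute)
qed

lemma twisted_d_square:
 assumes "x \<in> TT"
 shows "twisted_d (twisted_d x) = 0"
 using assms
proof (induction rule: tensor_total_induct)
 case (word ws)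
 have "twisted_d (twisted_d (opword ws)) = commutator_ops ws (\<lambda>w. twisted_d (opword w))"
  unfolding twisted_d_word[OF word]
  by (rule commutator_additive[where h = "twisted_d"]) (rule twisted_d_linear)
 also have "... = commutator_ops ws (\<lambda>w. commutator_ops w (\<lambda>w. opword w))"
  by (rule commutator_cong[OF graded_on_ops graded_on_ops]) (simp_all add: g_good word twisted_d_word)
 also have "... = 0"
  by (rule commutator_ops_square[OF word vs_f opword_multilinear])
 finally show ?case .
qed (simp_all add: twisted_d_linear fscale_zero)

lemma brace_product_act_word:
 "homVs xs ==> homVs ys ==>
  brace_product (commutator_ops xs (\<lambda>w. opword w)) (opword ys) = commutator_ops xs (\<lambda>w. act_ops w ys (\<lambda>w. opword w))"
proof -
 assume xs: "homVs xs" and ys: "homVs ys"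
 have "brace_product (commutator_ops xs (\<lambda>w. opword w)) (opword ys) = commutator_ops xs (\<lambda>w. brace_product (opword w) (opword ys))"
  by (rule commutator_additive[where h = "\<lambda>x. brace_product x (opword ys)"]) (rule brace_product_left)
 also have "... = commutator_ops xs (\<lambda>w. act_ops w ys (\<lambda>w. opword w))"
  by (rule commutator_cong[OF graded_on_ops graded_on_ops]) (simp_all add: g_good xs ys brace_product_words)
 finally show ?thesis .
qed

lemma twisted_d_derivation_words:
 assumes "homVs xs" "homVs ys"
 shows "twisted_d (brace_product (opword xs) (opword ys)) =
  brace_product (twisted_d (opword xs)) (opword ys) +
  sg (wdeg snd xs) (brace_product (opword xs) (twisted_d (opword ys)))"
proof -
 have gg: "homVs [g]" by (simp add: g_good)
 note comp = act_ops_compose[OF vs_f _ _ _ opword_multilinear]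
 have "twisted_d (brace_product (opword xs) (opword ys)) = act_ops xs ys (\<lambda>w. twisted_d (opword w))"
  unfolding brace_product_words[OF assms] by (rule act_additive[where h = "twisted_d"]) (rule twisted_d_linear)
 also have "... = act_ops xs ys (\<lambda>w. commutator_ops w (\<lambda>w. opword w))"
  by (rule act_cong[OF graded_on_ops assms]) (simp add: twisted_d_word)
 also have "... = commutator_ops xs (\<lambda>y. act_ops y ys (\<lambda>w. opword w)) +
   sg (wdeg snd xs) (commutator_ops ys (\<lambda>w. act_ops xs w (\<lambda>w. opword w)))"
  by (rule commutator_derivation[OF act_sg_degree[OF graded_on_ops assms] comp[OF gg assms] comp[OF assms(1) gg assms(2)]
     comp[OF assms gg]])
 also have "commutator_ops ys (\<lambda>w. act_ops xs w (\<lambda>w. opword w)) = brace_product (opword xs) (twisted_d (opword ys))"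
 proof -
  have "brace_product (opword xs) (twisted_d (opword ys)) =
    V.induced (\<lambda>ys. act_ops xs ys (\<lambda>w. opword w)) (commutator_ops ys (\<lambda>w. opword w))"
   using brace_product_op[OF assms(1) twisted_d_closed[OF opword_total[OF assms(2)]]]
    twisted_d_word[OF assms(2)] by simp
  also have "... = commutator_ops ys (\<lambda>w. V.induced (\<lambda>ys. act_ops xs ys (\<lambda>w. opword w)) (opword w))"
   by (rule commutator_additive[where h = "V.induced (\<lambda>ys. act_ops xs ys (\<lambda>w. opword w))"]) (rule V.induced_plus)
  also have "... = commutator_ops ys (\<lambda>w. act_ops xs w (\<lambda>w. opword w))"
   by (rule commutator_cong[OF graded_on_ops graded_on_ops])
    (simp_all add: g_good assms V.induced_word act_ops_multilinear[OF vs_f assms(1) opword_multilinear])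
  finally show ?thesis by simp
 qed
 finally show ?thesis
  by (simp add: twisted_d_word assms brace_product_act_word)
qed

lemma twisted_d_derivation:
 assumes "x \<in> tensor_gr sE E i" "y \<in> TT"
 shows "twisted_d (brace_product x y) =
  brace_product (twisted_d x) y + sg i (brace_product x (twisted_d y))"
 using assms(1)
proof (induction rule: tensor_gr_induct)
 case (word xs)
 note xs = word
 show ?case
  using assms(2)
 proof (induction rule: tensor_total_induct)
  case (word ys)
  show ?case
   using twisted_d_derivation_words[OF xs(1) word] xs(2) by (simp add: wdeg_def)
 next
  case (scale c y)
  then show ?case
   by (simp add: twisted_d_linear brace_product_right opword_total xs twisted_d_closed)
    (simp add: sg_fscale fscale_plus fscale_minus)
 qed (simp_all add: twisted_d_linear brace_product_right opword_total xs twisted_d_closed sg_add add_ac)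
next
 case (scale c x)
 then show ?case
  by (simp add: twisted_d_linear brace_product_left)
   (simp add: sg_fscale fscale_plus fscale_minus)
qed (simp_all add: twisted_d_linear brace_product_left sg_add add_ac)

lemma act_nonempty:
 "xs \<noteq> [] \<or> ys \<noteq> [] ==> act ev dp dc xs ys (\<lambda>w. if w = [] then c else 0) = 0"
 by (cases xs) (auto simp: act_Cons)

lemma counit_word:
 fixes vs :: "('a list => 'a) list"
 shows "counit (word sE vs) = (if vs = [] then 1 else 0)"
proof -
 have "multilin sE (*) (\<lambda>vs :: ('a list => 'a) list. if vs = [] then 1 else (0 :: 'k))"
  unfolding multilin_def linear_iff_additive by (auto simp: vector_space_pscale[OF vs_A] vs_k)
 then show ?thesis by (simp add: counit_def word_def)
qed

lemma counit_linear: "counit (x + y) = counit x + counit y" "counit (fscale c x) = c * counit x" "counit 0 = 0"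
 by (simp_all add: counit_def pointwise)

lemma deconc_product:
 assumes "homVs xs" "homVs ys"
 shows "deconc sE (brace_product (opword xs) (opword ys)) =
  spl xs (\<lambda>x y. spl ys (\<lambda>e f. sg (wdeg snd y * wdeg snd e)
   (brace_product (opword x) (opword e) \<otimes>\<^sub>f brace_product (opword y) (opword f))))"
proof -
 have "deconc sE (brace_product (opword xs) (opword ys)) = act_ops xs ys (\<lambda>w. deconc sE (opword w))"
  unfolding brace_product_words[OF assms] by (rule act_additive[where h = "deconc sE"]) (rule deconc_plus)
 also have "... = act_ops xs ys (\<lambda>w. spl w (\<lambda>a b. opword a \<otimes>\<^sub>f opword b))"
  by (simp add: deconc_word[OF vector_space_pscale[OF vs_A]] spl_map)
 also have "... = spl xs (\<lambda>x y. spl ys (\<lambda>e f. sg (wdeg snd y * wdeg snd e)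
   (act_ops x e (\<lambda>w. opword w) \<otimes>\<^sub>f act_ops y f (\<lambda>w. opword w))))"
  by (simp add: act_split act_tens)
 also have "... = spl xs (\<lambda>x y. spl ys (\<lambda>e f. sg (wdeg snd y * wdeg snd e)
   (brace_product (opword x) (opword e) \<otimes>\<^sub>f brace_product (opword y) (opword f))))"
  using assms by (intro spl_cong) (simp add: brace_product_words)
 finally show ?thesis .
qed

lemma deconc_twisted_d:
 assumes "homVs xs"
 shows "deconc sE (twisted_d (opword xs)) =
  spl xs (\<lambda>a b. twisted_d (opword a) \<otimes>\<^sub>f opword b +
   sg (wdeg snd a) (opword a \<otimes>\<^sub>f twisted_d (opword b)))"
proof -
 have unit: "on_ops c [] = [(0, c)]" if "c \<in> set xs" for c
  using assms that brace_Nil by (auto simp: on_ops_def list_all_iff)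
 have "deconc sE (twisted_d (opword xs)) = commutator_ops xs (\<lambda>w. deconc sE (opword w))"
  unfolding twisted_d_word[OF assms] by (rule commutator_additive[where h = "deconc sE"]) (rule deconc_plus)
 also have "... = commutator_ops xs (\<lambda>w. spl w (\<lambda>a b. opword a \<otimes>\<^sub>f opword b))"
  by (simp add: deconc_word[OF vector_space_pscale[OF vs_A]] spl_map)
 also have "... = spl xs (\<lambda>a b. commutator_ops a (\<lambda>w. opword w) \<otimes>\<^sub>f opword b +
   sg (wdeg snd a) (opword a \<otimes>\<^sub>f commutator_ops b (\<lambda>w. opword w)))"
  by (simp add: commutator_split unit commutator_tens)
 also have "... = spl xs (\<lambda>a b. twisted_d (opword a) \<otimes>\<^sub>f opword b +
   sg (wdeg snd a) (opword a \<otimes>\<^sub>f twisted_d (opword b)))"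
  using assms by (intro spl_cong) (simp add: twisted_d_word)
 finally show ?thesis .
qed

theorem Binf_algebra_braces: "Binf_algebra sE E twisted_d brace_product"
proof
 show "graded_bilinear fscale (tensor_gr sE E) fscale (tensor_gr sE E) fscale (tensor_gr sE E) brace_product"
  unfolding graded_bilinear_def lin_on_def
  by (auto simp: brace_product_left brace_product_right brace_product_gr)
 show "x \<in> TT ==> y \<in> TT ==> z \<in> TT ==>
   brace_product (brace_product x y) z = brace_product x (brace_product y z)" for x y z
  by (rule brace_product_assoc)
 have nil: "word sE [] = opword []" by simp
 show "brace_product (word sE []) x = x" if "x \<in> TT" for x
  unfolding nil using that
 proof (induction rule: tensor_total_induct)
  case (word ws)
  then show ?case using brace_product_words[of "[]" ws] by simp
 qed (use opword_total[of "[]"] in \<open>simp_all add: brace_product_right\<close>)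
 show "brace_product x (word sE []) = x" if "x \<in> TT" for x
  unfolding nil using that
 proof (induction rule: tensor_total_induct)
  case (word ws)
  have "act_ops ws [] (\<lambda>w. opword w) = opword ws"
   by (rule act_unit_right) (use word brace_Nil in \<open>auto simp: on_ops_def list_all_iff\<close>)
  then show ?case using word brace_product_words[of ws "[]"] by simp
 qed (simp_all add: brace_product_left)
 show "deconc sE (brace_product (word sE xs) (word sE ys)) =
   (\<Sum>i\<le>length xs. \<Sum>j\<le>length ys. fscale (ksign (sum_list (drop i ds) * sum_list (take j es)))
    (brace_product (word sE (take i xs)) (word sE (take j ys)) \<otimes>\<^sub>f
     brace_product (word sE (drop i xs)) (word sE (drop j ys))))"
  if "hom_word E xs ds" "hom_word E ys es" for xs ds ys es
 proof -
  from that obtain xs' ys' where "homVs xs'" "homVs ys'"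
   "xs = map fst xs'" "ds = map snd xs'" "ys = map fst ys'" "es = map snd ys'" by (auto elim!: hom_wordE)
  then show ?thesis
   by (simp add: deconc_product spl_atMost fscale_ksign wdeg_def take_map drop_map)
 qed
 show "counit (brace_product x y) = counit x * counit y" if "x \<in> TT" "y \<in> TT" for x y
  using that(1)
 proof (induction rule: tensor_total_induct)
  case (word xs)
  note xs = word
  show ?case
   using that(2)
  proof (induction rule: tensor_total_induct)
   case (word ys)
   have "counit (brace_product (opword xs) (opword ys)) = act_ops xs ys (\<lambda>w. counit (opword w))"
    unfolding brace_product_words[OF xs word] by (rule act_additive[where h = "counit"]) (rule counit_linear)
   also have "... = counit (opword xs) * counit (opword ys)"
    using act_nonempty[of xs ys on_ops snd snd "1 :: 'k"] by (auto simp: counit_word)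
   finally show ?case .
  qed (simp_all add: brace_product_right opword_total xs counit_linear algebra_simps)
 qed (simp_all add: brace_product_left counit_linear algebra_simps)
 show "graded_map fscale (tensor_gr sE E) fscale (tensor_gr sE E) 1 twisted_d"
  unfolding graded_map_def lin_on_def by (simp add: twisted_d_linear twisted_d_gr)
 show "x \<in> TT ==> twisted_d (twisted_d x) = 0" for x
  by (rule twisted_d_square)
 show "deconc sE (twisted_d (word sE xs)) =
   (\<Sum>i\<le>length xs. twisted_d (word sE (take i xs)) \<otimes>\<^sub>f word sE (drop i xs) +
    fscale (ksign (sum_list (take i ds))) (word sE (take i xs) \<otimes>\<^sub>f twisted_d (word sE (drop i xs))))"
  if "hom_word E xs ds" for xs ds
 proof -
  from that obtain xs' where "homVs xs'" "xs = map fst xs'" "ds = map snd xs'" by (auto elim!: hom_wordE)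
  then show ?thesis
   by (simp add: deconc_twisted_d spl_atMost fscale_ksign wdeg_def take_map drop_map)
 qed
 show "counit (twisted_d x) = 0" if "x \<in> TT" for x
  using that
 proof (induction rule: tensor_total_induct)
  case (word ws)
  have "counit (twisted_d (opword ws)) = commutator_ops ws (\<lambda>w. counit (opword w))"
   unfolding twisted_d_word[OF word] by (rule commutator_additive[where h = "counit"]) (rule counit_linear)
  also have "... = 0"
   unfolding commutator_def by (simp add: counit_word act_nonempty)
  finally show ?case .
 qed (simp_all add: twisted_d_linear counit_linear)
 show "twisted_d (word sE []) = 0"
  using twisted_d_word[of "[]"] brace_Nil[OF g_good(1)]
  by (simp add: commutator_def act_Cons sg_def)
 show "twisted_d (brace_product x y) =
   brace_product (twisted_d x) y + fscale (ksign i) (brace_product x (twisted_d y))"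
  if "x \<in> tensor_gr sE E i" "y \<in> TT" for x i y
  using twisted_d_derivation[OF that] by (simp add: fscale_ksign)
qed

end

section \<open>Left modules presented by letters\<close>

definition bar_shape :: "('v => 'c) => ('e list => 'c list) => 'c list => bool" where
 "bar_shape \<iota> enc w \<longleftrightarrow> (\<exists>us es vs. es \<noteq> [] \<and> w = map \<iota> us @ enc es @ map \<iota> vs)"

text \<open>The letters \<open>\<iota> P\<close> are operations, \<open>enc\<close> spells a chain
  in the other letters, \<open>evL\<close> gives the value of an operation on a block, and
  \<open>evR c\<close> the right multiplication of a letter \<open>c\<close>. The laws
  \<open>L_brace\<close>, \<open>L_R\<close> and \<open>R_R\<close> are the associativity laws for
  one operation or letter; they are only required on the blocks of words admitted by
  \<open>adm\<close>. The shape laws say that a block which does not belong to a bar word never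
  produces one.\<close>

locale letter_model = curved_Ainf_algebra sA A \<gamma>
 for sA :: "'k::field => 'a::ab_group_add => 'a" and A :: "int => 'a set" and \<gamma> :: "'a list => 'a" +
 fixes \<iota> :: "'a oper => 'c" and op_of :: "'c => 'a oper" and is_op :: "'c => bool"
  and dc :: "'c => int" and gc :: "'c => bool" and R :: "('c, 'k) linear_relations"
  and evL :: "('a oper, 'c) operation" and evR :: "('c, 'c) operation"
  and enc :: "('a \<times> int) list => 'c list" and adm :: "'c list => bool"
 assumes is_op [simp]: "is_op (\<iota> P)" and op_of [simp]: "op_of (\<iota> P) = P" and \<iota>_op_of: "is_op c ==> \<iota> (op_of c) = c"
  and dc_\<iota> [simp]: "dc (\<iota> P) = snd P" and gc_\<iota> [simp]: "gc (\<iota> P) = homV P"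
  and graded_R: "graded_relations gc dc R"
  and \<iota>_rel: "\<And>z a z1 b z2. (z, a, z1, b, z2) \<in> relV ==> (\<iota> z, a, \<iota> z1, b, \<iota> z2) \<in> R"
  and rel_op: "\<And>z a z1 b z2. (z, a, z1, b, z2) \<in> R ==> is_op z ==> is_op z1 \<and> is_op z2 \<and> (op_of z, a, op_of z1, b, op_of z2) \<in> relV"
  and rel_not_op: "\<And>z a z1 b z2. (z, a, z1, b, z2) \<in> R ==> \<not> is_op z ==> \<not> is_op z1 \<and> \<not> is_op z2"
  and graded_L: "graded_operation homV snd gc dc evL"
  and graded_Rt: "graded_operation gc dc gc dc evR"
  and L_args: "\<And>P k. homV P ==> linear_along fscale R (k :: 'c => ('a, 'k) chain_bar) ==> word_multilinear fscale R gc (\<lambda>b. lsum (evL P b) k)"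
  and L_op: "\<And>b k. list_all gc b ==> linear_along fscale R (k :: 'c => ('a, 'k) chain_bar) ==> linear_along fscale relV (\<lambda>P. lsum (evL P b) k)"
  and R_op: "\<And>b k. list_all gc b ==> linear_along fscale R (k :: 'c => ('a, 'k) chain_bar) ==> linear_along fscale R (\<lambda>c. lsum (evR c b) k)"
  and R_unit: "evR c [] = [(0, c)]"
  and enc_good: "es \<noteq> [] ==> list_all gc (enc es) = homAs es" and enc_deg: "es \<noteq> [] ==> wdeg dc (enc es) = wdeg sdeg es + 1"
  and enc_not_op: "es \<noteq> [] ==> enc es \<noteq> [] \<and> list_all (\<lambda>c. \<not> is_op c) (enc es)"
  and enc_inj: "es \<noteq> [] ==> es' \<noteq> [] ==> enc es = enc es' ==> es = es'"
  and enc_rel: "\<And>z a z1 b z2 l r. (z, a, z1, b, z2) \<in> relA ==> homAs l ==> homAs r ==>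
   \<exists>l' r' y y1 y2. (y, a, y1, b, y2) \<in> R \<and> list_all gc l' \<and> list_all gc r' \<and>
    enc (l @ z # r) = l' @ y # r' \<and> enc (l @ z1 # r) = l' @ y1 # r' \<and> enc (l @ z2 # r) = l' @ y2 # r'"
  and rel_enc: "\<And>z a z1 b z2 l r. (z, a, z1, b, z2) \<in> R ==> \<not> is_op z ==> list_all gc l ==> list_all gc r ==>
   \<exists>es. es \<noteq> [] \<and> (enc es = l @ z # r \<or> enc es = l @ z1 # r \<or> enc es = l @ z2 # r) ==>
   \<exists>p q x x1 x2. (x, a, x1, b, x2) \<in> relA \<and> enc (p @ x # q) = l @ z # r \<and>
    enc (p @ x1 # q) = l @ z1 # r \<and> enc (p @ x2 # q) = l @ z2 # r"
  and adm_sub: "\<And>a b c. adm (a @ b @ c) ==> adm b" and adm_bar: "\<And>us es vs. es \<noteq> [] ==> adm (map \<iota> us @ enc es @ map \<iota> vs)"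
  and L_brace: "\<And>P y cs k. [|homV P; homVs y; list_all gc cs; adm cs; linear_along fscale R (k :: 'c => ('a, 'k) chain_bar)|] ==>
   lsum (evL (brace P y) cs) k = act evL snd dc y cs (\<lambda>w. lsum (evL P w) k)"
  and L_R: "\<And>P cs k. [|homV P; list_all gc cs; adm cs; linear_along fscale R (k :: 'c => ('a, 'k) chain_bar)|] ==>
   lsum (evL P cs) (\<lambda>Q. lsum (evR Q [\<iota> (\<gamma>, 1)]) k) = act evR dc dc cs [\<iota> (\<gamma>, 1)] (\<lambda>w. lsum (evL P w) k)"
  and R_R: "\<And>c k. [|gc c; linear_along fscale R (k :: 'c => ('a, 'k) chain_bar)|] ==>
   lsum (evR c [\<iota> (\<gamma>, 1)]) (\<lambda>Q. lsum (evR Q [\<iota> (\<gamma>, 1)]) k) = act evR dc dc [\<iota> (\<gamma>, 1)] [\<iota> (\<gamma>, 1)] (\<lambda>w. lsum (evR c w) k)"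
  and R_\<iota>: "evR (\<iota> P) [\<iota> (\<gamma>, 1)] = [(0, \<iota> (brace P [(\<gamma>, 1)]))]"
  and R_zero: "\<And>c k. [|gc c; linear_along fscale R (k :: 'c => ('a, 'k) chain_bar)|] ==> lsum (evR c [\<iota> (0, 2)]) k = 0"
  and L_filter: "\<And>k :: _ => ('a list => 'a, 'k) tensor_algebra. lsum (evL P b) (\<lambda>z. if is_op z then k (op_of z) else 0) =
   (if list_all is_op b then k (brace P (map op_of b)) else 0)"
  and R_filter: "\<And>c n z. \<not> is_op c ==> (n, z) \<in> set (evR c [\<iota> (\<gamma>, 1)]) ==> \<not> is_op z"
  and L_shape: "\<And>n z P a b c. (n, z) \<in> set (evL P b) ==> bar_shape \<iota> enc (a @ z # c) ==> bar_shape \<iota> enc (a @ b @ c)"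
  and R_shape: "\<And>n z y a c. (n, z) \<in> set (evR y [\<iota> (\<gamma>, 1)]) ==> bar_shape \<iota> enc (a @ z # c) ==> bar_shape \<iota> enc (a @ y # c)"
  and \<iota>_shape: "\<And>a P c. bar_shape \<iota> enc (a @ \<iota> P # c) ==> bar_shape \<iota> enc (a @ c)"
begin

abbreviation "bw us es vs \<equiv> map \<iota> us @ enc es @ map \<iota> vs"
abbreviation "actL \<equiv> act evL snd dc"
abbreviation "actR \<equiv> act evR dc dc"
abbreviation "comm \<equiv> commutator evL snd evR dc g (\<iota> g)"
abbreviation "shape \<equiv> bar_shape \<iota> enc"

text \<open>Words of letters read as elements of \<open>T(End(A))\<close>; words that contain other
  letters are sent to zero.\<close>

definition OPW where
 "OPW w = (if list_all is_op w then opword (map op_of w) else 0)"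

text \<open>A word is cut into its leading operations, the letters that follow up to the next
  operation, and the rest. Words that spell no bar word have value zero, so that \<open>BAR\<close>
  is multilinear on all words.\<close>

definition core_value where
 "core_value u m v = (if (\<exists>es. es \<noteq> [] \<and> enc es = m) \<and> list_all is_op v
   then barw sE fscale (map (\<lambda>c. fst (op_of c)) u) (chain (THE es. es \<noteq> [] \<and> enc es = m)) (map (\<lambda>c. fst (op_of c)) v) else 0)"

definition BAR where
 "BAR w = core_value (takeWhile is_op w) (takeWhile (\<lambda>c. \<not> is_op c) (dropWhile is_op w))
   (dropWhile (\<lambda>c. \<not> is_op c) (dropWhile is_op w))"

lemma BAR_parts:
 assumes "list_all is_op u" "m \<noteq> []" "list_all (\<lambda>c. \<not> is_op c) m" "v = [] \<or> is_op (hd v)"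
 shows "BAR (u @ m @ v) = core_value u m v"
proof -
 obtain x m' where m: "m = x # m'" "\<not> is_op x" using assms(2,3) by (cases m) auto
 have 1: "takeWhile is_op (u @ m @ v) = u" "dropWhile is_op (u @ m @ v) = m @ v"
  using assms(1) m by (auto simp: list_all_iff takeWhile_append dropWhile_append)
 have 2: "takeWhile (\<lambda>c. \<not> is_op c) (m @ v) = m" "dropWhile (\<lambda>c. \<not> is_op c) (m @ v) = v"
  using assms(3,4) by (cases v; auto simp: list_all_iff takeWhile_append dropWhile_append)+
 show ?thesis unfolding BAR_def 1 2 ..
qed

lemma core_value_enc:
 assumes "es \<noteq> []"
 shows "core_value u (enc es) v = (if list_all is_op v
  then barw sE fscale (map (\<lambda>c. fst (op_of c)) u) (chain es) (map (\<lambda>c. fst (op_of c)) v) else 0)"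
proof -
 have "(THE es'. es' \<noteq> [] \<and> enc es' = enc es) = es"
  using enc_inj assms by blast
 then show ?thesis using assms unfolding core_value_def by auto
qed

lemma BAR_bw:
 assumes "es \<noteq> []"
 shows "BAR (bw us es vs) = barword us es vs"
proof -
 have "BAR (map \<iota> us @ enc es @ map \<iota> vs) = core_value (map \<iota> us) (enc es) (map \<iota> vs)"
  using enc_not_op[OF assms] by (intro BAR_parts) (auto simp: list_all_iff, cases vs, auto)
 then show ?thesis by (simp add: core_value_enc[OF assms] list_all_iff comp_def)
qed

lemma BAR_not_shape:
 assumes "\<not> shape w"
 shows "BAR w = 0"
proof (rule ccontr)
 define u m v where "u = takeWhile is_op w" and "m = takeWhile (\<lambda>c. \<not> is_op c) (dropWhile is_op w)"
  and "v = dropWhile (\<lambda>c. \<not> is_op c) (dropWhile is_op w)"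
 assume "BAR w \<noteq> 0"
 then obtain es where es: "es \<noteq> []" "enc es = m" "list_all is_op v"
  unfolding BAR_def core_value_def u_def[symmetric] m_def[symmetric] v_def[symmetric] by (auto split: if_splits)
 have "list_all is_op u" unfolding u_def by (auto simp: list_all_iff dest: set_takeWhileD)
 then have "u = map \<iota> (map op_of u)" "v = map \<iota> (map op_of v)"
  using es(3) by (auto simp: list_all_iff \<iota>_op_of map_idI)
 moreover have "w = u @ m @ v" unfolding u_def m_def v_def by simp
 ultimately have "w = bw (map op_of u) es (map op_of v)" using es by metis
 with assms es(1) show False unfolding bar_shape_def by blast
qed

lemma BAR_ops:
 assumes "list_all is_op b"
 shows "BAR b = 0"
proof (rule BAR_not_shape)
 show "\<not> shape b"
 proof
  assume "shape b"
  then obtain us es vs where es: "es \<noteq> []" and b: "b = bw us es vs" unfolding bar_shape_def by blast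
  then show False using enc_not_op[OF es] assms by (cases "enc es") auto
 qed
qed

lemma letter_linear_barw:
 assumes "fst z = pscale sA a (fst z1) + pscale sA b (fst (z2 :: 'a oper))"
 shows "barw sE fscale (us @ fst z # us') w vs = fscale a (barw sE fscale (us @ fst z1 # us') w vs) + fscale b (barw sE fscale (us @ fst z2 # us') w vs)"
  "barw sE fscale us w (vs @ fst z # vs') = fscale a (barw sE fscale us w (vs @ fst z1 # vs')) + fscale b (barw sE fscale us w (vs @ fst z2 # vs'))"
 unfolding assms barw_def fun_eq_iff bar_form_def multilin_def linear_iff_additive
 by (auto simp: plus_fun_apply pscale_apply)

lemma BAR_multilinear: "word_multilinear fscale R gc BAR"
proof (rule word_multilinearI)
 fix l r z a z1 b z2
 assume l: "list_all gc l" and r: "list_all gc r" and rel: "(z, a, z1, b, z2) \<in> R"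
 show "BAR (l @ z # r) = fscale a (BAR (l @ z1 # r)) + fscale b (BAR (l @ z2 # r))"
 proof (cases "is_op z")
  case True
  then have ops: "is_op z1" "is_op z2" "(op_of z, a, op_of z1, b, op_of z2) \<in> relV"
   using rel_op[OF rel] by auto
  then have z: "fst (op_of z) = pscale sA a (fst (op_of z1)) + pscale sA b (fst (op_of z2))"
   by (auto simp: letter_relations_def)
  show ?thesis
  proof (cases "list_all is_op l")
   case lop: True
   have "BAR (l @ y # r) = core_value (l @ y # takeWhile is_op r)
     (takeWhile (\<lambda>c. \<not> is_op c) (dropWhile is_op r)) (dropWhile (\<lambda>c. \<not> is_op c) (dropWhile is_op r))" if "is_op y" for y
    using lop that unfolding BAR_def by (simp add: list_all_iff takeWhile_append dropWhile_append)
   then show ?thesis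
    using True ops by (auto simp: core_value_def letter_linear_barw(1)[OF z] fscale_zero)
  next
   case lnop: False
   have "\<exists>x\<in>set (dropWhile is_op l). \<not> is_op x" "dropWhile is_op l \<noteq> []"
    using lnop by (auto simp: list_all_iff dropWhile_eq_Nil_conv)
     (metis dropWhile_eq_Nil_conv hd_dropWhile hd_in_set)
   define l' where "l' = dropWhile is_op l"
   have "BAR (l @ y # r) = core_value (takeWhile is_op l) (takeWhile (\<lambda>c. \<not> is_op c) l')
     (dropWhile (\<lambda>c. \<not> is_op c) l' @ y # r)" if "is_op y" for y
   proof -
    have "takeWhile is_op (l @ y # r) = takeWhile is_op l" "dropWhile is_op (l @ y # r) = l' @ y # r"
     using lnop by (auto simp: list_all_iff takeWhile_append dropWhile_append l'_def)
    moreover have "takeWhile (\<lambda>c. \<not> is_op c) (l' @ y # r) = takeWhile (\<lambda>c. \<not> is_op c) l'"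
     "dropWhile (\<lambda>c. \<not> is_op c) (l' @ y # r) = dropWhile (\<lambda>c. \<not> is_op c) l' @ y # r"
     using that by (auto simp: takeWhile_append dropWhile_append takeWhile_eq_all_conv[THEN iffD2])
    ultimately show ?thesis unfolding BAR_def by simp
   qed
   then show ?thesis
    using True ops by (auto simp: core_value_def letter_linear_barw(2)[OF z] fscale_zero)
  qed
 next
  case False
  then have nops: "\<not> is_op z1" "\<not> is_op z2" using rel_not_op[OF rel] by auto
  define l' where "l' = dropWhile is_op l"
  have tw: "takeWhile is_op (l @ y # r) = takeWhile is_op l \<and> dropWhile is_op (l @ y # r) = l' @ y # r" if "\<not> is_op y" for y
   using that by (auto simp: takeWhile_append dropWhile_append l'_def takeWhile_eq_all_conv[THEN iffD2])
  show ?thesis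
  proof (cases "list_all (\<lambda>c. \<not> is_op c) l'")
   case l'n: True
   define r1 r2 where "r1 = takeWhile (\<lambda>c. \<not> is_op c) r" and "r2 = dropWhile (\<lambda>c. \<not> is_op c) r"
   have B: "BAR (l @ y # r) = core_value (takeWhile is_op l) (l' @ y # r1) r2" if "\<not> is_op y" for y
    using tw[OF that] l'n that unfolding BAR_def
    by (simp add: list_all_iff takeWhile_append dropWhile_append r1_def r2_def)
   show ?thesis
   proof (cases "\<exists>es. es \<noteq> [] \<and> (enc es = l' @ z # r1 \<or> enc es = l' @ z1 # r1 \<or> enc es = l' @ z2 # r1)")
    case True
    have gl: "list_all gc l'" "list_all gc r1"
     using l r by (auto simp: list_all_iff l'_def r1_def dest: set_dropWhileD set_takeWhileD)
    from rel_enc[OF rel False gl True] obtain p q x x1 x2 where *: "(x, a, x1, b, x2) \<in> relA"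
     "enc (p @ x # q) = l' @ z # r1" "enc (p @ x1 # q) = l' @ z1 # r1" "enc (p @ x2 # q) = l' @ z2 # r1" by blast
    have "fst x = sA a (fst x1) + sA b (fst x2)" using *(1) by (auto simp: letter_relations_def)
    then have "chain (p @ x # q) = fscale a (chain (p @ x1 # q)) + fscale b (chain (p @ x2 # q))"
     by (simp add: word_letter)
    then show ?thesis
     using B[OF False] B[OF nops(1)] B[OF nops(2)]
     by (simp add: *(2-4)[symmetric] core_value_enc barw_w fscale_zero del: map_append list.map)
   next
    case none: False
    then show ?thesis
     using B[OF False] B[OF nops(1)] B[OF nops(2)] by (auto simp: core_value_def fscale_zero)
   qed
  next
   case l'n: False
   have "BAR (l @ y # r) = 0" if "\<not> is_op y" for y
   proof -
    have "dropWhile (\<lambda>c. \<not> is_op c) (l' @ y # r) = dropWhile (\<lambda>c. \<not> is_op c) l' @ y # r"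
     using l'n by (auto simp: list_all_iff dropWhile_append)
    then show ?thesis using tw[OF that] that unfolding BAR_def by (simp add: core_value_def)
   qed
   then show ?thesis using False nops by (simp add: fscale_zero)
  qed
 qed
qed

lemma OPW_op: "list_all is_op u ==> OPW u = word sE (map (\<lambda>c. fst (op_of c)) u)"
 by (simp add: OPW_def comp_def)

lemma vs_E: "vector_space sE"
 by (rule vector_space_pscale[OF vs_A])

text \<open>Of all ways to cut a bar word, only the cuts within the leading operations contribute:
  otherwise one of the two factors is zero.\<close>

lemma lcoact_BAR: "lcoact sE fscale (BAR w) = spl w (\<lambda>a b. OPW a \<otimes>\<^sub>f BAR b)"
proof -
 define u r where "u = takeWhile is_op w" and "r = dropWhile is_op w"
 have w: "w = u @ r" and uop: "list_all is_op u"
  unfolding u_def r_def by (auto simp: list_all_iff dest: set_takeWhileD)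
 have l0: "lcoact sE fscale 0 = 0" using lcoact_plus[of sE fscale 0 0] by simp
 show ?thesis
 proof (cases r)
  case Nil
  have "spl w (\<lambda>a b. OPW a \<otimes>\<^sub>f BAR b) = spl w (\<lambda>a b. 0)"
   using uop w Nil by (intro spl_cong) (auto simp: BAR_ops)
  then show ?thesis using uop w Nil l0 by (simp add: BAR_ops)
 next
  case (Cons m r')
  then have m: "\<not> is_op m" using hd_dropWhile[of is_op w] unfolding r_def by (metis list.sel(1) list.simps(3))
  define M v where "M = takeWhile (\<lambda>c. \<not> is_op c) r" and "v = dropWhile (\<lambda>c. \<not> is_op c) r"
  have B: "BAR (b @ m # r') = core_value b M v" if "list_all is_op b" for b
   using that m Cons unfolding BAR_def M_def v_def by (simp add: list_all_iff takeWhile_append dropWhile_append)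
  have "spl w (\<lambda>a b. OPW a \<otimes>\<^sub>f BAR b) = spl u (\<lambda>a b. OPW a \<otimes>\<^sub>f BAR (b @ m # r'))"
   unfolding w Cons spl_append_Cons using m by (simp add: OPW_def)
  also have "... = spl u (\<lambda>a b. word sE (map (\<lambda>c. fst (op_of c)) a) \<otimes>\<^sub>f core_value b M v)"
   by (intro spl_cong) (use uop in \<open>simp add: OPW_op B\<close>)
  also have "... = lcoact sE fscale (core_value u M v)"
   by (cases "(\<exists>es. es \<noteq> [] \<and> enc es = M) \<and> list_all is_op v")
    (simp_all only: core_value_def simp_thms if_True if_False lcoact_barw[OF vs_E vs_f] spl_map l0 tens_zero spl_zero)
  finally show ?thesis using B[OF uop] w Cons by simp
 qed
qed

lemma rcoact_BAR: "rcoact sE fscale (BAR w) = spl w (\<lambda>a b. BAR a \<otimes>\<^sub>f OPW b)"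
proof -
 define u r where "u = takeWhile is_op w" and "r = dropWhile is_op w"
 define M v where "M = takeWhile (\<lambda>c. \<not> is_op c) r" and "v = dropWhile (\<lambda>c. \<not> is_op c) r"
 have w: "w = u @ M @ v" and uop: "list_all is_op u" and Mn: "list_all (\<lambda>c. \<not> is_op c) M"
  unfolding u_def r_def M_def v_def by (auto simp: list_all_iff dest: set_takeWhileD)
 have hv: "v = [] \<or> is_op (hd v)" using hd_dropWhile[of "\<lambda>c. \<not> is_op c" r] unfolding v_def by auto
 have r0: "rcoact sE fscale 0 = 0" using rcoact_plus[of sE fscale 0 0] by simp
 note nil = BAR_ops
 show ?thesis
 proof (cases "M = []")
  case True
  have "r = []" using True hd_dropWhile[of is_op w] unfolding M_def r_def by (cases "dropWhile is_op w") auto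
  then have wu: "w = u" using w True unfolding v_def by simp
  then have "spl w (\<lambda>a b. BAR a \<otimes>\<^sub>f OPW b) = spl w (\<lambda>a b. 0)"
   using uop by (intro spl_cong) (auto simp: nil)
  then show ?thesis using nil[OF uop] wu r0 by simp
 next
  case False
  then obtain m0 m where M: "M = m0 @ [m]" by (metis append_butlast_last_id)
  have m: "\<not> is_op m" using Mn M by simp
  have "spl w (\<lambda>a b. BAR a \<otimes>\<^sub>f OPW b) = spl v (\<lambda>a b. BAR ((u @ m0) @ m # a) \<otimes>\<^sub>f OPW b)"
  proof -
   have "w = (u @ m0) @ m # v" using w M by simp
   then show ?thesis using m by (simp only: spl_append_Cons) (simp add: OPW_def)
  qed
  also have "... = spl v (\<lambda>a b. core_value u M a \<otimes>\<^sub>f OPW b)"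
  proof (rule spl_cong)
   fix a b assume v: "v = a @ b"
   have "BAR (u @ M @ a) = core_value u M a"
    by (rule BAR_parts[OF uop False Mn]) (use hv v in \<open>cases a; auto\<close>)
   then show "BAR ((u @ m0) @ m # a) \<otimes>\<^sub>f OPW b = core_value u M a \<otimes>\<^sub>f OPW b" by (simp add: M)
  qed
  also have "... = rcoact sE fscale (core_value u M v)"
  proof (cases "list_all is_op v")
   case True
   have "spl v (\<lambda>a b. core_value u M a \<otimes>\<^sub>f OPW b) = spl v (\<lambda>a b.
     (if \<exists>es. es \<noteq> [] \<and> enc es = M then barw sE fscale (map (\<lambda>c. fst (op_of c)) u) (chain (THE es. es \<noteq> [] \<and> enc es = M)) (map (\<lambda>c. fst (op_of c)) a) else 0)
      \<otimes>\<^sub>f word sE (map (\<lambda>c. fst (op_of c)) b))"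
    using True by (intro spl_cong) (simp add: core_value_def OPW_op)
   then show ?thesis
    using True
    by (cases "\<exists>es. es \<noteq> [] \<and> enc es = M")
     (simp_all only: core_value_def simp_thms if_True if_False rcoact_barw[OF vs_E vs_f] spl_map r0 tens_zero spl_zero)
  next
   case False
   have "spl v (\<lambda>a b. core_value u M a \<otimes>\<^sub>f OPW b) = spl v (\<lambda>a b. 0)"
    using False by (intro spl_cong) (auto simp: core_value_def OPW_def)
   then show ?thesis using False by (simp add: core_value_def r0)
  qed
  finally show ?thesis using BAR_parts[OF uop False Mn hv] w by simp
 qed
qed

end

lemma tens_scale: "fscale c x \<otimes>\<^sub>f y = fscale c (x \<otimes>\<^sub>f y)" "x \<otimes>\<^sub>f fscale c y = fscale c (x \<otimes>\<^sub>f y)"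
 by (auto simp: tens_def fun_eq_iff pscale_apply bilin_linear)

lemma lcoact_scale: "lcoact s t (fscale c x) = fscale c (lcoact s t x)"
 and rcoact_scale: "rcoact s t (fscale c x) = fscale c (rcoact s t x)"
 and lcoact_zero: "lcoact s t 0 = 0" and rcoact_zero: "rcoact s t 0 = 0"
 by (auto simp: lcoact_def rcoact_def fun_eq_iff pscale_apply zero_fun_apply)

lemma fscale_sum: "fscale c (sum f S) = (\<Sum>x\<in>S. fscale c (f x))"
 by (induction S rule: infinite_finite_induct) (auto simp: fscale_plus fscale_zero)

context letter_model
begin

lemma bar_gr_closed:
 "0 \<in> bar_gr sE E fscale W n"
 "x \<in> bar_gr sE E fscale W n ==> y \<in> bar_gr sE E fscale W n ==> x + y \<in> bar_gr sE E fscale W n"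
 "x \<in> bar_gr sE E fscale W n ==> fscale c x \<in> bar_gr sE E fscale W n"
proof -
 have m: "module (fscale :: 'k => ('x => 'k) => 'x => 'k)" using vector_space_fscale by (simp add: module_iff_vector_space)
 show "0 \<in> bar_gr sE E fscale W n"
  "x \<in> bar_gr sE E fscale W n ==> y \<in> bar_gr sE E fscale W n ==> x + y \<in> bar_gr sE E fscale W n"
  "x \<in> bar_gr sE E fscale W n ==> fscale c x \<in> bar_gr sE E fscale W n"
  unfolding bar_gr_eq by (simp_all add: module.span_zero[OF m] module.span_add[OF m] module.span_scale[OF m])
qed

lemma all_\<iota> [simp]:
 "list_all gc (map \<iota> xs) = homVs xs" "list_all is_op (map \<iota> xs)"
 by (induction xs) auto

lemma bw_good:
 assumes "homVs us" "es \<noteq> []" "homAs es" "homVs vs"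
 shows "list_all gc (bw us es vs)" "wdeg dc (bw us es vs) = wdeg snd us + (wdeg sdeg es + 1) + wdeg snd vs"
  "adm (bw us es vs)" "shape (bw us es vs)"
proof -
 have "wdeg dc (map \<iota> xs) = wdeg snd xs" for xs by (simp add: wdeg_def comp_def)
 then show "wdeg dc (bw us es vs) = wdeg snd us + (wdeg sdeg es + 1) + wdeg snd vs"
  using enc_deg[OF assms(2)] by simp
 show "list_all gc (bw us es vs)" using assms by (simp add: enc_good)
 show "adm (bw us es vs)" by (rule adm_bar[OF assms(2)])
 show "shape (bw us es vs)" using assms(2) unfolding bar_shape_def by blast
qed

lemma shapeE:
 assumes "shape w" "list_all gc w"
 obtains us es vs where "homVs us" "es \<noteq> []" "homAs es" "homVs vs" "w = bw us es vs"
 using assms unfolding bar_shape_def by (auto simp: enc_good)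

lemma BAR_in_gr:
 assumes "list_all gc w"
 shows "BAR w \<in> bar_gr sE E fscale W (wdeg dc w)"
proof (cases "shape w")
 case True
 then obtain us es vs where *: "homVs us" "es \<noteq> []" "homAs es" "homVs vs" "w = bw us es vs"
  using assms by (rule shapeE)
 then show ?thesis using barword_in_gr[OF *(1-4)] bw_good[OF *(1-4)] BAR_bw by simp
next
 case False
 then show ?thesis
  by (simp add: BAR_not_shape bar_gr_closed)
qed

lemma inserted_shape: "(n, w) \<in> set (inserted evL snd dc xs cs) ==> shape (p @ w) ==> shape (p @ cs)"
proof (induction xs arbitrary: cs n w p)
 case (Cons P xs)
 obtain a b c z w' m n' where *: "cs = a @ b @ c" "(m, z) \<in> set (evL P b)"
   "(n', w') \<in> set (inserted evL snd dc xs c)" "w = a @ z # w'"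
  using Cons.prems(1) by (auto elim!: set_bindE dest!: splits_append)
 have "shape ((p @ a @ [z]) @ c)" using Cons.IH[OF *(3), of "p @ a @ [z]"] Cons.prems(2) *(4) by simp
 then have "shape ((p @ a) @ b @ c)" using L_shape[OF *(2), of "p @ a" c] by simp
 then show ?case using *(1) by simp
qed auto

lemma actL_not_shape:
 assumes "\<not> shape w"
 shows "actL xs w BAR = 0"
proof -
 have "actL xs w BAR = actL xs w (\<lambda>w. 0)"
  unfolding act_def
 proof (rule lsum_cong)
  fix n z assume "(n, z) \<in> set (inserted evL snd dc xs w)"
  from inserted_shape[OF this, of "[]"] assms have "\<not> shape z" by auto
  then show "BAR z = 0" by (rule BAR_not_shape)
 qed
 then show ?thesis by simp
qed

lemma actR_gamma_Cons:
 "actR (c # cs) [\<iota> P] \<phi> = sg ((dc c + wdeg dc cs) * snd P) (\<phi> (\<iota> P # c # cs)) +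
  sg (wdeg dc cs * snd P) (lsum (evR c [\<iota> P]) (\<lambda>z. \<phi> (z # cs))) + actR cs [\<iota> P] (\<lambda>w. \<phi> (c # w))"
 by (simp add: act_Cons R_unit act_unit_right distrib_right add_ac)

lemma actR_not_shape:
 assumes "\<not> shape (p @ cs)"
 shows "actR cs [\<iota> g] (\<lambda>w. BAR (p @ w)) = 0"
 using assms
proof (induction cs arbitrary: p)
 case Nil
 then show ?case using \<iota>_shape[of p g "[]"] by (auto intro: BAR_not_shape)
next
 case (Cons c cs)
 have 1: "BAR (p @ \<iota> g # c # cs) = 0"
  using \<iota>_shape[of p g "c # cs"] Cons.prems by (auto intro: BAR_not_shape)
 have "lsum (evR c [\<iota> g]) (\<lambda>z. BAR (p @ z # cs)) = lsum (evR c [\<iota> g]) (\<lambda>z. 0)"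
  by (rule lsum_cong) (use R_shape Cons.prems in \<open>blast intro: BAR_not_shape\<close>)
 moreover have "actR cs [\<iota> g] (\<lambda>w. BAR ((p @ [c]) @ w)) = 0"
  by (rule Cons.IH) (use Cons.prems in simp)
 ultimately show ?case using 1 by (simp add: actR_gamma_Cons)
qed

lemma comm_not_shape: "\<not> shape w ==> comm w BAR = 0"
 using actR_not_shape[of "[]" w] actL_not_shape[of w "[g]"] by (simp add: commutator_def)

lemma actL_multilinear:
 fixes \<phi> :: "'c list => ('a, 'k) chain_bar"
 assumes "homVs xs" "word_multilinear fscale R gc \<phi>"
 shows "word_multilinear fscale R gc (\<lambda>cs. actL xs cs \<phi>)"
 by (rule vector_space.word_multilinear_act[OF vs_f graded_L graded_R L_args assms(2,1)])

lemma actL_multilinear_ops: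
 fixes \<phi> :: "'c list => ('a, 'k) chain_bar"
 assumes "list_all gc cs" "word_multilinear fscale R gc \<phi>"
 shows "word_multilinear fscale relV homV (\<lambda>xs. actL xs cs \<phi>)"
 by (rule vector_space.word_multilinear_act_operations[OF vs_f graded_L graded_relV L_op assms(2,1)])

lemma actR_multilinear:
 fixes \<phi> :: "'c list => ('a, 'k) chain_bar"
 assumes "word_multilinear fscale R gc \<phi>"
 shows "word_multilinear fscale R gc (\<lambda>cs. actR cs [\<iota> g] \<phi>)"
 by (rule vector_space.word_multilinear_act_operations[OF vs_f graded_Rt graded_R R_op assms])
  (simp_all add: g_good)

lemma comm_multilinear:
 fixes \<phi> :: "'c list => ('a, 'k) chain_bar"
 assumes "word_multilinear fscale R gc \<phi>"
 shows "word_multilinear fscale R gc (\<lambda>cs. comm cs \<phi>)"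
 unfolding commutator_def
 by (intro vector_space.word_multilinear_plus[OF vs_f] actL_multilinear actR_multilinear assms
   vector_space.word_multilinear_sg[OF vs_f _ graded_R, where h = "\<lambda>n. n + 1"])
  (simp_all add: g_good)

lemmas K_closed = vector_space.linear_along_zero[OF vs_f] vector_space.linear_along_plus[OF vs_f] vector_space.linear_along_sg[OF vs_f]

lemma actL_compose:
 fixes \<phi> :: "'c list => ('a, 'k) chain_bar"
 assumes "homVs x" "homVs y" "list_all gc cs" "adm cs" "word_multilinear fscale R gc \<phi>"
 shows "actL y cs (\<lambda>w. actL x w \<phi>) = act_ops x y (\<lambda>z. actL z cs \<phi>)"
proof (rule act_compose[where K = "linear_along fscale R", OF graded_L graded_on_ops graded_L assms(1-3)])
 fix P y1 y2 y3 e1 e2 e3 and k :: "'c => ('a, 'k) chain_bar"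
 assume *: "P \<in> set x" "y = y1 @ y2 @ y3" "cs = e1 @ e2 @ e3" "linear_along fscale R k"
 then have "adm e2" using assms(4) adm_sub by metis
 with * assms(1-3) show "lsum (on_ops P y2) (\<lambda>Q. lsum (evL Q e2) k) = actL y2 e2 (\<lambda>b. lsum (evL P b) k)"
  by (auto simp: list_all_iff intro!: L_brace)
qed (use assms(5) in \<open>auto intro: word_multilinear_linear_along K_closed\<close>)

lemma singleton_sub: "[c] = e1 @ e2 @ e3 ==> e2 = [] \<or> e2 = [c]"
 by (auto simp: Cons_eq_append_conv)

lemma actR_actL:
 fixes \<phi> :: "'c list => ('a, 'k) chain_bar"
 assumes "homVs x" "list_all gc cs" "adm cs" "word_multilinear fscale R gc \<phi>"
 shows "actR cs [\<iota> g] (\<lambda>w. actL x w \<phi>) = actL x cs (\<lambda>w. actR w [\<iota> g] \<phi>)"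
proof (rule act_compose[where K = "linear_along fscale R", OF graded_L graded_L graded_Rt assms(1,2)])
 fix P y1 y2 y3 e1 e2 e3 and k :: "'c => ('a, 'k) chain_bar"
 assume *: "P \<in> set x" "cs = y1 @ y2 @ y3" "[\<iota> g] = e1 @ e2 @ e3" "linear_along fscale R k"
 then have "adm y2" using assms(3) adm_sub by metis
 with * assms(1,2) singleton_sub[OF *(3)]
 show "lsum (evL P y2) (\<lambda>Q. lsum (evR Q e2) k) = actR y2 e2 (\<lambda>b. lsum (evL P b) k)"
  by (auto simp: list_all_iff R_unit act_unit_right intro!: L_R)
qed (use assms(4) in \<open>auto simp: g_good intro: word_multilinear_linear_along K_closed\<close>)

lemma actR_actR:
 fixes \<phi> :: "'c list => ('a, 'k) chain_bar"
 assumes "list_all gc cs" "word_multilinear fscale R gc \<phi>"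
 shows "actR [\<iota> g] [\<iota> g] (\<lambda>w. actR cs w \<phi>) = actR cs [\<iota> g] (\<lambda>w. actR w [\<iota> g] \<phi>)"
proof (rule act_compose[where K = "linear_along fscale R", OF graded_Rt graded_Rt graded_Rt assms(1)])
 fix P y1 y2 y3 e1 e2 e3 and k :: "'c => ('a, 'k) chain_bar"
 assume *: "P \<in> set cs" "[\<iota> g] = y1 @ y2 @ y3" "[\<iota> g] = e1 @ e2 @ e3" "linear_along fscale R k"
 then show "lsum (evR P y2) (\<lambda>Q. lsum (evR Q e2) k) = actR y2 e2 (\<lambda>b. lsum (evR P b) k)"
  using singleton_sub[OF *(2)] singleton_sub[OF *(3)] assms(1)
  by (auto simp: list_all_iff R_unit act_unit_right intro!: R_R)
qed (use assms(2) in \<open>auto simp: g_good intro: word_multilinear_linear_along K_closed\<close>)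

lemma actR_zero:
 fixes \<phi> :: "'c list => ('a, 'k) chain_bar"
 assumes "list_all gc cs" "word_multilinear fscale R gc \<phi>"
 shows "actR cs [\<iota> (0, 2)] \<phi> = 0"
proof -
 have 0: "(\<iota> (0, 2), 0, \<iota> (0, 2), 0, \<iota> (0, 2)) \<in> R"
  using V.subspace_0[OF V.subspace_component, of 2] by (intro \<iota>_rel) (auto simp: letter_relations_def)
 have "actR cs [\<iota> (0, 2)] (\<lambda>w. \<phi> (p @ w)) = 0" if "list_all gc p" for p
  using assms(1) that
 proof (induction cs arbitrary: p)
  case Nil
  then show ?case using word_multilinear_zero_letter[OF vs_f assms(2) _ _ 0, of p "[]"] by simp
 next
  case (Cons c cs)
  have "\<phi> (p @ \<iota> (0, 2) # c # cs) = 0"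
   using word_multilinear_zero_letter[OF vs_f assms(2) _ _ 0, of p "c # cs"] Cons.prems by simp
  moreover have "lsum (evR c [\<iota> (0, 2)]) (\<lambda>z. \<phi> (p @ z # cs)) = 0"
   using Cons.prems by (intro R_zero word_multilinear_linear_along[OF assms(2)]) auto
  moreover have "actR cs [\<iota> (0, 2)] (\<lambda>w. \<phi> ((p @ [c]) @ w)) = 0"
   using Cons.prems by (intro Cons.IH) auto
  ultimately show ?case by (simp add: actR_gamma_Cons)
 qed
 from this[of "[]"] show ?thesis by simp
qed

text \<open>The values \<open>\<gamma>{\<gamma>}\<close> vanish and the two words with two letters
  \<open>\<gamma>\<close> cancel.\<close>

lemma actR_gamma_gamma:
 fixes \<phi> :: "'c list => ('a, 'k) chain_bar"
 assumes "list_all gc cs" "word_multilinear fscale R gc \<phi>"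
 shows "actR [\<iota> g] [\<iota> g] (\<lambda>w. actR cs w \<phi>) = 0"
 using actR_zero[OF assms] by (simp add: actR_gamma_Cons R_\<iota> gamma_brace_zero sg_def)

text \<open>Each of the required identities is an instance of associativity, with
  \<open>\<gamma>\<close> on the left, on the right, or on both sides.\<close>

lemma comm_square:
 fixes \<phi> :: "'c list => ('a, 'k) chain_bar"
 assumes "list_all gc cs" "adm cs" "word_multilinear fscale R gc \<phi>"
 shows "comm cs (\<lambda>w. comm w \<phi>) = 0"
proof (rule commutator_square)
 have gg: "homVs [g]" and igg: "list_all gc [\<iota> g]" by (simp_all add: g_good)
 show "actL [g] cs (\<lambda>w. actL [g] w \<phi>) = 0"
  unfolding actL_compose[OF gg gg assms] by (rule act_ops_gamma_gamma[OF vs_f actL_multilinear_ops[OF assms(1,3)]])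
 show "actR cs [\<iota> g] (\<lambda>w. actR w [\<iota> g] \<phi>) = 0"
  unfolding actR_actR[OF assms(1,3), symmetric] by (rule actR_gamma_gamma[OF assms(1,3)])
 show "actR cs [\<iota> g] (\<lambda>w. actL [g] w \<phi>) = actL [g] cs (\<lambda>w. actR w [\<iota> g] \<phi>)"
  by (rule actR_actL[OF gg assms])
 show "actL [g] cs (\<lambda>w. sg (wdeg dc w) (h w)) = sg (1 + wdeg dc cs) (actL [g] cs h)" for h :: "_ => ('a, 'k) chain_bar"
  using act_sg_degree[OF graded_L gg assms(1), of h] by simp
 show "actR cs [\<iota> g] (\<lambda>w. sg (wdeg dc w) (h w)) = sg (1 + wdeg dc cs) (actR cs [\<iota> g] h)" for h :: "_ => ('a, 'k) chain_bar"
  using act_sg_degree[OF graded_Rt assms(1) igg, of h] by (simp add: add.commute)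
qed

lemma comm_derivation:
 fixes \<phi> :: "'c list => ('a, 'k) chain_bar"
 assumes x: "homVs x" and cs: "list_all gc cs" "adm cs" and \<phi>: "word_multilinear fscale R gc \<phi>"
 shows "actL x cs (\<lambda>w. comm w \<phi>) = commutator_ops x (\<lambda>y. actL y cs \<phi>) + sg (wdeg snd x) (comm cs (\<lambda>w. actL x w \<phi>))"
proof -
 have gg: "homVs [g]" by (simp add: g_good)
 show ?thesis
  by (rule commutator_derivation[OF act_sg_degree[OF graded_L x cs(1)] actL_compose[OF gg x cs \<phi>]
     actL_compose[OF x gg cs \<phi>] actR_actL[OF x cs \<phi>]])
qed

section \<open>The action and the differential on the bar space\<close>

lemma form_of_words:
 fixes \<Phi> :: "'c list => 'y => 'k"
 assumes "word_multilinear fscale R gc \<Phi>"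
 shows "multilinear_form (\<lambda>us es vs. \<Phi> (bw us es vs))"
 unfolding multilinear_form_def
proof (intro conjI allI impI; elim conjE; intro word_multilinearI)
 fix es vs l r z a z1 b z2
 assume "homAs es" "es \<noteq> []" "homVs vs" "homVs l" "homVs r" "(z, a, z1, b, z2) \<in> relV"
 then show "\<Phi> (bw (l @ z # r) es vs) = fscale a (\<Phi> (bw (l @ z1 # r) es vs)) + fscale b (\<Phi> (bw (l @ z2 # r) es vs))"
  using word_multilinearD[OF assms _ _ \<iota>_rel, of "map \<iota> l" "map \<iota> r @ enc es @ map \<iota> vs"]
  by (simp add: enc_good)
next
 fix us vs l r z a z1 b z2
 assume *: "homVs us" "homVs vs" "homAs l" "homAs r" "(z, a, z1, b, z2) \<in> relA"
 from enc_rel[OF *(5,3,4)] obtain l' r' y y1 y2 where "(y, a, y1, b, y2) \<in> R" "list_all gc l'" "list_all gc r'"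
  "enc (l @ z # r) = l' @ y # r'" "enc (l @ z1 # r) = l' @ y1 # r'" "enc (l @ z2 # r) = l' @ y2 # r'" by blast
 then show "\<Phi> (bw us (l @ z # r) vs) = fscale a (\<Phi> (bw us (l @ z1 # r) vs)) + fscale b (\<Phi> (bw us (l @ z2 # r) vs))"
  using word_multilinearD[OF assms, of "map \<iota> us @ l'" "r' @ map \<iota> vs"] *
  by simp
next
 fix us es l r z a z1 b z2
 assume "homVs us" "homAs es" "es \<noteq> []" "homVs l" "homVs r" "(z, a, z1, b, z2) \<in> relV"
 then show "\<Phi> (bw us es (l @ z # r)) = fscale a (\<Phi> (bw us es (l @ z1 # r))) + fscale b (\<Phi> (bw us es (l @ z2 # r)))"
  using word_multilinearD[OF assms _ _ \<iota>_rel, of "map \<iota> us @ enc es @ map \<iota> l" "map \<iota> r"]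
  by (simp add: enc_good)
qed

text \<open>The linear map out of the bar space with prescribed values on bar words.\<close>

definition on_bar :: "('c list => 'y => 'k) => ('a, 'k) chain_bar => 'y => 'k" where
 "on_bar \<Phi> = induced_bar (\<lambda>us es vs. \<Phi> (bw us es vs))"

lemma on_bar_linear:
 "on_bar \<Phi> (x + y) = on_bar \<Phi> x + on_bar \<Phi> y" "on_bar \<Phi> (fscale c x) = fscale c (on_bar \<Phi> x)" "on_bar \<Phi> 0 = 0"
 by (simp_all add: on_bar_def induced_bar_plus induced_bar_scale)

lemma on_bar_barword:
 assumes "word_multilinear fscale R gc \<Phi>" "homVs us" "es \<noteq> []" "homAs es" "homVs vs"
 shows "on_bar \<Phi> (barword us es vs) = \<Phi> (bw us es vs)"
 unfolding on_bar_def by (rule induced_bar_word[OF form_of_words[OF assms(1)] assms(2-5)])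

lemma on_bar_BAR:
 assumes "word_multilinear fscale R gc \<Phi>" "list_all gc w" "\<not> shape w ==> \<Phi> w = 0"
 shows "on_bar \<Phi> (BAR w) = \<Phi> w"
proof (cases "shape w")
 case True
 then obtain us es vs where *: "homVs us" "es \<noteq> []" "homAs es" "homVs vs" "w = bw us es vs"
  using assms(2) by (rule shapeE)
 then show ?thesis using on_bar_barword[OF assms(1) *(1-4)] BAR_bw[OF *(2)] by simp
qed (use assms(3) in \<open>simp add: BAR_not_shape on_bar_linear\<close>)

definition bar_action where
 "bar_action x z = V.induced (\<lambda>xs. on_bar (\<lambda>w. actL xs w BAR) z) x"

definition bar_diff where
 "bar_diff = on_bar (\<lambda>w. comm w BAR)"

lemma BT_closed: "0 \<in> BT" "x \<in> BT ==> y \<in> BT ==> x + y \<in> BT" "x \<in> BT ==> fscale c x \<in> BT"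
 and subspace_BT: "module.subspace fscale BT"
proof -
 have m: "module (fscale :: 'k => ('x => 'k) => 'x => 'k)" using vector_space_fscale by (simp add: module_iff_vector_space)
 show "0 \<in> BT" "x \<in> BT ==> y \<in> BT ==> x + y \<in> BT" "x \<in> BT ==> fscale c x \<in> BT"
  unfolding bar_total_eq by (simp_all add: module.span_zero[OF m] module.span_add[OF m] module.span_scale[OF m])
 show "module.subspace fscale BT" unfolding bar_total_eq by (rule module.subspace_span[OF m])
qed

lemma bar_action_op:
 assumes "homVs xs" "z \<in> BT"
 shows "bar_action (opword xs) z = on_bar (\<lambda>w. actL xs w BAR) z"
 unfolding bar_action_def
proof (rule V.induced_word[OF _ assms(1)])
 show "V.multilinear_on_words (\<lambda>xs. on_bar (\<lambda>w. actL xs w BAR) z)"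
  unfolding word_multilinear_def
 proof (intro allI impI, elim conjE)
  fix l r assume lr: "homVs l" "homVs r"
  show "linear_along fscale relV (\<lambda>P. on_bar (\<lambda>w. actL (l @ P # r) w BAR) z)"
   unfolding on_bar_def
  proof (rule linear_along_induced_bar[OF assms(2)])
   fix y a y1 b y2 assume "(y, a, y1, b, y2) \<in> relV"
   then have "homV y" "homV y1" "homV y2" using graded_relV unfolding graded_relations_def by auto
   then show "multilinear_form (\<lambda>us es vs. actL (l @ y # r) (bw us es vs) BAR) \<and>
    multilinear_form (\<lambda>us es vs. actL (l @ y1 # r) (bw us es vs) BAR) \<and>
    multilinear_form (\<lambda>us es vs. actL (l @ y2 # r) (bw us es vs) BAR)"
    using lr by (auto intro!: form_of_words actL_multilinear BAR_multilinear)
  next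
   fix us es vs assume "homVs us" "es \<noteq> []" "homAs es" "homVs vs"
   then show "linear_along fscale relV (\<lambda>P. actL (l @ P # r) (bw us es vs) BAR)"
    by (intro word_multilinear_linear_along[OF actL_multilinear_ops[OF bw_good(1) BAR_multilinear] lr])
  qed
 qed
qed

lemma barword_total:
 "[|homVs us; es \<noteq> []; homAs es; homVs vs|] ==> barword us es vs \<in> BT"
 using barword_in_gr bar_gr_total by blast

lemma bar_action_words:
 assumes "homVs xs" "homVs us" "es \<noteq> []" "homAs es" "homVs vs"
 shows "bar_action (opword xs) (barword us es vs) = actL xs (bw us es vs) BAR"
 using on_bar_barword[OF actL_multilinear[OF assms(1) BAR_multilinear] assms(2-5)]
 by (simp add: bar_action_op assms barword_total)

lemma bar_diff_barword:
 assumes "homVs us" "es \<noteq> []" "homAs es" "homVs vs"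
 shows "bar_diff (barword us es vs) = comm (bw us es vs) BAR"
 unfolding bar_diff_def by (rule on_bar_barword[OF comm_multilinear[OF BAR_multilinear] assms])

lemma bar_action_left:
 "bar_action (x + x') z = bar_action x z + bar_action x' z"
 "bar_action (fscale c x) z = fscale c (bar_action x z)" "bar_action 0 z = 0"
 by (simp_all add: bar_action_def V.induced_plus V.induced_scale)

lemma bar_action_right:
 assumes "x \<in> TT"
 shows "[|z \<in> BT; z' \<in> BT|] ==> bar_action x (z + z') = bar_action x z + bar_action x z'"
  and "z \<in> BT ==> bar_action x (fscale c z) = fscale c (bar_action x z)"
  and "bar_action x 0 = 0"
proof -
 show "bar_action x (z + z') = bar_action x z + bar_action x z'" if "z \<in> BT" "z' \<in> BT"
  by (rule tensor_total_induct[where P = "\<lambda>x. bar_action x (z + z') = bar_action x z + bar_action x z'", OF assms])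
   (simp_all add: that bar_action_left bar_action_op BT_closed on_bar_linear fscale_plus add_ac)
 show "bar_action x (fscale c z) = fscale c (bar_action x z)" if "z \<in> BT"
  by (rule tensor_total_induct[where P = "\<lambda>x. bar_action x (fscale c z) = fscale c (bar_action x z)", OF assms])
   (simp_all add: that bar_action_left bar_action_op BT_closed on_bar_linear fscale_plus fscale_commute[of c] fscale_zero)
 show "bar_action x 0 = 0"
  by (rule tensor_total_induct[where P = "\<lambda>x. bar_action x 0 = 0", OF assms])
   (simp_all add: bar_action_left bar_action_op BT_closed on_bar_linear fscale_zero)
qed

lemma actL_in_gr:
 assumes "homVs xs" "list_all gc cs"
 shows "actL xs cs BAR \<in> bar_gr sE E fscale W (wdeg snd xs + wdeg dc cs)"
proof (rule act_mem[OF subspace_bar_gr vs_f graded_L assms])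
 fix w assume "list_all gc w" "wdeg dc w = wdeg snd xs + wdeg dc cs"
 then show "BAR w \<in> bar_gr sE E fscale W (wdeg snd xs + wdeg dc cs)" using BAR_in_gr[of w] by simp
qed

lemma comm_in_gr:
 assumes "list_all gc cs"
 shows "comm cs BAR \<in> bar_gr sE E fscale W (wdeg dc cs + 1)"
proof (rule commutator_mem[OF subspace_bar_gr vs_f graded_L graded_Rt])
 fix w assume "list_all gc w" "wdeg dc w = wdeg dc cs + 1"
 then show "BAR w \<in> bar_gr sE E fscale W (wdeg dc cs + 1)" using BAR_in_gr[of w] by simp
qed (simp_all add: g_good assms)

lemma bar_action_gr:
 assumes "x \<in> tensor_gr sE E i" "z \<in> bar_gr sE E fscale W j"
 shows "bar_action x z \<in> bar_gr sE E fscale W (i + j)"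
 using assms(1)
proof (induction x rule: tensor_gr_induct)
 case (word xs)
 note xs = word
 show ?case
  using assms(2)
 proof (induction z rule: bar_gr_induct)
  case (word us es vs)
  then show ?case
   using actL_in_gr[OF xs(1) bw_good(1)[OF word(1-4)]] xs bw_good(2)[OF word(1-4)]
   by (simp add: bar_action_words wdeg_def)
 qed (simp_all add: bar_action_right opword_total xs bar_gr_closed bar_gr_total)
qed (simp_all add: bar_action_left bar_gr_closed)

lemma bar_action_closed:
 assumes "x \<in> TT" "z \<in> BT"
 shows "bar_action x z \<in> BT"
 using assms(1)
proof (induction x rule: tensor_total_induct)
 case (word xs)
 note xs = word
 show ?case
  using assms(2)
 proof (induction z rule: bar_total_induct)
  case (word us es vs)
  then show ?case
   using bar_gr_total[OF actL_in_gr[OF xs(1) bw_good(1)[OF word(1-4)]]] by (simp add: bar_action_words xs)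
 qed (simp_all add: bar_action_right opword_total xs BT_closed)
qed (simp_all add: bar_action_left BT_closed)

lemma bar_diff_linear:
 "bar_diff (x + y) = bar_diff x + bar_diff y" "bar_diff (fscale c x) = fscale c (bar_diff x)" "bar_diff 0 = 0"
 by (simp_all add: bar_diff_def on_bar_linear)

lemma bar_diff_gr:
 assumes "z \<in> bar_gr sE E fscale W i"
 shows "bar_diff z \<in> bar_gr sE E fscale W (i + 1)"
 using assms
proof (induction z rule: bar_gr_induct)
 case (word us es vs)
 then show ?case
  using comm_in_gr[OF bw_good(1)[OF word(1-4)]] bw_good(2)[OF word(1-4)] by (simp add: bar_diff_barword)
qed (simp_all add: bar_diff_linear bar_gr_closed)

lemma bar_diff_closed: "z \<in> BT ==> bar_diff z \<in> BT"
proof (induction z rule: bar_total_induct)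
 case (word us es vs)
 then show ?case
  using bar_gr_total[OF comm_in_gr[OF bw_good(1)[OF word(1-4)]]] by (simp add: bar_diff_barword)
qed (simp_all add: bar_diff_linear BT_closed)

lemma on_bar_actL:
 assumes "word_multilinear fscale R gc \<Phi>" "\<And>w. \<not> shape w ==> \<Phi> w = 0" "homVs xs" "list_all gc cs"
 shows "on_bar \<Phi> (actL xs cs BAR) = actL xs cs \<Phi>"
proof -
 have "on_bar \<Phi> (actL xs cs BAR) = actL xs cs (\<lambda>w. on_bar \<Phi> (BAR w))"
  by (rule act_additive[where h = "on_bar \<Phi>"]) (rule on_bar_linear)
 also have "... = actL xs cs \<Phi>"
  by (rule act_cong[OF graded_L assms(3,4)]) (simp add: on_bar_BAR assms)
 finally show ?thesis .
qed

lemma on_bar_comm: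
 assumes "word_multilinear fscale R gc \<Phi>" "\<And>w. \<not> shape w ==> \<Phi> w = 0" "list_all gc cs"
 shows "on_bar \<Phi> (comm cs BAR) = comm cs \<Phi>"
proof -
 have "on_bar \<Phi> (comm cs BAR) = comm cs (\<lambda>w. on_bar \<Phi> (BAR w))"
  by (rule commutator_additive[where h = "on_bar \<Phi>"]) (rule on_bar_linear)
 also have "... = comm cs \<Phi>"
  by (rule commutator_cong[OF graded_L graded_Rt]) (simp_all add: on_bar_BAR assms g_good)
 finally show ?thesis .
qed

lemma bar_action_assoc:
 assumes "x \<in> TT" "y \<in> TT" "z \<in> BT"
 shows "bar_action (brace_product x y) z = bar_action x (bar_action y z)"
 using assms(1)
proof (induction x rule: tensor_total_induct)
 case (word xs)
 note xs = word
 show ?case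
  using assms(2)
 proof (induction y rule: tensor_total_induct)
  case (word ys)
  note ys = word
  show ?case
   using assms(3)
  proof (induction z rule: bar_total_induct)
   case (word us es vs)
   let ?w = "bw us es vs"
   have "bar_action (brace_product (opword xs) (opword ys)) (barword us es vs) =
     act_ops xs ys (\<lambda>w. bar_action (opword w) (barword us es vs))"
    unfolding brace_product_words[OF xs ys]
    by (rule act_additive[where h = "\<lambda>x. bar_action x (barword us es vs)"]) (rule bar_action_left)
   also have "... = act_ops xs ys (\<lambda>w. actL w ?w BAR)"
    by (rule act_cong[OF graded_on_ops xs ys]) (simp add: bar_action_words word)
   also have "... = actL ys ?w (\<lambda>w. actL xs w BAR)"
    by (rule actL_compose[OF xs ys bw_good(1,3)[OF word] BAR_multilinear, symmetric])
   also have "... = on_bar (\<lambda>w. actL xs w BAR) (actL ys ?w BAR)"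
    by (rule on_bar_actL[OF actL_multilinear[OF xs BAR_multilinear] actL_not_shape ys bw_good(1)[OF word], symmetric])
   also have "... = bar_action (opword xs) (bar_action (opword ys) (barword us es vs))"
    using bar_gr_total[OF actL_in_gr[OF ys bw_good(1)[OF word]]]
    by (simp add: bar_action_op[OF xs] bar_action_words[OF ys word])
   finally show ?case .
  qed (simp_all add: bar_action_right brace_product_closed opword_total xs ys bar_action_closed)
 qed (simp_all add: bar_action_left bar_action_right brace_product_right brace_product_closed opword_total xs assms bar_action_closed)
qed (simp_all add: bar_action_left brace_product_left)

lemma bar_diff_square:
 assumes "z \<in> BT"
 shows "bar_diff (bar_diff z) = 0"
 using assms
proof (induction z rule: bar_total_induct)
 case (word us es vs)
 have "bar_diff (bar_diff (barword us es vs)) = comm (bw us es vs) (\<lambda>w. comm w BAR)"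
  unfolding bar_diff_barword[OF word] unfolding bar_diff_def
  by (rule on_bar_comm[OF comm_multilinear[OF BAR_multilinear] comm_not_shape bw_good(1)[OF word]])
 also have "... = 0"
  by (rule comm_square[OF bw_good(1,3)[OF word] BAR_multilinear])
 finally show ?case .
qed (simp_all add: bar_diff_linear fscale_zero)

lemma bar_diff_derivation_words:
 assumes xs: "homVs xs" and w: "homVs us" "es \<noteq> []" "homAs es" "homVs vs"
 shows "bar_diff (bar_action (opword xs) (barword us es vs)) =
  bar_action (twisted_d (opword xs)) (barword us es vs) +
  sg (wdeg snd xs) (bar_action (opword xs) (bar_diff (barword us es vs)))"
proof -
 let ?w = "bw us es vs"
 have "bar_diff (bar_action (opword xs) (barword us es vs)) = actL xs ?w (\<lambda>w. comm w BAR)"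
  unfolding bar_action_words[OF assms] unfolding bar_diff_def
  by (rule on_bar_actL[OF comm_multilinear[OF BAR_multilinear] comm_not_shape xs bw_good(1)[OF w]])
 also have "... = commutator_ops xs (\<lambda>y. actL y ?w BAR) + sg (wdeg snd xs) (comm ?w (\<lambda>w. actL xs w BAR))"
  by (rule comm_derivation[OF xs bw_good(1,3)[OF w] BAR_multilinear])
 also have "commutator_ops xs (\<lambda>y. actL y ?w BAR) = commutator_ops xs (\<lambda>y. bar_action (opword y) (barword us es vs))"
  by (rule commutator_cong[OF graded_on_ops graded_on_ops]) (simp_all add: g_good xs bar_action_words w)
 also have "... = bar_action (twisted_d (opword xs)) (barword us es vs)"
  unfolding twisted_d_word[OF xs]
  by (rule commutator_additive[where h = "\<lambda>x. bar_action x (barword us es vs)", symmetric]) (rule bar_action_left)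
 also have "comm ?w (\<lambda>w. actL xs w BAR) = bar_action (opword xs) (bar_diff (barword us es vs))"
  unfolding bar_action_op[OF xs bar_diff_closed[OF barword_total[OF w]]] unfolding bar_diff_barword[OF w]
  by (rule on_bar_comm[OF actL_multilinear[OF xs BAR_multilinear] actL_not_shape bw_good(1)[OF w], symmetric])
 finally show ?thesis .
qed

lemma bar_diff_derivation:
 assumes "x \<in> tensor_gr sE E i" "z \<in> BT"
 shows "bar_diff (bar_action x z) = bar_action (twisted_d x) z + sg i (bar_action x (bar_diff z))"
 using assms(1)
proof (induction x rule: tensor_gr_induct)
 case (word xs)
 note xs = word
 show ?case
  using assms(2)
 proof (induction rule: bar_total_induct[where P = "\<lambda>z. bar_diff (bar_action (opword xs) z) =
   bar_action (twisted_d (opword xs)) z + sg i (bar_action (opword xs) (bar_diff z))"])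
  case (word us es vs)
  show ?case
   using bar_diff_derivation_words[OF xs(1) word(1) _ word(2,3)] word(4) xs(2) by (simp add: wdeg_def)
 qed (simp_all add: bar_diff_linear bar_action_right opword_total xs twisted_d_closed bar_diff_closed
   sg_add sg_fscale fscale_plus add_ac)
qed (simp_all add: bar_diff_linear bar_action_left twisted_d_linear sg_add sg_fscale fscale_plus add_ac)

section \<open>Compatibility with the coactions\<close>

text \<open>An operation produces an operation only from a block of operations. Hence the part of
  the result without chain letters is the product in \<open>T(End(A))\<close>.\<close>

lemma actL_OPW:
 "actL xs cs OPW = (if list_all is_op cs then act_ops xs (map op_of cs) (\<lambda>w. opword w) else 0)"
proof -
 have "actL xs cs (\<lambda>w. if list_all is_op w then \<phi> (map op_of w) else 0) =
   (if list_all is_op cs then act_ops xs (map op_of cs) \<phi> else 0)" for \<phi> :: "_ => ('a list => 'a, 'k) tensor_algebra"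
 proof (induction xs arbitrary: cs \<phi>)
  case (Cons P xs)
  have wd: "wdeg snd (map op_of a) = wdeg dc a" if "list_all is_op a" for a
   using that by (induction a) (auto simp: dc_\<iota>[symmetric] \<iota>_op_of simp del: dc_\<iota>)
  have "lsum (evL P b) (\<lambda>z. actL xs c (\<lambda>w. if list_all is_op (a @ z # w) then \<phi> (map op_of (a @ z # w)) else 0)) =
    (if list_all is_op (a @ b @ c) then act_ops xs (map op_of c) (\<lambda>w. \<phi> (map op_of a @ brace P (map op_of b) # w)) else 0)" for a b c
  proof (cases "list_all is_op a")
   case True
   define k where "k Q = (if list_all is_op c then act_ops xs (map op_of c) (\<lambda>w. \<phi> (map op_of a @ Q # w)) else 0)" for Q
   have "actL xs c (\<lambda>w. if list_all is_op (a @ z # w) then \<phi> (map op_of (a @ z # w)) else 0) =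
    (if is_op z then k (op_of z) else 0)" for z
    using Cons.IH[of c "\<lambda>w. \<phi> (map op_of a @ op_of z # w)"] True
    by (cases "is_op z") (simp_all add: k_def cong: if_cong)
   then have "lsum (evL P b) (\<lambda>z. actL xs c (\<lambda>w. if list_all is_op (a @ z # w) then \<phi> (map op_of (a @ z # w)) else 0)) =
    (if list_all is_op b then k (brace P (map op_of b)) else 0)"
    by (simp only: L_filter)
   then show ?thesis using True by (simp add: k_def)
  qed auto
  then have "actL (P # xs) cs (\<lambda>w. if list_all is_op w then \<phi> (map op_of w) else 0) =
   spl cs (\<lambda>a r. spl r (\<lambda>b c. sg (snd P * wdeg dc a + wdeg snd xs * (wdeg dc a + wdeg dc b))
    (if list_all is_op (a @ b @ c) then act_ops xs (map op_of c) (\<lambda>w. \<phi> (map op_of a @ brace P (map op_of b) # w)) else 0)))"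
   by (simp only: act_Cons)
  also have "... = (if list_all is_op cs then act_ops (P # xs) (map op_of cs) \<phi> else 0)"
  proof (cases "list_all is_op cs")
   case True
   then show ?thesis by (simp add: act_Cons spl_map) (intro spl_cong, simp add: wd)
  next
   case False
   have "spl cs (\<lambda>a r. spl r (\<lambda>b c. sg (snd P * wdeg dc a + wdeg snd xs * (wdeg dc a + wdeg dc b))
    (if list_all is_op (a @ b @ c) then act_ops xs (map op_of c) (\<lambda>w. \<phi> (map op_of a @ brace P (map op_of b) # w)) else 0))) =
    spl cs (\<lambda>a r. spl r (\<lambda>b c. 0))"
    using False by (intro spl_cong) auto
   then show ?thesis using False by simp
  qed
  finally show ?case .
 qed simp
 from this[of "\<lambda>w. opword w"] show ?thesis unfolding OPW_def .
qed

lemma actR_OPW: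
 assumes "list_all gc cs"
 shows "actR cs [\<iota> g] OPW = (if list_all is_op cs then act_ops (map op_of cs) [g] (\<lambda>w. opword w) else 0)"
proof -
 have "actR cs [\<iota> g] (\<lambda>w. if list_all is_op w then \<phi> (map op_of w) else 0) =
   (if list_all is_op cs then act_ops (map op_of cs) [g] \<phi> else 0)" for \<phi> :: "_ => ('a list => 'a, 'k) tensor_algebra"
  using assms
 proof (induction cs arbitrary: \<phi>)
  case (Cons c cs)
  show ?case
  proof (cases "is_op c")
   case True
   have hom: "homV (op_of d)" if "is_op d" "gc d" for d
    using that \<iota>_op_of[OF that(1)] gc_\<iota>[of "op_of d"] by simp
   have c: "c = \<iota> (op_of c)" "homV (op_of c)" using \<iota>_op_of[OF True] hom[OF True] Cons.prems by simp_all
   have wd: "wdeg snd (map op_of a) = wdeg dc a" if "list_all is_op a" for a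
    using that by (induction a) (auto simp: dc_\<iota>[symmetric] \<iota>_op_of simp del: dc_\<iota>)
   have unit: "on_ops P [] = [(0, P)]" if "P \<in> set (map op_of (c # cs))" "list_all is_op cs" for P
    using that hom Cons.prems True by (auto simp: on_ops_def list_all_iff brace_Nil)
   have ev: "evR c [\<iota> g] = [(0, \<iota> (brace (op_of c) [g]))]" using R_\<iota>[of "op_of c"] \<iota>_op_of[OF True] by simp
   have dcc: "dc c = snd (op_of c)" using \<iota>_op_of[OF True] dc_\<iota>[of "op_of c"] by simp
   have gs: "snd g = 1" "dc (\<iota> g) = 1" by (simp_all add: g_good)
   have IH: "actR cs [\<iota> g] (\<lambda>w. if list_all is_op w then \<phi> (op_of c # map op_of w) else 0) =
     (if list_all is_op cs then act_ops (map op_of cs) [g] (\<lambda>w. \<phi> (op_of c # w)) else 0)"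
    using Cons.IH[of "\<lambda>w. \<phi> (op_of c # w)"] Cons.prems by simp
   have filt: "(if list_all is_op (c # w) then \<phi> (map op_of (c # w)) else 0) =
     (if list_all is_op w then \<phi> (op_of c # map op_of w) else 0)" for w
    using True by simp
   show ?thesis
   proof (cases "list_all is_op cs")
    case ops: True
    have u: "on_ops (op_of c) [] = [(0, op_of c)]" "act_ops (map op_of cs) [] \<phi>' = \<phi>' (map op_of cs)" for \<phi>' :: "_ => ('a list => 'a, 'k) tensor_algebra"
     using unit[OF _ ops] by (simp, intro act_unit_right) auto
    show ?thesis
     unfolding actR_gamma_Cons ev filt IH using True ops
     by (simp add: act_Cons[of on_ops] u wd dcc add_ac distrib_right brace_Nil[OF c(2)])
   next
    case False
    then show ?thesis unfolding actR_gamma_Cons ev filt IH using True by simp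
   qed
  next
   case False
   have "lsum (evR c [\<iota> g]) (\<lambda>z. if list_all is_op (z # cs) then \<phi> (map op_of (z # cs)) else 0) =
     lsum (evR c [\<iota> g]) (\<lambda>z. 0)"
    by (rule lsum_cong) (use R_filter[OF False] in auto)
   then show ?thesis using False by (simp add: actR_gamma_Cons)
  qed
 qed simp
 from this[of "\<lambda>w. opword w"] show ?thesis unfolding OPW_def .
qed

lemma act_ops_OPW:
 assumes "homVs xs" "homVs us"
 shows "actL xs (map \<iota> us) OPW = brace_product (opword xs) (opword us)"
 using assms by (simp add: actL_OPW brace_product_words list_all_iff comp_def)

lemma comm_OPW:
 assumes "homVs us"
 shows "comm (map \<iota> us) OPW = twisted_d (opword us)"
proof -
 have "wdeg dc (map \<iota> us) = wdeg snd us" by (simp add: wdeg_def comp_def)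
 then show ?thesis
  using assms actR_OPW[of "map \<iota> us"]
  by (simp add: actL_OPW twisted_d_word commutator_def list_all_iff comp_def)
qed

lemma act_OPW_nop: "\<not> list_all is_op cs ==> actL xs cs OPW = 0"
 by (simp add: actL_OPW)

lemma comm_OPW_nop: "list_all gc cs ==> \<not> list_all is_op cs ==> comm cs OPW = 0"
 by (simp add: commutator_def actL_OPW actR_OPW)

lemma OPW_map: "OPW (map \<iota> us) = opword us"
 by (simp add: OPW_def list_all_iff comp_def)

lemma enc_Cons:
 assumes "es \<noteq> []"
 obtains m r where "enc es = m # r" "\<not> is_op m"
 using enc_not_op[OF assms] by (cases "enc es") auto

lemma enc_snoc:
 assumes "es \<noteq> []"
 obtains m r where "enc es = r @ [m]" "\<not> is_op m"
 using enc_not_op[OF assms] by (cases "enc es" rule: rev_cases) auto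

lemma spl_left:
 assumes "es \<noteq> []" "\<And>a b. bw us es vs = a @ b ==> \<not> list_all is_op a ==> f a b = 0"
 shows "spl (bw us es vs) f = spl us (\<lambda>a b. f (map \<iota> a) (bw b es vs))"
proof -
 obtain m r where m: "enc es = m # r" "\<not> is_op m" using assms(1) by (rule enc_Cons)
 have "spl (r @ map \<iota> vs) (\<lambda>a b. f (map \<iota> us @ m # a) b) = spl (r @ map \<iota> vs) (\<lambda>a b. 0)"
  by (rule spl_cong) (use m in \<open>auto intro!: assms(2)\<close>)
 then show ?thesis using spl_append_Cons[of "map \<iota> us" m "r @ map \<iota> vs" f] by (simp add: m spl_map)
qed

lemma spl_right:
 assumes "es \<noteq> []" "\<And>a b. bw us es vs = a @ b ==> \<not> list_all is_op b ==> f a b = 0"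
 shows "spl (bw us es vs) f = spl vs (\<lambda>a b. f (bw us es a) (map \<iota> b))"
proof -
 obtain m r where m: "enc es = r @ [m]" "\<not> is_op m" using assms(1) by (rule enc_snoc)
 have "spl (map \<iota> us @ r) (\<lambda>a b. f a (b @ m # map \<iota> vs)) = spl (map \<iota> us @ r) (\<lambda>a b. 0)"
  by (rule spl_cong) (use m in \<open>auto intro!: assms(2)\<close>)
 then show ?thesis using spl_append_Cons[of "map \<iota> us @ r" m "map \<iota> vs" f] by (simp add: m spl_map)
qed

text \<open>By \<open>act_split\<close>, the coaction of the result splits both words; the left
  factor is a word of operations only if it comes from leading operations of the bar word.\<close>

lemma lcoact_action:
 assumes xs: "homVs xs" and w: "homVs us" "es \<noteq> []" "homAs es" "homVs vs"
 shows "lcoact sE fscale (bar_action (opword xs) (barword us es vs)) =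
  spl xs (\<lambda>x y. spl us (\<lambda>a b. sg (wdeg snd y * wdeg snd a)
   (brace_product (opword x) (opword a) \<otimes>\<^sub>f bar_action (opword y) (barword b es vs))))"
proof -
 have "lcoact sE fscale (bar_action (opword xs) (barword us es vs)) = actL xs (bw us es vs) (\<lambda>w. lcoact sE fscale (BAR w))"
  unfolding bar_action_words[OF assms] by (rule act_additive[where h = "lcoact sE fscale"]) (rule lcoact_plus)
 also have "... = spl xs (\<lambda>x y. spl (bw us es vs) (\<lambda>e f. sg (wdeg snd y * wdeg dc e) (actL x e OPW \<otimes>\<^sub>f actL y f BAR)))"
  by (simp add: lcoact_BAR act_split act_tens)
 also have "... = spl xs (\<lambda>x y. spl us (\<lambda>a b. sg (wdeg snd y * wdeg dc (map \<iota> a)) (actL x (map \<iota> a) OPW \<otimes>\<^sub>f actL y (bw b es vs) BAR)))"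
  by (subst spl_left[OF w(2)]) (simp_all add: act_OPW_nop)
 also have "... = spl xs (\<lambda>x y. spl us (\<lambda>a b. sg (wdeg snd y * wdeg snd a)
   (brace_product (opword x) (opword a) \<otimes>\<^sub>f bar_action (opword y) (barword b es vs))))"
  using assms by (intro spl_cong) (simp add: act_ops_OPW bar_action_words wdeg_def comp_def)
 finally show ?thesis .
qed

lemma rcoact_action:
 assumes xs: "homVs xs" and w: "homVs us" "es \<noteq> []" "homAs es" "homVs vs"
 shows "rcoact sE fscale (bar_action (opword xs) (barword us es vs)) =
  spl xs (\<lambda>x y. spl vs (\<lambda>a b. sg (wdeg snd y * (wdeg snd us + (wdeg sdeg es + 1) + wdeg snd a))
   (bar_action (opword x) (barword us es a) \<otimes>\<^sub>f brace_product (opword y) (opword b))))"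
proof -
 have "rcoact sE fscale (bar_action (opword xs) (barword us es vs)) = actL xs (bw us es vs) (\<lambda>w. rcoact sE fscale (BAR w))"
  unfolding bar_action_words[OF assms] by (rule act_additive[where h = "rcoact sE fscale"]) (rule rcoact_plus)
 also have "... = spl xs (\<lambda>x y. spl (bw us es vs) (\<lambda>e f. sg (wdeg snd y * wdeg dc e) (actL x e BAR \<otimes>\<^sub>f actL y f OPW)))"
  by (simp add: rcoact_BAR act_split act_tens)
 also have "... = spl xs (\<lambda>x y. spl vs (\<lambda>a b. sg (wdeg snd y * wdeg dc (bw us es a)) (actL x (bw us es a) BAR \<otimes>\<^sub>f actL y (map \<iota> b) OPW)))"
  by (subst spl_right[OF w(2)]) (simp_all add: act_OPW_nop)
 also have "... = spl xs (\<lambda>x y. spl vs (\<lambda>a b. sg (wdeg snd y * (wdeg snd us + (wdeg sdeg es + 1) + wdeg snd a))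
   (bar_action (opword x) (barword us es a) \<otimes>\<^sub>f brace_product (opword y) (opword b))))"
  using assms by (intro spl_cong) (simp add: act_ops_OPW bar_action_words bw_good(2) del: wdeg_simps)
 finally show ?thesis .
qed

lemma lcoact_diff:
 assumes w: "homVs us" "es \<noteq> []" "homAs es" "homVs vs"
 shows "lcoact sE fscale (bar_diff (barword us es vs)) =
  spl us (\<lambda>a b. twisted_d (opword a) \<otimes>\<^sub>f barword b es vs +
   sg (wdeg snd a) (opword a \<otimes>\<^sub>f bar_diff (barword b es vs)))"
proof -
 have gw: "list_all gc (bw us es vs)" by (rule bw_good[OF w])
 have "lcoact sE fscale (bar_diff (barword us es vs)) = comm (bw us es vs) (\<lambda>w. lcoact sE fscale (BAR w))"
  unfolding bar_diff_barword[OF w] by (rule commutator_additive[where h = "lcoact sE fscale"]) (rule lcoact_plus)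
 also have "... = spl (bw us es vs) (\<lambda>e f. comm e OPW \<otimes>\<^sub>f BAR f + sg (wdeg dc e) (OPW e \<otimes>\<^sub>f comm f BAR))"
  by (simp add: lcoact_BAR commutator_split g_good R_unit commutator_tens)
 also have "... = spl us (\<lambda>a b. comm (map \<iota> a) OPW \<otimes>\<^sub>f BAR (bw b es vs) + sg (wdeg dc (map \<iota> a)) (OPW (map \<iota> a) \<otimes>\<^sub>f comm (bw b es vs) BAR))"
  by (rule spl_left[OF w(2)]) (use gw in \<open>simp add: comm_OPW_nop OPW_def\<close>)
 also have "... = spl us (\<lambda>a b. twisted_d (opword a) \<otimes>\<^sub>f barword b es vs +
   sg (wdeg snd a) (opword a \<otimes>\<^sub>f bar_diff (barword b es vs)))"
  using assms by (intro spl_cong) (simp add: comm_OPW OPW_map BAR_bw bar_diff_barword wdeg_def comp_def)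
 finally show ?thesis .
qed

lemma rcoact_diff:
 assumes w: "homVs us" "es \<noteq> []" "homAs es" "homVs vs"
 shows "rcoact sE fscale (bar_diff (barword us es vs)) =
  spl vs (\<lambda>a b. bar_diff (barword us es a) \<otimes>\<^sub>f opword b +
   sg (wdeg snd us + (wdeg sdeg es + 1) + wdeg snd a) (barword us es a \<otimes>\<^sub>f twisted_d (opword b)))"
proof -
 have gw: "list_all gc (bw us es vs)" by (rule bw_good[OF w])
 have "rcoact sE fscale (bar_diff (barword us es vs)) = comm (bw us es vs) (\<lambda>w. rcoact sE fscale (BAR w))"
  unfolding bar_diff_barword[OF w] by (rule commutator_additive[where h = "rcoact sE fscale"]) (rule rcoact_plus)
 also have "... = spl (bw us es vs) (\<lambda>e f. comm e BAR \<otimes>\<^sub>f OPW f + sg (wdeg dc e) (BAR e \<otimes>\<^sub>f comm f OPW))"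
  by (simp add: rcoact_BAR commutator_split g_good R_unit commutator_tens)
 also have "... = spl vs (\<lambda>a b. comm (bw us es a) BAR \<otimes>\<^sub>f OPW (map \<iota> b) + sg (wdeg dc (bw us es a)) (BAR (bw us es a) \<otimes>\<^sub>f comm (map \<iota> b) OPW))"
  by (rule spl_right[OF w(2)]) (use gw in \<open>simp add: comm_OPW_nop OPW_def\<close>)
 also have "... = spl vs (\<lambda>a b. bar_diff (barword us es a) \<otimes>\<^sub>f opword b +
   sg (wdeg snd us + (wdeg sdeg es + 1) + wdeg snd a) (barword us es a \<otimes>\<^sub>f twisted_d (opword b)))"
  using assms by (intro spl_cong) (simp add: comm_OPW OPW_map BAR_bw bar_diff_barword bw_good(2) del: wdeg_simps)
 finally show ?thesis .
qed

theorem bar_differential_model: "bar_differential sE E fscale W twisted_d bar_diff"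
proof
 show "graded_map fscale (bar_gr sE E fscale W) fscale (bar_gr sE E fscale W) 1 bar_diff"
  unfolding graded_map_def lin_on_def by (simp add: bar_diff_linear bar_diff_gr)
 show "z \<in> BT ==> bar_diff (bar_diff z) = 0" for z
  by (rule bar_diff_square)
next
 fix us ds w k vs es assume us: "hom_word E us ds" and w: "w \<in> W k" and vs: "hom_word E vs es"
 from us obtain us' where us': "homVs us'" "us = map fst us'" "ds = map snd us'" by (rule hom_wordE)
 from vs obtain vs' where vs': "homVs vs'" "vs = map fst vs'" "es = map snd vs'" by (rule hom_wordE)
 let ?L = "\<lambda>w. lcoact sE fscale (bar_diff (barw sE fscale us w vs))"
 let ?R = "\<lambda>w. \<Sum>j\<le>length us. twisted_d (word sE (take j us)) \<otimes>\<^sub>f barw sE fscale (drop j us) w vs +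
   fscale (ksign (sum_list (take j ds))) (word sE (take j us) \<otimes>\<^sub>f bar_diff (barw sE fscale (drop j us) w vs))"
 show "?L w = ?R w"
  by (rule chain_gr_induct[where P = "\<lambda>w. ?L w = ?R w", OF w])
   (use us' vs' in \<open>simp_all add: lcoact_diff spl_atMost fscale_ksign wdeg_def take_map drop_map
    barw_w bar_diff_linear lcoact_plus lcoact_scale tens_plus tens_scale sg_add sg_fscale fscale_sum fscale_plus sum.distrib lcoact_zero\<close>)
 let ?L' = "\<lambda>w. rcoact sE fscale (bar_diff (barw sE fscale us w vs))"
 let ?R' = "\<lambda>w. \<Sum>j\<le>length vs. bar_diff (barw sE fscale us w (take j vs)) \<otimes>\<^sub>f word sE (drop j vs) +
   fscale (ksign (sum_list ds + k + sum_list (take j es))) (barw sE fscale us w (take j vs) \<otimes>\<^sub>f twisted_d (word sE (drop j vs)))"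
 show "?L' w = ?R' w"
  by (rule chain_gr_induct[where P = "\<lambda>w. ?L' w = ?R' w", OF w])
   (use us' vs' in \<open>simp_all add: rcoact_diff spl_atMost fscale_ksign wdeg_def take_map drop_map
    barw_w bar_diff_linear rcoact_plus rcoact_scale tens_plus tens_scale sg_add sg_fscale fscale_sum fscale_plus sum.distrib rcoact_zero\<close>)
qed

text \<open>All module laws are identities for \<open>act\<close> on words, transported along
  \<open>on_bar\<close>.\<close>

theorem left_Binf_module_model:
 "left_Binf_module sE E twisted_d brace_product fscale W bar_diff bar_action"
proof -
 interpret B: Binf_algebra sE E twisted_d brace_product by (rule Binf_algebra_braces)
 interpret D: bar_differential sE E fscale W twisted_d bar_diff by (rule bar_differential_model)
 show ?thesis
 proof
  show "graded_bilinear fscale (tensor_gr sE E) fscale (bar_gr sE E fscale W) fscale (bar_gr sE E fscale W) bar_action"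
   unfolding graded_bilinear_def lin_on_def
   by (auto simp: bar_action_left bar_action_right bar_action_gr)
  show "bar_action (word sE []) z = z" if "z \<in> BT" for z
  proof -
   have nil: "word sE [] \<in> TT" using opword_total[of "[]"] by simp
   have "bar_action (opword []) z = z"
    by (rule bar_total_induct[where P = "\<lambda>z. bar_action (opword []) z = z", OF that])
     (use bar_action_words[of "[]"] nil BAR_bw in \<open>simp_all add: bar_action_right\<close>)
   then show ?thesis by simp
  qed
  show "bar_action (brace_product x y) z = bar_action x (bar_action y z)" if "x \<in> TT" "y \<in> TT" "z \<in> BT" for x y z
   by (rule bar_action_assoc[OF that])
  show "bar_diff (bar_action x z) = bar_action (twisted_d x) z + fscale (ksign i) (bar_action x (bar_diff z))"
   if "x \<in> tensor_gr sE E i" "z \<in> BT" for x i z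
   using bar_diff_derivation[OF that] by (simp add: fscale_ksign)
 next
  fix xs cs us ds w k vs es
  assume xs: "hom_word E xs cs" and us: "hom_word E us ds" and w: "w \<in> W k" and vs: "hom_word E vs es"
  from xs obtain xs' where xs': "homVs xs'" "xs = map fst xs'" "cs = map snd xs'" by (rule hom_wordE)
  from us obtain us' where us': "homVs us'" "us = map fst us'" "ds = map snd us'" by (rule hom_wordE)
  from vs obtain vs' where vs': "homVs vs'" "vs = map fst vs'" "es = map snd vs'" by (rule hom_wordE)
  have bT: "barw sE fscale (map fst us') w (map fst vs') \<in> BT" if "homVs us'" "homVs vs'" "w \<in> W k" for us' vs' w
   by (rule chain_gr_induct[where P = "\<lambda>w. barw sE fscale (map fst us') w (map fst vs') \<in> BT", OF that(3)])
    (use that in \<open>simp_all add: barw_w BT_closed barword_total\<close>)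
  have b1: "barw sE fscale (drop j us) w vs \<in> BT" "barw sE fscale us w (take j vs) \<in> BT" "barw sE fscale us w vs \<in> BT"
   if "w \<in> W k" for j w
   using bT[of "drop j us'" vs' w] bT[of us' "take j vs'" w] bT[of us' vs' w] us' vs' that
   by (auto simp: drop_map take_map list_all_iff dest: in_set_dropD in_set_takeD)
  have x1: "word sE (take j xs) \<in> TT" "word sE (drop j xs) \<in> TT" "word sE xs \<in> TT" for j
   using opword_total[of "take j xs'"] opword_total[of "drop j xs'"] opword_total[of xs'] xs'
   by (auto simp: drop_map take_map list_all_iff dest: in_set_dropD in_set_takeD)
  let ?L = "\<lambda>w. lcoact sE fscale (bar_action (word sE xs) (barw sE fscale us w vs))"
  let ?R = "\<lambda>w. \<Sum>i\<le>length xs. \<Sum>j\<le>length us.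
    fscale (ksign (sum_list (drop i cs) * sum_list (take j ds)))
     (brace_product (word sE (take i xs)) (word sE (take j us)) \<otimes>\<^sub>f bar_action (word sE (drop i xs)) (barw sE fscale (drop j us) w vs))"
  show "?L w = ?R w"
   by (rule chain_gr_induct[where P = "\<lambda>w. ?L w = ?R w", OF w])
    (use xs' us' vs' in \<open>simp_all add: lcoact_action spl_atMost fscale_ksign wdeg_def take_map drop_map
     barw_w bar_action_right b1 x1 lcoact_plus lcoact_scale tens_plus tens_scale sg_add sg_fscale fscale_sum sum.distrib lcoact_zero
     x1[unfolded xs'(2) take_map drop_map] b1[unfolded us'(2) vs'(2) take_map drop_map]\<close>)
  let ?L' = "\<lambda>w. rcoact sE fscale (bar_action (word sE xs) (barw sE fscale us w vs))"
  let ?R' = "\<lambda>w. \<Sum>i\<le>length xs. \<Sum>j\<le>length vs.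
    fscale (ksign (sum_list (drop i cs) * (sum_list ds + k + sum_list (take j es))))
     (bar_action (word sE (take i xs)) (barw sE fscale us w (take j vs)) \<otimes>\<^sub>f brace_product (word sE (drop i xs)) (word sE (drop j vs)))"
  show "?L' w = ?R' w"
   by (rule chain_gr_induct[where P = "\<lambda>w. ?L' w = ?R' w", OF w])
    (use xs' us' vs' in \<open>simp_all add: rcoact_action spl_atMost fscale_ksign wdeg_def take_map drop_map
     barw_w bar_action_right b1 x1 rcoact_plus rcoact_scale tens_plus tens_scale sg_add sg_fscale fscale_sum sum.distrib rcoact_zero
     x1[unfolded xs'(2) take_map drop_map] b1[unfolded us'(2) vs'(2) take_map drop_map]\<close>)
 qed
qed

end

section \<open>Letters for the cyclic action\<close>

lemma word_multilinear_subword: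
 assumes "word_multilinear t R g \<phi>" "list_all g p" "list_all g q"
 shows "word_multilinear t R g (\<lambda>a. \<phi> (p @ a @ q))"
proof (rule word_multilinearI)
 fix l r z a z1 b z2 assume "list_all g l" "list_all g r" "(z, a, z1, b, z2) \<in> R"
 then show "\<phi> (p @ (l @ z # r) @ q) = t a (\<phi> (p @ (l @ z1 # r) @ q)) + t b (\<phi> (p @ (l @ z2 # r) @ q))"
  using word_multilinearD[OF assms(1), of "p @ l" "r @ q"] assms(2,3) by simp
qed

context curved_Ainf_algebra
begin

type_synonym 'b cyclic_letter = "('b oper) + ('b \<times> int) list"

definition cdeg :: "'a cyclic_letter => int" where
 "cdeg c = (case c of Inl P => snd P | Inr es => wdeg sdeg es + 1)"

definition cgood :: "'a cyclic_letter => bool" where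
 "cgood c = (case c of Inl P => homV P | Inr es => es \<noteq> [] \<and> homAs es)"

lemma cletter_simps [simp]:
 "cdeg (Inl P) = snd P" "cdeg (Inr es) = wdeg sdeg es + 1"
 "cgood (Inl P) = homV P" "cgood (Inr es) \<longleftrightarrow> es \<noteq> [] \<and> homAs es"
 by (simp_all add: cdeg_def cgood_def)

definition crel :: "('a cyclic_letter, 'k) linear_relations" where
 "crel = {(Inl z, a, Inl z1, b, Inl z2) | z a z1 b z2. (z, a, z1, b, z2) \<in> relV} \<union>
   {(Inr (l @ z # r), a, Inr (l @ z1 # r), b, Inr (l @ z2 # r)) | l r z a z1 b z2.
    homAs l \<and> homAs r \<and> (z, a, z1, b, z2) \<in> relA}"

text \<open>The value of \<open>P\<close> on the block \<open>u, (e\<^sub>0|e), v\<close>: the tail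
  \<open>e\<close> is cut into \<open>e1, e2, e3\<close>, the operations \<open>u\<close> are
  inserted into \<open>e3\<close> and \<open>v\<close> into \<open>e1\<close>, and \<open>P\<close>
  is applied to \<open>e3, e\<^sub>0, e1\<close>. The sign rotates \<open>e3\<close> to the front
  and moves \<open>v\<close> from behind the chain to \<open>e1\<close>.\<close>

definition cyclic :: "'a oper => ('a oper) list => ('a \<times> int) list =>
  ('a oper) list => (int \<times> 'a cyclic_letter) list" where
 "cyclic P u es v = (case es of [] => [] | e0 # e =>
   bind (splits e) (\<lambda>(e1, r). bind (splits r) (\<lambda>(e2, e3). bind (inserted on_args snd sdeg u e3) (\<lambda>ua.
    map (\<lambda>(n, vb). ((sdeg e0 + wdeg sdeg e1 + wdeg sdeg e2) * wdeg sdeg e3 + wdeg snd v * (wdeg sdeg e1 + wdeg sdeg e2 + 1) + n,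
      Inr (apply_op P (ua @ e0 # vb) # e2)))
     (inserted on_args snd sdeg v e1)))))"

lemma lsum_cyclic:
 "lsum (cyclic P u (e0 # e) v) k = spl e (\<lambda>e1 r. spl r (\<lambda>e2 e3.
   sg ((sdeg e0 + wdeg sdeg e1 + wdeg sdeg e2) * wdeg sdeg e3 + wdeg snd v * (wdeg sdeg e1 + wdeg sdeg e2 + 1))
    (act_args u e3 (\<lambda>ua. act_args v e1 (\<lambda>vb. k (Inr (apply_op P (ua @ e0 # vb) # e2)))))))"
 by (simp add: cyclic_def spl_def split_beta lsum_shift lsum_sg act_def)

lemma cyclic_Nil [simp]: "cyclic P u [] v = []"
 by (simp add: cyclic_def)

text \<open>On a block of operations the value is the brace, on a block with one chain the cyclic
  value, and there is no value on a block with several chains.\<close>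

definition ev_cyclic :: "('a oper, 'a cyclic_letter) operation" where
 "ev_cyclic P cs = (if list_all isl cs then [(0, Inl (brace P (map projl cs)))] else
   if list_all isl (tl (dropWhile isl cs))
   then cyclic P (map projl (takeWhile isl cs)) (projr (hd (dropWhile isl cs))) (map projl (tl (dropWhile isl cs)))
   else [])"

text \<open>Right multiplication inserts the operation into the tail of a chain. The sign moves the
  operation from behind the chain to its beginning; it is what turns the commutator with
  \<open>\<gamma>\<close> into the difference of the two actions.\<close>

definition ev_cyclic_right :: "('a cyclic_letter, 'a cyclic_letter) operation" where
 "ev_cyclic_right c ys = (if ys = [] then [(0, c)] else if length ys = 1 \<and> isl (hd ys) then
   (let Q = projl (hd ys) in case c of Inl P => [(0, Inl (brace P [Q]))]
   | Inr es => (case es of [] => [] | e0 # e =>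
     map (\<lambda>(n, w). (snd Q * wdeg sdeg e + n, Inr (e0 # w))) (inserted on_args snd sdeg [Q] e)))
   else [])"

lemma isl_map_Inl [simp]: "list_all isl (map Inl us)"
 by (induction us) auto

lemma isl_words: "list_all isl cs ==> \<exists>us. cs = map Inl us"
 by (induction cs) (auto simp: isl_def intro: exI[of _ "_ # _"])

lemma ev_cyclic_Inl [simp]: "ev_cyclic P (map Inl us) = [(0, Inl (brace P us))]"
 by (simp add: ev_cyclic_def comp_def)

lemma parse_Inr:
 "takeWhile isl (map Inl us @ Inr es # r) = map Inl us" "dropWhile isl (map Inl us @ Inr es # r) = Inr es # r"
 by (simp_all add: takeWhile_append dropWhile_append comp_def)

lemma ev_cyclic_Inr [simp]: "ev_cyclic P (map Inl us @ Inr es # map Inl vs) = cyclic P us es vs"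
 by (simp add: ev_cyclic_def parse_Inr comp_def)

lemma ev_cyclic_many: "\<not> list_all isl r ==> ev_cyclic P (map Inl us @ Inr es # r) = []"
 by (simp add: ev_cyclic_def parse_Inr)

lemma cword_cases:
 obtains us where "cs = map Inl us" | us es vs where "cs = map Inl us @ Inr es # map Inl vs"
 | us es r where "cs = map Inl us @ Inr es # r" "\<not> list_all isl r"
proof (cases "list_all isl cs")
 case True
 then show ?thesis using isl_words that(1) by blast
next
 case False
 have "list_all isl (takeWhile isl cs)" by (auto simp: list_all_iff dest: set_takeWhileD)
 then obtain us where us: "takeWhile isl cs = map Inl us" using isl_words by blast
 obtain c r where d: "dropWhile isl cs = c # r" using False
  by (cases "dropWhile isl cs") (auto simp: list_all_iff dropWhile_eq_Nil_conv)
 then have "\<not> isl c" using hd_dropWhile[of isl cs] by simp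
 then obtain es where "c = Inr es" by (cases c) auto
 then have cs: "cs = map Inl us @ Inr es # r" using takeWhile_dropWhile_id[of isl cs] us d by simp
 show ?thesis
 proof (cases "list_all isl r")
  case True
  then show ?thesis using isl_words[OF True] cs that(2) by blast
 qed (use cs that(3) in blast)
qed

text \<open>Blocks with several chains have no value and do not occur in bar words, which contain
  one chain; the laws below are stated for blocks with at most one.\<close>

definition one_chain :: "'a cyclic_letter list => bool" where
 "one_chain cs \<longleftrightarrow> length (filter (\<lambda>c. \<not> isl c) cs) \<le> 1"

lemma one_chain_cases:
 assumes "one_chain cs"
 obtains us where "cs = map Inl us" | us es vs where "cs = map Inl us @ Inr es # map Inl vs"
proof (cases cs rule: cword_cases)
 case (3 us es r)
 then have "filter (\<lambda>c. \<not> isl c) r \<noteq> []" by (auto simp: list_all_iff filter_empty_conv)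
 with assms 3 show ?thesis by (auto simp: one_chain_def)
qed (use that in auto)

lemma ev_right_simps [simp]:
 "ev_cyclic_right c [] = [(0, c)]"
 "ev_cyclic_right (Inl P) [Inl Q] = [(0, Inl (brace P [Q]))]"
 "ev_cyclic_right (Inr []) [Inl Q] = []"
 by (simp_all add: ev_cyclic_right_def Let_def)

lemma lsum_ev_right:
 "lsum (ev_cyclic_right (Inr (e0 # e)) [Inl Q]) k = sg (snd Q * wdeg sdeg e) (act_args [Q] e (\<lambda>w. k (Inr (e0 # w))))"
 by (simp add: ev_cyclic_right_def Let_def lsum_shift act_def)

lemma ev_right_cases:
 assumes "ev_cyclic_right c ys \<noteq> []"
 obtains "ys = []" | Q where "ys = [Inl Q]"
 using assms unfolding ev_cyclic_right_def
 by (cases ys) (auto split: if_splits simp: isl_def)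

lemma graded_crel: "graded_relations cgood cdeg crel"
proof -
 have "homA z \<and> homA z1 \<and> homA z2 \<and> sdeg z1 = sdeg z \<and> sdeg z2 = sdeg z" if "(z, a, z1, b, z2) \<in> relA" for z a z1 b z2
  using graded_relA that unfolding graded_relations_def by fastforce
 moreover have "homV z \<and> homV z1 \<and> homV z2 \<and> snd z1 = snd z \<and> snd z2 = snd z" if "(z, a, z1, b, z2) \<in> relV" for z a z1 b z2
  using graded_relV that unfolding graded_relations_def by fastforce
 ultimately show ?thesis unfolding graded_relations_def crel_def by fastforce
qed

lemma cyclic_graded:
 assumes "homV P" "homVs u" "homAs es" "homVs v" "(n, z) \<in> set (cyclic P u es v)"
 shows "cgood z \<and> cdeg z = snd P + (wdeg snd u + (wdeg sdeg es + 1) + wdeg snd v)"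
proof -
 obtain e0 e where es: "es = e0 # e" using assms(5) by (cases es) auto
 obtain e1 e2 e3 i ua j vb where e: "e = e1 @ e2 @ e3" and ua: "(i, ua) \<in> set (inserted on_args snd sdeg u e3)"
  and vb: "(j, vb) \<in> set (inserted on_args snd sdeg v e1)" and z: "z = Inr (apply_op P (ua @ e0 # vb) # e2)"
  using assms(5) unfolding es cyclic_def by (auto elim!: set_bindE dest!: splits_append)
 have g: "homAs e1" "homAs e2" "homAs e3" "homA e0" using assms(3) es e by auto
 note A = inserted_graded[OF graded_on_args assms(2) g(3) ua] and B = inserted_graded[OF graded_on_args assms(4) g(1) vb]
 have "homA (apply_op P (ua @ e0 # vb))" using A B g by (intro End_apply[OF assms(1)]) auto
 then show ?thesis using A B g by (simp add: z es e)
qed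

lemma graded_ev_cyclic: "graded_operation homV snd cgood cdeg ev_cyclic"
 unfolding graded_operation_def
proof (intro allI impI, elim conjE)
 fix P b n z assume P: "homV P" and b: "list_all cgood b" and z: "(n, z) \<in> set (ev_cyclic P b)"
 have wd: "wdeg cdeg (map Inl us) = wdeg snd us" for us by (induction us) auto
 have gd: "list_all cgood (map Inl us) = homVs us" for us by (induction us) auto
 show "cgood z \<and> cdeg z = snd P + wdeg cdeg b"
 proof (cases b rule: cword_cases)
  case (1 us)
  then show ?thesis using z b brace_homogeneous[OF P] by (simp add: wd gd)
 next
  case (2 us es vs)
  then show ?thesis using z b cyclic_graded[OF P, of us es vs n z] by (simp add: wd gd)
 next
  case (3 us es r)
  then show ?thesis using z by (simp add: ev_cyclic_many)
 qed
qed

lemma graded_ev_right: "graded_operation cgood cdeg cgood cdeg ev_cyclic_right"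
 unfolding graded_operation_def
proof (intro allI impI, elim conjE)
 fix c b n z assume c: "cgood c" and b: "list_all cgood b" and z: "(n, z) \<in> set (ev_cyclic_right c b)"
 then have "ev_cyclic_right c b \<noteq> []" by auto
 then show "cgood z \<and> cdeg z = cdeg c + wdeg cdeg b"
 proof (cases rule: ev_right_cases)
  case 1
  then show ?thesis using z c by simp
 next
  case (2 Q)
  show ?thesis
  proof (cases c)
   case (Inl P)
   then show ?thesis using z c b 2 brace_homogeneous[of P "[Q]"] by simp
  next
   case (Inr es)
   then obtain e0 e where es: "es = e0 # e" using c by (cases es) auto
   then obtain m w where w: "(m, w) \<in> set (inserted on_args snd sdeg [Q] e)" "z = Inr (e0 # w)"
    using z unfolding ev_cyclic_right_def 2 Inr by (auto simp: Let_def)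
   have "homVs [Q]" "homAs e" using b c 2 Inr es by auto
   from inserted_graded[OF graded_on_args this w(1)] show ?thesis
    using w c b 2 Inr es by simp
  qed
 qed
qed

lemma linear_along_Inl: "linear_along t crel k ==> linear_along t relV (\<lambda>P. k (Inl P))"
 by (rule linear_alongI) (auto elim!: linear_alongD simp: crel_def)

lemma word_multilinear_Inr: "linear_along t crel k ==> word_multilinear t relA homA (\<lambda>es. k (Inr es))"
 by (rule word_multilinearI) (auto elim!: linear_alongD simp: crel_def)

lemma linear_along_first:
 assumes "linear_along t crel k" "homAs e2"
 shows "linear_along t relA (\<lambda>x. k (Inr (x # e2)))"
 using word_multilinear_linear_along[OF word_multilinear_Inr[OF assms(1)], of "[]" e2] assms(2) by simp

context
 fixes k :: "'a cyclic_letter => ('a, 'k) chain_bar"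
 assumes k: "linear_along fscale crel k"
begin

lemma output_multilinear:
 assumes "homV P" "homAs e2"
 shows "word_multilinear fscale relA homA (\<lambda>w. k (Inr (apply_op P w # e2)))"
 using on_args_multilinear[OF assms(1) linear_along_first[OF k assms(2)]] by simp

lemma output_left:
 assumes "homV P" "homAs e2" "homA e0" "homAs vb"
 shows "word_multilinear fscale relA homA (\<lambda>ua. k (Inr (apply_op P (ua @ e0 # vb) # e2)))"
 using word_multilinear_subword[OF output_multilinear[OF assms(1,2)], of "[]" "e0 # vb"] assms by simp

lemma output_right:
 assumes "homV P" "homAs e2" "homA e0" "homAs ua"
 shows "word_multilinear fscale relA homA (\<lambda>vb. k (Inr (apply_op P (ua @ e0 # vb) # e2)))"
 using word_multilinear_subword[OF output_multilinear[OF assms(1,2)], of "ua @ [e0]" "[]"] assms by simp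

lemma cyclic_multilinear_left:
 assumes P: "homV P" and e: "homA e0" "homAs e" and v: "homVs v"
 shows "word_multilinear fscale relV homV (\<lambda>u. lsum (cyclic P u (e0 # e) v) k)"
 unfolding lsum_cyclic
proof (intro vector_space.word_multilinear_spl_param[OF vs_f])
 fix e1 r e2 e3 assume "e = e1 @ r" "r = e2 @ e3"
 then have g: "homAs e1" "homAs e2" "homAs e3" using e by auto
 have "word_multilinear fscale relV homV (\<lambda>u. act_args u e3 (\<lambda>ua. act_args v e1 (\<lambda>vb. k (Inr (apply_op P (ua @ e0 # vb) # e2)))))"
  by (rule act_args_multilinear_ops[OF vs_f g(3)],
    rule vector_space.word_multilinear_act_param[OF vs_f graded_on_args v g(1)],
    rule output_left[OF P g(2) e(1)])
 from vector_space.word_multilinear_sg[OF vs_f this graded_relV, of "\<lambda>_. (sdeg e0 + wdeg sdeg e1 + wdeg sdeg e2) * wdeg sdeg e3 + wdeg snd v * (wdeg sdeg e1 + wdeg sdeg e2 + 1)"]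
 show "word_multilinear fscale relV homV (\<lambda>u. sg ((sdeg e0 + wdeg sdeg e1 + wdeg sdeg e2) * wdeg sdeg e3 + wdeg snd v * (wdeg sdeg e1 + wdeg sdeg e2 + 1))
   (act_args u e3 (\<lambda>ua. act_args v e1 (\<lambda>vb. k (Inr (apply_op P (ua @ e0 # vb) # e2))))))" .
qed

lemma cyclic_multilinear_right:
 assumes P: "homV P" and e: "homA e0" "homAs e" and u: "homVs u"
 shows "word_multilinear fscale relV homV (\<lambda>v. lsum (cyclic P u (e0 # e) v) k)"
 unfolding lsum_cyclic
proof (intro vector_space.word_multilinear_spl_param[OF vs_f])
 fix e1 r e2 e3 assume "e = e1 @ r" "r = e2 @ e3"
 then have g: "homAs e1" "homAs e2" "homAs e3" using e by auto
 have "word_multilinear fscale relV homV (\<lambda>v. act_args u e3 (\<lambda>ua. act_args v e1 (\<lambda>vb. k (Inr (apply_op P (ua @ e0 # vb) # e2)))))"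
  by (rule vector_space.word_multilinear_act_param[OF vs_f graded_on_args u g(3)],
    rule act_args_multilinear_ops[OF vs_f g(1)], rule output_right[OF P g(2) e(1)])
 from vector_space.word_multilinear_sg[OF vs_f this graded_relV, of "\<lambda>n. (sdeg e0 + wdeg sdeg e1 + wdeg sdeg e2) * wdeg sdeg e3 + n * (wdeg sdeg e1 + wdeg sdeg e2 + 1)"]
 show "word_multilinear fscale relV homV (\<lambda>v. sg ((sdeg e0 + wdeg sdeg e1 + wdeg sdeg e2) * wdeg sdeg e3 + wdeg snd v * (wdeg sdeg e1 + wdeg sdeg e2 + 1))
   (act_args u e3 (\<lambda>ua. act_args v e1 (\<lambda>vb. k (Inr (apply_op P (ua @ e0 # vb) # e2))))))" .
qed

lemma cyclic_multilinear_chain: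
 assumes P: "homV P" and u: "homVs u" and v: "homVs v"
 shows "word_multilinear fscale relA homA (\<lambda>es. lsum (cyclic P u es v) k)"
proof (rule word_multilinearI)
 fix l r z a z1 b z2 assume lr: "homAs l" "homAs r" and rel: "(z, a, z1, b, z2) \<in> relA"
 have zg: "homA z" "homA z1" "homA z2" "sdeg z1 = sdeg z" "sdeg z2 = sdeg z"
  using graded_relA rel unfolding graded_relations_def by auto
 define s where "s x1 x2 e0 e3 = (e0 + x1 + x2) * e3 + wdeg snd v * (x1 + x2 + 1)" for x1 x2 e0 e3 :: int
 define F where "F e0 e1 e2 e3 = act_args u e3 (\<lambda>ua. act_args v e1 (\<lambda>vb. k (Inr (apply_op P (ua @ e0 # vb) # e2))))" for e0 e1 e2 e3
 have F1: "word_multilinear fscale relA homA (\<lambda>e1. F e0 e1 e2 e3)" if "homA e0" "homAs e2" "homAs e3" for e0 e2 e3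
  unfolding F_def
  by (rule vector_space.word_multilinear_act_param[OF vs_f graded_on_args u that(3)],
    rule act_args_multilinear[OF vs_f v], rule output_right[OF P that(2,1)])
 have F3: "word_multilinear fscale relA homA (\<lambda>e3. F e0 e1 e2 e3)" if "homA e0" "homAs e1" "homAs e2" for e0 e1 e2
  unfolding F_def
  by (rule act_args_multilinear[OF vs_f u],
    rule vector_space.word_multilinear_act_param[OF vs_f graded_on_args v that(2)], rule output_left[OF P that(3,1)])
 have F2: "word_multilinear fscale relA homA (\<lambda>e2. F e0 e1 e2 e3)" if "homA e0" "homAs e1" "homAs e3" for e0 e1 e3
  unfolding F_def
 proof (rule vector_space.word_multilinear_act_param[OF vs_f graded_on_args u that(3)],
   rule vector_space.word_multilinear_act_param[OF vs_f graded_on_args v that(2)])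
  fix ua vb assume "homAs ua" "homAs vb"
  then have "homA (apply_op P (ua @ e0 # vb))" using that by (intro End_apply[OF P]) auto
  then show "word_multilinear fscale relA homA (\<lambda>e2. k (Inr (apply_op P (ua @ e0 # vb) # e2)))"
   using word_multilinear_subword[OF word_multilinear_Inr[OF k], of "[apply_op P (ua @ e0 # vb)]" "[]"] by simp
 qed
 show "lsum (cyclic P u (l @ z # r) v) k = fscale a (lsum (cyclic P u (l @ z1 # r) v) k) + fscale b (lsum (cyclic P u (l @ z2 # r) v) k)"
 proof (cases l)
  case Nil
  have "F z e1 e2 e3 = fscale a (F z1 e1 e2 e3) + fscale b (F z2 e1 e2 e3)"
   if "homAs e1" "homAs e2" "homAs e3" for e1 e2 e3
  proof -
   have "linear_along fscale relA (\<lambda>e0. F e0 e1 e2 e3)"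
    unfolding F_def
   proof (rule vector_space.linear_along_act[OF vs_f graded_on_args u that(3)],
     rule vector_space.linear_along_act[OF vs_f graded_on_args v that(1)])
    fix ua vb assume "homAs ua" "homAs vb"
    then show "linear_along fscale relA (\<lambda>e0. k (Inr (apply_op P (ua @ e0 # vb) # e2)))"
     by (rule word_multilinear_linear_along[OF output_multilinear[OF P that(2)]])
   qed
   from linear_alongD[OF this rel] show ?thesis .
  qed
  then have "spl r (\<lambda>e1 r. spl r (\<lambda>e2 e3. sg (s (wdeg sdeg e1) (wdeg sdeg e2) (sdeg z) (wdeg sdeg e3)) (F z e1 e2 e3))) =
   spl r (\<lambda>e1 r. spl r (\<lambda>e2 e3. fscale a (sg (s (wdeg sdeg e1) (wdeg sdeg e2) (sdeg z) (wdeg sdeg e3)) (F z1 e1 e2 e3)) +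
    fscale b (sg (s (wdeg sdeg e1) (wdeg sdeg e2) (sdeg z) (wdeg sdeg e3)) (F z2 e1 e2 e3))))"
   by (intro spl_cong) (use lr in \<open>simp add: sg_add sg_fscale\<close>)
  then show ?thesis
   unfolding Nil append_Nil lsum_cyclic F_def[symmetric]
   by (simp add: spl_plus spl_additive[of "fscale a", OF fscale_plus] spl_additive[of "fscale b", OF fscale_plus] s_def zg)
 next
  case (Cons e0 l')
  then have e0: "homA e0" and l': "homAs l'" using lr by auto
  have "word_multilinear fscale relA homA (\<lambda>e. spl e (\<lambda>e1 r. spl r (\<lambda>e2 e3.
    sg (s (wdeg sdeg e1) (wdeg sdeg e2) (sdeg e0) (wdeg sdeg e3)) (F e0 e1 e2 e3))))"
  proof (intro vector_space.word_multilinear_spl[OF vs_f graded_relA] vector_space.word_multilinear_spl_param[OF vs_f])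
   fix r e2 e3 assume "homAs r" "r = e2 @ e3"
   then show "word_multilinear fscale relA homA (\<lambda>e1. sg (s (wdeg sdeg e1) (wdeg sdeg e2) (sdeg e0) (wdeg sdeg e3)) (F e0 e1 e2 e3))"
    by (intro vector_space.word_multilinear_sg[OF vs_f _ graded_relA] F1 e0) auto
  next
   fix e1 e3 assume "homAs e1" "homAs e3"
   then show "word_multilinear fscale relA homA (\<lambda>e2. sg (s (wdeg sdeg e1) (wdeg sdeg e2) (sdeg e0) (wdeg sdeg e3)) (F e0 e1 e2 e3))"
    by (intro vector_space.word_multilinear_sg[OF vs_f _ graded_relA] F2 e0)
  next
   fix e1 e2 assume "homAs e1" "homAs e2"
   then show "word_multilinear fscale relA homA (\<lambda>e3. sg (s (wdeg sdeg e1) (wdeg sdeg e2) (sdeg e0) (wdeg sdeg e3)) (F e0 e1 e2 e3))"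
    by (intro vector_space.word_multilinear_sg[OF vs_f _ graded_relA] F3 e0)
  qed
  from word_multilinearD[OF this l' lr(2) rel] show ?thesis
   unfolding Cons append_Cons lsum_cyclic F_def[symmetric] by (simp add: s_def)
 qed
qed

lemma cyclic_linear_op:
 assumes u: "homVs u" and es: "homAs es" and v: "homVs v"
 shows "linear_along fscale relV (\<lambda>P. lsum (cyclic P u es v) k)"
proof (cases es)
 case Nil
 then show ?thesis by (simp add: vector_space.linear_along_zero[OF vs_f])
next
 case (Cons e0 e)
 show ?thesis
  unfolding Cons lsum_cyclic
 proof (intro vector_space.linear_along_spl[OF vs_f] vector_space.linear_along_sg[OF vs_f])
  fix e1 r e2 e3 assume "e = e1 @ r" "r = e2 @ e3"
  then have g: "homAs e1" "homAs e2" "homAs e3" "homA e0" using es Cons by auto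
  show "linear_along fscale relV (\<lambda>P. act_args u e3 (\<lambda>ua. act_args v e1 (\<lambda>vb. k (Inr (apply_op P (ua @ e0 # vb) # e2)))))"
  proof (rule vector_space.linear_along_act[OF vs_f graded_on_args u g(3)],
    rule vector_space.linear_along_act[OF vs_f graded_on_args v g(1)])
   fix ua vb assume "homAs ua" "homAs vb"
   then show "linear_along fscale relV (\<lambda>P. k (Inr (apply_op P (ua @ e0 # vb) # e2)))"
    using on_args_linear[OF _ linear_along_first[OF k g(2)], of "ua @ e0 # vb"] g(4) by simp
  qed
 qed
qed

end

end

context curved_Ainf_algebra
begin

section \<open>The cyclic value of a brace\<close>

abbreviation "act_cyclic \<equiv> act ev_cyclic snd cdeg"
abbreviation "act_cyclic_right \<equiv> act ev_cyclic_right cdeg cdeg"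

lemma wdeg_Inl [simp]: "wdeg cdeg (map Inl us) = wdeg snd us"
 by (induction us) auto

lemma cgood_Inl [simp]: "list_all cgood (map Inl us) = homVs us"
 by (induction us) auto

lemma act_cyclic_Inl: "act_cyclic y (map Inl u) \<phi> = act_ops y u (\<lambda>w. \<phi> (map Inl w))"
 by (induction y arbitrary: u \<phi>) (simp_all add: act_Cons spl_map)

lemma act_cyclic_right_Inl:
 "homVs u ==> act_cyclic_right (map Inl u) [Inl Q] \<phi> = act_ops u [Q] (\<lambda>w. \<phi> (map Inl w))"
proof (induction u arbitrary: \<phi>)
 case (Cons P u)
 have u: "act_ops u [] \<phi>' = \<phi>' u" for \<phi>' :: "_ => 'b"
  by (rule act_unit_right) (use Cons.prems brace_Nil in \<open>auto simp: on_ops_def list_all_iff\<close>)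
 show ?case
  using Cons by (simp add: act_Cons u act_unit_right brace_Nil)
qed simp

context
 fixes k :: "'a cyclic_letter => ('a, 'k) chain_bar" and P y u v e0 e
 assumes k: "linear_along fscale crel k" and P: "homV P" and y: "homVs y" and u: "homVs u"
  and v: "homVs v" and e0: "homA e0" and e: "homAs e"
begin

abbreviation (input) "out e2 w \<equiv> k (Inr (apply_op P w # e2))"

text \<open>The entry \<open>e\<^sub>0\<close> is not an argument of any of the operations
  \<open>y\<close>: those in front of \<open>e\<^sub>0\<close> are applied after \<open>u\<close>,
  those behind it after \<open>v\<close>, and both compositions are braces.\<close>

lemma cyclic_brace_outside:
 assumes g: "homAs e1" "homAs e2" "homAs e3" and y12: "y = y1 @ y2"
 shows "act_args u e3 (\<lambda>ua. act_args v e1 (\<lambda>vb. act_args y1 ua (\<lambda>a. act_args y2 vb (\<lambda>b. out e2 (a @ e0 # b))))) =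
  act_ops y1 u (\<lambda>a'. act_ops y2 v (\<lambda>b'. act_args a' e3 (\<lambda>a. act_args b' e1 (\<lambda>b. out e2 (a @ e0 # b)))))"
proof -
 have gy: "homVs y1" "homVs y2" using y y12 by auto
 have inner: "act_args v e1 (\<lambda>vb. act_args y2 vb (\<lambda>b. out e2 (a @ e0 # b))) =
   act_ops y2 v (\<lambda>b'. act_args b' e1 (\<lambda>b. out e2 (a @ e0 # b)))" if "homAs a" for a
  by (rule act_args_compose[OF vs_f gy(2) v g(1) output_right[OF k P g(2) e0 that]])
 have ml: "word_multilinear fscale relA homA (\<lambda>a. act_ops y2 v (\<lambda>b'. act_args b' e1 (\<lambda>b. out e2 (a @ e0 # b))))"
  by (rule vector_space.word_multilinear_act_param[OF vs_f graded_on_ops gy(2) v],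
    rule vector_space.word_multilinear_act_param[OF vs_f graded_on_args _ g(1)], assumption,
    rule output_left[OF k P g(2) e0])
 have "act_args u e3 (\<lambda>ua. act_args v e1 (\<lambda>vb. act_args y1 ua (\<lambda>a. act_args y2 vb (\<lambda>b. out e2 (a @ e0 # b))))) =
   act_args u e3 (\<lambda>ua. act_args y1 ua (\<lambda>a. act_args v e1 (\<lambda>vb. act_args y2 vb (\<lambda>b. out e2 (a @ e0 # b)))))"
  by (simp only: act_act[of on_args snd sdeg v e1])
 also have "... = act_args u e3 (\<lambda>ua. act_args y1 ua (\<lambda>a. act_ops y2 v (\<lambda>b'. act_args b' e1 (\<lambda>b. out e2 (a @ e0 # b)))))"
  by (intro act_cong[OF graded_on_args u g(3)] act_cong[OF graded_on_args gy(1)]) (simp_all add: inner)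
 also have "... = act_ops y1 u (\<lambda>a'. act_args a' e3 (\<lambda>a. act_ops y2 v (\<lambda>b'. act_args b' e1 (\<lambda>b. out e2 (a @ e0 # b)))))"
  by (rule act_args_compose[OF vs_f gy(1) u g(3) ml])
 also have "... = act_ops y1 u (\<lambda>a'. act_ops y2 v (\<lambda>b'. act_args a' e3 (\<lambda>a. act_args b' e1 (\<lambda>b. out e2 (a @ e0 # b)))))"
  by (simp only: act_act[of on_ops snd snd y2 v])
 finally show ?thesis .
qed

text \<open>The entry \<open>e\<^sub>0\<close> is an argument of \<open>P'\<close>. Then only the
  parts of \<open>u\<close> and \<open>v\<close> that are outermost are composed with other
  operations of \<open>y\<close>; the inner parts act on arguments of \<open>P'\<close>.\<close>

lemma cyclic_brace_inside:
 assumes g: "homAs i1" "homAs i2" "homAs e2" "homAs h1" "homAs h2"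
  and y12: "y = y1 @ P' # y2" and uu: "u = u1 @ u2" and vv: "v = v1 @ v2"
 shows "act_args u1 h1 (\<lambda>ua1. act_args u2 h2 (\<lambda>ua2. act_args v1 i1 (\<lambda>vb1. act_args v2 i2 (\<lambda>vb2.
   act_args y1 ua1 (\<lambda>a. act_args y2 vb2 (\<lambda>b. out e2 (a @ apply_op P' (ua2 @ e0 # vb1) # b))))))) =
  act_ops y1 u1 (\<lambda>a'. act_args u2 h2 (\<lambda>ua2. act_args v1 i1 (\<lambda>vb1. act_ops y2 v2 (\<lambda>b'.
   act_args a' h1 (\<lambda>a. act_args b' i2 (\<lambda>b. out e2 (a @ apply_op P' (ua2 @ e0 # vb1) # b)))))))"
proof -
 have gy: "homVs y1" "homV P'" "homVs y2" and gu: "homVs u1" "homVs u2"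
  and gv: "homVs v1" "homVs v2" using y y12 u uu v vv by auto
 let ?z = "\<lambda>ua2 vb1. apply_op P' (ua2 @ e0 # vb1)"
 have "act_args u1 h1 (\<lambda>ua1. act_args u2 h2 (\<lambda>ua2. act_args v1 i1 (\<lambda>vb1. act_args v2 i2 (\<lambda>vb2.
   act_args y1 ua1 (\<lambda>a. act_args y2 vb2 (\<lambda>b. out e2 (a @ ?z ua2 vb1 # b))))))) =
  act_args u2 h2 (\<lambda>ua2. act_args v1 i1 (\<lambda>vb1. act_args u1 h1 (\<lambda>ua1. act_args v2 i2 (\<lambda>vb2.
   act_args y1 ua1 (\<lambda>a. act_args y2 vb2 (\<lambda>b. out e2 (a @ ?z ua2 vb1 # b)))))))"
  by (simp only: act_act[of on_args snd sdeg u1 h1 on_args snd sdeg u2 h2] act_act[of on_args snd sdeg u1 h1 on_args snd sdeg v1 i1])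
 also have "... = act_args u2 h2 (\<lambda>ua2. act_args v1 i1 (\<lambda>vb1. act_ops y1 u1 (\<lambda>a'. act_ops y2 v2 (\<lambda>b'.
   act_args a' h1 (\<lambda>a. act_args b' i2 (\<lambda>b. out e2 (a @ ?z ua2 vb1 # b)))))))"
 proof (intro act_cong[OF graded_on_args gu(2) g(5)] act_cong[OF graded_on_args gv(1) g(1)])
  fix ua2 vb1 assume "homAs ua2" "homAs vb1"
  then have z: "homA (?z ua2 vb1)" using e0 by (intro End_apply[OF gy(2)]) auto
  have inner: "act_args v2 i2 (\<lambda>vb. act_args y2 vb (\<lambda>b. out e2 (a @ ?z ua2 vb1 # b))) =
    act_ops y2 v2 (\<lambda>b'. act_args b' i2 (\<lambda>b. out e2 (a @ ?z ua2 vb1 # b)))" if "homAs a" for a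
   by (rule act_args_compose[OF vs_f gy(3) gv(2) g(2) output_right[OF k P g(3) z that]])
  have ml: "word_multilinear fscale relA homA (\<lambda>a. act_ops y2 v2 (\<lambda>b'. act_args b' i2 (\<lambda>b. out e2 (a @ ?z ua2 vb1 # b))))"
   by (rule vector_space.word_multilinear_act_param[OF vs_f graded_on_ops gy(3) gv(2)],
     rule vector_space.word_multilinear_act_param[OF vs_f graded_on_args _ g(2)], assumption,
     rule output_left[OF k P g(3) z])
  have "act_args u1 h1 (\<lambda>ua. act_args v2 i2 (\<lambda>vb. act_args y1 ua (\<lambda>a. act_args y2 vb (\<lambda>b. out e2 (a @ ?z ua2 vb1 # b))))) =
    act_args u1 h1 (\<lambda>ua. act_args y1 ua (\<lambda>a. act_args v2 i2 (\<lambda>vb. act_args y2 vb (\<lambda>b. out e2 (a @ ?z ua2 vb1 # b)))))"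
   by (simp only: act_act[of on_args snd sdeg v2 i2])
  also have "... = act_args u1 h1 (\<lambda>ua. act_args y1 ua (\<lambda>a. act_ops y2 v2 (\<lambda>b'. act_args b' i2 (\<lambda>b. out e2 (a @ ?z ua2 vb1 # b)))))"
   by (intro act_cong[OF graded_on_args gu(1) g(4)] act_cong[OF graded_on_args gy(1)]) (simp_all add: inner)
  also have "... = act_ops y1 u1 (\<lambda>a'. act_args a' h1 (\<lambda>a. act_ops y2 v2 (\<lambda>b'. act_args b' i2 (\<lambda>b. out e2 (a @ ?z ua2 vb1 # b)))))"
   by (rule act_args_compose[OF vs_f gy(1) gu(1) g(4) ml])
  also have "... = act_ops y1 u1 (\<lambda>a'. act_ops y2 v2 (\<lambda>b'. act_args a' h1 (\<lambda>a. act_args b' i2 (\<lambda>b. out e2 (a @ ?z ua2 vb1 # b)))))"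
   by (simp only: act_act[of on_ops snd snd y2 v2])
  finally show "act_args u1 h1 (\<lambda>ua1. act_args v2 i2 (\<lambda>vb2. act_args y1 ua1 (\<lambda>a. act_args y2 vb2 (\<lambda>b. out e2 (a @ ?z ua2 vb1 # b))))) =
   act_ops y1 u1 (\<lambda>a'. act_ops y2 v2 (\<lambda>b'. act_args a' h1 (\<lambda>a. act_args b' i2 (\<lambda>b. out e2 (a @ ?z ua2 vb1 # b)))))" .
 qed
 also have "... = act_ops y1 u1 (\<lambda>a'. act_args u2 h2 (\<lambda>ua2. act_args v1 i1 (\<lambda>vb1. act_ops y2 v2 (\<lambda>b'.
   act_args a' h1 (\<lambda>a. act_args b' i2 (\<lambda>b. out e2 (a @ ?z ua2 vb1 # b)))))))"
  by (simp only: act_act[of on_ops snd snd y1 u1])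
 finally show ?thesis .
qed

definition "outside_term y1 y2 e1 e2 e3 = act_ops y1 u (\<lambda>a'. act_ops y2 v (\<lambda>b'.
 act_args a' e3 (\<lambda>a. act_args b' e1 (\<lambda>b. out e2 (a @ e0 # b)))))"

definition "inside_term y1 P' y2 u1 u2 v1 v2 i1 i2 e2 h1 h2 =
 act_ops y1 u1 (\<lambda>a'. act_args u2 h2 (\<lambda>ua2. act_args v1 i1 (\<lambda>vb1. act_ops y2 v2 (\<lambda>b'.
   act_args a' h1 (\<lambda>a. act_args b' i2 (\<lambda>b. out e2 (a @ apply_op P' (ua2 @ e0 # vb1) # b)))))))"

abbreviation (input) "D \<equiv> wdeg sdeg"
abbreviation (input) "B \<equiv> wdeg snd"

definition "inside_sign y1 P' y2 u1 u2 v1 v2 i1 i2 e2 h1 h2 =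
 (sdeg e0 + D i1 + D i2 + D e2) * (D h1 + D h2) + (B v1 + B v2) * (D i1 + D i2 + D e2 + 1) + B u2 * D h1 + B v2 * D i1
 + snd P' * (B u1 + D h1) + B y2 * (B u1 + D h1 + B u2 + D h2 + sdeg e0 + B v1 + D i1)"

definition "inside_sum = marked y (\<lambda>y1 P' y2. spl u (\<lambda>u1 u2. spl v (\<lambda>v1 v2.
  spl e (\<lambda>i1 r. spl r (\<lambda>i2 r. spl r (\<lambda>e2 r. spl r (\<lambda>h1 h2.
   sg (inside_sign y1 P' y2 u1 u2 v1 v2 i1 i2 e2 h1 h2) (inside_term y1 P' y2 u1 u2 v1 v2 i1 i2 e2 h1 h2))))))))"

definition "outside_sum = spl y (\<lambda>y1 y2. spl e (\<lambda>e1 r. spl r (\<lambda>e2 e3.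
  sg ((sdeg e0 + D e1 + D e2) * D e3 + B v * (D e1 + D e2 + 1) + B y2 * (B u + D e3 + sdeg e0)) (outside_term y1 y2 e1 e2 e3))))"

text \<open>Apply \<open>P{y}\<close> around \<open>e\<^sub>0\<close> and distinguish, by
  \<open>act_marked\<close>, whether \<open>e\<^sub>0\<close> is an argument of one of the
  operations \<open>y\<close>.\<close>

lemma cyclic_brace_lhs: "lsum (cyclic (brace P y) u (e0 # e) v) k = outside_sum + inside_sum"
proof -
 define s where "s e1 e2 e3 = (sdeg e0 + D e1 + D e2) * D e3 + B v * (D e1 + D e2 + 1)"  for e1 e2 e3 :: "('a \<times> int) list"
 define X2 where "X2 e1 e2 e3 = marked y (\<lambda>y1 P' y2. spl u (\<lambda>u1 u2. spl v (\<lambda>v1 v2.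
   spl e1 (\<lambda>i1 i2. spl e3 (\<lambda>h1 h2.
   sg (inside_sign y1 P' y2 u1 u2 v1 v2 i1 i2 e2 h1 h2) (inside_term y1 P' y2 u1 u2 v1 v2 i1 i2 e2 h1 h2))))))" for e1 e2 e3
 have main: "sg (s e1 e2 e3) (act_args u e3 (\<lambda>ua. act_args v e1 (\<lambda>vb. k (Inr (apply_op (brace P y) (ua @ e0 # vb) # e2))))) =
   spl y (\<lambda>y1 y2. sg (s e1 e2 e3 + B y2 * (B u + D e3 + sdeg e0)) (outside_term y1 y2 e1 e2 e3)) + X2 e1 e2 e3"
  if g: "homAs e1" "homAs e2" "homAs e3" for e1 e2 e3
 proof -
  define Y where "Y y1 P' y2 ua1 ua2 vb1 vb2 = act_args y1 ua1 (\<lambda>a. act_args y2 vb2 (\<lambda>b. out e2 (a @ apply_op P' (ua2 @ e0 # vb1) # b)))"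
   for y1 P' y2 ua1 ua2 vb1 vb2
  define t where "t P' y2 a1 b1 = snd P' * a1 + B y2 * (B u + D e3 + sdeg e0 + b1)" for P' :: "'a oper" and y2 :: "('a oper) list" and a1 b1
  have "act_args u e3 (\<lambda>ua. act_args v e1 (\<lambda>vb. k (Inr (apply_op (brace P y) (ua @ e0 # vb) # e2)))) =
    act_args u e3 (\<lambda>ua. act_args v e1 (\<lambda>vb.
     spl y (\<lambda>y1 y2. sg (B y2 * (B u + D e3 + sdeg e0)) (act_args y1 ua (\<lambda>a. act_args y2 vb (\<lambda>b. out e2 (a @ e0 # b)))))
    + marked y (\<lambda>y1 P' y2. spl ua (\<lambda>ua1 ua2. spl vb (\<lambda>vb1 vb2. sg (t P' y2 (D ua1) (D vb1)) (Y y1 P' y2 ua1 ua2 vb1 vb2))))))"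
  proof (intro act_cong[OF graded_on_args u g(3)] act_cong[OF graded_on_args v g(1)])
   fix ua vb assume a: "homAs ua" "D ua = B u + D e3" and b: "homAs vb" "D vb = B v + D e1"
   have "k (Inr (apply_op (brace P y) (ua @ e0 # vb) # e2)) = act_args y (ua @ e0 # vb) (\<lambda>w. out e2 w)"
    by (rule brace_letter[OF vs_f P y _ linear_along_first[OF k g(2)]]) (use a b e0 in simp)
   then show "k (Inr (apply_op (brace P y) (ua @ e0 # vb) # e2)) =
     spl y (\<lambda>y1 y2. sg (B y2 * (B u + D e3 + sdeg e0)) (act_args y1 ua (\<lambda>a. act_args y2 vb (\<lambda>b. out e2 (a @ e0 # b)))))
    + marked y (\<lambda>y1 P' y2. spl ua (\<lambda>ua1 ua2. spl vb (\<lambda>vb1 vb2. sg (t P' y2 (D ua1) (D vb1)) (Y y1 P' y2 ua1 ua2 vb1 vb2))))"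
    by (simp add: act_marked a(2) Y_def t_def)
  qed
  also have "... = spl y (\<lambda>y1 y2. sg (B y2 * (B u + D e3 + sdeg e0)) (outside_term y1 y2 e1 e2 e3)) +
    marked y (\<lambda>y1 P' y2. act_args u e3 (\<lambda>ua. spl ua (\<lambda>ua1 ua2. act_args v e1 (\<lambda>vb. spl vb (\<lambda>vb1 vb2.
     sg (t P' y2 (D ua1) (D vb1)) (Y y1 P' y2 ua1 ua2 vb1 vb2))))))"
  proof -
   have "spl y (\<lambda>y1 y2. sg (B y2 * (B u + D e3 + sdeg e0)) (act_args u e3 (\<lambda>ua. act_args v e1 (\<lambda>vb. act_args y1 ua (\<lambda>a. act_args y2 vb (\<lambda>b. out e2 (a @ e0 # b))))))) =
    spl y (\<lambda>y1 y2. sg (B y2 * (B u + D e3 + sdeg e0)) (outside_term y1 y2 e1 e2 e3))"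
    by (intro spl_cong arg_cong[where f = "sg _"]) (simp only: cyclic_brace_outside[OF g] outside_term_def)
   then show ?thesis
    by (simp add: act_plus act_spl act_sg act_marked_swap)
  qed
  also have "marked y (\<lambda>y1 P' y2. act_args u e3 (\<lambda>ua. spl ua (\<lambda>ua1 ua2. act_args v e1 (\<lambda>vb. spl vb (\<lambda>vb1 vb2.
     sg (t P' y2 (D ua1) (D vb1)) (Y y1 P' y2 ua1 ua2 vb1 vb2)))))) =
    marked y (\<lambda>y1 P' y2. spl u (\<lambda>u1 u2. spl v (\<lambda>v1 v2. spl e1 (\<lambda>i1 i2. spl e3 (\<lambda>h1 h2.
     sg (B u2 * D h1 + B v2 * D i1 + t P' y2 (B u1 + D h1) (B v1 + D i1)) (inside_term y1 P' y2 u1 u2 v1 v2 i1 i2 e2 h1 h2))))))"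
  proof (intro marked_cong)
   fix y1 P' y2 assume yy: "y = y1 @ P' # y2"
   have "act_args u e3 (\<lambda>ua. spl ua (\<lambda>ua1 ua2. act_args v e1 (\<lambda>vb. spl vb (\<lambda>vb1 vb2.
     sg (t P' y2 (D ua1) (D vb1)) (Y y1 P' y2 ua1 ua2 vb1 vb2))))) =
    spl u (\<lambda>u1 u2. spl e3 (\<lambda>h1 h2. sg (B u2 * D h1) (act_args u1 h1 (\<lambda>ua1. act_args u2 h2 (\<lambda>ua2.
     spl v (\<lambda>v1 v2. spl e1 (\<lambda>i1 i2. sg (B v2 * D i1) (act_args v1 i1 (\<lambda>vb1. act_args v2 i2 (\<lambda>vb2.
      sg (t P' y2 (D ua1) (D vb1)) (Y y1 P' y2 ua1 ua2 vb1 vb2)))))))))))"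
    by (simp only: act_split)
   also have "... = spl u (\<lambda>u1 u2. spl e3 (\<lambda>h1 h2. spl v (\<lambda>v1 v2. spl e1 (\<lambda>i1 i2. sg (B u2 * D h1 + B v2 * D i1)
     (act_args u1 h1 (\<lambda>ua1. act_args u2 h2 (\<lambda>ua2. act_args v1 i1 (\<lambda>vb1. act_args v2 i2 (\<lambda>vb2.
      sg (t P' y2 (D ua1) (D vb1)) (Y y1 P' y2 ua1 ua2 vb1 vb2))))))))))"
    by (simp only: act_spl act_sg spl_sg[symmetric] sg_sg)
   also have "... = spl u (\<lambda>u1 u2. spl e3 (\<lambda>h1 h2. spl v (\<lambda>v1 v2. spl e1 (\<lambda>i1 i2.
     sg (B u2 * D h1 + B v2 * D i1 + t P' y2 (B u1 + D h1) (B v1 + D i1)) (inside_term y1 P' y2 u1 u2 v1 v2 i1 i2 e2 h1 h2)))))"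
   proof (intro spl_cong)
    fix u1 u2 h1 h2 v1 v2 i1 i2 assume uu: "u = u1 @ u2" and ee: "e3 = h1 @ h2" and vv: "v = v1 @ v2" and ii: "e1 = i1 @ i2"
    have gg: "homVs u1" "homVs u2" "homVs v1" "homVs v2"
     "homAs h1" "homAs h2" "homAs i1" "homAs i2"
     using u v g uu ee vv ii by auto
    have "act_args u1 h1 (\<lambda>ua1. act_args u2 h2 (\<lambda>ua2. act_args v1 i1 (\<lambda>vb1. act_args v2 i2 (\<lambda>vb2.
      sg (t P' y2 (D ua1) (D vb1)) (Y y1 P' y2 ua1 ua2 vb1 vb2))))) =
     act_args u1 h1 (\<lambda>ua1. act_args u2 h2 (\<lambda>ua2. act_args v1 i1 (\<lambda>vb1. act_args v2 i2 (\<lambda>vb2.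
      sg (t P' y2 (B u1 + D h1) (B v1 + D i1)) (Y y1 P' y2 ua1 ua2 vb1 vb2)))))"
     by (intro act_cong[OF graded_on_args gg(1,5)] act_cong[OF graded_on_args gg(2,6)]
       act_cong[OF graded_on_args gg(3,7)] act_cong[OF graded_on_args gg(4,8)]) simp
    then show "sg (B u2 * D h1 + B v2 * D i1) (act_args u1 h1 (\<lambda>ua1. act_args u2 h2 (\<lambda>ua2. act_args v1 i1 (\<lambda>vb1. act_args v2 i2 (\<lambda>vb2.
      sg (t P' y2 (D ua1) (D vb1)) (Y y1 P' y2 ua1 ua2 vb1 vb2)))))) =
     sg (B u2 * D h1 + B v2 * D i1 + t P' y2 (B u1 + D h1) (B v1 + D i1)) (inside_term y1 P' y2 u1 u2 v1 v2 i1 i2 e2 h1 h2)"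
     using cyclic_brace_inside[OF gg(7,8) g(2) gg(5,6) yy uu vv] by (simp add: act_sg sg_sg Y_def inside_term_def)
   qed
   also have "... = spl u (\<lambda>u1 u2. spl v (\<lambda>v1 v2. spl e1 (\<lambda>i1 i2. spl e3 (\<lambda>h1 h2.
     sg (B u2 * D h1 + B v2 * D i1 + t P' y2 (B u1 + D h1) (B v1 + D i1)) (inside_term y1 P' y2 u1 u2 v1 v2 i1 i2 e2 h1 h2)))))"
    by (simp only: spl_spl[of e3])
   finally show "act_args u e3 (\<lambda>ua. spl ua (\<lambda>ua1 ua2. act_args v e1 (\<lambda>vb. spl vb (\<lambda>vb1 vb2.
     sg (t P' y2 (D ua1) (D vb1)) (Y y1 P' y2 ua1 ua2 vb1 vb2))))) = \<dots>" .
  qed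
  finally have "act_args u e3 (\<lambda>ua. act_args v e1 (\<lambda>vb. k (Inr (apply_op (brace P y) (ua @ e0 # vb) # e2)))) =
   spl y (\<lambda>y1 y2. sg (B y2 * (B u + D e3 + sdeg e0)) (outside_term y1 y2 e1 e2 e3)) +
   marked y (\<lambda>y1 P' y2. spl u (\<lambda>u1 u2. spl v (\<lambda>v1 v2. spl e1 (\<lambda>i1 i2. spl e3 (\<lambda>h1 h2.
     sg (B u2 * D h1 + B v2 * D i1 + t P' y2 (B u1 + D h1) (B v1 + D i1)) (inside_term y1 P' y2 u1 u2 v1 v2 i1 i2 e2 h1 h2))))))" .
  moreover have "sg (s e1 e2 e3) (marked y (\<lambda>y1 P' y2. spl u (\<lambda>u1 u2. spl v (\<lambda>v1 v2. spl e1 (\<lambda>i1 i2. spl e3 (\<lambda>h1 h2.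
     sg (B u2 * D h1 + B v2 * D i1 + t P' y2 (B u1 + D h1) (B v1 + D i1)) (inside_term y1 P' y2 u1 u2 v1 v2 i1 i2 e2 h1 h2))))))) = X2 e1 e2 e3"
   unfolding X2_def marked_sg[symmetric] spl_sg[symmetric] sg_sg
   by (intro marked_cong spl_cong) (simp add: inside_sign_def s_def t_def algebra_simps)
  ultimately show ?thesis by (simp add: sg_add spl_sg[symmetric] sg_sg)
 qed
 have "lsum (cyclic (brace P y) u (e0 # e) v) k = spl e (\<lambda>e1 r. spl r (\<lambda>e2 e3.
   spl y (\<lambda>y1 y2. sg (s e1 e2 e3 + B y2 * (B u + D e3 + sdeg e0)) (outside_term y1 y2 e1 e2 e3)) + X2 e1 e2 e3))"
  unfolding lsum_cyclic using e by (intro spl_cong) (simp add: main s_def[symmetric])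
 also have "... = outside_sum + spl e (\<lambda>e1 r. spl r (\<lambda>e2 e3. X2 e1 e2 e3))"
  unfolding outside_sum_def by (simp add: spl_plus spl_spl[of y] s_def)
 also have "spl e (\<lambda>e1 r. spl r (\<lambda>e2 e3. X2 e1 e2 e3)) = inside_sum"
 proof -
  define Z where "Z y1 P' y2 u1 u2 v1 v2 i1 i2 e2 h1 h2 = sg (inside_sign y1 P' y2 u1 u2 v1 v2 i1 i2 e2 h1 h2) (inside_term y1 P' y2 u1 u2 v1 v2 i1 i2 e2 h1 h2)"
   for y1 P' y2 u1 u2 v1 v2 i1 i2 e2 h1 h2
  have "spl e (\<lambda>e1 r. spl r (\<lambda>e2 e3. spl e1 (\<lambda>i1 i2. spl e3 (\<lambda>h1 h2. Z y1 P' y2 u1 u2 v1 v2 i1 i2 e2 h1 h2)))) =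
   spl e (\<lambda>i1 r. spl r (\<lambda>i2 r. spl r (\<lambda>e2 r. spl r (\<lambda>h1 h2. Z y1 P' y2 u1 u2 v1 v2 i1 i2 e2 h1 h2))))" for y1 P' y2 u1 u2 v1 v2
  proof -
   have "spl e (\<lambda>e1 r. spl r (\<lambda>e2 e3. spl e1 (\<lambda>i1 i2. spl e3 (\<lambda>h1 h2. Z y1 P' y2 u1 u2 v1 v2 i1 i2 e2 h1 h2)))) =
    spl e (\<lambda>e1 r. spl e1 (\<lambda>i1 i2. spl r (\<lambda>e2 e3. spl e3 (\<lambda>h1 h2. Z y1 P' y2 u1 u2 v1 v2 i1 i2 e2 h1 h2))))"
    by (intro spl_cong spl_spl)
   then show ?thesis by (simp only: spl_assoc)
  qed
  note regroup = this
  have "spl e (\<lambda>e1 r. spl r (\<lambda>e2 e3. spl u (\<lambda>u1 u2. spl v (\<lambda>v1 v2. G u1 u2 v1 v2 e1 e2 e3)))) =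
   spl u (\<lambda>u1 u2. spl v (\<lambda>v1 v2. spl e (\<lambda>e1 r. spl r (\<lambda>e2 e3. G u1 u2 v1 v2 e1 e2 e3))))" for G :: "_ => _ => _ => _ => _ => _ => _ => ('a, 'k) chain_bar"
  proof -
   define H where "H u1 u2 e1 e2 e3 = spl v (\<lambda>v1 v2. G u1 u2 v1 v2 e1 e2 e3)" for u1 u2 e1 e2 e3
   have "spl u (\<lambda>u1 u2. spl v (\<lambda>v1 v2. spl e (\<lambda>e1 r. spl r (\<lambda>e2 e3. G u1 u2 v1 v2 e1 e2 e3)))) =
    spl u (\<lambda>u1 u2. spl e (\<lambda>e1 r. spl r (\<lambda>e2 e3. H u1 u2 e1 e2 e3)))"
    unfolding H_def by (simp only: spl_spl[of v])
   also have "... = spl e (\<lambda>e1 r. spl r (\<lambda>e2 e3. spl u (\<lambda>u1 u2. H u1 u2 e1 e2 e3)))"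
    by (simp only: spl_spl[of u])
   finally show ?thesis unfolding H_def by simp
  qed
  note pull = this
  show ?thesis
   unfolding X2_def inside_sum_def Z_def[symmetric] marked_spl
   by (intro marked_cong) (simp only: pull regroup)
 qed
 finally show ?thesis .
qed

lemma cyclic_after_outside:
 assumes yy: "y = y1 @ y2"
 shows "act_ops y1 u (\<lambda>a'. act_ops y2 v (\<lambda>b'. lsum (cyclic P a' (e0 # e) b') k)) =
  spl e (\<lambda>e1 r. spl r (\<lambda>e2 e3. sg ((sdeg e0 + D e1 + D e2) * D e3 + (B y2 + B v) * (D e1 + D e2 + 1)) (outside_term y1 y2 e1 e2 e3)))"
proof -
 have gy: "homVs y1" "homVs y2" using y yy by auto
 have "act_ops y1 u (\<lambda>a'. act_ops y2 v (\<lambda>b'. lsum (cyclic P a' (e0 # e) b') k)) =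
  act_ops y1 u (\<lambda>a'. act_ops y2 v (\<lambda>b'. spl e (\<lambda>e1 r. spl r (\<lambda>e2 e3.
   sg ((sdeg e0 + D e1 + D e2) * D e3 + (B y2 + B v) * (D e1 + D e2 + 1))
    (act_args a' e3 (\<lambda>a. act_args b' e1 (\<lambda>b. out e2 (a @ e0 # b))))))))"
  by (intro act_cong[OF graded_on_ops gy(1) u] act_cong[OF graded_on_ops gy(2) v]) (simp add: lsum_cyclic)
 then show ?thesis by (simp add: act_spl act_sg outside_term_def)
qed

lemma cyclic_after_inside:
 assumes yy: "y = y1 @ P' # y2" and uu: "u = u1 @ u2" and vv: "v = v1 @ v2"
 shows "act_ops y1 u1 (\<lambda>a'. lsum (cyclic P' u2 (e0 # e) v1) (\<lambda>z. act_ops y2 v2 (\<lambda>b'. lsum (ev_cyclic P (map Inl a' @ z # map Inl b')) k))) =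
  spl e (\<lambda>i1 r. spl r (\<lambda>i2 r. spl r (\<lambda>e2 r. spl r (\<lambda>h1 h2.
   sg ((sdeg e0 + D i1 + (D i2 + D e2 + D h1)) * D h2 + B v1 * (D i1 + (D i2 + D e2 + D h1) + 1)
    + ((snd P' + B u2 + D h2 + sdeg e0 + B v1 + D i1 + D i2 + D e2) * D h1 + (B y2 + B v2) * (D i2 + D e2 + 1)))
   (inside_term y1 P' y2 u1 u2 v1 v2 i1 i2 e2 h1 h2)))))"
proof -
 have gy: "homVs y1" "homV P'" "homVs y2" and gu: "homVs u1" "homVs u2"
  and gv: "homVs v1" "homVs v2" using y yy u uu v vv by auto
 define s1 where "s1 i1 q h2 = (sdeg e0 + D i1 + D q) * D h2 + B v1 * (D i1 + D q + 1)" for i1 q h2 :: "('a \<times> int) list"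
 define s2 where "s2 i1 i2 e2 h1 h2 = (snd P' + B u2 + D h2 + sdeg e0 + B v1 + D i1 + D i2 + D e2) * D h1 + (B y2 + B v2) * (D i2 + D e2 + 1)"
  for i1 i2 e2 h1 h2 :: "('a \<times> int) list"
 have inner: "act_ops y1 u1 (\<lambda>a'. act_args u2 h2 (\<lambda>ua2. act_args v1 i1 (\<lambda>vb1. act_ops y2 v2 (\<lambda>b'.
   lsum (cyclic P a' (apply_op P' (ua2 @ e0 # vb1) # q) b') k)))) =
  spl q (\<lambda>i2 r. spl r (\<lambda>e2 h1. sg (s2 i1 i2 e2 h1 h2) (inside_term y1 P' y2 u1 u2 v1 v2 i1 i2 e2 h1 h2)))"
  if g: "homAs h2" "homAs i1" for i1 q h2
 proof -
  have "act_ops y1 u1 (\<lambda>a'. act_args u2 h2 (\<lambda>ua2. act_args v1 i1 (\<lambda>vb1. act_ops y2 v2 (\<lambda>b'.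
   lsum (cyclic P a' (apply_op P' (ua2 @ e0 # vb1) # q) b') k)))) =
   act_ops y1 u1 (\<lambda>a'. act_args u2 h2 (\<lambda>ua2. act_args v1 i1 (\<lambda>vb1. act_ops y2 v2 (\<lambda>b'.
   spl q (\<lambda>i2 r. spl r (\<lambda>e2 h1. sg (s2 i1 i2 e2 h1 h2) (act_args a' h1 (\<lambda>a. act_args b' i2 (\<lambda>b. out e2 (a @ apply_op P' (ua2 @ e0 # vb1) # b))))))))))"
   by (intro act_cong[OF graded_on_ops gy(1) gu(1)] act_cong[OF graded_on_args gu(2) g(1)]
     act_cong[OF graded_on_args gv(1) g(2)] act_cong[OF graded_on_ops gy(3) gv(2)])
    (simp add: lsum_cyclic s2_def algebra_simps)
  then show ?thesis by (simp add: act_spl act_sg inside_term_def)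
 qed
 have "act_ops y1 u1 (\<lambda>a'. lsum (cyclic P' u2 (e0 # e) v1) (\<lambda>z. act_ops y2 v2 (\<lambda>b'. lsum (ev_cyclic P (map Inl a' @ z # map Inl b')) k))) =
  spl e (\<lambda>i1 r. spl r (\<lambda>q h2. sg (s1 i1 q h2) (act_ops y1 u1 (\<lambda>a'. act_args u2 h2 (\<lambda>ua2. act_args v1 i1 (\<lambda>vb1. act_ops y2 v2 (\<lambda>b'.
   lsum (cyclic P a' (apply_op P' (ua2 @ e0 # vb1) # q) b') k)))))))"
  by (simp add: lsum_cyclic[of P' u2] act_spl act_sg s1_def)
 also have "... = spl e (\<lambda>i1 r. spl r (\<lambda>q h2. spl q (\<lambda>i2 r. spl r (\<lambda>e2 h1. sg (s1 i1 (i2 @ e2 @ h1) h2 + s2 i1 i2 e2 h1 h2) (inside_term y1 P' y2 u1 u2 v1 v2 i1 i2 e2 h1 h2)))))"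
  by (intro spl_cong) (use e in \<open>simp add: inner spl_sg[symmetric] sg_sg, intro spl_cong, simp\<close>)
 also have "... = spl e (\<lambda>i1 r. spl r (\<lambda>i2 r. spl r (\<lambda>e2 r. spl r (\<lambda>h1 h2. sg (s1 i1 (i2 @ e2 @ h1) h2 + s2 i1 i2 e2 h1 h2) (inside_term y1 P' y2 u1 u2 v1 v2 i1 i2 e2 h1 h2)))))"
  by (simp only: spl_assoc)
 finally show ?thesis by (simp add: s1_def s2_def algebra_simps)
qed

text \<open>Let \<open>y\<close> act first, and distinguish whether one of its operations takes the
  chain. If one does, the tail is cut twice, by \<open>P'\<close> and then by \<open>P\<close>, into
  five parts; these are the same five parts as for the other side, and the signs agree modulo two.\<close>

lemma cyclic_brace_rhs:
 "act_cyclic y (map Inl u @ Inr (e0 # e) # map Inl v) (\<lambda>w. lsum (ev_cyclic P w) k) = outside_sum + inside_sum"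
proof -
 define c where "c = sdeg e0 + D e + 1"
 have main: "act_cyclic y (map Inl u @ Inr (e0 # e) # map Inl v) (\<lambda>w. lsum (ev_cyclic P w) k) =
   spl y (\<lambda>y1 y2. sg (B y2 * (B u + c)) (act_ops y1 u (\<lambda>a'. act_ops y2 v (\<lambda>b'. lsum (cyclic P a' (e0 # e) b') k))))
  + marked y (\<lambda>y1 P' y2. spl u (\<lambda>u1 u2. spl v (\<lambda>v1 v2. sg (snd P' * B u1 + B y2 * (B u + c + B v1))
    (act_ops y1 u1 (\<lambda>a'. lsum (cyclic P' u2 (e0 # e) v1) (\<lambda>z. act_ops y2 v2 (\<lambda>b'. lsum (ev_cyclic P (map Inl a' @ z # map Inl b')) k)))))))"
  by (simp add: act_marked act_cyclic_Inl spl_map c_def add_ac)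
 have o: "spl y (\<lambda>y1 y2. sg (B y2 * (B u + c)) (act_ops y1 u (\<lambda>a'. act_ops y2 v (\<lambda>b'. lsum (cyclic P a' (e0 # e) b') k)))) = outside_sum"
  unfolding outside_sum_def
 proof (rule spl_cong)
  fix y1 y2 assume "y = y1 @ y2"
  show "sg (B y2 * (B u + c)) (act_ops y1 u (\<lambda>a'. act_ops y2 v (\<lambda>b'. lsum (cyclic P a' (e0 # e) b') k))) =
   spl e (\<lambda>e1 r. spl r (\<lambda>e2 e3.
    sg ((sdeg e0 + D e1 + D e2) * D e3 + B v * (D e1 + D e2 + 1) + B y2 * (B u + D e3 + sdeg e0)) (outside_term y1 y2 e1 e2 e3)))"
   unfolding cyclic_after_outside[OF \<open>y = y1 @ y2\<close>] spl_sg[symmetric] sg_sg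
   by (intro spl_cong sg_eq) (simp add: c_def algebra_simps)
 qed
 have i: "marked y (\<lambda>y1 P' y2. spl u (\<lambda>u1 u2. spl v (\<lambda>v1 v2. sg (snd P' * B u1 + B y2 * (B u + c + B v1))
    (act_ops y1 u1 (\<lambda>a'. lsum (cyclic P' u2 (e0 # e) v1) (\<lambda>z. act_ops y2 v2 (\<lambda>b'. lsum (ev_cyclic P (map Inl a' @ z # map Inl b')) k))))))) = inside_sum"
  unfolding inside_sum_def
 proof (intro marked_cong spl_cong)
  fix y1 P' y2 u1 u2 v1 v2 assume eqs: "y = y1 @ P' # y2" "u = u1 @ u2" "v = v1 @ v2"
  show "sg (snd P' * B u1 + B y2 * (B u + c + B v1))
    (act_ops y1 u1 (\<lambda>a'. lsum (cyclic P' u2 (e0 # e) v1) (\<lambda>z. act_ops y2 v2 (\<lambda>b'. lsum (ev_cyclic P (map Inl a' @ z # map Inl b')) k)))) =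
   spl e (\<lambda>i1 r. spl r (\<lambda>i2 r. spl r (\<lambda>e2 r. spl r (\<lambda>h1 h2.
    sg (inside_sign y1 P' y2 u1 u2 v1 v2 i1 i2 e2 h1 h2) (inside_term y1 P' y2 u1 u2 v1 v2 i1 i2 e2 h1 h2)))))"
   unfolding cyclic_after_inside[OF eqs] spl_sg[symmetric] sg_sg
   by (intro spl_cong sg_eq) (simp add: c_def eqs(2) inside_sign_def algebra_simps)
 qed
 show ?thesis unfolding main o i ..
qed

end

lemma ev_cyclic_brace:
 fixes k :: "'a cyclic_letter => ('a, 'k) chain_bar"
 assumes P: "homV P" and y: "homVs y" and cs: "list_all cgood cs" "one_chain cs" and k: "linear_along fscale crel k"
 shows "lsum (ev_cyclic (brace P y) cs) k = act_cyclic y cs (\<lambda>w. lsum (ev_cyclic P w) k)"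
 using cs(2)
proof (cases rule: one_chain_cases)
 case (1 us)
 then show ?thesis
  using brace_brace_letter[OF vs_f P y _ linear_along_Inl[OF k], of us] cs(1) by (simp add: act_cyclic_Inl)
next
 case (2 us es vs)
 then obtain e0 e where es: "es = e0 # e" using cs(1) by (cases es) auto
 then have g: "homVs us" "homVs vs" "homA e0" "homAs e" using cs(1) 2 by auto
 show ?thesis unfolding 2 es ev_cyclic_Inr
  using cyclic_brace_lhs[OF k P y g] cyclic_brace_rhs[OF k P y g] by simp
qed

end

context curved_Ainf_algebra
begin

lemma zero_relV: "((0, d), 0, (0, d), 0, (0, d)) \<in> relV"
 using V.subspace_0[OF V.subspace_component, of d] by (auto simp: letter_relations_def)

lemma ev_cyclic_args:
 fixes k :: "'a cyclic_letter => ('a, 'k) chain_bar"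
 assumes P: "homV P" and k: "linear_along fscale crel k"
 shows "word_multilinear fscale crel cgood (\<lambda>b. lsum (ev_cyclic P b) k)"
proof (rule word_multilinearI)
 fix l r z a z1 b z2 assume l: "list_all cgood l" and r: "list_all cgood r" and rel: "(z, a, z1, b, z2) \<in> crel"
 have zero: "fscale x 0 = (0 :: ('a, 'k) chain_bar)" for x by (rule fscale_zero)
 from rel consider (op) y y1 y2 where "z = Inl y" "z1 = Inl y1" "z2 = Inl y2" "(y, a, y1, b, y2) \<in> relV"
  | (chain) p q y y1 y2 where "z = Inr (p @ y # q)" "z1 = Inr (p @ y1 # q)" "z2 = Inr (p @ y2 # q)"
    "homAs p" "homAs q" "(y, a, y1, b, y2) \<in> relA"
  unfolding crel_def by blast
 then show "lsum (ev_cyclic P (l @ z # r)) k = fscale a (lsum (ev_cyclic P (l @ z1 # r)) k) + fscale b (lsum (ev_cyclic P (l @ z2 # r)) k)"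
 proof cases
  case op
  show ?thesis
  proof (cases l rule: cword_cases)
   case l1: (1 us)
   show ?thesis
   proof (cases r rule: cword_cases)
    case (1 vs)
    have w: "l @ Inl x # r = map Inl (us @ x # vs)" for x using l1 1 by simp
    show ?thesis unfolding op(1-3) w ev_cyclic_Inl
     using word_multilinearD[OF on_ops_multilinear[OF P linear_along_Inl[OF k]] _ _ op(4), of us vs] l r l1 1 by simp
   next
    case (2 us' es vs)
    then obtain e0 e where es: "es = e0 # e" using r by (cases es) auto
    have w: "l @ Inl x # r = map Inl (us @ x # us') @ Inr (e0 # e) # map Inl vs" for x using l1 2 es by simp
    show ?thesis unfolding op(1-3) w ev_cyclic_Inr
     using word_multilinearD[OF cyclic_multilinear_left[OF k P] _ _ op(4), of e0 e vs us us'] l r l1 2 es by simp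
   next
    case (3 us' es r')
    have w: "l @ Inl x # r = map Inl (us @ x # us') @ Inr es # r'" for x using l1 3 by simp
    show ?thesis unfolding op(1-3) w ev_cyclic_many[OF 3(2)] by (simp add: zero)
   qed
  next
   case l2: (2 us es vs')
   then obtain e0 e where es: "es = e0 # e" using l by (cases es) auto
   show ?thesis
   proof (cases "list_all isl r")
    case True
    then obtain vs where r': "r = map Inl vs" using isl_words by blast
    have w: "l @ Inl x # r = map Inl us @ Inr (e0 # e) # map Inl (vs' @ x # vs)" for x using l2 r' es by simp
    show ?thesis unfolding op(1-3) w ev_cyclic_Inr
     using word_multilinearD[OF cyclic_multilinear_right[OF k P] _ _ op(4), of e0 e us vs' vs] l r l2 r' es by simp
   next
    case False
    then have "ev_cyclic P (l @ Inl x # r) = []" for x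
     using ev_cyclic_many[of "map Inl vs' @ Inl x # r" P us es] l2 by simp
    then show ?thesis unfolding op(1-3) by (simp add: zero)
   qed
  next
   case (3 us es r')
   then have "ev_cyclic P (l @ Inl x # r) = []" for x
    using ev_cyclic_many[of "r' @ Inl x # r" P us es] by simp
   then show ?thesis unfolding op(1-3) by (simp add: zero)
  qed
 next
  case chain
  have many: "ev_cyclic P (l @ Inr x # r) = []" if not: "\<not> (list_all isl l \<and> list_all isl r)" for x
  proof (cases l rule: cword_cases)
   case (1 us)
   then show ?thesis using ev_cyclic_many[of r P us x] not by simp
  next
   case (2 us es vs)
   then show ?thesis using ev_cyclic_many[of "map Inl vs @ Inr x # r" P us es] by simp
  next
   case (3 us es r')
   then show ?thesis using ev_cyclic_many[of "r' @ Inr x # r" P us es] by simp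
  qed
  show ?thesis
  proof (cases "list_all isl l \<and> list_all isl r")
   case True
   then obtain us vs where lr: "l = map Inl us" "r = map Inl vs" using isl_words by blast
   show ?thesis unfolding chain(1-3) lr ev_cyclic_Inr
    by (rule word_multilinearD[OF cyclic_multilinear_chain[OF k P] chain(4-6)]) (use l r lr in auto)
  next
   case False
   show ?thesis unfolding chain(1-3) many[OF False] by (simp add: zero)
  qed
 qed
qed

lemma ev_cyclic_op:
 fixes k :: "'a cyclic_letter => ('a, 'k) chain_bar"
 assumes b: "list_all cgood b" and k: "linear_along fscale crel k"
 shows "linear_along fscale relV (\<lambda>P. lsum (ev_cyclic P b) k)"
proof (cases b rule: cword_cases)
 case (1 us)
 then show ?thesis using on_ops_linear[OF _ linear_along_Inl[OF k], of us] b by simp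
next
 case (2 us es vs)
 then show ?thesis using cyclic_linear_op[OF k, of us es vs] b by simp
next
 case (3 us es r)
 then show ?thesis by (simp add: ev_cyclic_many vector_space.linear_along_zero[OF vs_f])
qed

lemma ev_right_op:
 fixes k :: "'a cyclic_letter => ('a, 'k) chain_bar"
 assumes b: "list_all cgood b" and k: "linear_along fscale crel k"
 shows "linear_along fscale crel (\<lambda>c. lsum (ev_cyclic_right c b) k)"
proof -
 consider "b = []" | Q where "b = [Inl Q]" | "b \<noteq> []" "\<And>Q. b \<noteq> [Inl Q]" by blast
 then show ?thesis
 proof cases
  case 1
  then show ?thesis using k by simp
 next
  case (2 Q)
  then have Q: "homV Q" using b by simp
  show ?thesis unfolding 2
  proof (rule linear_alongI)
   fix z a z1 b z2 assume "(z, a, z1, b, z2) \<in> crel"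
   then consider (op) y y1 y2 where "z = Inl y" "z1 = Inl y1" "z2 = Inl y2" "(y, a, y1, b, y2) \<in> relV"
    | (chain) p q y y1 y2 where "z = Inr (p @ y # q)" "z1 = Inr (p @ y1 # q)" "z2 = Inr (p @ y2 # q)"
      "homAs p" "homAs q" "(y, a, y1, b, y2) \<in> relA"
    unfolding crel_def by blast
   then show "lsum (ev_cyclic_right z [Inl Q]) k = fscale a (lsum (ev_cyclic_right z1 [Inl Q]) k) + fscale b (lsum (ev_cyclic_right z2 [Inl Q]) k)"
   proof cases
    case op
    then show ?thesis
     using linear_alongD[OF on_ops_linear[OF _ linear_along_Inl[OF k], of "[Q]"] op(4)] Q by simp
   next
    case chain
    show ?thesis
    proof (cases p)
     case Nil
     have "linear_along fscale relA (\<lambda>x. act_args [Q] q (\<lambda>w. k (Inr (x # w))))"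
      by (rule vector_space.linear_along_act[OF vs_f graded_on_args _ chain(5)])
       (use Q linear_along_first[OF k] in auto)
     from linear_alongD[OF vector_space.linear_along_sg[OF vs_f this, of "snd Q * wdeg sdeg q"] chain(6)]
     show ?thesis using chain Nil by (simp add: lsum_ev_right)
    next
     case (Cons e0 p')
     have e0: "homA e0" "homAs p'" using chain(4) Cons by auto
     have "word_multilinear fscale relA homA (\<lambda>w. k (Inr (e0 # w)))"
      using word_multilinear_subword[OF word_multilinear_Inr[OF k], of "[e0]" "[]"] e0 by simp
     then have "word_multilinear fscale relA homA (\<lambda>e. act_args [Q] e (\<lambda>w. k (Inr (e0 # w))))"
      using Q by (intro act_args_multilinear[OF vs_f]) auto
     from word_multilinearD[OF vector_space.word_multilinear_sg[OF vs_f this graded_relA, of "\<lambda>n. snd Q * n"] e0(2) chain(5,6)]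
     show ?thesis using chain Cons by (simp add: lsum_ev_right)
    qed
   qed
  qed
 next
  case 3
  then have "ev_cyclic_right c b = []" for c by (metis ev_right_cases)
  then show ?thesis by (simp add: vector_space.linear_along_zero[OF vs_f])
 qed
qed

section \<open>The cyclic value and right multiplication\<close>

lemma ev_right_zero:
 fixes k :: "'a cyclic_letter => ('a, 'k) chain_bar"
 assumes c: "cgood c" and k: "linear_along fscale crel k"
 shows "lsum (ev_cyclic_right c [Inl (0, 2)]) k = 0"
proof (cases c)
 case (Inl P)
 have "lsum (on_ops P ([] @ (0, 2) # [])) (\<lambda>P. k (Inl P)) = 0"
  by (rule word_multilinear_zero_letter[OF vs_f on_ops_multilinear[OF _ linear_along_Inl[OF k]] _ _ zero_relV])
   (use c Inl in auto)
 then show ?thesis by (simp add: Inl)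
next
 case (Inr es)
 then obtain e0 e where es: "es = e0 # e" "homA e0" "homAs e" using c by (cases es) auto
 have "word_multilinear fscale relA homA (\<lambda>w. k (Inr (e0 # w)))"
  using word_multilinear_subword[OF word_multilinear_Inr[OF k], of "[e0]" "[]"] es by simp
 from word_multilinear_zero_letter[OF vs_f act_args_multilinear_ops[OF vs_f es(3) this] _ _ zero_relV[of 2], of "[]" "[]"]
 show ?thesis unfolding Inr es lsum_ev_right by simp
qed

text \<open>Both sides vanish: the left one is an action of \<open>\<gamma>\<close> on
  \<open>\<gamma>\<close> by associativity.\<close>

lemma ev_right_square:
 fixes k :: "'a cyclic_letter => ('a, 'k) chain_bar"
 assumes c: "cgood c" and k: "linear_along fscale crel k"
 shows "lsum (ev_cyclic_right c [Inl g]) (\<lambda>Q. lsum (ev_cyclic_right Q [Inl g]) k) =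
  act_cyclic_right [Inl g] [Inl g] (\<lambda>w. lsum (ev_cyclic_right c w) k)"
proof -
 have two: "ev_cyclic_right c [x, y] = []" for x y by (simp add: ev_cyclic_right_def)
 have rhs: "act_cyclic_right [Inl g] [Inl g] (\<lambda>w. lsum (ev_cyclic_right c w) k) = 0"
  by (simp add: act_Cons gamma_brace_zero ev_right_zero[OF c k] two)
 show ?thesis
 proof (cases c)
  case (Inl P)
  then have P: "homV P" using c by simp
  have "k (Inl (brace (brace P [g]) [g])) = act_ops [g] [g] (\<lambda>b. k (Inl (brace P b)))"
   by (rule brace_brace_letter[OF vs_f P _ _ linear_along_Inl[OF k]]) (simp_all add: g_good)
  also have "... = 0"
   using act_ops_gamma_gamma[OF vs_f on_ops_multilinear[OF P linear_along_Inl[OF k]]] by simp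
  finally show ?thesis unfolding rhs by (simp add: Inl)
 next
  case (Inr es)
  then obtain e0 e where es: "es = e0 # e" "homA e0" "homAs e" using c by (cases es) auto
  have gg: "homVs [g]" by (simp add: g_good)
  have m: "word_multilinear fscale relA homA (\<lambda>w. k (Inr (e0 # w)))"
   using word_multilinear_subword[OF word_multilinear_Inr[OF k], of "[e0]" "[]"] es by simp
  have "act_args [g] e (\<lambda>w. act_args [g] w (\<lambda>w. k (Inr (e0 # w)))) = 0"
   unfolding act_args_compose[OF vs_f gg gg es(3) m]
   by (rule act_ops_gamma_gamma[OF vs_f act_args_multilinear_ops[OF vs_f es(3) m]])
  moreover have "act_args [g] e (\<lambda>w. sg (wdeg sdeg w) (act_args [g] w (\<lambda>w. k (Inr (e0 # w))))) =
    sg (1 + wdeg sdeg e) (act_args [g] e (\<lambda>w. act_args [g] w (\<lambda>w. k (Inr (e0 # w)))))"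
   using act_sg_degree[OF graded_on_args gg es(3)] by simp
  ultimately show ?thesis unfolding rhs by (simp add: Inr es lsum_ev_right)
 qed
qed

text \<open>One odd operation on a word that is cut into three parts acts on one of the parts.\<close>

lemma act_gamma_split3:
 "act_args [g] e (\<lambda>w. spl w (\<lambda>w1 r. spl r (\<lambda>w2 w3. h w1 w2 w3))) =
  spl e (\<lambda>e1 r. spl r (\<lambda>e2 e3. act_args [g] e1 (\<lambda>w. h w e2 e3) +
   sg (wdeg sdeg e1) (act_args [g] e2 (\<lambda>w. h e1 w e3)) + sg (wdeg sdeg e1 + wdeg sdeg e2) (act_args [g] e3 (\<lambda>w. h e1 e2 w))))"
 by (simp add: act_split spl_plus act_spl spl_sg[symmetric] sg_add sg_sg add.assoc)

text \<open>On the right-hand side \<open>\<gamma>\<close> is inserted among \<open>v\<close>, into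
  the tail, or among \<open>u\<close>. Cut the tail into \<open>e1, e2, e3\<close>. Composition of
  \<open>v\<close> with \<open>\<gamma>\<close> is insertion of \<open>\<gamma>\<close> into
  \<open>e1\<close> before \<open>v\<close> is inserted, and similarly for \<open>u\<close> and
  \<open>e3\<close>; these two terms cancel against the insertions of \<open>\<gamma>\<close> into
  \<open>e1\<close> and \<open>e3\<close>, since \<open>\<gamma>\<close> is odd. The insertion into
  \<open>e2\<close> remains, which is the right multiplication of the value.\<close>

lemma ev_cyclic_gamma:
 fixes k :: "'a cyclic_letter => ('a, 'k) chain_bar"
 assumes P: "homV P" and cs: "list_all cgood cs" "one_chain cs" and k: "linear_along fscale crel k"
 shows "lsum (ev_cyclic P cs) (\<lambda>Q. lsum (ev_cyclic_right Q [Inl g]) k) = act_cyclic_right cs [Inl g] (\<lambda>w. lsum (ev_cyclic P w) k)"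
 using cs(2)
proof (cases rule: one_chain_cases)
 case (1 us)
 then have us: "homVs us" using cs by simp
 have "k (Inl (brace (brace P us) [g])) = act_ops us [g] (\<lambda>b. k (Inl (brace P b)))"
  by (rule brace_brace_letter[OF vs_f P us _ linear_along_Inl[OF k]]) (simp add: g_good)
 then show ?thesis unfolding 1 act_cyclic_right_Inl[OF us] by simp
next
 case (2 u es v)
 then obtain e0 e where es: "es = e0 # e" using cs(1) by (cases es) auto
 then have u: "homVs u" and v: "homVs v" and e0: "homA e0" and e: "homAs e" using cs(1) 2 by auto
 have gg: "homVs [g]" by (simp add: g_good)
 let ?D = "wdeg sdeg" and ?B = "wdeg snd"
 define s where "s e1 e2 e3 = (sdeg e0 + ?D e1 + ?D e2) * ?D e3 + ?B v * (?D e1 + ?D e2 + 1)" for e1 e2 e3 :: "('a \<times> int) list"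
 define G where "G e1 e2 e3 = act_args u e3 (\<lambda>ua. act_args v e1 (\<lambda>vb. k (Inr (apply_op P (ua @ e0 # vb) # e2))))" for e1 e2 e3
 define H1 where "H1 e1 e2 e3 = act_args [g] e1 (\<lambda>w. G w e2 e3)" for e1 e2 e3
 define H2 where "H2 e1 e2 e3 = act_args [g] e2 (\<lambda>w. G e1 w e3)" for e1 e2 e3
 define H3 where "H3 e1 e2 e3 = act_args [g] e3 (\<lambda>w. G e1 e2 w)" for e1 e2 e3
 have lhs: "lsum (ev_cyclic P cs) (\<lambda>Q. lsum (ev_cyclic_right Q [Inl g]) k) =
   spl e (\<lambda>e1 r. spl r (\<lambda>e2 e3. sg (s e1 e2 e3 + ?D e2) (H2 e1 e2 e3)))"
  unfolding 2 es ev_cyclic_Inr lsum_cyclic lsum_ev_right H2_def G_def s_def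
  by (simp add: act_sg sg_sg act_act[of on_args snd sdeg "[g]"])
 have unit: "act_cyclic_right (map Inl w) [] \<phi> = \<phi> (map Inl w)" for w and \<phi> :: "_ => ('a, 'k) chain_bar"
  by (rule act_unit_right) auto
 have rhs: "act_cyclic_right cs [Inl g] (\<lambda>w. lsum (ev_cyclic P w) k) =
   act_ops v [g] (\<lambda>v'. lsum (cyclic P u (e0 # e) v') k)
  + sg (?B v + ?D e) (act_args [g] e (\<lambda>w. lsum (cyclic P u (e0 # w) v) k))
  + sg (sdeg e0 + ?D e + 1 + ?B v) (act_ops u [g] (\<lambda>u'. lsum (cyclic P u' (e0 # e) v) k))"
  unfolding 2 es act_append_Cons
  by (simp add: unit act_cyclic_right_Inl[OF u] act_cyclic_right_Inl[OF v] lsum_ev_right sg_sg)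
 have good: "homAs e1 \<and> homAs e2 \<and> homAs e3" if "e = e1 @ r" "r = e2 @ e3" for e1 r e2 e3
  using that e by auto
 have t1: "act_ops v [g] (\<lambda>v'. lsum (cyclic P u (e0 # e) v') k) =
   spl e (\<lambda>e1 r. spl r (\<lambda>e2 e3. sg (s e1 e2 e3 + ?D e1 + ?D e2 + 1) (H1 e1 e2 e3)))"
 proof -
  have "act_ops v [g] (\<lambda>v'. lsum (cyclic P u (e0 # e) v') k) =
   act_ops v [g] (\<lambda>v'. spl e (\<lambda>e1 r. spl r (\<lambda>e2 e3. sg (s e1 e2 e3 + ?D e1 + ?D e2 + 1)
    (act_args u e3 (\<lambda>ua. act_args v' e1 (\<lambda>vb. k (Inr (apply_op P (ua @ e0 # vb) # e2))))))))"
   by (intro act_cong[OF graded_on_ops v gg]) (simp add: lsum_cyclic s_def algebra_simps)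
  also have "... = spl e (\<lambda>e1 r. spl r (\<lambda>e2 e3. sg (s e1 e2 e3 + ?D e1 + ?D e2 + 1)
    (act_args u e3 (\<lambda>ua. act_ops v [g] (\<lambda>v'. act_args v' e1 (\<lambda>vb. k (Inr (apply_op P (ua @ e0 # vb) # e2))))))))"
   by (simp only: act_spl act_sg act_act[of on_ops snd snd v "[g]"])
  also have "... = spl e (\<lambda>e1 r. spl r (\<lambda>e2 e3. sg (s e1 e2 e3 + ?D e1 + ?D e2 + 1) (H1 e1 e2 e3)))"
  proof (intro spl_cong arg_cong[where f = "sg _"])
   fix e1 r e2 e3 assume "e = e1 @ r" "r = e2 @ e3"
   then have g: "homAs e1" "homAs e2" "homAs e3" using good by auto
   have "act_args u e3 (\<lambda>ua. act_ops v [g] (\<lambda>v'. act_args v' e1 (\<lambda>vb. k (Inr (apply_op P (ua @ e0 # vb) # e2))))) =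
    act_args u e3 (\<lambda>ua. act_args [g] e1 (\<lambda>w. act_args v w (\<lambda>vb. k (Inr (apply_op P (ua @ e0 # vb) # e2)))))"
    by (intro act_cong[OF graded_on_args u g(3)] act_args_compose[symmetric, OF vs_f v gg g(1)] output_right[OF k P g(2) e0])
   then show "act_args u e3 (\<lambda>ua. act_ops v [g] (\<lambda>v'. act_args v' e1 (\<lambda>vb. k (Inr (apply_op P (ua @ e0 # vb) # e2))))) = H1 e1 e2 e3"
    unfolding H1_def G_def by (simp only: act_act[of on_args snd sdeg "[g]" e1])
  qed
  finally show ?thesis .
 qed
 have t3: "act_ops u [g] (\<lambda>u'. lsum (cyclic P u' (e0 # e) v) k) = spl e (\<lambda>e1 r. spl r (\<lambda>e2 e3. sg (s e1 e2 e3) (H3 e1 e2 e3)))"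
  unfolding lsum_cyclic act_spl act_sg s_def[symmetric]
 proof (intro spl_cong arg_cong[where f = "sg _"])
  fix e1 r e2 e3 assume "e = e1 @ r" "r = e2 @ e3"
  then have g: "homAs e1" "homAs e2" "homAs e3" using good by auto
  have "word_multilinear fscale relA homA (\<lambda>ua. act_args v e1 (\<lambda>vb. k (Inr (apply_op P (ua @ e0 # vb) # e2))))"
   by (rule vector_space.word_multilinear_act_param[OF vs_f graded_on_args v g(1)], rule output_left[OF k P g(2) e0])
  from act_args_compose[OF vs_f u gg g(3) this]
  show "act_ops u [g] (\<lambda>u'. act_args u' e3 (\<lambda>ua. act_args v e1 (\<lambda>vb. k (Inr (apply_op P (ua @ e0 # vb) # e2))))) = H3 e1 e2 e3"
   unfolding H3_def G_def by simp
 qed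
 have t2: "act_args [g] e (\<lambda>w. lsum (cyclic P u (e0 # w) v) k) =
   spl e (\<lambda>e1 r. spl r (\<lambda>e2 e3. sg (s e1 e2 e3 + ?D e3 + ?B v) (H1 e1 e2 e3) +
    sg (s e1 e2 e3 + ?D e1 + ?D e3 + ?B v) (H2 e1 e2 e3) + sg (s e1 e2 e3 + ?D e1 + ?D e2 + sdeg e0 + ?D e1 + ?D e2) (H3 e1 e2 e3)))"
  unfolding lsum_cyclic s_def[symmetric] G_def[symmetric] act_gamma_split3
 proof (intro spl_cong)
  fix e1 r e2 e3 assume "e = e1 @ r" "r = e2 @ e3"
  then have g: "homAs e1" "homAs e2" "homAs e3" using good by auto
  have 1: "act_args [g] e1 (\<lambda>w. sg (s w e2 e3) (G w e2 e3)) = sg (s e1 e2 e3 + ?D e3 + ?B v) (H1 e1 e2 e3)"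
   unfolding H1_def act_sg[symmetric]
   by (rule act_cong[OF graded_on_args gg g(1)]) (simp add: s_def algebra_simps)
  have 2: "act_args [g] e2 (\<lambda>w. sg (s e1 w e3) (G e1 w e3)) = sg (s e1 e2 e3 + ?D e3 + ?B v) (H2 e1 e2 e3)"
   unfolding H2_def act_sg[symmetric]
   by (rule act_cong[OF graded_on_args gg g(2)]) (simp add: s_def algebra_simps)
  have 3: "act_args [g] e3 (\<lambda>w. sg (s e1 e2 w) (G e1 e2 w)) = sg (s e1 e2 e3 + sdeg e0 + ?D e1 + ?D e2) (H3 e1 e2 e3)"
   unfolding H3_def act_sg[symmetric]
   by (rule act_cong[OF graded_on_args gg g(3)]) (simp add: s_def algebra_simps)
  show "act_args [g] e1 (\<lambda>w. sg (s w e2 e3) (G w e2 e3)) + sg (?D e1) (act_args [g] e2 (\<lambda>w. sg (s e1 w e3) (G e1 w e3))) +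
    sg (?D e1 + ?D e2) (act_args [g] e3 (\<lambda>w. sg (s e1 e2 w) (G e1 e2 w))) =
   sg (s e1 e2 e3 + ?D e3 + ?B v) (H1 e1 e2 e3) + sg (s e1 e2 e3 + ?D e1 + ?D e3 + ?B v) (H2 e1 e2 e3) +
    sg (s e1 e2 e3 + ?D e1 + ?D e2 + sdeg e0 + ?D e1 + ?D e2) (H3 e1 e2 e3)"
   unfolding 1 2 3 sg_sg by (simp add: algebra_simps)
 qed
 show ?thesis
  unfolding lhs rhs t1 t2 t3 spl_sg[symmetric] spl_plus[symmetric]
 proof (intro spl_cong)
  fix e1 r e2 e3 assume ee: "e = e1 @ r" "r = e2 @ e3"
  have 1: "sg (s e1 e2 e3 + ?D e1 + ?D e2 + 1) x = - sg (?B v + ?D e + (s e1 e2 e3 + ?D e3 + ?B v)) x" for x :: "('a, 'k) chain_bar"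
   by (rule sg_neg) (simp add: ee)
  have 2: "sg (s e1 e2 e3 + ?D e2) x = sg (?B v + ?D e + (s e1 e2 e3 + ?D e1 + ?D e3 + ?B v)) x" for x :: "('a, 'k) chain_bar"
   by (rule sg_eq) (simp add: ee)
  have 3: "sg (sdeg e0 + ?D e + 1 + ?B v + s e1 e2 e3) x = - sg (?B v + ?D e + (s e1 e2 e3 + ?D e1 + ?D e2 + sdeg e0 + ?D e1 + ?D e2)) x"
   for x :: "('a, 'k) chain_bar"
   by (rule sg_neg) (simp add: ee)
  show "sg (s e1 e2 e3 + ?D e2) (H2 e1 e2 e3) =
   sg (s e1 e2 e3 + ?D e1 + ?D e2 + 1) (H1 e1 e2 e3) +
   sg (?B v + ?D e) (sg (s e1 e2 e3 + ?D e3 + ?B v) (H1 e1 e2 e3) + sg (s e1 e2 e3 + ?D e1 + ?D e3 + ?B v) (H2 e1 e2 e3) +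
    sg (s e1 e2 e3 + ?D e1 + ?D e2 + sdeg e0 + ?D e1 + ?D e2) (H3 e1 e2 e3)) +
   sg (sdeg e0 + ?D e + 1 + ?B v) (sg (s e1 e2 e3) (H3 e1 e2 e3))"
   unfolding sg_add sg_sg 1 2 3 by simp
 qed
qed

end

context curved_Ainf_algebra
begin

section \<open>The model of the cyclic action\<close>

lemma cyclic_shape:
 fixes w :: "'a cyclic_letter list"
 shows "bar_shape Inl (\<lambda>es. [Inr es]) w \<longleftrightarrow> (\<exists>es. es \<noteq> [] \<and> filter (\<lambda>c. \<not> isl c) w = [Inr es])"
proof
 assume "\<exists>es. es \<noteq> [] \<and> filter (\<lambda>c. \<not> isl c) w = [Inr es]"
 then obtain es where es: "es \<noteq> []" "filter (\<lambda>c. \<not> isl c) w = [Inr es]" by blast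
 then have "one_chain w" by (simp add: one_chain_def)
 then show "bar_shape Inl (\<lambda>es. [Inr es]) w"
 proof (cases rule: one_chain_cases)
  case (2 us es' vs)
  then have "es' = es" using es by (simp add: filter_map comp_def)
  then show ?thesis unfolding bar_shape_def using 2 es(1) by auto
 qed (use es in \<open>simp add: filter_map comp_def\<close>)
qed (auto simp: bar_shape_def filter_map comp_def)

lemma set_cyclic: "(n, z) \<in> set (cyclic P u es v) ==> es \<noteq> [] \<and> (\<exists>x e. z = Inr (x # e))"
 by (cases es) (auto simp: cyclic_def elim!: set_bindE)

lemma ev_cyclic_shape:
 assumes "(n, z) \<in> set (ev_cyclic P b)" "bar_shape Inl (\<lambda>es. [Inr es]) (a @ z # c)"
 shows "bar_shape Inl (\<lambda>es. [Inr es]) (a @ b @ c)"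
proof (cases b rule: cword_cases)
 case (1 us)
 then show ?thesis using assms unfolding cyclic_shape by (auto simp: filter_map comp_def)
next
 case (2 us es vs)
 then show ?thesis using assms set_cyclic[of n z P us es vs] unfolding cyclic_shape
  by (auto simp: filter_map comp_def append_eq_Cons_conv)
next
 case (3 us es r)
 then show ?thesis using assms by (simp add: ev_cyclic_many)
qed

lemma ev_right_shape:
 assumes "(n, z) \<in> set (ev_cyclic_right y [Inl Q])"
 shows "(isl y \<longleftrightarrow> isl z) \<and> (\<forall>es. y = Inr es \<longrightarrow> es \<noteq> [])"
 using assms by (cases y; cases "projr y") (auto simp: ev_cyclic_right_def Let_def)

lemma ev_cyclic_filter:
 fixes k :: "_ => ('a list => 'a, 'k) tensor_algebra"
 shows "lsum (ev_cyclic P b) (\<lambda>z. if isl z then k (projl z) else 0) = (if list_all isl b then k (brace P (map projl b)) else 0)"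
proof (cases b rule: cword_cases)
 case (1 us)
 then show ?thesis by (simp add: comp_def)
next
 case (2 us es vs)
 have "lsum (cyclic P us es vs) (\<lambda>z. if isl z then k (projl z) else 0) = lsum (cyclic P us es vs) (\<lambda>z. 0)"
  by (rule lsum_cong) (auto dest: set_cyclic)
 then show ?thesis using 2 by simp
next
 case (3 us es r)
 then show ?thesis by (simp add: ev_cyclic_many)
qed

sublocale cyclic: letter_model sA A \<gamma> Inl projl isl cdeg cgood crel ev_cyclic ev_cyclic_right "\<lambda>es. [Inr es]" one_chain
proof (unfold_locales, goal_cases)
 case (3 c)
 then show ?case by simp
next
 case 6
 show ?case by (rule graded_crel)
next
 case (7 z a z1 b z2)
 then show ?case unfolding crel_def by blast
next
 case (8 z a z1 b z2)
 then show ?case unfolding crel_def by auto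
next
 case (9 z a z1 b z2)
 then show ?case unfolding crel_def by auto
next
 case 10
 show ?case by (rule graded_ev_cyclic)
next
 case 11
 show ?case by (rule graded_ev_right)
next
 case (12 P k)
 then show ?case by (rule ev_cyclic_args)
next
 case (13 b k)
 then show ?case by (rule ev_cyclic_op)
next
 case (14 b k)
 then show ?case by (rule ev_right_op)
next
 case (20 z a z1 b z2 l r)
 have "(Inr (l @ z # r), a, Inr (l @ z1 # r), b, Inr (l @ z2 # r)) \<in> crel"
  using 20 unfolding crel_def by blast
 then show ?case by (intro exI[of _ "[]"] exI conjI) auto
next
 case (21 z a z1 b z2 l r)
 then have "l = []" "r = []" by (auto simp: Cons_eq_append_conv)
 moreover from 21 obtain p q y y1 y2 where "z = Inr (p @ y # q)" "z1 = Inr (p @ y1 # q)" "z2 = Inr (p @ y2 # q)" "(y, a, y1, b, y2) \<in> relA"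
  unfolding crel_def by auto
 ultimately show ?case by (intro exI[of _ p] exI[of _ q] exI[of _ y] exI[of _ y1] exI[of _ y2]) simp
next
 case (22 a b c)
 then show ?case by (simp add: one_chain_def)
next
 case (23 us es vs)
 then show ?case by (simp add: one_chain_def filter_map comp_def)
next
 case (24 P y cs k)
 then show ?case by (rule ev_cyclic_brace)
next
 case (25 P cs k)
 then show ?case by (rule ev_cyclic_gamma)
next
 case (26 c k)
 then show ?case by (rule ev_right_square)
next
 case (28 c k)
 then show ?case by (rule ev_right_zero)
next
 case (29 P b k)
 then show ?case by (rule ev_cyclic_filter)
next
 case (30 c n z)
 then show ?case using ev_right_shape by blast
next
 case (31 n z P a b c)
 then show ?case by (rule ev_cyclic_shape)
next
 case (32 n z y a c)
 note s = ev_right_shape[OF 32(1)]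
 show ?case
 proof (cases y)
  case (Inl P)
  then have "isl z" using s by simp
  then show ?thesis using 32(2) Inl unfolding cyclic_shape by auto
 next
  case (Inr es)
  then have "\<not> isl z" "es \<noteq> []" using s by auto
  then show ?thesis using 32(2) Inr unfolding cyclic_shape by (auto simp: append_eq_Cons_conv)
 qed
next
 case (33 a P c)
 then show ?case unfolding cyclic_shape by simp
qed auto

end

section \<open>Letters for the insertion action\<close>

text \<open>Operations, the entry \<open>e\<^sub>0\<close>, and the other entries of a chain.
  Keeping \<open>e\<^sub>0\<close> apart prevents operations from taking it as an argument, and
  keeps entries and operations from being interchanged.\<close>

datatype 'b insertion_letter =
 is_VL: VL (un_VL: "'b oper") | is_HL: HL (un_HL: "'b \<times> int") | is_BL: BL (un_BL: "'b \<times> int")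

lemma map_letters [simp]:
 fixes u :: "('b oper) list" and e :: "('b \<times> int) list"
 shows   "list_all is_VL (map VL u)" "list_all is_BL (map BL e)" "list_all is_VL (map BL e) \<longleftrightarrow> e = []" "list_all is_BL (map VL u) \<longleftrightarrow> u = []"
 "un_VL \<circ> VL = id" "un_BL \<circ> BL = id"
proof -
 show "list_all is_VL (map VL u)" "list_all is_BL (map BL e)" by (simp_all add: list_all_iff)
 show "list_all is_VL (map BL e) \<longleftrightarrow> e = []" by (cases e) auto
 show "list_all is_BL (map VL u) \<longleftrightarrow> u = []" by (cases u) auto
qed (auto simp: fun_eq_iff)

lemma all_VL: "list_all is_VL w ==> w = map VL (map un_VL w)"
 by (auto simp: list_all_iff map_idI)

lemma all_BL: "list_all is_BL w ==> w = map BL (map un_BL w)"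
 by (auto simp: list_all_iff map_idI)

context curved_Ainf_algebra
begin

definition ins_enc :: "('a \<times> int) list => 'a insertion_letter list" where
 "ins_enc es = (case es of [] => [] | e0 # e => HL e0 # map BL e)"

text \<open>The letter for \<open>e\<^sub>0\<close> has its degree in \<open>A\<close>, the other
  entries are shifted; the sum is the degree of the chain.\<close>

definition ideg :: "'a insertion_letter => int" where
 "ideg c = (case c of VL P => snd P | HL e => sdeg e + 1 | BL e => sdeg e)"

definition igood :: "'a insertion_letter => bool" where
 "igood c = (case c of VL P => homV P | HL e => homA e | BL e => homA e)"

definition irel :: "('a insertion_letter, 'k) linear_relations" where
 "irel = {(VL z, a, VL z1, b, VL z2) | z a z1 b z2. (z, a, z1, b, z2) \<in> relV} \<union>
   {(HL z, a, HL z1, b, HL z2) | z a z1 b z2. (z, a, z1, b, z2) \<in> relA} \<union>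
   {(BL z, a, BL z1, b, BL z2) | z a z1 b z2. (z, a, z1, b, z2) \<in> relA}"

text \<open>An empty block is both a block of operations and a block of entries, and has two values.
  Of the resulting words at most the ones where each letter is at an admissible position are bar
  words.\<close>

definition ev_ins :: "('a oper, 'a insertion_letter) operation" where
 "ev_ins P cs = (if list_all is_VL cs then [(0, VL (brace P (map un_VL cs)))] else []) @
   (if list_all is_BL cs then [(0, BL (apply_op P (map un_BL cs)))] else [])"

definition ev_ins_right :: "('a insertion_letter, 'a insertion_letter) operation" where
 "ev_ins_right c ys = (if ys = [] then [(0, c)] else
   if is_VL c \<and> length ys = 1 \<and> is_VL (hd ys) then [(0, VL (brace (un_VL c) [un_VL (hd ys)]))] else [])"

abbreviation "act_ins \<equiv> act ev_ins snd ideg"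
abbreviation "act_ins_right \<equiv> act ev_ins_right ideg ideg"

lemma ins_simps [simp]:
 "ideg (VL P) = snd P" "ideg (HL e) = sdeg e + 1" "ideg (BL e) = sdeg e"
 "igood (VL P) = homV P" "igood (HL e) = homA e" "igood (BL e) = homA e"
 "ins_enc (e0 # e') = HL e0 # map BL e'"
 "ev_ins_right c [] = [(0, c)]" "ev_ins_right (VL P) [VL Q] = [(0, VL (brace P [Q]))]"
 "ev_ins_right (HL e) [Q'] = []" "ev_ins_right (BL e) [Q'] = []"
 by (simp_all add: ideg_def igood_def ins_enc_def ev_ins_right_def)

lemma map_letters_hom [simp]:
 "list_all igood (map VL u) = homVs u" "list_all igood (map BL e) = homAs e"
 "wdeg ideg (map VL u) = wdeg snd u" "wdeg ideg (map BL e) = wdeg sdeg e"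
proof -
 show "list_all igood (map VL u) = homVs u" "wdeg ideg (map VL u) = wdeg snd u" by (induction u) auto
 show "list_all igood (map BL e) = homAs e" "wdeg ideg (map BL e) = wdeg sdeg e" by (induction e) auto
qed

lemma lsum_ev_ins:
 "lsum (ev_ins P b) k = (if list_all is_VL b then k (VL (brace P (map un_VL b))) else 0) +
   (if list_all is_BL b then k (BL (apply_op P (map un_BL b))) else 0)"
 by (simp add: ev_ins_def)

text \<open>If only words of operations are kept, the action is the product of
  \<open>T(End(A))\<close>.\<close>

lemma act_ins_VL:
 "act_ins y cs (\<lambda>w. if list_all is_VL w then \<phi> (map un_VL w) else 0) =
   (if list_all is_VL cs then act_ops y (map un_VL cs) \<phi> else 0)"
proof (induction y arbitrary: cs \<phi>)
 case (Cons P y)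
 have inner: "lsum (ev_ins P b) (\<lambda>z. act_ins y c (\<lambda>w. if list_all is_VL (a @ z # w) then \<phi> (map un_VL (a @ z # w)) else 0)) =
  (if list_all is_VL (a @ b @ c) then act_ops y (map un_VL c) (\<lambda>w. \<phi> (map un_VL a @ brace P (map un_VL b) # w)) else 0)" for a b c
  using Cons.IH[of c "\<lambda>w. \<phi> (map un_VL a @ brace P (map un_VL b) # w)"] by (cases "list_all is_VL a") (auto simp: lsum_ev_ins cong: if_cong)
 show ?case
 proof (cases "list_all is_VL cs")
  case True
  then obtain u where u: "cs = map VL u" using all_VL by blast
  show ?thesis unfolding act_Cons inner u by (simp add: spl_map)
 next
  case False
  have "act_ins (P # y) cs (\<lambda>w. if list_all is_VL w then \<phi> (map un_VL w) else 0) = spl cs (\<lambda>a r. spl r (\<lambda>b c. 0))"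
   unfolding act_Cons inner using False by (intro spl_cong) auto
  then show ?thesis using False by simp
 qed
qed simp

text \<open>If only words of entries are kept, the action is the application of operations to
  arguments.\<close>

lemma act_ins_BL:
 "act_ins y cs (\<lambda>w. if list_all is_BL w then \<phi> (map un_BL w) else 0) =
   (if list_all is_BL cs then act_args y (map un_BL cs) \<phi> else 0)"
proof (induction y arbitrary: cs \<phi>)
 case (Cons P y)
 have inner: "lsum (ev_ins P b) (\<lambda>z. act_ins y c (\<lambda>w. if list_all is_BL (a @ z # w) then \<phi> (map un_BL (a @ z # w)) else 0)) =
  (if list_all is_BL (a @ b @ c) then act_args y (map un_BL c) (\<lambda>w. \<phi> (map un_BL a @ apply_op P (map un_BL b) # w)) else 0)" for a b c
  using Cons.IH[of c "\<lambda>w. \<phi> (map un_BL a @ apply_op P (map un_BL b) # w)"] by (cases "list_all is_BL a") (auto simp: lsum_ev_ins cong: if_cong)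
 show ?case
 proof (cases "list_all is_BL cs")
  case True
  then obtain u where u: "cs = map BL u" using all_BL by blast
  show ?thesis unfolding act_Cons inner u by (simp add: spl_map)
 next
  case False
  have "act_ins (P # y) cs (\<lambda>w. if list_all is_BL w then \<phi> (map un_BL w) else 0) = spl cs (\<lambda>a r. spl r (\<lambda>b c. 0))"
   unfolding act_Cons inner using False by (intro spl_cong) auto
  then show ?thesis using False by simp
 qed
qed simp

lemma graded_irel: "graded_relations igood ideg irel"
proof -
 have "homA z \<and> homA z1 \<and> homA z2 \<and> sdeg z1 = sdeg z \<and> sdeg z2 = sdeg z" if "(z, a, z1, b, z2) \<in> relA" for z a z1 b z2
  using graded_relA that unfolding graded_relations_def by fastforce
 moreover have "homV z \<and> homV z1 \<and> homV z2 \<and> snd z1 = snd z \<and> snd z2 = snd z" if "(z, a, z1, b, z2) \<in> relV" for z a z1 b z2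
  using graded_relV that unfolding graded_relations_def by fastforce
 ultimately show ?thesis unfolding graded_relations_def irel_def by fastforce
qed

lemma ins_word_multilinear_VL:
 fixes \<phi> :: "_ => ('a, 'k) chain_bar"
 assumes "word_multilinear fscale relV homV \<phi>"
 shows "word_multilinear fscale irel igood (\<lambda>b. if list_all is_VL b then \<phi> (map un_VL b) else 0)"
proof (rule word_multilinearI)
 fix l r z a z1 b z2 assume l: "list_all igood l" and r: "list_all igood r" and rel: "(z, a, z1, b, z2) \<in> irel"
 show "(if list_all is_VL (l @ z # r) then \<phi> (map un_VL (l @ z # r)) else 0) =
  fscale a (if list_all is_VL (l @ z1 # r) then \<phi> (map un_VL (l @ z1 # r)) else 0) +
  fscale b (if list_all is_VL (l @ z2 # r) then \<phi> (map un_VL (l @ z2 # r)) else 0)"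
 proof (cases "is_VL z \<and> list_all is_VL l \<and> list_all is_VL r")
  case True
  then obtain y y1 y2 where y: "z = VL y" "z1 = VL y1" "z2 = VL y2" "(y, a, y1, b, y2) \<in> relV"
   using rel unfolding irel_def by auto
  have "homVs (map un_VL l)" "homVs (map un_VL r)"
   using True all_VL[of l] all_VL[of r] l r map_letters_hom(1) by metis+
  then show ?thesis using word_multilinearD[OF assms _ _ y(4)] True y by simp
 next
  case False
  then show ?thesis using rel unfolding irel_def by (auto simp: fscale_zero)
 qed
qed

lemma ins_word_multilinear_BL:
 fixes \<phi> :: "_ => ('a, 'k) chain_bar"
 assumes "word_multilinear fscale relA homA \<phi>"
 shows "word_multilinear fscale irel igood (\<lambda>b. if list_all is_BL b then \<phi> (map un_BL b) else 0)"
proof (rule word_multilinearI)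
 fix l r z a z1 b z2 assume l: "list_all igood l" and r: "list_all igood r" and rel: "(z, a, z1, b, z2) \<in> irel"
 show "(if list_all is_BL (l @ z # r) then \<phi> (map un_BL (l @ z # r)) else 0) =
  fscale a (if list_all is_BL (l @ z1 # r) then \<phi> (map un_BL (l @ z1 # r)) else 0) +
  fscale b (if list_all is_BL (l @ z2 # r) then \<phi> (map un_BL (l @ z2 # r)) else 0)"
 proof (cases "is_BL z \<and> list_all is_BL l \<and> list_all is_BL r")
  case True
  then obtain y y1 y2 where y: "z = BL y" "z1 = BL y1" "z2 = BL y2" "(y, a, y1, b, y2) \<in> relA"
   using rel unfolding irel_def by auto
  have "homAs (map un_BL l)" "homAs (map un_BL r)"
   using True all_BL[of l] all_BL[of r] l r map_letters_hom(2) by metis+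
  then show ?thesis using word_multilinearD[OF assms _ _ y(4)] True y by simp
 next
  case False
  then show ?thesis using rel unfolding irel_def by (auto simp: fscale_zero)
 qed
qed

context
 fixes k :: "'a insertion_letter => ('a, 'k) chain_bar"
 assumes k: "linear_along fscale irel k"
begin

lemma linear_along_VL: "linear_along fscale relV (\<lambda>P. k (VL P))"
 by (rule linear_alongI) (rule linear_alongD[OF k], auto simp: irel_def)

lemma linear_along_BL: "linear_along fscale relA (\<lambda>P. k (BL P))"
 by (rule linear_alongI) (rule linear_alongD[OF k], auto simp: irel_def)

lemma ins_VL_multilinear: "homV P ==> word_multilinear fscale relV homV (\<lambda>b. k (VL (brace P b)))"
 using on_ops_multilinear[OF _ linear_along_VL] by simp

lemma ins_BL_multilinear: "homV P ==> word_multilinear fscale relA homA (\<lambda>b. k (BL (apply_op P b)))"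
 using on_args_multilinear[OF _ linear_along_BL] by simp

lemma ev_ins_args:
 assumes "homV P"
 shows "word_multilinear fscale irel igood (\<lambda>b. lsum (ev_ins P b) k)"
 unfolding lsum_ev_ins
 by (intro vector_space.word_multilinear_plus[OF vs_f] ins_word_multilinear_VL ins_word_multilinear_BL
   ins_VL_multilinear ins_BL_multilinear assms)

lemma ev_ins_op:
 assumes b: "list_all igood b"
 shows "linear_along fscale relV (\<lambda>P. lsum (ev_ins P b) k)"
 unfolding lsum_ev_ins
proof (intro vector_space.linear_along_plus[OF vs_f])
 show "linear_along fscale relV (\<lambda>P. if list_all is_VL b then k (VL (brace P (map un_VL b))) else 0)"
 proof (cases "list_all is_VL b")
  case True
  then have "homVs (map un_VL b)" using b all_VL[of b] map_letters_hom(1) by metis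
  then show ?thesis using on_ops_linear[OF _ linear_along_VL] True by simp
 qed (simp add: vector_space.linear_along_zero[OF vs_f])
 show "linear_along fscale relV (\<lambda>P. if list_all is_BL b then k (BL (apply_op P (map un_BL b))) else 0)"
 proof (cases "list_all is_BL b")
  case True
  then have "homAs (map un_BL b)" using b all_BL[of b] map_letters_hom(2) by metis
  then show ?thesis using on_args_linear[OF _ linear_along_BL] True by simp
 qed (simp add: vector_space.linear_along_zero[OF vs_f])
qed

lemma ev_ins_right_op:
 assumes b: "list_all igood b"
 shows "linear_along fscale irel (\<lambda>c. lsum (ev_ins_right c b) k)"
proof -
 consider "b = []" | Q where "b = [VL Q]" | "b \<noteq> []" "\<And>Q. b \<noteq> [VL Q]" by blast
 then show ?thesis
 proof cases
  case 1
  then show ?thesis using k by simp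
 next
  case (2 Q)
  then have Q: "homVs [Q]" using b by simp
  show ?thesis unfolding 2
  proof (rule linear_alongI)
   fix z a z1 b z2 assume "(z, a, z1, b, z2) \<in> irel"
   then show "lsum (ev_ins_right z [VL Q]) k = fscale a (lsum (ev_ins_right z1 [VL Q]) k) + fscale b (lsum (ev_ins_right z2 [VL Q]) k)"
    using linear_alongD[OF on_ops_linear[OF Q linear_along_VL]] unfolding irel_def by (auto simp: fscale_zero)
  qed
 next
  case 3
  have "ev_ins_right c b = []" for c
   using 3 unfolding ev_ins_right_def by (cases b) (auto simp: is_VL_def)
  then show ?thesis by (simp add: vector_space.linear_along_zero[OF vs_f])
 qed
qed

lemma ev_ins_right_zero:
 assumes "igood c"
 shows "lsum (ev_ins_right c [VL (0, 2)]) k = 0"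
proof (cases c)
 case (VL P)
 have "lsum (on_ops P ([] @ (0, 2) # [])) (\<lambda>P. k (VL P)) = 0"
  by (rule word_multilinear_zero_letter[OF vs_f on_ops_multilinear[OF _ linear_along_VL] _ _ zero_relV])
   (use assms VL in auto)
 then show ?thesis by (simp add: VL)
qed simp_all

lemma ev_ins_right_square:
 assumes "igood c"
 shows "lsum (ev_ins_right c [VL g]) (\<lambda>Q. lsum (ev_ins_right Q [VL g]) k) =
  act_ins_right [VL g] [VL g] (\<lambda>w. lsum (ev_ins_right c w) k)"
proof -
 have two: "ev_ins_right c [x, y] = []" for x y by (simp add: ev_ins_right_def)
 have rhs: "act_ins_right [VL g] [VL g] (\<lambda>w. lsum (ev_ins_right c w) k) = 0"
  by (simp add: act_Cons gamma_brace_zero ev_ins_right_zero[OF assms] two)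
 show ?thesis
 proof (cases c)
  case (VL P)
  then have P: "homV P" using assms by simp
  have "k (VL (brace (brace P [g]) [g])) = act_ops [g] [g] (\<lambda>b. k (VL (brace P b)))"
   by (rule brace_brace_letter[OF vs_f P _ _ linear_along_VL]) (simp_all add: g_good)
  also have "... = 0" by (rule act_ops_gamma_gamma[OF vs_f ins_VL_multilinear[OF P]])
  finally show ?thesis unfolding rhs by (simp add: VL)
 qed (unfold rhs, simp_all)
qed

lemma ev_ins_brace:
 assumes P: "homV P" and y: "homVs y" and cs: "list_all igood cs"
 shows "lsum (ev_ins (brace P y) cs) k = act_ins y cs (\<lambda>w. lsum (ev_ins P w) k)"
proof -
 have "k (VL (brace (brace P y) (map un_VL cs))) = act_ops y (map un_VL cs) (\<lambda>b. k (VL (brace P b)))" if "list_all is_VL cs"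
  by (rule brace_brace_letter[OF vs_f P y _ linear_along_VL]) (metis that cs all_VL map_letters_hom(1))
 moreover have "k (BL (apply_op (brace P y) (map un_BL cs))) = act_args y (map un_BL cs) (\<lambda>b. k (BL (apply_op P b)))" if "list_all is_BL cs"
  by (rule brace_letter[OF vs_f P y _ linear_along_BL]) (metis that cs all_BL map_letters_hom(2))
 ultimately show ?thesis
  unfolding lsum_ev_ins act_plus
   act_ins_VL[of y cs "\<lambda>b. k (VL (brace P b))"] act_ins_BL[of y cs "\<lambda>b. k (BL (apply_op P b))"] by simp
qed

end

lemma act_ins_right_Cons:
 "act_ins_right (c # cs) [Q] \<phi> = sg ((ideg c + wdeg ideg cs) * ideg Q) (\<phi> (Q # c # cs)) +
  sg (wdeg ideg cs * ideg Q) (lsum (ev_ins_right c [Q]) (\<lambda>z. \<phi> (z # cs))) + act_ins_right cs [Q] (\<lambda>w. \<phi> (c # w))"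
 by (simp add: act_Cons act_unit_right distrib_right add_ac)

lemma act_ins_right_map_VL:
 "homVs u ==> act_ins_right (map VL u) [VL Q] \<phi> = act_ops u [Q] (\<lambda>w. \<phi> (map VL w))"
proof (induction u arbitrary: \<phi>)
 case (Cons P u)
 have u: "act_ops u [] \<phi>' = \<phi>' u" for \<phi>' :: "_ => 'b"
  by (rule act_unit_right) (use Cons.prems brace_Nil in \<open>auto simp: on_ops_def list_all_iff\<close>)
 show ?case
  using Cons by (simp add: act_Cons u act_unit_right brace_Nil)
qed simp

lemma act_ins_right_not_VL:
 assumes "\<not> list_all is_VL cs" "\<And>w. \<not> list_all is_VL w ==> \<phi> w = 0"
 shows "act_ins_right cs [VL Q] \<phi> = 0"
 using assms
proof (induction cs arbitrary: \<phi>)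
 case (Cons c cs)
 show ?case
 proof (cases c)
  case (VL P)
  then have "act_ins_right cs [VL Q] (\<lambda>w. \<phi> (c # w)) = 0" using Cons.prems by (intro Cons.IH) auto
  then show ?thesis using Cons.prems VL by (simp add: act_ins_right_Cons)
 qed (use Cons.prems in \<open>simp_all add: act_ins_right_Cons\<close>)
qed simp

lemma act_ins_right_no_VL:
 assumes "\<And>w. \<exists>x\<in>set w. is_VL x ==> \<phi> w = 0"
 shows "act_ins_right cs [VL Q] \<phi> = 0"
 using assms
proof (induction cs arbitrary: \<phi>)
 case (Cons c cs)
 have "act_ins_right cs [VL Q] (\<lambda>w. \<phi> (c # w)) = 0" using Cons.prems by (intro Cons.IH) auto
 moreover have "lsum (ev_ins_right c [VL Q]) (\<lambda>z. \<phi> (z # cs)) = 0" using Cons.prems by (cases c) auto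
 ultimately show ?case using Cons.prems by (simp add: act_ins_right_Cons)
qed simp

text \<open>A right multiplication always leaves an operation in the word, so only the part of the
  value on operations contributes.\<close>

lemma ev_ins_gamma:
 fixes k :: "'a insertion_letter => ('a, 'k) chain_bar"
 assumes P: "homV P" and cs: "list_all igood cs" and k: "linear_along fscale irel k"
 shows "lsum (ev_ins P cs) (\<lambda>Q. lsum (ev_ins_right Q [VL g]) k) = act_ins_right cs [VL g] (\<lambda>w. lsum (ev_ins P w) k)"
proof -
 have BL: "act_ins_right cs [VL g] (\<lambda>w. if list_all is_BL w then k (BL (apply_op P (map un_BL w))) else 0) = 0"
 proof (rule act_ins_right_no_VL)
  fix w :: "'a insertion_letter list" assume "\<exists>x\<in>set w. is_VL x"
  then obtain x where "x \<in> set w" "\<not> is_BL x" by (auto simp: is_VL_def)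
  then have "\<not> list_all is_BL w" by (auto simp: list_all_iff)
  then show "(if list_all is_BL w then k (BL (apply_op P (map un_BL w))) else 0) = 0" by simp
 qed
 show ?thesis
 proof (cases "list_all is_VL cs")
  case True
  then obtain u where u: "cs = map VL u" using all_VL by blast
  have "k (VL (brace (brace P u) [g])) = act_ops u [g] (\<lambda>b. k (VL (brace P b)))"
   by (rule brace_brace_letter[OF vs_f P _ _ linear_along_VL[OF k]]) (use cs u in \<open>simp_all add: g_good\<close>)
  moreover have "act_ins_right cs [VL g] (\<lambda>w. if list_all is_VL w then k (VL (brace P (map un_VL w))) else 0) =
    act_ops u [g] (\<lambda>b. k (VL (brace P b)))"
   using cs unfolding u by (subst act_ins_right_map_VL) simp_all
  ultimately show ?thesis unfolding lsum_ev_ins act_plus BL by (simp add: u)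
 next
  case False
  then have "act_ins_right cs [VL g] (\<lambda>w. if list_all is_VL w then k (VL (brace P (map un_VL w))) else 0) = 0"
   by (rule act_ins_right_not_VL) simp
  then show ?thesis unfolding lsum_ev_ins act_plus BL using False by simp
 qed
qed

text \<open>A finite automaton for bar words: state 0 reads the leading operations, state 1 the
  entries after \<open>e\<^sub>0\<close>, and state 2 the final operations.\<close>

fun accepted :: "nat => 'a insertion_letter list => bool" where
 "accepted s [] = (s \<noteq> 0)"
| "accepted s (VL P # w) = accepted (if s = 0 then 0 else 2) w"
| "accepted s (HL e # w) = (s = 0 \<and> accepted 1 w)"
| "accepted s (BL e # w) = (s = 1 \<and> accepted 1 w)"

lemma accepted_2: "accepted 2 w ==> accepted (Suc 0) w \<and> (\<exists>vs. w = map VL vs)"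
proof (induction w)
 case (Cons c w)
 then show ?case by (cases c) (auto intro: exI[of _ "_ # _"])
qed simp

lemma accepted_1: "accepted (Suc 0) w ==> \<exists>es vs. w = map BL es @ map VL vs"
proof (induction w)
 case (Cons c w)
 show ?case
 proof (cases c)
  case (VL P)
  then obtain vs where "w = map VL vs" using Cons.prems accepted_2 by auto
  then show ?thesis using VL by (intro exI[of _ "[]"] exI[of _ "P # vs"]) simp
 next
  case (BL e)
  then obtain es vs where "w = map BL es @ map VL vs" using Cons by auto
  then show ?thesis using BL by (intro exI[of _ "e # es"] exI[of _ vs]) simp
 qed (use Cons.prems in simp)
qed simp

lemma accepted_0: "accepted 0 w ==> bar_shape VL ins_enc w"
proof (induction w)
 case (Cons c w)
 show ?case
 proof (cases c)
  case (VL P)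
  then obtain us es vs where "es \<noteq> []" "w = map VL us @ ins_enc es @ map VL vs" using Cons unfolding bar_shape_def by auto
  then show ?thesis unfolding bar_shape_def using VL by (intro exI[of _ "P # us"] exI[of _ es] exI[of _ vs]) simp
 next
  case (HL e)
  then have "accepted (Suc 0) w" using Cons.prems by simp
  then obtain es vs where "w = map BL es @ map VL vs" using accepted_1 by blast
  then show ?thesis unfolding bar_shape_def using HL by (intro exI[of _ "[]"] exI[of _ "e # es"] exI[of _ vs]) simp
 qed (use Cons.prems in simp)
qed simp

lemma accepted_map:
 "accepted 2 (map VL vs)" "accepted (Suc 0) (map VL vs)" "accepted (Suc 0) (map BL es @ w) = accepted (Suc 0) w"
 "accepted 0 (map VL us @ w) = accepted 0 w" "accepted 2 (map VL us @ w) = accepted 2 w"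
 "u \<noteq> [] ==> accepted (Suc 0) (map VL u @ w) = accepted 2 w"
proof -
 show v: "accepted 2 (map VL vs)" for vs by (induction vs) auto
 then show "accepted (Suc 0) (map VL vs)" by (cases vs) auto
 show "accepted (Suc 0) (map BL es @ w) = accepted (Suc 0) w" by (induction es) auto
 show "accepted 0 (map VL us @ w) = accepted 0 w" for us by (induction us) auto
 show *: "accepted 2 (map VL us @ w) = accepted 2 w" for us by (induction us) auto
 show "u \<noteq> [] ==> accepted (Suc 0) (map VL u @ w) = accepted 2 w" by (cases u) (auto simp: *)
qed

lemma insertion_shape: "bar_shape VL ins_enc w \<longleftrightarrow> accepted 0 w"
proof
 assume "bar_shape VL ins_enc w"
 then obtain us es vs where "es \<noteq> []" "w = map VL us @ ins_enc es @ map VL vs" unfolding bar_shape_def by blast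
 then show "accepted 0 w" by (cases es) (auto simp: accepted_map)
qed (rule accepted_0)

text \<open>Replacing a factor of a word by another one that is accepted from at least the same
  states preserves acceptance.\<close>

lemma accepted_context:
 assumes "\<And>t. accepted t r ==> accepted t r'" "accepted s (a @ r)"
 shows "accepted s (a @ r')"
 using assms(2)
proof (induction a arbitrary: s)
 case (Cons c a)
 then show ?case by (cases c) auto
qed (use assms(1) in simp)

lemma accepted_VL:
 assumes "accepted t (VL z # c)"
 shows "accepted t (map VL u @ c)"
proof -
 consider "t = 0" | "t = 1" | "t \<noteq> 0" "t \<noteq> 1" by blast
 then show ?thesis
 proof cases
  case 2
  then show ?thesis using assms accepted_2[of c] by (cases "u = []") (auto simp: accepted_map)
 next
  case 3
  have "accepted 2 c" using assms 3 by simp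
  then obtain vs where "c = map VL vs" using accepted_2 by blast
  then have "map VL u @ c = map VL (u @ vs)" by simp
  moreover have "accepted t (map VL ws)" for ws using 3 accepted_map(1) by (cases ws) auto
  ultimately show ?thesis by metis
 qed (use assms in \<open>simp add: accepted_map\<close>)
qed

sublocale insertion: letter_model sA A \<gamma> VL un_VL is_VL ideg igood irel ev_ins ev_ins_right ins_enc "\<lambda>_. True"
proof (unfold_locales, goal_cases)
 case (3 c)
 then show ?case by simp
next
 case 6
 show ?case by (rule graded_irel)
next
 case (7 z a z1 b z2)
 then show ?case unfolding irel_def by blast
next
 case (8 z a z1 b z2)
 then show ?case unfolding irel_def by auto
next
 case (9 z a z1 b z2)
 then show ?case unfolding irel_def by auto
next
 case 10
 show ?case
  unfolding graded_operation_def
 proof (intro allI impI, elim conjE)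
  fix P b n z assume P: "homV P" and b: "list_all igood b" and z: "(n, z) \<in> set (ev_ins P b)"
  from z consider "list_all is_VL b" "z = VL (brace P (map un_VL b))" | "list_all is_BL b" "z = BL (apply_op P (map un_BL b))"
   unfolding ev_ins_def by (auto split: if_splits)
  then show "igood z \<and> ideg z = snd P + wdeg ideg b"
  proof cases
   case 1
   then obtain u where "b = map VL u" using all_VL by blast
   then show ?thesis using 1 b brace_homogeneous[OF P, of u] by simp
  next
   case 2
   then obtain u where "b = map BL u" using all_BL by blast
   then show ?thesis using 2 b End_apply[OF P, of u] by simp
  qed
 qed
next
 case 11
 show ?case
  unfolding graded_operation_def
 proof (intro allI impI, elim conjE)
  fix c b n z assume c: "igood c" and b: "list_all igood b" and z: "(n, z) \<in> set (ev_ins_right c b)"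
  from z consider "b = []" "z = c" | P Q where "c = VL P" "b = [VL Q]" "z = VL (brace P [Q])"
   unfolding ev_ins_right_def by (cases b) (auto split: if_splits simp: is_VL_def)
  then show "igood z \<and> ideg z = ideg c + wdeg ideg b"
  proof cases
   case (2 P Q)
   then show ?thesis using b c brace_homogeneous[of P "[Q]"] by simp
  qed (use c in simp)
 qed
next
 case (12 P k)
 then show ?case by (intro ev_ins_args)
next
 case (13 b k)
 then show ?case by (intro ev_ins_op)
next
 case (14 b k)
 then show ?case by (intro ev_ins_right_op)
next
 case (16 es)
 then show ?case by (cases es) auto
next
 case (17 es)
 then show ?case by (cases es) auto
next
 case (18 es)
 then show ?case by (cases es) (auto simp: list_all_iff)
next
 case (19 es es')
 then show ?case by (cases es; cases es') (auto simp: inj_map_eq_map inj_def)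
next
 case (20 z a z1 b z2 l r)
 show ?case
 proof (cases l)
  case Nil
  have "(HL z, a, HL z1, b, HL z2) \<in> irel" using 20 unfolding irel_def by blast
  then show ?thesis using 20 Nil by (intro exI[of _ "[]"] exI[of _ "map BL r"] exI conjI) auto
 next
  case (Cons e0 l')
  have "(BL z, a, BL z1, b, BL z2) \<in> irel" using 20 unfolding irel_def by blast
  then show ?thesis using 20 Cons by (intro exI[of _ "HL e0 # map BL l'"] exI[of _ "map BL r"] exI conjI) auto
 qed
next
 case (21 z a z1 b z2 l r)
 from 21(5) obtain es x where es: "es \<noteq> []" "ins_enc es = l @ x # r" "x = z \<or> x = z1 \<or> x = z2" by blast
 then obtain e0 e where e: "HL e0 # map BL e = l @ x # r" by (cases es) auto
 from 21(1,2) consider (m) y y1 y2 where "z = HL y" "z1 = HL y1" "z2 = HL y2" "(y, a, y1, b, y2) \<in> relA"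
  | (b) y y1 y2 where "z = BL y" "z1 = BL y1" "z2 = BL y2" "(y, a, y1, b, y2) \<in> relA"
  unfolding irel_def by auto
 then show ?case
 proof cases
  case m
  then have "is_HL x" using es(3) by auto
  then have "l = [] \<and> r = map BL e" using e by (auto simp: Cons_eq_append_conv map_eq_append_conv)
  then show ?thesis using m by (intro exI[of _ "[]"] exI[of _ e] exI conjI) auto
 next
  case b
  then have "is_BL x" using es(3) by auto
  then obtain l' r' where "l = HL e0 # map BL l' \<and> r = map BL r'" using e by (auto simp: Cons_eq_append_conv map_eq_append_conv)
  then show ?thesis using b by (intro exI[of _ "e0 # l'"] exI[of _ r'] exI conjI) auto
 qed
next
 case (24 P y cs k)
 then show ?case by (intro ev_ins_brace)
next
 case (25 P cs k)
 then show ?case by (intro ev_ins_gamma)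
next
 case (26 c k)
 then show ?case by (intro ev_ins_right_square)
next
 case (28 c k)
 then show ?case by (intro ev_ins_right_zero)
next
 case (29 P b k)
 then show ?case by (simp add: lsum_ev_ins)
next
 case (30 c n z)
 then show ?case by (cases c) auto
next
 case (31 n z P a b c)
 from 31(1) consider u where "b = map VL u" "is_VL z" | e where "b = map BL e" "is_BL z"
  unfolding ev_ins_def using all_VL[of b] all_BL[of b]
  by (auto split: if_splits simp del: map_map)
 then show ?case
 proof cases
  case (1 u)
  show ?thesis
   using 31(2) accepted_context[of "z # c" "b @ c"] accepted_VL 1 unfolding insertion_shape by (auto simp: is_VL_def)
 next
  case (2 e)
  show ?thesis
   using 31(2) accepted_context[of "z # c" "b @ c"] 2 unfolding insertion_shape by (auto simp: is_BL_def accepted_map)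
 qed
next
 case (32 n z y a c)
 then obtain P Q where "y = VL P" "z = VL Q" by (cases y) auto
 then show ?case using 32(2) accepted_context[of "z # c" "y # c" 0 a] unfolding insertion_shape by auto
next
 case (33 a P c)
 then show ?case using accepted_context[of "VL P # c" c 0 a] accepted_VL[of _ P c "[]"] unfolding insertion_shape by auto
qed auto

end

section \<open>Structure maps\<close>

lemma spl_last: "(\<And>a b. a \<noteq> [] ==> f a b = 0) ==> spl cs f = f [] cs"
 by (cases cs) simp_all

lemma spl_first: "(\<And>a b. b \<noteq> [] ==> f a b = 0) ==> spl cs f = f cs []"
 by (induction cs arbitrary: f) simp_all

text \<open>To be reduced to a single letter, the word has to be the block of the operation.\<close>

lemma act_one_letter:
 assumes "\<And>w. length w \<noteq> 1 ==> \<phi> w = 0"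
 shows "act ev dp dc [P] cs \<phi> = lsum (ev P cs) (\<lambda>z. \<phi> [z])"
proof -
 have "act ev dp dc [P] cs \<phi> = spl cs (\<lambda>b c. sg (dp P * wdeg dc [] + wdeg dp [] * (wdeg dc [] + wdeg dc b)) (lsum (ev P b) (\<lambda>z. \<phi> ([] @ z # c))))"
  unfolding act_Cons act_Nil by (rule spl_last) (simp add: assms)
 also have "... = lsum (ev P cs) (\<lambda>z. \<phi> [z])"
  by (subst spl_first) (simp_all add: assms)
 finally show ?thesis .
qed

lemma inserted_length: "(n, w) \<in> set (inserted ev dp dc xs cs) ==> length xs \<le> length w"
proof (induction xs arbitrary: cs n w)
 case (Cons P xs)
 then show ?case by (auto elim!: set_bindE) (meson Cons.IH add_leE le_SucI trans_le_add2)
qed simp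

text \<open>Each operation produces a letter.\<close>

lemma act_long:
 assumes "\<And>w. length xs \<le> length w ==> \<phi> w = 0"
 shows "act ev dp dc xs cs \<phi> = 0"
proof -
 have "act ev dp dc xs cs \<phi> = act ev dp dc xs cs (\<lambda>w. 0)"
  unfolding act_def by (rule lsum_cong) (use inserted_length assms in blast)
 then show ?thesis by simp
qed

lemma even_sum_diff:
 fixes f g :: "nat => int"
 assumes "\<And>k. k < n ==> even (f k - g k)"
 shows "even ((\<Sum>k<n. f k) - (\<Sum>k<n. g k))"
 unfolding sum_subtractf[symmetric] using assms by (intro dvd_sum) auto

lemma sg_sum: "sg i (\<Sum>x\<in>X. y x) = (\<Sum>x\<in>X. sg i (y x))"
 by (simp add: sg_def sum_negf)

lemma even_shift: "even ((x - l) * (y - k) - (l + x) * (k + y))" for x y k l :: int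
proof -
 have "(x - l) * (y - k) - (l + x) * (k + y) = 2 * (- (x * k + l * y))" by algebra
 then show ?thesis by (metis dvd_triv_left)
qed

lemma even_three:
 fixes a a' b b' c c' w :: int
 assumes "even (a - a')" "even (b - b')" "even (w + c - c')"
 shows "even (a + w + (b + c) - (a' + b' + c'))"
proof -
 have "a + w + (b + c) - (a' + b' + c') = (a - a') + (b - b') + (w + c - c')" by simp
 then show ?thesis using assms by (metis dvd_add)
qed

lemma sum_triangle:
 "(\<Sum>n\<in>{a..b}. \<Sum>l\<in>{n..b}. f n l) = (\<Sum>l\<in>{a..b}. \<Sum>n\<in>{a..l}. f n l)" for a b :: nat
proof -
 have "(\<Sum>n\<in>{a..b}. \<Sum>l\<in>{n..b}. f n l) = (\<Sum>(n, l)\<in>(SIGMA n:{a..b}. {n..b}). f n l)"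
  by (rule sum.Sigma) auto
 also have "... = (\<Sum>(l, n)\<in>(SIGMA l:{a..b}. {a..l}). f n l)"
  by (rule sum.reindex_bij_witness[of _ "\<lambda>(x, y). (y, x)" "\<lambda>(x, y). (y, x)"]) auto
 also have "... = (\<Sum>l\<in>{a..b}. \<Sum>n\<in>{a..l}. f n l)"
  by (rule sum.Sigma[symmetric]) auto
 finally show ?thesis .
qed

lemma multilin_length_one:
 assumes "vector_space t" "multilin s t \<phi>"
 shows "multilin s t (\<lambda>vs. if length vs = 1 then \<phi> vs else 0)"
proof -
 interpret T: vector_space t by fact
 have "Vector_Spaces.linear s t (\<lambda>x. if length (xs @ x # ys) = 1 then \<phi> (xs @ x # ys) else 0)" for xs ys
 proof (cases "length xs + length ys = 0")
  case True
  then show ?thesis using assms(2) unfolding multilin_def by (auto dest: spec[of _ "[]"])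
 next
  case False
  have "Vector_Spaces.linear s t (\<lambda>x. \<phi> (xs @ x # ys))" using assms(2) unfolding multilin_def by blast
  then show ?thesis using False by (auto simp: linear_iff_additive)
 qed
 then show ?thesis unfolding multilin_def by blast
qed

context curved_Ainf_algebra
begin

lemma cogen_opword:
 "cogen sE (opword w) = (if length w = 1 then opword w else 0)"
proof -
 have k: "vector_space ((*) :: 'k => 'k => 'k)" by unfold_locales (auto simp: algebra_simps)
 show ?thesis by (auto simp: cogen_def word_def fun_eq_iff zero_fun_apply multilin_length_one[OF k, unfolded One_nat_def])
qed

lemma cogen_plus: "cogen s (x + y) = cogen s x + cogen s y"
 by (simp add: cogen_def fun_eq_iff pointwise)

lemma cogen_brace_product:
 assumes "homVs xs" "homVs ys"
 shows "cogen sE (brace_product (opword xs) (opword ys)) = act_ops xs ys (\<lambda>w. if length w = 1 then opword w else 0)"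
 by (simp add: brace_product_words[OF assms] act_additive[where h = "cogen sE", OF cogen_plus] cogen_opword)

lemma is_brace_brace:
 assumes "homV P" "homVs Qs"
 shows "is_brace sA A (fst P) (map fst Qs) (map snd Qs) (fst (brace P Qs))"
 unfolding is_brace_def
proof (intro conjI allI impI)
 show "multilin sA sA (fst (brace P Qs))"
  using brace_homogeneous[OF assms] by (auto simp: homogeneous_def End_gr_def)
 fix es \<delta> assume "hom_word A es \<delta>"
 then obtain ws where "homAs ws" "es = map fst ws" "\<delta> = map snd ws" by (auto elim: hom_wordE)
 then show "fst (brace P Qs) es = brace_value sA (fst P) (map fst Qs) (map snd Qs) es \<delta>"
  using brace_word[OF assms] brace_value_eq by simp
qed

theorem brace_structure_maps: "has_brace_structure_maps sA A brace_product"
 unfolding has_brace_structure_maps_def Let_def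
proof (intro conjI allI impI)
 fix Q q assume "Q \<in> E q"
 then have "homVs [(Q, q)]" by (simp add: homogeneous_def)
 from cogen_brace_product[OF _ this, of "[]"] show "cogen sE (brace_product (word sE []) (word sE [Q])) = word sE [Q]" by simp
next
 fix P p assume "P \<in> E p"
 then have P: "homV (P, p)" by (simp add: homogeneous_def)
 with cogen_brace_product[of "[(P, p)]" "[]"] show "cogen sE (brace_product (word sE [P]) (word sE [])) = word sE [P]"
  by (simp add: act_Cons brace_Nil[OF P])
next
 fix P p Qs ds assume *: "P \<in> E p \<and> hom_word E Qs ds \<and> Qs \<noteq> []"
 then obtain ws where ws: "homVs ws" "Qs = map fst ws" "ds = map snd ws" by (auto elim: hom_wordE)
 have P: "homV (P, p)" using * by (simp add: homogeneous_def)
 have "cogen sE (brace_product (word sE [P]) (word sE Qs)) = word sE [fst (brace (P, p) ws)]"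
  using cogen_brace_product[of "[(P, p)]" ws] P ws by (simp add: act_one_letter)
 then show "\<exists>B. is_brace sA A P Qs ds B \<and> cogen sE (brace_product (word sE [P]) (word sE Qs)) = word sE [B]"
  using is_brace_brace[OF P ws(1)] ws by auto
next
 fix Ps cs Qs ds assume *: "hom_word E Ps cs \<and> hom_word E Qs ds \<and> 2 \<le> length Ps \<and> Qs \<noteq> []"
 then obtain xs ys where ws: "homVs xs" "Ps = map fst xs" "homVs ys" "Qs = map fst ys" by (auto elim!: hom_wordE)
 then show "cogen sE (brace_product (word sE Ps) (word sE Qs)) = 0"
  using cogen_brace_product[OF ws(1,3)] * by (auto intro!: act_long)
qed

abbreviation in_chains :: "('a, 'k) tensor_algebra => ('a, 'k) chain_bar" where "in_chains x \<equiv> barw sE fscale [] x []"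
abbreviation bgen :: "('a, 'k) chain_bar => ('a, 'k) chain_bar" where "bgen \<equiv> bar_cogen sE fscale"

lemma in_chains_linear:
 "in_chains (x + y) = in_chains x + in_chains y" "in_chains 0 = 0" "in_chains (- x) = - in_chains x" "in_chains (x - y) = in_chains x - in_chains y"
proof -
 have l: "Vector_Spaces.linear fscale (*) (\<lambda>w. \<phi> [] w [])" if "bar_form sE fscale \<phi>" for \<phi> :: "_ => ('a, 'k) tensor_algebra => _ => 'k"
  using that by (simp add: bar_form_def)
 show p: "in_chains (x + y) = in_chains x + in_chains y" for x y
 proof
  fix \<phi> show "in_chains (x + y) \<phi> = (in_chains x + in_chains y) \<phi>"
  proof (cases "bar_form sE fscale \<phi>")
   case True
   then show ?thesis using l[OF True] unfolding linear_iff_additive by (simp add: barw_def plus_fun_apply)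
  qed (simp add: barw_def plus_fun_apply)
 qed
 show z: "in_chains 0 = 0" using p[of 0 0] by simp
 show m: "in_chains (- x) = - in_chains x" for x
  by (rule minus_unique[symmetric]) (simp add: p[symmetric] z)
 show "in_chains (x - y) = in_chains x - in_chains y" using p[of x "- y"] m by simp
qed

lemma in_chains_sg: "in_chains (sg n x) = sg n (in_chains x)"
 by (simp add: sg_def in_chains_linear)

lemma in_chains_sum: "in_chains (sum f I) = (\<Sum>i\<in>I. in_chains (f i))"
 by (induction I rule: infinite_finite_induct) (simp_all add: in_chains_linear)

lemma bgen_plus: "bgen (x + y) = bgen x + bgen y"
 by (simp add: bar_cogen_def fun_eq_iff pointwise)

lemma bgen_zero: "bgen 0 = 0"
 using bgen_plus[of 0 0] by simp

lemma bgen_sg: "bgen (sg n x) = sg n (bgen x)"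
proof -
 have "bgen (- x) = - bgen x"
  by (rule minus_unique[symmetric]) (simp add: bgen_plus[symmetric] bgen_zero)
 then show ?thesis by (simp add: sg_def)
qed

lemma bar_form_core:
 assumes "bar_form sE fscale \<phi>"
 shows "bar_form sE fscale (\<lambda>us (w :: ('a, 'k) tensor_algebra) vs. if us = [] \<and> vs = [] then \<phi> us w vs else (0 :: 'k))"
 using assms unfolding bar_form_def multilin_def by (auto simp: linear_iff_additive)

lemma bgen_barw: "bgen (barw sE fscale us w vs) = (if us = [] \<and> vs = [] then in_chains w else 0)"
 by (auto simp: bar_cogen_def barw_def fun_eq_iff zero_fun_apply bar_form_core)

definition "cyclic_gen w = (case w of [Inr es] => if es = [] then 0 else in_chains (chain es) | _ => 0)"
 for w :: "'a cyclic_letter list"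

definition "ins_gen w = (case w of HL e0 # r => if list_all is_BL r then in_chains (chain (e0 # map un_BL r)) else 0 | _ => 0)"
 for w :: "'a insertion_letter list"

lemma bgen_cyclic_BAR: "bgen (cyclic.BAR w) = cyclic_gen w"
proof (cases "bar_shape Inl (\<lambda>es. [Inr es]) w")
 case True
 then obtain us es vs where w: "es \<noteq> []" "w = map Inl us @ [Inr es] @ map Inl vs" unfolding bar_shape_def by blast
 show ?thesis
  unfolding w(2) cyclic.BAR_bw[OF w(1)] bgen_barw cyclic_gen_def
  using w(1) by (cases us; cases vs) (auto split: list.splits)
next
 case False
 have "cyclic_gen w = 0"
 proof (rule ccontr)
  assume "cyclic_gen w \<noteq> 0"
  then obtain es where "w = map Inl [] @ [Inr es] @ map Inl []" "es \<noteq> []"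
   by (auto simp: cyclic_gen_def split: list.splits sum.splits if_splits)
  with False show False unfolding bar_shape_def by blast
 qed
 then show ?thesis by (simp add: cyclic.BAR_not_shape[OF False] bgen_zero)
qed

lemma bgen_ins_BAR: "bgen (insertion.BAR w) = ins_gen w"
proof (cases "bar_shape VL ins_enc w")
 case True
 then obtain us es vs where w: "es \<noteq> []" "w = map VL us @ ins_enc es @ map VL vs" unfolding bar_shape_def by blast
 then obtain e0 e where es: "es = e0 # e" by (cases es) auto
 show ?thesis
  unfolding w(2) insertion.BAR_bw[OF w(1)] bgen_barw ins_gen_def
  using es by (cases us; cases vs) (auto split: list.splits)
next
 case False
 have "ins_gen w = 0"
 proof (rule ccontr)
  assume "ins_gen w \<noteq> 0"
  then obtain e0 r where "w = HL e0 # r" "list_all is_BL r"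
   by (auto simp: ins_gen_def split: list.splits insertion_letter.splits if_splits)
  then have "w = map VL [] @ ins_enc (e0 # map un_BL r) @ map VL []" using all_BL by simp
  with False show False unfolding bar_shape_def by blast
 qed
 then show ?thesis by (simp add: insertion.BAR_not_shape[OF False] bgen_zero)
qed

lemma cyclic_gen_length: "length w \<noteq> 1 ==> cyclic_gen w = 0"
 by (auto simp: cyclic_gen_def split: list.splits sum.splits)

subsection \<open>The cyclic action\<close>

lemma sum_sdeg:
 assumes "i \<le> j" "j \<le> length ws"
 shows "(\<Sum>k\<in>{i..<j}. sdeg (ws ! k)) = (\<Sum>k\<in>{i..<j}. map snd ws ! k) - (int j - int i)"
proof -
 have "(\<Sum>k\<in>{i..<j}. sdeg (ws ! k)) = (\<Sum>k\<in>{i..<j}. map snd ws ! k - 1)"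
  using assms by (intro sum.cong) (auto simp: sdeg_def)
 then show ?thesis using assms by (simp add: sum_subtractf)
qed

lemma seg_tail: "ws \<noteq> [] ==> ws = ws ! 0 # seg ws 1 (length ws)"
 by (cases ws) (simp_all add: seg_def map_Suc_upt[symmetric] comp_def map_nth del: upt_Suc map_Suc_upt)

lemma wdeg_eq_sum: "wdeg f ws = (\<Sum>k<length ws. f (ws ! k))"
 by (simp add: wdeg_def sum_list_sum_nth atLeast0LessThan)

text \<open>The indices \<open>1 \<le> n \<le> l \<le> m + 1\<close> are the two cuts of the tail.
  Since \<open>sdeg\<close> is the degree minus one, each exponent differs from the stated one by an
  even number.\<close>

lemma cyclic_placements:
 fixes h :: "'a list => 'x::ab_group_add" and us vs ws
 assumes ws: "ws \<noteq> []"
 defines "m \<equiv> length ws - 1" and "es \<equiv> map fst ws" and "\<delta> \<equiv> map snd ws"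
 shows "lsum (cyclic P us ws vs) (\<lambda>z. h (map fst (projr z))) =
  (\<Sum>l\<in>{1..m + 1}. \<Sum>n\<in>{1..l}. \<Sum>js\<in>placements l (m + 1) (length us). \<Sum>ks\<in>placements 1 n (length vs).
   sg ((int l + (\<Sum>j<l. \<delta> ! j)) * (int m - int l + 1 + (\<Sum>j\<in>{l..m}. \<delta> ! j))
      + (\<Sum>a<length us. snd (us ! a) * (int (fst (js ! a)) - int l + (\<Sum>i\<in>{l..<fst (js ! a)}. \<delta> ! i)))
      + (\<Sum>b<length vs. snd (vs ! b) * (int (fst (ks ! b)) - int l - 1 + (\<Sum>f\<in>{fst (ks ! b)..<l}. \<delta> ! f))))
    (h (fst P (plug es l (m + 1) (zip (map fst us) js) @ es ! 0 # plug es 1 n (zip (map fst vs) ks)) # seg es n l)))" (is "_ = ?rhs")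
proof -
 let ?S = "\<lambda>i j. \<Sum>k\<in>{i..<j}. sdeg (ws ! k)" and ?T = "\<lambda>i j. \<Sum>k\<in>{i..<j}. \<delta> ! k"
 have M: "m + 1 = length ws" using ws by (simp add: m_def)
 have S: "?S i j = ?T i j - (int j - int i)" if "i \<le> j" "j \<le> m + 1" for i j
  using sum_sdeg[of i j ws] that M by (simp add: \<delta>_def)
 have h0: "es ! 0 = fst (ws ! 0)" using ws by (simp add: es_def)
 have "lsum (cyclic P us ws vs) (\<lambda>z. h (map fst (projr z))) =
   lsum (cyclic P us (ws ! 0 # seg ws 1 (m + 1)) vs) (\<lambda>z. h (map fst (projr z)))"
  using seg_tail[OF ws] M by simp
 also have "... = (\<Sum>n\<in>{1..m + 1}. \<Sum>l\<in>{n..m + 1}.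
   sg ((sdeg (ws ! 0) + ?S 1 n + ?S n l) * ?S l (m + 1) + wdeg snd vs * (?S 1 n + ?S n l + 1))
   (\<Sum>js\<in>placements l (m + 1) (length us). sg (\<Sum>k<length us. snd (us ! k) * ?S l (fst (js ! k)))
    (\<Sum>ks\<in>placements 1 n (length vs). sg (\<Sum>k<length vs. snd (vs ! k) * ?S 1 (fst (ks ! k)))
     (h (fst P (plug es l (m + 1) (zip (map fst us) js) @ es ! 0 # plug es 1 n (zip (map fst vs) ks)) # seg es n l)))))"
  (is "_ = (\<Sum>n\<in>_. \<Sum>l\<in>_. ?R n l)")
 proof -
  have inner: "act_args us (seg ws l (m + 1)) (\<lambda>ua. act_args vs (seg ws 1 n) (\<lambda>vb. h (fst P (map fst ua @ es ! 0 # map fst vb) # seg es n l))) =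
   (\<Sum>js\<in>placements l (m + 1) (length us). sg (\<Sum>k<length us. snd (us ! k) * ?S l (fst (js ! k)))
    (\<Sum>ks\<in>placements 1 n (length vs). sg (\<Sum>k<length vs. snd (vs ! k) * ?S 1 (fst (ks ! k)))
     (h (fst P (plug es l (m + 1) (zip (map fst us) js) @ es ! 0 # plug es 1 n (zip (map fst vs) ks)) # seg es n l))))"
   if "n \<in> {1..m + 1}" "l \<in> {n..m + 1}" for n l
  proof -
   have v: "act_args vs (seg ws 1 n) (\<lambda>vb. h (fst P (a @ es ! 0 # map fst vb) # seg es n l)) =
     (\<Sum>ks\<in>placements 1 n (length vs). sg (\<Sum>k<length vs. snd (vs ! k) * ?S 1 (fst (ks ! k)))
     (h (fst P (a @ es ! 0 # plug es 1 n (zip (map fst vs) ks)) # seg es n l)))" for a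
    unfolding es_def by (rule act_args_placements) (use that M in auto)
   have "act_args us (seg ws l (m + 1)) (\<lambda>ua. (\<lambda>a. act_args vs (seg ws 1 n) (\<lambda>vb. h (fst P (a @ es ! 0 # map fst vb) # seg es n l))) (map fst ua)) =
    (\<Sum>js\<in>placements l (m + 1) (length us). sg (\<Sum>k<length us. snd (us ! k) * ?S l (fst (js ! k)))
     ((\<lambda>a. act_args vs (seg ws 1 n) (\<lambda>vb. h (fst P (a @ es ! 0 # map fst vb) # seg es n l))) (plug (map fst ws) l (m + 1) (zip (map fst us) js))))"
    by (rule act_args_placements) (use that M in auto)
   then show ?thesis unfolding v es_def[symmetric] .
  qed
  show ?thesis
   unfolding lsum_cyclic
  proof (subst spl_seg, simp add: M[symmetric], intro sum.cong refl)
   fix n assume n: "n \<in> {1..m + 1}"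
   show "spl (seg ws n (m + 1)) (\<lambda>e2 e3. sg ((sdeg (ws ! 0) + wdeg sdeg (seg ws 1 n) + wdeg sdeg e2) * wdeg sdeg e3 +
      wdeg snd vs * (wdeg sdeg (seg ws 1 n) + wdeg sdeg e2 + 1))
      (act_args us e3 (\<lambda>ua. act_args vs (seg ws 1 n) (\<lambda>vb. h (map fst (projr (Inr (apply_op P (ua @ ws ! 0 # vb) # e2)))))))) =
    (\<Sum>l\<in>{n..m + 1}. ?R n l)"
   proof (subst spl_seg, use n in simp, intro sum.cong refl)
    fix l assume l: "l \<in> {n..m + 1}"
    have w: "wdeg sdeg (seg ws 1 n) = ?S 1 n" "wdeg sdeg (seg ws n l) = ?S n l" "wdeg sdeg (seg ws l (m + 1)) = ?S l (m + 1)"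
     using n l M by (auto intro!: wdeg_seg)
    have f: "map fst (seg ws n l) = seg es n l" unfolding es_def using n l M by (intro map_seg) auto
    show "sg ((sdeg (ws ! 0) + wdeg sdeg (seg ws 1 n) + wdeg sdeg (seg ws n l)) * wdeg sdeg (seg ws l (m + 1)) +
      wdeg snd vs * (wdeg sdeg (seg ws 1 n) + wdeg sdeg (seg ws n l) + 1))
      (act_args us (seg ws l (m + 1)) (\<lambda>ua. act_args vs (seg ws 1 n) (\<lambda>vb. h (map fst (projr (Inr (apply_op P (ua @ ws ! 0 # vb) # seg ws n l))))))) = ?R n l"
     unfolding w inner[OF n l, symmetric] by (simp add: apply_op_def f h0)
   qed
  qed
 qed
 also have "... = (\<Sum>l\<in>{1..m + 1}. \<Sum>n\<in>{1..l}. ?R n l)" by (rule sum_triangle)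
 also have "... = ?rhs"
 proof (intro sum.cong refl)
  fix l n assume l: "l \<in> {1..m + 1}" and n: "n \<in> {1..l}"
  show "?R n l = (\<Sum>js\<in>placements l (m + 1) (length us). \<Sum>ks\<in>placements 1 n (length vs).
   sg ((int l + (\<Sum>j<l. \<delta> ! j)) * (int m - int l + 1 + (\<Sum>j\<in>{l..m}. \<delta> ! j))
      + (\<Sum>a<length us. snd (us ! a) * (int (fst (js ! a)) - int l + (\<Sum>i\<in>{l..<fst (js ! a)}. \<delta> ! i)))
      + (\<Sum>b<length vs. snd (vs ! b) * (int (fst (ks ! b)) - int l - 1 + (\<Sum>f\<in>{fst (ks ! b)..<l}. \<delta> ! f))))
    (h (fst P (plug es l (m + 1) (zip (map fst us) js) @ es ! 0 # plug es 1 n (zip (map fst vs) ks)) # seg es n l)))"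
   unfolding sg_sum sg_sg
  proof (intro sum.cong refl sg_eq)
   fix js ks assume js: "js \<in> placements l (m + 1) (length us)" and ks: "ks \<in> placements 1 n (length vs)"
   have jb: "l \<le> fst (js ! a)" "fst (js ! a) \<le> m + 1" if "a < length us" for a
    using js that by (fastforce simp: placements_def)+
   have kb: "1 \<le> fst (ks ! b)" "fst (ks ! b) \<le> l" if "b < length vs" for b
    using ks that n by (fastforce simp: placements_def)+
   have s0: "sdeg (ws ! 0) + ?S 1 n + ?S n l = ?S 0 l"
   proof -
    have "?S 1 n + ?S n l = ?S 1 l" using n by (intro sum.atLeastLessThan_concat) auto
    moreover have "?S 0 l = sdeg (ws ! 0) + ?S 1 l" using l by (simp add: sum.atLeast_Suc_lessThan)
    ultimately show ?thesis by simp
   qed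
   have S0: "?S 0 l = (\<Sum>j<l. \<delta> ! j) - int l" using S[of 0 l] l by (simp add: atLeast0LessThan)
   have S3: "?S l (m + 1) = (\<Sum>j\<in>{l..m}. \<delta> ! j) - (int m + 1 - int l)"
    using S[of l "m + 1"] l by (simp add: atLeastLessThanSuc_atLeastAtMost)
   have A: "even ((sdeg (ws ! 0) + ?S 1 n + ?S n l) * ?S l (m + 1) -
     (int l + (\<Sum>j<l. \<delta> ! j)) * (int m - int l + 1 + (\<Sum>j\<in>{l..m}. \<delta> ! j)))"
   proof -
    have k: "int m - int l + 1 = int m + 1 - int l" by simp
    show ?thesis unfolding s0 S0 S3 k using even_shift[of "\<Sum>j<l. \<delta> ! j" "int l" "\<Sum>j\<in>{l..m}. \<delta> ! j" "int m + 1 - int l"] .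
   qed
   have B: "even ((\<Sum>k<length us. snd (us ! k) * ?S l (fst (js ! k))) -
     (\<Sum>a<length us. snd (us ! a) * (int (fst (js ! a)) - int l + (\<Sum>i\<in>{l..<fst (js ! a)}. \<delta> ! i))))"
   proof (rule even_sum_diff)
    fix a assume a: "a < length us"
    show "even (snd (us ! a) * ?S l (fst (js ! a)) - snd (us ! a) * (int (fst (js ! a)) - int l + ?T l (fst (js ! a))))"
     unfolding right_diff_distrib[symmetric] S[OF jb[OF a]] by simp
   qed
   have C: "even (wdeg snd vs * (?S 1 n + ?S n l + 1) + (\<Sum>k<length vs. snd (vs ! k) * ?S 1 (fst (ks ! k))) -
     (\<Sum>b<length vs. snd (vs ! b) * (int (fst (ks ! b)) - int l - 1 + (\<Sum>f\<in>{fst (ks ! b)..<l}. \<delta> ! f))))"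
    unfolding wdeg_eq_sum sum_distrib_right sum.distrib[symmetric]
   proof (rule even_sum_diff)
    fix b assume b: "b < length vs"
    have 1: "?S 1 n + ?S n l = ?S 1 l" using n by (intro sum.atLeastLessThan_concat) auto
    have 2: "?S 1 l = ?S 1 (fst (ks ! b)) + ?S (fst (ks ! b)) l" using kb[OF b] by (simp add: sum.atLeastLessThan_concat)
    have 3: "?S (fst (ks ! b)) l = ?T (fst (ks ! b)) l - (int l - int (fst (ks ! b)))" using S kb[OF b] l by simp
    show "even (snd (vs ! b) * (?S 1 n + ?S n l + 1) + snd (vs ! b) * ?S 1 (fst (ks ! b)) -
     snd (vs ! b) * (int (fst (ks ! b)) - int l - 1 + ?T (fst (ks ! b)) l))"
     unfolding 1 2 3 distrib_left[symmetric] right_diff_distrib[symmetric] by simp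
   qed
   show "even ((sdeg (ws ! 0) + ?S 1 n + ?S n l) * ?S l (m + 1) + wdeg snd vs * (?S 1 n + ?S n l + 1) +
     ((\<Sum>k<length us. snd (us ! k) * ?S l (fst (js ! k))) + (\<Sum>k<length vs. snd (vs ! k) * ?S 1 (fst (ks ! k)))) -
     ((int l + (\<Sum>j<l. \<delta> ! j)) * (int m - int l + 1 + (\<Sum>j\<in>{l..m}. \<delta> ! j))
      + (\<Sum>a<length us. snd (us ! a) * (int (fst (js ! a)) - int l + (\<Sum>i\<in>{l..<fst (js ! a)}. \<delta> ! i)))
      + (\<Sum>b<length vs. snd (vs ! b) * (int (fst (ks ! b)) - int l - 1 + (\<Sum>f\<in>{fst (ks ! b)..<l}. \<delta> ! f)))))"
    by (rule even_three[OF A B C])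
  qed
 qed
 finally show ?thesis .
qed

lemma sum_map_snd: "(\<Sum>a<length us. map snd us ! a * f a) = (\<Sum>a<length us. snd (us ! a) * f a)" for f :: "nat => int"
 by (rule sum.cong) simp_all

lemma in_chains_cyclic_value:
 assumes ws: "ws \<noteq> []"
 shows "in_chains (cyclic_value sA (fst P) (map fst us) (map snd us) (map fst ws) (map snd ws) (map fst vs) (map snd vs)) =
  lsum (cyclic P us ws vs) (\<lambda>z. cyclic_gen [z])"
proof -
 have "lsum (cyclic P us ws vs) (\<lambda>z. cyclic_gen [z]) = lsum (cyclic P us ws vs) (\<lambda>z. (\<lambda>es. in_chains (word sA es)) (map fst (projr z)))"
  by (rule lsum_cong) (auto dest!: set_cyclic simp: cyclic_gen_def)
 also have "... = in_chains (cyclic_value sA (fst P) (map fst us) (map snd us) (map fst ws) (map snd ws) (map fst vs) (map snd vs))"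
  unfolding cyclic_placements[OF ws, where h = "\<lambda>es. in_chains (word sA es)"]
   cyclic_value_def Let_def fscale_ksign in_chains_sum in_chains_sg length_map sum_map_snd ..
 finally show ?thesis by simp
qed

lemma bgen_cyclic_action:
 assumes "homVs xs" "homVs us" "es \<noteq> []" "homAs es" "homVs vs"
 shows "bgen (cyclic.bar_action (opword xs) (barword us es vs)) = act_cyclic xs (map Inl us @ Inr es # map Inl vs) cyclic_gen"
 unfolding cyclic.bar_action_words[OF assms] act_additive[where h = bgen, OF bgen_plus] bgen_cyclic_BAR by simp

theorem cyclic_structure_maps: "has_cyclic_structure_maps sA A cyclic.bar_action"
 unfolding has_cyclic_structure_maps_def Let_def
proof (intro allI impI, elim conjE)
 fix Ps bs Qs cs es \<delta> Rs ds
 assume "hom_word E Ps bs" "hom_word E Qs cs" "es \<noteq> []" "hom_word A es \<delta>" "hom_word E Rs ds"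
 then obtain xs us ws vs where eqs: "Ps = map fst xs" "bs = map snd xs" "Qs = map fst us" "cs = map snd us" "es = map fst ws" "\<delta> = map snd ws"
   "Rs = map fst vs" "ds = map snd vs" and g: "homVs xs" "homVs us" "ws \<noteq> []" "homAs ws" "homVs vs"
  by (auto elim!: hom_wordE)
 note gen = bgen_cyclic_action[OF g]
 show "(length Ps = 1 \<longrightarrow> bgen (cyclic.bar_action (word sE Ps) (barw sE fscale Qs (word sA es) Rs)) =
    barw sE fscale [] (cyclic_value sA (hd Ps) Qs cs es \<delta> Rs ds) []) \<and>
   (Ps = [] \<and> Qs = [] \<and> Rs = [] \<longrightarrow> bgen (cyclic.bar_action (word sE Ps) (barw sE fscale Qs (word sA es) Rs)) = barw sE fscale [] (word sA es) []) \<and>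
   (Ps = [] \<and> \<not> (Qs = [] \<and> Rs = []) \<longrightarrow> bgen (cyclic.bar_action (word sE Ps) (barw sE fscale Qs (word sA es) Rs)) = 0) \<and>
   (2 \<le> length Ps \<longrightarrow> bgen (cyclic.bar_action (word sE Ps) (barw sE fscale Qs (word sA es) Rs)) = 0)"
  unfolding eqs gen
 proof (intro conjI impI)
  assume "length (map fst xs) = 1"
  then obtain P where xs: "xs = [P]" by (cases xs) auto
  show "act_cyclic xs (map Inl us @ Inr ws # map Inl vs) cyclic_gen =
   in_chains (cyclic_value sA (hd (map fst xs)) (map fst us) (map snd us) (map fst ws) (map snd ws) (map fst vs) (map snd vs))"
   using in_chains_cyclic_value[OF g(3), of P us vs] xs by (simp add: act_one_letter cyclic_gen_length)
 next
  assume "2 \<le> length (map fst xs)"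
  then show "act_cyclic xs (map Inl us @ Inr ws # map Inl vs) cyclic_gen = 0"
   by (intro act_long cyclic_gen_length) auto
 next
  assume "map fst xs = [] \<and> map fst us = [] \<and> map fst vs = []"
  then show "act_cyclic xs (map Inl us @ Inr ws # map Inl vs) cyclic_gen = in_chains (chain ws)"
   using g(3) by (simp add: cyclic_gen_def)
 next
  assume "map fst xs = [] \<and> \<not> (map fst us = [] \<and> map fst vs = [])"
  then have xs: "xs = []" and "length (map Inl us @ Inr ws # map Inl vs) \<noteq> 1" by auto
  then show "act_cyclic xs (map Inl us @ Inr ws # map Inl vs) cyclic_gen = 0"
   unfolding xs act_Nil by (intro cyclic_gen_length)
 qed
qed

subsection \<open>The insertion action\<close>

text \<open>Operations inserted into the tail have passed \<open>e\<^sub>0\<close>, of degree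
  \<open>sdeg e\<^sub>0 + 1\<close>.\<close>

lemma in_chains_insertion_value:
 assumes ws: "ws \<noteq> []"
 shows "in_chains (insertion_value sA (map fst xs) (map snd xs) (map fst ws) (map snd ws)) =
  sg (wdeg snd xs * (sdeg (hd ws) + 1)) (act_args xs (tl ws) (\<lambda>b. in_chains (chain (hd ws # b))))"
proof -
 let ?S = "\<lambda>i j. \<Sum>k\<in>{i..<j}. sdeg (ws ! k)"
 define m where "m = length ws - 1"
 have M: "m + 1 = length ws" using ws by (simp add: m_def)
 have hd: "hd ws = ws ! 0" by (rule hd_conv_nth[OF ws])
 have h0: "map fst ws ! 0 = fst (ws ! 0)" using ws by simp
 have tl: "tl ws = seg ws 1 (m + 1)"
  unfolding M using arg_cong[OF seg_tail[OF ws], of tl] by (simp only: list.sel)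
 have "act_args xs (seg ws 1 (m + 1)) (\<lambda>b. (\<lambda>es. in_chains (word sA (fst (ws ! 0) # es))) (map fst b)) =
  (\<Sum>ps\<in>placements 1 (m + 1) (length xs). sg (\<Sum>k<length xs. snd (xs ! k) * ?S 1 (fst (ps ! k)))
    ((\<lambda>es. in_chains (word sA (fst (ws ! 0) # es))) (plug (map fst ws) 1 (m + 1) (zip (map fst xs) ps))))"
  by (rule act_args_placements) (use M in auto)
 then have "sg (wdeg snd xs * (sdeg (ws ! 0) + 1)) (act_args xs (seg ws 1 (m + 1)) (\<lambda>b. in_chains (chain (ws ! 0 # b)))) =
  (\<Sum>ps\<in>placements 1 (m + 1) (length xs). sg (wdeg snd xs * (sdeg (ws ! 0) + 1) + (\<Sum>k<length xs. snd (xs ! k) * ?S 1 (fst (ps ! k))))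
    (in_chains (word sA (fst (ws ! 0) # plug (map fst ws) 1 (m + 1) (zip (map fst xs) ps)))))"
  by (simp only: sg_sum sg_sg list.map)
 also have "... = in_chains (insertion_value sA (map fst xs) (map snd xs) (map fst ws) (map snd ws))"
  unfolding insertion_value_def Let_def fscale_ksign in_chains_sum in_chains_sg length_map m_def[symmetric]
 proof (intro sum.cong refl)
  fix ps assume ps: "ps \<in> placements 1 (m + 1) (length xs)"
  have "even (wdeg snd xs * (sdeg (ws ! 0) + 1) + (\<Sum>k<length xs. snd (xs ! k) * ?S 1 (fst (ps ! k))) -
    (\<Sum>a<length xs. map snd xs ! a * (int (fst (ps ! a)) - 1 + (\<Sum>i<fst (ps ! a). map snd ws ! i))))"
   unfolding wdeg_eq_sum sum_distrib_right sum.distrib[symmetric]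
  proof (rule even_sum_diff)
   fix a assume a: "a < length xs"
   then have "1 \<le> fst (ps ! a) \<and> fst (ps ! a) + snd (ps ! a) \<le> m + 1" using ps unfolding placements_def by blast
   then have b: "1 \<le> fst (ps ! a)" "fst (ps ! a) \<le> length ws" using M by linarith+
   have "?S 0 (fst (ps ! a)) = sdeg (ws ! 0) + ?S 1 (fst (ps ! a))" using b by (simp add: sum.atLeast_Suc_lessThan)
   moreover have "?S 0 (fst (ps ! a)) = (\<Sum>i<fst (ps ! a). map snd ws ! i) - int (fst (ps ! a))"
    using sum_sdeg[of 0 "fst (ps ! a)" ws] b by (simp add: atLeast0LessThan)
   ultimately have *: "sdeg (ws ! 0) + 1 + ?S 1 (fst (ps ! a)) = (\<Sum>i<fst (ps ! a). map snd ws ! i) - int (fst (ps ! a)) + 1" by simp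
   show "even (snd (xs ! a) * (sdeg (ws ! 0) + 1) + snd (xs ! a) * ?S 1 (fst (ps ! a)) -
    map snd xs ! a * (int (fst (ps ! a)) - 1 + (\<Sum>i<fst (ps ! a). map snd ws ! i)))"
    unfolding nth_map[OF a] distrib_left[symmetric] right_diff_distrib[symmetric] * by simp
  qed
  then show "sg (wdeg snd xs * (sdeg (ws ! 0) + 1) + (\<Sum>k<length xs. snd (xs ! k) * ?S 1 (fst (ps ! k))))
    (in_chains (word sA (fst (ws ! 0) # plug (map fst ws) 1 (m + 1) (zip (map fst xs) ps)))) =
   sg (\<Sum>a<length xs. map snd xs ! a * (int (fst (ps ! a)) - 1 + (\<Sum>i<fst (ps ! a). map snd ws ! i)))
    (in_chains (word sA (map fst ws ! 0 # plug (map fst ws) 1 (m + 1) (zip (map fst xs) ps))))"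
   unfolding h0 by (rule sg_eq)
 qed
 finally show ?thesis unfolding hd tl by (rule sym)
qed

lemma act_ins_keeps_VL:
 assumes "\<exists>x\<in>set cs. is_VL x" "(n, w) \<in> set (inserted ev_ins snd ideg xs cs)"
 shows "\<exists>x\<in>set w. is_VL x"
 using assms
proof (induction xs arbitrary: cs n w)
 case (Cons P xs)
 obtain a b c z w' n' n'' where *: "cs = a @ b @ c" "(n', z) \<in> set (ev_ins P b)" "(n'', w') \<in> set (inserted ev_ins snd ideg xs c)" "w = a @ z # w'"
  using Cons.prems(2) by (auto elim!: set_bindE dest!: splits_append)
 consider "\<exists>x\<in>set a. is_VL x" | "\<exists>x\<in>set b. is_VL x" | "\<exists>x\<in>set c. is_VL x" using Cons.prems(1) *(1) by auto
 then show ?case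
 proof cases
  case 2
  then obtain x where "x \<in> set b" "\<not> is_BL x" by (auto simp: is_VL_def)
  then have "\<not> list_all is_BL b" by (auto simp: list_all_iff)
  then have "is_VL z" using *(2) unfolding ev_ins_def by (auto split: if_splits)
  then show ?thesis using *(4) by auto
 next
  case 3
  then show ?thesis using Cons.IH[OF _ *(3)] *(4) by auto
 qed (use * in auto)
qed simp

lemma ins_gen_VL: "\<exists>x\<in>set w. is_VL x ==> ins_gen w = 0"
 by (auto simp: ins_gen_def list_all_iff is_VL_def split: list.splits insertion_letter.splits) force

text \<open>An operation letter is never removed by the action, so \<open>u\<close> and
  \<open>v\<close> have to be empty. By \<open>act_marked\<close>, with \<open>e\<^sub>0\<close> as
  the marked letter, all operations act on the tail: in front of \<open>e\<^sub>0\<close> they would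
  leave a letter, and none of them takes \<open>e\<^sub>0\<close>.\<close>

lemma act_ins_gen:
 assumes ws: "ws \<noteq> []"
 shows "act_ins xs (map VL us @ ins_enc ws @ map VL vs) ins_gen =
  (if us = [] \<and> vs = [] then in_chains (insertion_value sA (map fst xs) (map snd xs) (map fst ws) (map snd ws)) else 0)"
proof (cases "us = [] \<and> vs = []")
 case True
 obtain e0 e where e: "ws = e0 # e" using ws by (cases ws) auto
 have a: "act_ins y1 [] (\<lambda>a. act_ins y2 (map BL e) (\<lambda>b. ins_gen (a @ HL e0 # b))) = 0" if y1: "y1 \<noteq> []" for y1 y2
 proof (rule act_long)
  fix w :: "'a insertion_letter list" assume "length y1 \<le> length w"
  then obtain x w' where w: "w = x # w'" using y1 by (cases w) auto
  have "ins_gen (w @ HL e0 # b) = 0" for b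
   unfolding w by (simp add: ins_gen_def split: insertion_letter.splits)
  then show "act_ins y2 (map BL e) (\<lambda>b. ins_gen (w @ HL e0 # b)) = 0" by simp
 qed
 have m: "ev_ins P (HL e0 # v1) = []" for P v1 by (simp add: ev_ins_def)
 have "act_ins xs (HL e0 # map BL e) ins_gen = act_ins xs ([] @ HL e0 # map BL e) ins_gen" by simp
 also have "... = spl xs (\<lambda>y1 y2. sg (wdeg snd y2 * (sdeg e0 + 1))
   (act_ins y1 [] (\<lambda>a. act_ins y2 (map BL e) (\<lambda>b. ins_gen (a @ HL e0 # b)))))"
  unfolding act_marked by (simp add: m)
 also have "... = sg (wdeg snd xs * (sdeg e0 + 1)) (act_ins xs (map BL e) (\<lambda>b. ins_gen (HL e0 # b)))"
  by (subst spl_last) (simp_all add: a)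
 also have "act_ins xs (map BL e) (\<lambda>b. ins_gen (HL e0 # b)) = act_args xs e (\<lambda>b. in_chains (chain (e0 # b)))"
  using act_ins_BL[of xs "map BL e" "\<lambda>b. in_chains (chain (e0 # b))"] by (simp add: ins_gen_def)
 finally show ?thesis using True in_chains_insertion_value[OF ws, of xs] e by simp
next
 case False
 then have VL: "\<exists>x\<in>set (map VL us @ ins_enc ws @ map VL vs). is_VL x" by (cases us; cases vs) auto
 have "act_ins xs (map VL us @ ins_enc ws @ map VL vs) ins_gen = act_ins xs (map VL us @ ins_enc ws @ map VL vs) (\<lambda>w. 0)"
  unfolding act_def by (rule lsum_cong) (use act_ins_keeps_VL[OF VL] ins_gen_VL in blast)
 then show ?thesis using False by auto
qed

theorem insertion_structure_maps: "has_insertion_structure_maps sA A insertion.bar_action"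
 unfolding has_insertion_structure_maps_def Let_def
proof (intro allI impI, elim conjE)
 fix Ps bs Qs cs es \<delta> Rs ds
 assume "hom_word E Ps bs" "hom_word E Qs cs" "es \<noteq> []" "hom_word A es \<delta>" "hom_word E Rs ds"
 then obtain xs us ws vs where eqs: "Ps = map fst xs" "bs = map snd xs" "Qs = map fst us" "cs = map snd us" "es = map fst ws" "\<delta> = map snd ws"
   "Rs = map fst vs" "ds = map snd vs" and g: "homVs xs" "homVs us" "ws \<noteq> []" "homAs ws" "homVs vs"
  by (auto elim!: hom_wordE)
 have "bgen (insertion.bar_action (opword xs) (barword us ws vs)) = act_ins xs (map VL us @ ins_enc ws @ map VL vs) ins_gen"
  unfolding insertion.bar_action_words[OF g] act_additive[where h = bgen, OF bgen_plus] bgen_ins_BAR ..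
 then show "(Qs = [] \<and> Rs = [] \<longrightarrow> bgen (insertion.bar_action (word sE Ps) (barw sE fscale Qs (word sA es) Rs)) =
    barw sE fscale [] (insertion_value sA Ps bs es \<delta>) []) \<and>
   (\<not> (Qs = [] \<and> Rs = []) \<longrightarrow> bgen (insertion.bar_action (word sE Ps) (barw sE fscale Qs (word sA es) Rs)) = 0)"
  unfolding eqs act_ins_gen[OF g(3)] by auto
qed

subsection \<open>The differentials\<close>

lemma bgen_commutator:
 "bgen (commutator evL dp evR dc g0 g' cs \<phi>) = commutator evL dp evR dc g0 g' cs (\<lambda>w. bgen (\<phi> w))"
 unfolding commutator_def bgen_plus bgen_sg act_additive[where h = bgen, OF bgen_plus] ..

text \<open>The left multiplication by \<open>\<gamma>\<close> gives the cyclic value. The right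
  multiplication leaves the operations of \<open>u\<close> and \<open>v\<close> in the word, hence
  contributes only if both are empty; there it is \<open>- m\<^sub>L\<^sub>,\<^sub>2(\<gamma>,
  c)\<close>.\<close>

theorem b_gamma_structure_maps: "has_b_gamma_structure_maps sA A \<gamma> cyclic.bar_diff"
 unfolding has_b_gamma_structure_maps_def Let_def
proof (intro allI impI, elim conjE)
 fix Qs cs es \<delta> Rs ds
 assume "hom_word E Qs cs" "es \<noteq> []" "hom_word A es \<delta>" "hom_word E Rs ds"
 then obtain us ws vs where eqs: "Qs = map fst us" "cs = map snd us" "es = map fst ws" "\<delta> = map snd ws"
   "Rs = map fst vs" "ds = map snd vs" and g: "homVs us" "ws \<noteq> []" "homAs ws" "homVs vs"
  by (auto elim!: hom_wordE)
 let ?w = "map Inl us @ Inr ws # map Inl vs"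
 obtain e0 e where e: "ws = e0 # e" using g(2) by (cases ws) auto
 have "bgen (cyclic.bar_diff (barword us ws vs)) =
   lsum (cyclic (\<gamma>, 1) us ws vs) (\<lambda>z. cyclic_gen [z]) + sg (wdeg cdeg ?w + 1) (act_cyclic_right ?w [Inl (\<gamma>, 1)] cyclic_gen)"
  unfolding cyclic.bar_diff_barword[OF g] bgen_commutator bgen_cyclic_BAR
  by (simp add: commutator_def act_one_letter cyclic_gen_length)
 also have "lsum (cyclic (\<gamma>, 1) us ws vs) (\<lambda>z. cyclic_gen [z]) =
   in_chains (cyclic_value sA \<gamma> (map fst us) (map snd us) (map fst ws) (map snd ws) (map fst vs) (map snd vs))"
  using in_chains_cyclic_value[OF g(2), of "(\<gamma>, 1)" us vs] by simp
 also have "sg (wdeg cdeg ?w + 1) (act_cyclic_right ?w [Inl (\<gamma>, 1)] cyclic_gen) =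
   (if us = [] \<and> vs = [] then - in_chains (insertion_value sA [\<gamma>] [1] (map fst ws) (map snd ws)) else 0)"
 proof (cases "us = [] \<and> vs = []")
  case True
  have "act_cyclic_right [Inr ws] [Inl (\<gamma>, 1)] cyclic_gen = lsum (ev_cyclic_right (Inr ws) [Inl (\<gamma>, 1)]) (\<lambda>z. cyclic_gen [z])"
   by (rule act_one_letter) (rule cyclic_gen_length)
  also have "... = sg (wdeg sdeg e) (act_args [(\<gamma>, 1)] e (\<lambda>b. in_chains (chain (e0 # b))))"
   unfolding e lsum_ev_right by (simp add: cyclic_gen_def)
  finally show ?thesis
   using True in_chains_insertion_value[OF g(2), of "[(\<gamma>, 1)]"] e by (simp add: sg_sg) (simp add: sg_def)
 next
  case False
  then have "act_cyclic_right ?w [Inl (\<gamma>, 1)] cyclic_gen = 0"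
   by (intro act_long cyclic_gen_length) (cases us; cases vs; auto)
  then show ?thesis using False by auto
 qed
 finally show "(Qs = [] \<and> Rs = [] \<longrightarrow> bgen (cyclic.bar_diff (barw sE fscale Qs (word sA es) Rs)) =
   barw sE fscale [] (cyclic_value sA \<gamma> [] [] es \<delta> [] [] - insertion_value sA [\<gamma>] [1] es \<delta>) []) \<and>
  (\<not> (Qs = [] \<and> Rs = []) \<longrightarrow> bgen (cyclic.bar_diff (barw sE fscale Qs (word sA es) Rs)) =
   barw sE fscale [] (cyclic_value sA \<gamma> Qs cs es \<delta> Rs ds) [])"
  unfolding eqs by (auto simp: in_chains_linear)
qed

theorem insertion_differential_structure_maps: "has_insertion_differential_structure_maps sA A \<gamma> insertion.bar_diff"
 unfolding has_insertion_differential_structure_maps_def Let_def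
proof (intro allI impI, elim conjE)
 fix Qs cs es \<delta> Rs ds
 assume "hom_word E Qs cs" "es \<noteq> []" "hom_word A es \<delta>" "hom_word E Rs ds"
 then obtain us ws vs where eqs: "Qs = map fst us" "cs = map snd us" "es = map fst ws" "\<delta> = map snd ws"
   "Rs = map fst vs" "ds = map snd vs" and g: "homVs us" "ws \<noteq> []" "homAs ws" "homVs vs"
  by (auto elim!: hom_wordE)
 have "bgen (insertion.bar_diff (barword us ws vs)) =
   act_ins [(\<gamma>, 1)] (map VL us @ ins_enc ws @ map VL vs) ins_gen"
  unfolding insertion.bar_diff_barword[OF g] bgen_commutator bgen_ins_BAR
  by (simp add: commutator_def act_ins_right_no_VL[OF ins_gen_VL])
 then show "(Qs = [] \<and> Rs = [] \<longrightarrow> bgen (insertion.bar_diff (barw sE fscale Qs (word sA es) Rs)) =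
   barw sE fscale [] (insertion_value sA [\<gamma>] [1] es \<delta>) []) \<and>
  (\<not> (Qs = [] \<and> Rs = []) \<longrightarrow> bgen (insertion.bar_diff (barw sE fscale Qs (word sA es) Rs)) = 0)"
  unfolding eqs act_ins_gen[OF g(2)] by auto
qed

subsection \<open>The two actions differ\<close>

text \<open>A chain \<open>(x)\<close> with \<open>x \<noteq> 0\<close> is detected by the
  projection to words of length one.\<close>

lemma in_chains_nonzero:
 assumes "x \<noteq> (0 :: 'a)"
 shows "in_chains (word sA [x]) \<noteq> 0"
proof
 have "multilin sA sA (\<lambda>es. if length es = 1 then hd es else 0)"
  unfolding multilin_def linear_iff_additive
  by (auto simp: vs_A append_eq_Cons_conv)
 then have nz: "word sA [x] \<noteq> 0"
  using word_relations[of "\<lambda>_. 1" sA "\<lambda>_. [x]" "{()}" sA "\<lambda>es. if length es = 1 then hd es else 0"] assms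
  by (auto simp: pscale_def)
 obtain h where h: "Vector_Spaces.linear fscale (*) h" "h (word sA [x]) = (1 :: 'k)"
  using separating_functional[OF vs_f nz] by blast
 define \<phi> where "\<phi> us w vs = (if us = [] \<and> vs = [] then h w else (0 :: 'k))" for us vs :: "('a list => 'a) list" and w
 have "vector_space (sE :: 'k => ('a list => 'a) => 'a list => 'a)" using graded_vs_End by (simp add: graded_vector_space_def)
 then have "bar_form sE fscale \<phi>"
  using h(1) unfolding bar_form_def multilin_def \<phi>_def
  by (auto simp: linear_iff_additive)
 moreover assume "in_chains (word sA [x]) = 0"
 then have "in_chains (word sA [x]) \<phi> = 0" by (simp add: zero_fun_apply)
 ultimately show False using h(2) by (simp add: barw_def \<phi>_def)
qed

text \<open>The cyclic action applies \<open>P\<close> to \<open>e\<^sub>0\<close>, while the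
  insertion action never does.\<close>

theorem actions_differ:
 assumes "\<exists>e :: 'a. e \<noteq> 0"
 shows "\<exists>x\<in>TT. \<exists>z\<in>BT. cyclic.bar_action x z \<noteq> insertion.bar_action x z"
proof -
 obtain e d where e: "e \<in> A d" "e \<noteq> 0"
 proof (rule ccontr)
  assume "\<not> thesis"
  then have "(\<Union>i. A i) \<subseteq> {0}" using that by blast
  then have "span (\<Union>i. A i) \<subseteq> {0}" using span_mono[of "\<Union>i. A i" "{0}"] by simp
  then show False using total_UNIV assms unfolding total_def by blast
 qed
 define P where "P es = (if length es = 1 then hd es else 0)" for es :: "'a list"
 have "multilin sA sA P"
  unfolding multilin_def linear_iff_additive P_def
  by (auto simp: vs_A append_eq_Cons_conv)
 moreover have "P es \<in> A (0 - (int (length es) - 1) + sum_list \<delta>)" if "hom_word A es \<delta>" for es \<delta>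
 proof (cases "length es = 1")
  case True
  then obtain x where "es = [x]" by (cases es) auto
  then show ?thesis using that by (auto simp: P_def hom_word_def list_all2_Cons1)
 qed (simp add: P_def subspace_0[OF subspace_component])
 ultimately have P: "homV (P, 0)" unfolding homogeneous_def End_gr_def by auto
 have ed: "homAs [(e, d)]" using e by (simp add: homogeneous_def)
 have "bgen (cyclic.bar_action (word sE [P]) (in_chains (word sA [e]))) = lsum (cyclic (P, 0) [] [(e, d)] []) (\<lambda>z. cyclic_gen [z])"
  using bgen_cyclic_action[of "[(P, 0)]" "[]" "[(e, d)]" "[]"] P ed by (simp add: act_one_letter cyclic_gen_length ev_cyclic_Inr[of _ "[]" _ "[]", simplified])
 also have "... = in_chains (word sA [e])"
  unfolding lsum_cyclic by (simp add: cyclic_gen_def apply_op_def P_def)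
 finally have 1: "bgen (cyclic.bar_action (word sE [P]) (in_chains (word sA [e]))) = in_chains (word sA [e])" .
 have "bgen (insertion.bar_action (word sE [P]) (in_chains (word sA [e]))) = act_ins [(P, 0)] (map VL [] @ ins_enc [(e, d)] @ map VL []) ins_gen"
  using insertion.bar_action_words[of "[(P, 0)]" "[]" "[(e, d)]" "[]"] P ed
  by (simp add: act_additive[where h = bgen, OF bgen_plus] bgen_ins_BAR)
 also have "... = in_chains (insertion_value sA [P] [0] [e] [d])"
  by (subst act_ins_gen) simp_all
 also have "... = in_chains (word sA [e, 0])"
  using in_chains_insertion_value[of "[(e, d)]" "[(P, 0)]"] by (simp add: act_Cons apply_op_def P_def)
 also have "word sA [e, 0] = 0"
 proof -
  have "\<phi> [e, 0] = 0" if "multilin sA (*) \<phi>" for \<phi> :: "'a list => 'k"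
  proof -
   have "Vector_Spaces.linear sA (*) (\<lambda>x. \<phi> ([e] @ x # []))" using that unfolding multilin_def by blast
   then have "\<phi> [e, 0 + 0] = \<phi> [e, 0] + \<phi> [e, 0]" unfolding linear_iff_additive by (metis append_Cons append_Nil)
   then show ?thesis by (simp only: add_0_left add_cancel_right_right)
  qed
  then show ?thesis by (auto simp: word_def fun_eq_iff zero_fun_apply)
 qed
 finally have 2: "bgen (insertion.bar_action (word sE [P]) (in_chains (word sA [e]))) = 0" by (simp add: in_chains_linear)
 have "cyclic.bar_action (word sE [P]) (in_chains (word sA [e])) \<noteq> insertion.bar_action (word sE [P]) (in_chains (word sA [e]))"
  using 1 2 in_chains_nonzero[OF e(2)] by metis
 moreover have "word sE [P] \<in> TT" using opword_total[of "[(P, 0)]"] P by simp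
 moreover have "in_chains (word sA [e]) \<in> BT" using cyclic.barword_total[of "[]" "[(e, d)]" "[]"] ed by simp
 ultimately show ?thesis by blast
qed

end

theorem theorem2p4:
  fixes sA :: "'k::field_char_0 \<Rightarrow> 'a::ab_group_add \<Rightarrow> 'a"
    and A :: "int \<Rightarrow> 'a set"
    and \<gamma> :: "'a list \<Rightarrow> 'a"
  assumes "curved_Ainf_algebra sA A \<gamma>"
  shows "\<exists>m d\<^sub>\<gamma> mL\<^sub>1 mL\<^sub>2 b\<^sub>\<gamma> b\<^sub>2.
    has_brace_structure_maps sA A m \<and>
    is_twisted_differential (pscale sA) (End_gr sA A) m \<gamma> d\<^sub>\<gamma> \<and>
    Binf_algebra (pscale sA) (End_gr sA A) d\<^sub>\<gamma> m \<and>
    has_cyclic_structure_maps sA A mL\<^sub>1 \<and>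
    has_insertion_structure_maps sA A mL\<^sub>2 \<and>
    has_b_gamma_structure_maps sA A \<gamma> b\<^sub>\<gamma> \<and>
    has_insertion_differential_structure_maps sA A \<gamma> b\<^sub>2 \<and>
    bar_differential (pscale sA) (End_gr sA A) fscale (chain_gr sA A) d\<^sub>\<gamma> b\<^sub>\<gamma> \<and>
    left_Binf_module (pscale sA) (End_gr sA A) d\<^sub>\<gamma> m fscale (chain_gr sA A) b\<^sub>\<gamma> mL\<^sub>1 \<and>
    left_Binf_module (pscale sA) (End_gr sA A) d\<^sub>\<gamma> m fscale (chain_gr sA A) b\<^sub>2 mL\<^sub>2 \<and>
    ((\<exists>e::'a. e \<noteq> 0) \<longrightarrow>
      (\<exists>x\<in>tensor_total (pscale sA) (End_gr sA A).
        \<exists>z\<in>bar_total (pscale sA) (End_gr sA A) fscale (chain_gr sA A). mL\<^sub>1 x z \<noteq> mL\<^sub>2 x z))"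
proof -
  interpret curved_Ainf_algebra sA A \<gamma> by fact
  show ?thesis
    by (intro exI conjI impI)
      (rule brace_structure_maps is_twisted Binf_algebra_braces cyclic_structure_maps insertion_structure_maps
        b_gamma_structure_maps insertion_differential_structure_maps cyclic.bar_differential_model
        cyclic.left_Binf_module_model insertion.left_Binf_module_model | erule actions_differ)+
qed

end
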